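(* Let $R=K[X_1,\dots,X_n]$ be a standard graded polynomial ring over a field $K$, let $M$ be a (nonzero) finitely generated graded $R$-module with $\dim(M)=d$, and let $l_1,\dots,l_d$ be a filter regular sequence on $M$ of homogeneous elements of $R$ of positive degrees $D_1,\dots,D_d$. Then $$\operatorname{reg}(M)=\max_{i\in\{0,\dots,d\}}\Big\{\alpha\big(M/(l_1,\dots,l_i)M\big)-\sum_{j=1}^i(D_j-1)\Big\}.$$
   Context: $R_+$ is the homogeneous maximal ideal of $R$ and $H^i_{R_+}(M)$ the graded $i$-th local cohomology module; for a graded module $P$, $P_{>a}=\bigoplus_{i>a}P_i$. The Castelnuovo-Mumford regularity $\operatorname{reg}(M)$ is the minimum of all $m\in\mathbb Z$ such that $H^i_{R_+}(M)_{>m-i}=0$ for all $i\in\{0,\dots,n\}$. $\dim$ is Krull dimension. Postulation number: the Hilbert series $\sum_{i\in\mathbb Z}\dim_K(M_i)Z^i$ of a nonzero finitely generated graded module $M$ of dimension $d$ has the form $h(Z)/(1-Z)^d$ with $h(Z)\in\mathbb Z[Z,1/Z]$; writing $h(Z)=\sum_{i=a}^b c_iZ^i$ with $c_b\neq 0$, one sets $\alpha(M)=b-d$. (Equivalently, $\alpha(M)$ is the highest integer $i$ at which the Hilbert function of $M$ differs from its Hilbert polynomial.) A homogeneous element $l\in R$ of degree $D$ is filter regular on a graded $R$-module $M$ if the multiplication map $l:M_{i-D}\to M_i$ is injective for all $i\gg 0$. A sequence $l_1,\dots,l_m$ of homogeneous elements is a filter regular sequence on $M$ if $l_i$ is filter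 regular on $M/(l_1,\dots,l_{i-1})M$ for $i=1,\dots,m$. *)

theory Defs
  imports
    "HOL-Library.Poly_Mapping"
    "HOL-Library.Extended_Nat"
    "HOL-Computational_Algebra.Formal_Laurent_Series"
    "HOL-Algebra.QuotRing"
    "Jordan_Normal_Form.Missing_VectorSpace"
begin

section \<open>The standard graded polynomial ring\<close>

text \<open>A monomial is its finitely supported exponent vector, and a polynomial is a finitely
  supported family of coefficients, multiplied by convolution. The variables are indexed by
  all of \<^typ>\<open>nat\<close>; \<open>K[X\<^sub>1,\<dots>,X\<^sub>n]\<close> consists of the polynomials in which only
  \<open>X\<^sub>1,\<dots>,X\<^sub>n\<close> occur.\<close>

type_synonym 'k mpol = "(nat \<Rightarrow>\<^sub>0 nat) \<Rightarrow>\<^sub>0 'k"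

definition poly_ring :: "nat \<Rightarrow> 'k::field mpol ring" where
  "poly_ring n =
    \<lparr>carrier = {p. \<forall>m\<in>Poly_Mapping.keys p. Poly_Mapping.keys m \<subseteq> {1..n}},
     mult = (*), one = 1, zero = 0, add = (+)\<rparr>"

definition X_var :: "nat \<Rightarrow> 'k::field mpol" where
  "X_var i = Poly_Mapping.single (Poly_Mapping.single i 1) 1"

definition monomial_degree :: "(nat \<Rightarrow>\<^sub>0 nat) \<Rightarrow> nat" where
  "monomial_degree m = (\<Sum>i\<in>Poly_Mapping.keys m. Poly_Mapping.lookup m i)"

text \<open>The graded component \<open>R\<^sub>D\<close>; it contains \<open>0\<close>.\<close>

definition homogeneous_polys :: "nat \<Rightarrow> nat \<Rightarrow> 'k::field mpol set" where
  "homogeneous_polys n D =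
    {p \<in> carrier (poly_ring n). \<forall>m\<in>Poly_Mapping.keys p. monomial_degree m = D}"

text \<open>The coefficient field, as the subring of constant polynomials. A module over the polynomial
  ring is a vector space over this field without changing its scalar multiplication.\<close>

definition coeff_field :: "'k::field mpol ring" where
  "coeff_field = (poly_ring 0) \<lparr>carrier := range (Poly_Mapping.single 0)\<rparr>"


section \<open>Graded modules\<close>

record ('a, 'b) graded_module = "('a, 'b) module" +
  component :: "int \<Rightarrow> 'b set"

locale graded_poly_module = Module.module "poly_ring n" M
  for n :: nat and M :: "('k::field mpol, 'm) graded_module" (structure) +
  assumes component_subgroup: "additive_subgroup (component M i) M"
    and smult_component:
      "\<lbrakk>p \<in> homogeneous_polys n D; x \<in> component M i\<rbrakk>
        \<Longrightarrow> p \<odot>\<^bsub>M\<^esub> x \<in> component M (i + int D)"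
    and decomposition:
      "x \<in> carrier M \<Longrightarrow>
        \<exists>!f. (\<forall>i. f i \<in> component M i) \<and> finite {i. f i \<noteq> \<zero>\<^bsub>M\<^esub>} \<and>
             x = (\<Oplus>\<^bsub>M\<^esub>i\<in>{i. f i \<noteq> \<zero>\<^bsub>M\<^esub>}. f i)"

definition finitely_generated :: "nat \<Rightarrow> ('k::field mpol, 'm) graded_module \<Rightarrow> bool" where
  "finitely_generated n M \<longleftrightarrow>
    (\<exists>S. finite S \<and> S \<subseteq> carrier M \<and> module.span (poly_ring n) M S = carrier M)"

text \<open>The quotient \<open>M/N\<close> by a homogeneous submodule \<open>N\<close>. As everywhere for modules, the fields
  \<^const>\<open>mult\<close> and \<^const>\<open>one\<close> inherited from the ring record carry no meaning.\<close>

definition quotient_module ::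
    "('a, 'm) graded_module \<Rightarrow> 'm set \<Rightarrow> ('a, 'm set) graded_module" where
  "quotient_module M N =
    \<lparr>carrier = a_rcosets\<^bsub>M\<^esub> N,
     mult = (\<lambda>_ _. N), one = N, zero = N,
     add = set_add M,
     smult = (\<lambda>a X. \<Union>x\<in>X. N +>\<^bsub>M\<^esub> (a \<odot>\<^bsub>M\<^esub> x)),
     component = (\<lambda>i. (\<lambda>x. N +>\<^bsub>M\<^esub> x) ` component M i)\<rparr>"

text \<open>\<open>(S)M\<close> and \<open>M/(S)M\<close> for a set \<open>S\<close> of polynomials.\<close>

definition ideal_times_module ::
    "nat \<Rightarrow> 'k::field mpol set \<Rightarrow> ('k mpol, 'm) graded_module \<Rightarrow> 'm set" where
  "ideal_times_module n S M =
    module.span (poly_ring n) M {a \<odot>\<^bsub>M\<^esub> x | a x. a \<in> genideal (poly_ring n) S \<and> x \<in> carrier M}"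

definition quotient_by_ideal ::
    "nat \<Rightarrow> ('k::field mpol, 'm) graded_module \<Rightarrow> 'k mpol set \<Rightarrow> ('k mpol, 'm set) graded_module"
  where "quotient_by_ideal n M S = quotient_module M (ideal_times_module n S M)"


section \<open>Krull dimension\<close>

text \<open>The supremum is \<open>0\<close> for the zero ring, which has no prime ideals; the Krull dimension is
  only used for nonzero modules.\<close>

definition ring_krull_dim :: "('a, 'b) ring_scheme \<Rightarrow> enat" where
  "ring_krull_dim A =
    Sup {enat r | r. \<exists>P. (\<forall>i\<le>r. primeideal (P i) A) \<and> (\<forall>i<r. P i \<subset> P (Suc i))}"

definition annihilator :: "nat \<Rightarrow> ('k::field mpol, 'm) graded_module \<Rightarrow> 'k mpol set" where
  "annihilator n M =
    {a \<in> carrier (poly_ring n). \<forall>x\<in>carrier M. a \<odot>\<^bsub>M\<^esub> x = \<zero>\<^bsub>M\<^esub>}"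

definition krull_dim :: "nat \<Rightarrow> ('k::field mpol, 'm) graded_module \<Rightarrow> enat" where
  "krull_dim n M = ring_krull_dim (poly_ring n Quot annihilator n M)"


section \<open>Hilbert series and postulation number\<close>

definition hilbert_function :: "('k::field mpol, 'm) graded_module \<Rightarrow> int \<Rightarrow> nat" where
  "hilbert_function M i = vectorspace.dim coeff_field (M\<lparr>carrier := component M i\<rparr>)"

text \<open>A formal Laurent series, since a finitely generated graded module has no nonzero components
  in sufficiently negative degrees.\<close>

definition hilbert_series :: "('k::field mpol, 'm) graded_module \<Rightarrow> int fls" where
  "hilbert_series M = Abs_fls (\<lambda>i. int (hilbert_function M i))"

text \<open>The numerator \<open>h\<close> of the Hilbert series \<open>h / (1 - Z)\<^sup>d\<close>, \<open>d\<close> being the dimension; for finitely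
  generated nonzero \<open>M\<close> it is a nonzero Laurent polynomial.\<close>

definition hilbert_numerator :: "nat \<Rightarrow> ('k::field mpol, 'm) graded_module \<Rightarrow> int fls" where
  "hilbert_numerator n M = hilbert_series M * (1 - fls_X) ^ the_enat (krull_dim n M)"

definition postulation_number :: "nat \<Rightarrow> ('k::field mpol, 'm) graded_module \<Rightarrow> int" where
  "postulation_number n M =
    Max {i. fls_nth (hilbert_numerator n M) i \<noteq> 0} - int (the_enat (krull_dim n M))"


section \<open>Filter regular sequences\<close>

definition filter_regular ::
    "nat \<Rightarrow> ('k::field mpol, 'm) graded_module \<Rightarrow> nat \<Rightarrow> 'k mpol \<Rightarrow> bool" where
  "filter_regular n M D l \<longleftrightarrow>
    l \<in> homogeneous_polys n D \<and>
    (\<exists>i\<^sub>0. \<forall>i\<ge>i\<^sub>0. inj_on (\<lambda>x. l \<odot>\<^bsub>M\<^esub> x) (component M (i - int D)))"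

text \<open>The sequence \<open>l 1, \<dots>, l m\<close>, where \<open>l i\<close> has degree \<open>D i\<close>.\<close>

definition filter_regular_sequence ::
    "nat \<Rightarrow> ('k::field mpol, 'm) graded_module \<Rightarrow> nat \<Rightarrow> (nat \<Rightarrow> nat) \<Rightarrow> (nat \<Rightarrow> 'k mpol) \<Rightarrow> bool"
  where "filter_regular_sequence n M m D l \<longleftrightarrow>
    (\<forall>i\<in>{1..m}. filter_regular n (quotient_by_ideal n M (l ` {1..<i})) (D i) (l i))"


section \<open>Localization at the powers of one element\<close>

text \<open>\<open>fraction M f x k\<close> is the element \<open>x / f\<^sup>k\<close> of \<open>M\<^sub>f\<close>, i.e. the set of all pairs \<open>(y, l)\<close> such
  that \<open>f\<^sup>t (f\<^sup>l x - f\<^sup>k y) = 0\<close> for some \<open>t\<close>.\<close>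

definition fraction ::
    "('k::field mpol, 'm) graded_module \<Rightarrow> 'k mpol \<Rightarrow> 'm \<Rightarrow> nat \<Rightarrow> ('m \<times> nat) set" where
  "fraction M f x k =
    {(y, l). y \<in> carrier M \<and> (\<exists>t. f ^ (t + l) \<odot>\<^bsub>M\<^esub> x = f ^ (t + k) \<odot>\<^bsub>M\<^esub> y)}"

text \<open>\<open>M\<^sub>f\<close> for \<open>f\<close> homogeneous of degree \<open>e\<close>. The operations are given by
  \<open>x/f\<^sup>k + y/f\<^sup>l = (f\<^sup>l x + f\<^sup>k y)/f\<^bsup>k+l\<^esup>\<close> and \<open>a (x/f\<^sup>k) = (a x)/f\<^sup>k\<close>; the unions range
  over the representatives of the arguments.\<close>

definition localization ::
    "('k::field mpol, 'm) graded_module \<Rightarrow> 'k mpol \<Rightarrow> nat \<Rightarrow> ('k mpol, ('m \<times> nat) set) graded_module"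
  where "localization M f e =
    \<lparr>carrier = {fraction M f x k | x k. x \<in> carrier M},
     mult = (\<lambda>_ _. fraction M f \<zero>\<^bsub>M\<^esub> 0), one = fraction M f \<zero>\<^bsub>M\<^esub> 0,
     zero = fraction M f \<zero>\<^bsub>M\<^esub> 0,
     add = (\<lambda>A B. \<Union>(x, k)\<in>A. \<Union>(y, l)\<in>B.
       fraction M f (f ^ l \<odot>\<^bsub>M\<^esub> x \<oplus>\<^bsub>M\<^esub> f ^ k \<odot>\<^bsub>M\<^esub> y) (k + l)),
     smult = (\<lambda>a A. \<Union>(x, k)\<in>A. fraction M f (a \<odot>\<^bsub>M\<^esub> x) k),
     component = (\<lambda>i. {fraction M f x k | x k. x \<in> component M (i + int (k * e))})\<rparr>"


section \<open>Graded local cohomology and regularity\<close>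

text \<open>Local cohomology with support in \<open>R\<^sub>+ = (X\<^sub>1,\<dots>,X\<^sub>n)\<close> is the cohomology of the Cech complex
  whose \<open>i\<close>-th term is the direct sum of the localizations of \<open>M\<close> at the products
  \<open>\<Prod>\<^bsub>j\<in>S\<^esub> X\<^sub>j\<close>, over all \<open>i\<close>-element subsets \<open>S\<close> of \<open>{1,\<dots>,n}\<close>.\<close>

definition X_prod :: "nat set \<Rightarrow> 'k::field mpol" where
  "X_prod S = (\<Prod>j\<in>S. X_var j)"

definition cech_localization ::
    "('k::field mpol, 'm) graded_module \<Rightarrow> nat set \<Rightarrow> ('k mpol, ('m \<times> nat) set) graded_module" where
  "cech_localization M S = localization M (X_prod S) (card S)"

definition cech_index :: "nat \<Rightarrow> nat \<Rightarrow> nat set set" where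
  "cech_index n i = {S. S \<subseteq> {1..n} \<and> card S = i}"

definition cech_module ::
    "nat \<Rightarrow> ('k::field mpol, 'm) graded_module \<Rightarrow> nat \<Rightarrow>
      ('k mpol, nat set \<Rightarrow> ('m \<times> nat) set) graded_module" where
  "cech_module n M i =
    \<lparr>carrier = (\<Pi>\<^sub>E S\<in>cech_index n i. carrier (cech_localization M S)),
     mult = (\<lambda>_ _. \<lambda>S\<in>cech_index n i. \<zero>\<^bsub>cech_localization M S\<^esub>),
     one = (\<lambda>S\<in>cech_index n i. \<zero>\<^bsub>cech_localization M S\<^esub>),
     zero = (\<lambda>S\<in>cech_index n i. \<zero>\<^bsub>cech_localization M S\<^esub>),
     add = (\<lambda>u v. \<lambda>S\<in>cech_index n i. u S \<oplus>\<^bsub>cech_localization M S\<^esub> v S),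
     smult = (\<lambda>a u. \<lambda>S\<in>cech_index n i. a \<odot>\<^bsub>cech_localization M S\<^esub> u S),
     component = (\<lambda>j. \<Pi>\<^sub>E S\<in>cech_index n i. component (cech_localization M S) j)\<rparr>"

text \<open>For \<open>S \<subseteq> T\<close>, the canonical map between the localizations at the products over \<open>S\<close> and over
  \<open>T\<close>: with \<open>f\<close>, \<open>g\<close> the products over \<open>S\<close> and \<open>T - S\<close>, it sends \<open>x / f\<^sup>k\<close> to
  \<open>(g\<^sup>k x) / (g f)\<^sup>k\<close>.\<close>

definition cech_restriction ::
    "('k::field mpol, 'm) graded_module \<Rightarrow> nat set \<Rightarrow> nat set \<Rightarrow> ('m \<times> nat) set \<Rightarrow> ('m \<times> nat) set"
  where "cech_restriction M S T A =
    (\<Union>(x, k)\<in>A. fraction M (X_prod T) (X_prod (T - S) ^ k \<odot>\<^bsub>M\<^esub> x) k)"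

definition cech_differential ::
    "nat \<Rightarrow> ('k::field mpol, 'm) graded_module \<Rightarrow> nat \<Rightarrow>
      (nat set \<Rightarrow> ('m \<times> nat) set) \<Rightarrow> (nat set \<Rightarrow> ('m \<times> nat) set)" where
  "cech_differential n M i u =
    (\<lambda>T\<in>cech_index n (Suc i).
      \<Oplus>\<^bsub>cech_localization M T\<^esub>s\<in>T.
        ((-1) ^ card {t \<in> T. t < s}) \<odot>\<^bsub>cech_localization M T\<^esub>
          cech_restriction M (T - {s}) T (u (T - {s})))"

definition cech_cocycles ::
    "nat \<Rightarrow> ('k::field mpol, 'm) graded_module \<Rightarrow> nat \<Rightarrow> (nat set \<Rightarrow> ('m \<times> nat) set) set" where
  "cech_cocycles n M i =
    {u \<in> carrier (cech_module n M i). cech_differential n M i u = \<zero>\<^bsub>cech_module n M (Suc i)\<^esub>}"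

definition cech_coboundaries ::
    "nat \<Rightarrow> ('k::field mpol, 'm) graded_module \<Rightarrow> nat \<Rightarrow> (nat set \<Rightarrow> ('m \<times> nat) set) set" where
  "cech_coboundaries n M i =
    (case i of 0 \<Rightarrow> {\<zero>\<^bsub>cech_module n M 0\<^esub>}
     | Suc i' \<Rightarrow> cech_differential n M i' ` carrier (cech_module n M i'))"

definition local_cohomology ::
    "nat \<Rightarrow> ('k::field mpol, 'm) graded_module \<Rightarrow> nat \<Rightarrow>
      ('k mpol, (nat set \<Rightarrow> ('m \<times> nat) set) set) graded_module" where
  "local_cohomology n M i =
    quotient_module
      ((cech_module n M i)
        \<lparr>carrier := cech_cocycles n M i,
         component := \<lambda>j. cech_cocycles n M i \<inter> component (cech_module n M i) j\<rparr>)
      (cech_coboundaries n M i)"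

definition regularity :: "nat \<Rightarrow> ('k::field mpol, 'm) graded_module \<Rightarrow> int" where
  "regularity n M =
    (LEAST m. \<forall>i\<in>{0..n}. \<forall>j > m - int i.
      component (local_cohomology n M i) j = {\<zero>\<^bsub>local_cohomology n M i\<^esub>})"

end

theory Submission
  imports Defs "HOL-Library.Product_Lexorder" "HOL-Algebra.Ring_Divisibility"
begin

text \<open>
  Let \<open>l\<close> of degree \<open>D\<close> be filter regular on \<open>M\<close>, and let \<open>U\<close> be the kernel of \<open>l\<close> on \<open>M\<close>, which
  has finite length. The long exact cohomology sequence for \<open>M \<rightarrow> M(D) \<rightarrow> (M/lM)(D)\<close>, together
  with the fact that every local cohomology class is annihilated by a power of \<open>l\<close>, shows that
  \<open>reg M \<le> m\<close> holds iff \<open>U\<close> vanishes above degree \<open>m\<close> and \<open>reg (M/lM) \<le> m + D - 1\<close>.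

  Comparing Hilbert series, with \<open>e\<close> the dimension of \<open>M/lM\<close>, gives
  \<open>h\<^sub>M (1 + Z + \<dots> + Z\<^bsup>D-1\<^esup>) = h\<^bsub>M/lM\<^esub> - Z\<^bsup>D\<^esup> (1 - Z)\<^bsup>e\<^esup> H\<^sub>U\<close>, where \<open>H\<^sub>U\<close> is
  the Hilbert series of \<open>U\<close>. Reading off top degrees shows that, as
  soon as \<open>\<alpha>(M/lM) \<le> m + D - 1\<close>, the module \<open>U\<close> vanishes above degree \<open>m\<close> iff \<open>\<alpha>(M) \<le> m\<close>. Hence
  \<open>reg M = max (\<alpha>(M)) (reg (M/lM) - (D - 1))\<close>, and induction on the length of the sequence ends
  with a module of finite length, whose regularity is its top degree, i.e. \<open>\<alpha>\<close>.

  That each \<open>l\<^sub>i\<close> lowers the dimension by exactly one is seen as follows: a chain of primes over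
  the annihilator of \<open>M/lM\<close> can be prolonged downwards, as \<open>l\<close> lies in no minimal prime other
  than the irrelevant ideal, while the growth of the Hilbert function bounds the dimension and
  increases by at most one degree from \<open>M/lM\<close> to \<open>M\<close>.
\<close>

section \<open>Polynomials\<close>

text \<open>The long exact sequence is replaced by chases with elements of the modules. A Cech
  cochain is a finite family of fractions, so it has a common denominator exponent \<open>k\<close>,
  its level, and an equality of fractions becomes an equality in the module once the level is
  raised. Raising the level also disposes of the kernel \<open>U\<close>: in positive cohomological
  degree it pushes entries into internal degrees where \<open>l\<close> is injective. Regularity
  enters as the condition \<open>reg_bound n M m\<close> on an arbitrary \<open>m\<close>; each step
  of the induction is then an equivalence, and the minimum and the maximum are compared only at the
  end. The exponent in the Hilbert numerator is the Krull dimension, so neither its being a Laurent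
  polynomial nor its behaviour under quotients is automatic. The Hilbert-Serre theorem supplies the
  exponent \<open>n\<close>; the sequence itself brings it down to the dimension, which is why the
  dimension of every quotient must be known exactly. Multiplication of a series by
  \<open>1 - Z\<close> is a backward difference of its coefficients, and all identities of series
  are read as identities of iterated differences.\<close>

abbreviation Rn :: "nat \<Rightarrow> 'k::field mpol set" where
  "Rn n \<equiv> carrier (poly_ring n)"

lemma poly_ring_simps [simp]:
  "mult (poly_ring n) = (*)" "one (poly_ring n) = 1" "zero (poly_ring n) = 0" "add (poly_ring n) = (+)"
  by (simp_all add: poly_ring_def)

lemma mem_Rn: "p \<in> Rn n \<longleftrightarrow> (\<forall>m\<in>Poly_Mapping.keys p. Poly_Mapping.keys m \<subseteq> {1..n})"
  by (simp add: poly_ring_def)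

lemma keys_add_nat: "Poly_Mapping.keys (a + b :: nat \<Rightarrow>\<^sub>0 nat) = Poly_Mapping.keys a \<union> Poly_Mapping.keys b"
  by (auto simp: in_keys_iff lookup_add)

lemma Rn_zero [simp]: "0 \<in> Rn n" and Rn_one [simp]: "1 \<in> Rn n"
  by (auto simp: mem_Rn)

lemma Rn_add [simp]: "p \<in> Rn n \<Longrightarrow> q \<in> Rn n \<Longrightarrow> p + q \<in> Rn n"
  using keys_add[of p q] by (fastforce simp: mem_Rn)

lemma Rn_uminus [simp]: "p \<in> Rn n \<Longrightarrow> - p \<in> Rn n"
  by (auto simp: mem_Rn in_keys_iff)

lemma Rn_diff [simp]: "p \<in> Rn n \<Longrightarrow> q \<in> Rn n \<Longrightarrow> p - q \<in> Rn n"
  using Rn_add[of p n "- q"] by simp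

lemma Rn_mult [simp]: "p \<in> Rn n \<Longrightarrow> q \<in> Rn n \<Longrightarrow> p * q \<in> Rn n"
proof -
  assume pq: "p \<in> Rn n" "q \<in> Rn n"
  show ?thesis
    unfolding mem_Rn
  proof
    fix m assume "m \<in> Poly_Mapping.keys (p * q)"
    then obtain a b where "a \<in> Poly_Mapping.keys p" "b \<in> Poly_Mapping.keys q" "m = a + b"
      using keys_mult[of p q] by blast
    thus "Poly_Mapping.keys m \<subseteq> {1..n}"
      using pq by (auto simp: mem_Rn keys_add_nat)
  qed
qed

lemma Rn_power [simp]: "p \<in> Rn n \<Longrightarrow> p ^ k \<in> Rn n"
  by (induction k) auto

lemma Rn_sum: "(\<And>i. i \<in> A \<Longrightarrow> f i \<in> Rn n) \<Longrightarrow> sum f A \<in> Rn n"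
  by (induction A rule: infinite_finite_induct) auto

lemma Rn_single: "Poly_Mapping.keys m \<subseteq> {1..n} \<Longrightarrow> Poly_Mapping.single m c \<in> Rn n"
  by (cases "c = 0") (auto simp: mem_Rn)

lemma Rn_const [simp]: "Poly_Mapping.single 0 c \<in> Rn n"
  by (rule Rn_single) auto

lemma cring_poly_ring: "cring (poly_ring n :: 'k::field mpol ring)"
proof (rule cringI)
  show "abelian_group (poly_ring n :: 'k mpol ring)"
  proof (rule abelian_groupI)
    fix x :: "'k mpol" assume "x \<in> Rn n"
    thus "\<exists>y\<in>Rn n. y \<oplus>\<^bsub>poly_ring n\<^esub> x = \<zero>\<^bsub>poly_ring n\<^esub>"
      by (intro bexI[of _ "- x"]) auto
  qed (auto simp: add_ac)
  show "Group.comm_monoid (poly_ring n :: 'k mpol ring)"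
    by (rule comm_monoidI) (auto simp: mult_ac)
qed (auto simp: distrib_right)

lemma a_inv_poly_ring [simp]: "p \<in> Rn n \<Longrightarrow> \<ominus>\<^bsub>poly_ring n\<^esub> p = - p"
proof -
  interpret cring "poly_ring n :: 'a mpol ring" by (rule cring_poly_ring)
  assume p: "p \<in> Rn n"
  show ?thesis
    by (rule minus_equality) (use p in auto)
qed

lemma nat_pow_poly_ring [simp]: "p [^]\<^bsub>poly_ring n\<^esub> (k::nat) = p ^ k"
  by (induction k) (simp_all add: mult.commute)

lemma poly_eq_sum_monomials:
  "(p :: ('a \<Rightarrow>\<^sub>0 'b::comm_monoid_add)) = (\<Sum>m\<in>Poly_Mapping.keys p. Poly_Mapping.single m (Poly_Mapping.lookup p m))"
proof (rule poly_mapping_eqI)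
  fix k
  show "Poly_Mapping.lookup p k = Poly_Mapping.lookup
    (\<Sum>m\<in>Poly_Mapping.keys p. Poly_Mapping.single m (Poly_Mapping.lookup p m)) k"
    by (simp add: lookup_sum lookup_single when_def in_keys_iff sum.delta)
qed

section \<open>Degrees of monomials and homogeneous polynomials\<close>

lemma monomial_degree_alt:
  "finite A \<Longrightarrow> Poly_Mapping.keys m \<subseteq> A \<Longrightarrow> monomial_degree m = (\<Sum>i\<in>A. Poly_Mapping.lookup m i)"
  unfolding monomial_degree_def by (rule sum.mono_neutral_left) (auto simp: in_keys_iff)

lemma monomial_degree_zero [simp]: "monomial_degree 0 = 0"
  by (simp add: monomial_degree_def)

lemma monomial_degree_add: "monomial_degree (a + b) = monomial_degree a + monomial_degree b"
  by (subst (1 2 3) monomial_degree_alt[where A = "Poly_Mapping.keys a \<union> Poly_Mapping.keys b"])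
    (auto simp: keys_add_nat lookup_add sum.distrib)

lemma monomial_degree_single [simp]: "monomial_degree (Poly_Mapping.single i k) = k"
  by (cases "k = 0") (auto simp: monomial_degree_def)

definition expos :: "nat \<Rightarrow> (nat \<Rightarrow>\<^sub>0 nat) set" where
  "expos n = {m. Poly_Mapping.keys m \<subseteq> {1..n}}"

text \<open>An exponent is at most the degree, so restriction to \<open>{1..n}\<close> embeds the
  set in a finite box of functions. The graded components are finite-dimensional because of
  this.\<close>

lemma finite_expos_degree: "finite {m \<in> expos n. monomial_degree m = d}"
proof -
  have inj: "inj_on (\<lambda>m. restrict (Poly_Mapping.lookup m) {1..n}) (expos n)"
  proof (rule inj_onI)
    fix a b assume ab: "a \<in> expos n" "b \<in> expos n"
      "restrict (Poly_Mapping.lookup a) {1..n} = restrict (Poly_Mapping.lookup b) {1..n}"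
    show "a = b"
    proof (rule poly_mapping_eqI)
      fix i
      show "Poly_Mapping.lookup a i = Poly_Mapping.lookup b i"
      proof (cases "i \<in> {1..n}")
        case True
        thus ?thesis using fun_cong[OF ab(3), of i] by simp
      next
        case False
        hence "i \<notin> Poly_Mapping.keys a" "i \<notin> Poly_Mapping.keys b" using ab by (auto simp: expos_def)
        thus ?thesis by (simp add: in_keys_iff)
      qed
    qed
  qed
  have "(\<lambda>m. restrict (Poly_Mapping.lookup m) {1..n}) ` {m \<in> expos n. monomial_degree m = d} \<subseteq> (\<Pi>\<^sub>E i\<in>{1..n}. {..d})"
  proof (rule image_subsetI)
    fix m assume m: "m \<in> {m \<in> expos n. monomial_degree m = d}"
    have "Poly_Mapping.lookup m i \<le> d" if "i \<in> {1..n}" for i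
      using m member_le_sum[of i "{1..n}" "Poly_Mapping.lookup m"] that by (auto simp: expos_def monomial_degree_alt[of "{1..n}"])
    thus "restrict (Poly_Mapping.lookup m) {1..n} \<in> (\<Pi>\<^sub>E i\<in>{1..n}. {..d})" by auto
  qed
  moreover have "finite (\<Pi>\<^sub>E i\<in>{1..n}. {..d})" by (intro finite_PiE) auto
  moreover have "inj_on (\<lambda>m. restrict (Poly_Mapping.lookup m) {1..n}) {m \<in> expos n. monomial_degree m = d}"
    by (rule inj_on_subset[OF inj]) auto
  ultimately show ?thesis by (meson inj_on_finite)
qed

abbreviation Hom :: "nat \<Rightarrow> nat \<Rightarrow> 'k::field mpol set" where
  "Hom n D \<equiv> homogeneous_polys n D"

lemma Hom_Rn: "p \<in> Hom n D \<Longrightarrow> p \<in> Rn n"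
  by (simp add: homogeneous_polys_def)

lemma Hom_one: "1 \<in> Hom n 0"
  by (simp add: homogeneous_polys_def)

lemma Hom_uminus: "p \<in> Hom n D \<Longrightarrow> - p \<in> Hom n D"
  by (auto simp: homogeneous_polys_def in_keys_iff)

lemma Hom_mult: "p \<in> Hom n D \<Longrightarrow> q \<in> Hom n E \<Longrightarrow> p * q \<in> Hom n (D + E)"
  using keys_mult[of p q] by (fastforce simp: homogeneous_polys_def monomial_degree_add)

lemma Hom_power: "p \<in> Hom n D \<Longrightarrow> p ^ k \<in> Hom n (D * k)"
  by (induction k) (auto simp: Hom_one dest: Hom_mult)

lemma Hom_single: "Poly_Mapping.keys m \<subseteq> {1..n} \<Longrightarrow> Poly_Mapping.single m c \<in> Hom n (monomial_degree m)"
  by (cases "c = 0") (auto simp: homogeneous_polys_def Rn_single)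

lemma Hom_const: "Poly_Mapping.single 0 c \<in> Hom n 0"
  using Hom_single[of 0 n c] by simp

lemma X_var_Hom: "i \<in> {1..n} \<Longrightarrow> X_var i \<in> Hom n 1"
  using Hom_single[of "Poly_Mapping.single i 1" n 1] by (simp add: X_var_def)

lemma X_prod_Hom: "S \<subseteq> {1..n} \<Longrightarrow> X_prod S \<in> Hom n (card S)"
proof -
  assume S: "S \<subseteq> {1..n}"
  hence "finite S" by (rule finite_subset) simp
  thus ?thesis using S
  proof (induction S)
    case empty
    thus ?case by (simp add: X_prod_def Hom_one)
  next
    case (insert x S)
    thus ?case using Hom_mult[OF X_var_Hom[of x n], of "X_prod S" "card S"]
      by (simp add: X_prod_def)
  qed
qed

lemma X_prod_Rn [simp]: "S \<subseteq> {1..n} \<Longrightarrow> X_prod S \<in> Rn n"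
  by (blast intro: X_prod_Hom Hom_Rn)

lemma X_var_Rn [simp]: "Suc 0 \<le> i \<Longrightarrow> i \<le> n \<Longrightarrow> X_var i \<in> Rn n"
  by (rule Hom_Rn[OF X_var_Hom]) auto

lemma X_prod_empty [simp]: "X_prod {} = 1"
  by (simp add: X_prod_def)

lemma X_prod_mult: "finite T \<Longrightarrow> S \<subseteq> T \<Longrightarrow> X_prod S * X_prod (T - S) = X_prod T"
  unfolding X_prod_def by (metis mult.commute prod.subset_diff)

lemma X_prod_remove: "finite T \<Longrightarrow> s \<in> T \<Longrightarrow> X_prod T = X_var s * X_prod (T - {s})"
  unfolding X_prod_def by (simp add: prod.remove)

lemma field_coeff_field: "field (coeff_field :: 'k::field mpol ring)"
proof -
  have simps: "mult (coeff_field :: 'k mpol ring) = (*)" "one (coeff_field :: 'k mpol ring) = 1"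
    "zero (coeff_field :: 'k mpol ring) = 0" "add (coeff_field :: 'k mpol ring) = (+)"
    "carrier (coeff_field :: 'k mpol ring) = range (Poly_Mapping.single 0)"
    by (simp_all add: coeff_field_def poly_ring_def)
  have "cring (coeff_field :: 'k mpol ring)"
  proof (rule cringI)
    show "abelian_group (coeff_field :: 'k mpol ring)"
    proof (rule abelian_groupI)
      fix x :: "'k mpol" assume "x \<in> carrier coeff_field"
      thus "\<exists>y\<in>carrier coeff_field. y \<oplus>\<^bsub>coeff_field\<^esub> x = \<zero>\<^bsub>coeff_field\<^esub>"
        by (intro bexI[of _ "- x"]) (auto simp: simps single_uminus[symmetric])
    qed (auto simp: simps add_ac single_add[symmetric] single_zero intro: range_eqI[where x=0])
    show "Group.comm_monoid (coeff_field :: 'k mpol ring)"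
      by (rule comm_monoidI) (auto simp: simps mult_ac mult_single intro: range_eqI[where x=1])
  qed (auto simp: simps distrib_right)
  then interpret cring "coeff_field :: 'k mpol ring" .
  show ?thesis
  proof (rule cring_fieldI2)
    show "\<zero>\<^bsub>coeff_field\<^esub> \<noteq> (\<one>\<^bsub>coeff_field\<^esub> :: 'k mpol)" by (simp add: simps)
    fix a :: "'k mpol" assume a: "a \<in> carrier coeff_field" "a \<noteq> \<zero>\<^bsub>coeff_field\<^esub>"
    then obtain c where c: "a = Poly_Mapping.single 0 c" "c \<noteq> 0" by (fastforce simp: simps)
    thus "\<exists>b\<in>carrier coeff_field. a \<otimes>\<^bsub>coeff_field\<^esub> b = \<one>\<^bsub>coeff_field\<^esub>"
      by (intro bexI[of _ "Poly_Mapping.single 0 (inverse c)"]) (auto simp: simps mult_single)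
  qed
qed

lemma coeff_field_simps [simp]:
  "mult coeff_field = (*)" "one coeff_field = 1" "zero coeff_field = 0" "add coeff_field = (+)"
  "carrier coeff_field = range (Poly_Mapping.single 0)"
  by (simp_all add: coeff_field_def)

section \<open>Graded modules\<close>

context graded_poly_module
begin

lemma comp_carrier [simp]: "x \<in> component M i \<Longrightarrow> x \<in> carrier M"
  using additive_subgroup.a_subset[OF component_subgroup] by blast

lemma comp_subset: "component M i \<subseteq> carrier M"
  by auto

lemma comp_zero [simp]: "\<zero> \<in> component M i"
  by (rule additive_subgroup.zero_closed[OF component_subgroup])

lemma comp_add [simp]: "x \<in> component M i \<Longrightarrow> y \<in> component M i \<Longrightarrow> x \<oplus> y \<in> component M i"
  by (rule additive_subgroup.a_closed[OF component_subgroup])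

lemma comp_neg [simp]: "x \<in> component M i \<Longrightarrow> \<ominus> x \<in> component M i"
  by (rule additive_subgroup.a_inv_closed[OF component_subgroup])

lemma comp_minus [simp]: "x \<in> component M i \<Longrightarrow> y \<in> component M i \<Longrightarrow> x \<ominus> y \<in> component M i"
  by (simp add: a_minus_def)

lemma comp_finsum: "(\<And>a. a \<in> A \<Longrightarrow> f a \<in> component M i) \<Longrightarrow> finsum M f A \<in> component M i"
proof (induction A rule: infinite_finite_induct)
  case (insert a A)
  have "f \<in> A \<rightarrow> carrier M" "f a \<in> carrier M" using insert.prems comp_carrier by blast+
  thus ?case using insert by (simp add: finsum_insert)
qed auto

lemma smult_add: "a \<in> Rn n \<Longrightarrow> b \<in> Rn n \<Longrightarrow> x \<in> carrier M \<Longrightarrow> (a + b) \<odot> x = a \<odot> x \<oplus> b \<odot> x"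
  using smult_l_distr[of a b x] by simp

lemma smult_mult: "a \<in> Rn n \<Longrightarrow> b \<in> Rn n \<Longrightarrow> x \<in> carrier M \<Longrightarrow> (a * b) \<odot> x = a \<odot> (b \<odot> x)"
  using smult_assoc1[of a b x] by simp

lemma smult_1 [simp]: "x \<in> carrier M \<Longrightarrow> 1 \<odot> x = x"
  using smult_one[of x] by simp

lemma smult_0 [simp]: "x \<in> carrier M \<Longrightarrow> 0 \<odot> x = \<zero>"
  using smult_l_null[of x] by simp

lemma smult_uminus: "a \<in> Rn n \<Longrightarrow> x \<in> carrier M \<Longrightarrow> (- a) \<odot> x = \<ominus> (a \<odot> x)"
  using smult_l_minus[of a x] by simp

lemma smult_minus: "a \<in> Rn n \<Longrightarrow> x \<in> carrier M \<Longrightarrow> y \<in> carrier M \<Longrightarrow> a \<odot> (x \<ominus> y) = a \<odot> x \<ominus> a \<odot> y"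
  by (simp add: a_minus_def smult_r_distr smult_r_minus)

lemma smult_comm: "a \<in> Rn n \<Longrightarrow> b \<in> Rn n \<Longrightarrow> x \<in> carrier M \<Longrightarrow> a \<odot> (b \<odot> x) = b \<odot> (a \<odot> x)"
  by (metis smult_mult mult.commute)

lemma smult_sum: "(\<And>i. i \<in> A \<Longrightarrow> f i \<in> Rn n) \<Longrightarrow> finite A \<Longrightarrow> x \<in> carrier M
    \<Longrightarrow> (\<Sum>i\<in>A. f i) \<odot> x = (\<Oplus>i\<in>A. f i \<odot> x)"
proof (induction A rule: infinite_finite_induct)
  case (insert a A)
  hence "(\<lambda>i. f i \<odot> x) \<in> A \<rightarrow> carrier M" by auto
  thus ?case using insert by (simp add: finsum_insert smult_add Rn_sum)
qed auto

lemma smult_comp: "p \<in> Hom n D \<Longrightarrow> x \<in> component M i \<Longrightarrow> j = i + int D \<Longrightarrow> p \<odot> x \<in> component M j"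
  using smult_component[of p D x i] by simp

lemma finsum_mono_neutral:
  assumes "finite B" "A \<subseteq> B" "\<And>i. i \<in> B - A \<Longrightarrow> f i = \<zero>" "\<And>i. i \<in> A \<Longrightarrow> f i \<in> carrier M"
  shows "finsum M f A = finsum M f B"
proof -
  have "f b \<in> carrier M" if "b \<in> B" for b using that assms(3,4) by (cases "b \<in> A") auto
  thus ?thesis using assms by (intro add.finprod_mono_neutral_cong_left) auto
qed

section \<open>Homogeneous components of an element\<close>

definition proj :: "'m \<Rightarrow> int \<Rightarrow> 'm" where
  "proj x = (THE f. (\<forall>i. f i \<in> component M i) \<and> finite {i. f i \<noteq> \<zero>} \<and>
             x = (\<Oplus>i\<in>{i. f i \<noteq> \<zero>}. f i))"

lemma proj_props:
  assumes "x \<in> carrier M"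
  shows proj_comp [simp]: "proj x i \<in> component M i"
    and proj_finite: "finite {i. proj x i \<noteq> \<zero>}"
    and proj_sum: "x = (\<Oplus>i\<in>{i. proj x i \<noteq> \<zero>}. proj x i)"
  using theI'[OF decomposition[OF assms]] unfolding proj_def[symmetric] by simp_all

lemma proj_carrier [simp]: "x \<in> carrier M \<Longrightarrow> proj x i \<in> carrier M"
  using proj_comp comp_carrier by blast

lemma proj_unique:
  assumes x: "x \<in> carrier M" and f: "\<And>i. f i \<in> component M i" and A: "finite A" "\<And>i. i \<notin> A \<Longrightarrow> f i = \<zero>"
    and sum: "x = (\<Oplus>i\<in>A. f i)"
  shows "proj x = f"
proof -
  have sub: "{i. f i \<noteq> \<zero>} \<subseteq> A" using A by auto
  have "(\<Oplus>i\<in>{i. f i \<noteq> \<zero>}. f i) = (\<Oplus>i\<in>A. f i)"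
    by (rule finsum_mono_neutral[OF A(1) sub]) (use comp_carrier[OF f] in auto)
  hence "(\<forall>i. f i \<in> component M i) \<and> finite {i. f i \<noteq> \<zero>} \<and> x = (\<Oplus>i\<in>{i. f i \<noteq> \<zero>}. f i)"
    using f sum finite_subset[OF sub A(1)] by auto
  thus ?thesis
    unfolding proj_def by (intro the1_equality[OF decomposition[OF x]])
qed

lemma proj_sum_sup:
  assumes "x \<in> carrier M" "finite A" "{i. proj x i \<noteq> \<zero>} \<subseteq> A"
  shows "x = (\<Oplus>i\<in>A. proj x i)"
  using finsum_mono_neutral[OF assms(2,3), of "proj x"] proj_sum[OF assms(1)] assms(1) by auto

lemma proj_of_comp: "x \<in> component M i \<Longrightarrow> proj x j = (if j = i then x else \<zero>)"
proof -
  assume x: "x \<in> component M i"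
  have "proj x = (\<lambda>j. if j = i then x else \<zero>)"
    by (rule proj_unique[where A = "{i}"]) (use x in auto)
  thus ?thesis by simp
qed

lemma proj_zero [simp]: "proj \<zero> i = \<zero>"
  using proj_of_comp[of \<zero> i i] by simp

lemma proj_add: "x \<in> carrier M \<Longrightarrow> y \<in> carrier M \<Longrightarrow> proj (x \<oplus> y) i = proj x i \<oplus> proj y i"
proof -
  assume xy: "x \<in> carrier M" "y \<in> carrier M"
  let ?A = "{i. proj x i \<noteq> \<zero>} \<union> {i. proj y i \<noteq> \<zero>}"
  have fin: "finite ?A" using proj_finite xy by auto
  have "proj (x \<oplus> y) = (\<lambda>i. proj x i \<oplus> proj y i)"
  proof (rule proj_unique[OF _ _ fin])
    have "x \<oplus> y = (\<Oplus>i\<in>?A. proj x i) \<oplus> (\<Oplus>i\<in>?A. proj y i)"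
      using proj_sum_sup[of x ?A] proj_sum_sup[of y ?A] xy fin by auto
    also have "\<dots> = (\<Oplus>i\<in>?A. proj x i \<oplus> proj y i)"
      by (subst finsum_addf) (use xy in auto)
    finally show "x \<oplus> y = (\<Oplus>i\<in>?A. proj x i \<oplus> proj y i)" .
  qed (use xy in auto)
  thus ?thesis by simp
qed

lemma proj_smult:
  assumes "x \<in> carrier M" "p \<in> Hom n D"
  shows "proj (p \<odot> x) i = p \<odot> proj x (i - int D)"
proof -
  have p: "p \<in> Rn n" using assms by (auto intro: Hom_Rn)
  let ?A = "{i. proj x i \<noteq> \<zero>}"
  let ?B = "(\<lambda>i. i + int D) ` ?A"
  have fin: "finite ?A" using proj_finite assms by auto
  have "proj (p \<odot> x) = (\<lambda>i. p \<odot> proj x (i - int D))"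
  proof (rule proj_unique[where A = ?B])
    fix i assume "i \<notin> ?B"
    hence "proj x (i - int D) = \<zero>" by (auto simp: image_iff)
    thus "p \<odot> proj x (i - int D) = \<zero>" using p by simp
  next
    have "p \<odot> x = p \<odot> (\<Oplus>i\<in>?A. proj x i)" using proj_sum[OF assms(1)] by simp
    also have "\<dots> = (\<Oplus>i\<in>?A. p \<odot> proj x i)"
      by (rule finsum_smult_ldistr) (use assms p fin in auto)
    also have "\<dots> = (\<Oplus>i\<in>?B. p \<odot> proj x (i - int D))"
      by (subst finsum_reindex) (use assms p in \<open>auto simp: inj_on_def\<close>)
    finally show "p \<odot> x = (\<Oplus>i\<in>?B. p \<odot> proj x (i - int D))" .
  qed (use assms p fin in \<open>auto intro!: smult_comp[where i = "i - int D" for i]\<close>)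
  thus ?thesis by simp
qed

lemma proj_neg: "x \<in> carrier M \<Longrightarrow> proj (\<ominus> x) i = \<ominus> proj x i"
proof -
  assume x: "x \<in> carrier M"
  have "proj x i \<oplus> proj (\<ominus> x) i = \<zero>"
    using proj_add[of x "\<ominus> x" i] x by (simp add: r_neg)
  thus ?thesis using x by (metis minus_equality add.inv_closed a_comm proj_carrier)
qed

lemma proj_finsum:
  assumes "\<And>a. a \<in> A \<Longrightarrow> f a \<in> carrier M" shows "proj (finsum M f A) i = (\<Oplus>a\<in>A. proj (f a) i)"
  using assms
proof (induction A rule: infinite_finite_induct)
  case (insert a A)
  hence "f \<in> A \<rightarrow> carrier M" by auto
  thus ?case using insert by (simp add: finsum_insert proj_add)
qed auto

lemma proj_eqI: "x \<in> carrier M \<Longrightarrow> y \<in> carrier M \<Longrightarrow> (\<And>i. proj x i = proj y i) \<Longrightarrow> x = y"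
  using proj_sum[of x] proj_sum[of y] by simp

lemma proj_all_zero: "x \<in> carrier M \<Longrightarrow> (\<And>i. proj x i = \<zero>) \<Longrightarrow> x = \<zero>"
  using proj_eqI[of x \<zero>] by simp

lemma zero_of_comps: "(\<And>j. component M j = {\<zero>}) \<Longrightarrow> carrier M = {\<zero>}"
proof -
  assume *: "\<And>j. component M j = {\<zero>}"
  have "x = \<zero>" if "x \<in> carrier M" for x
  proof (rule proj_all_zero[OF that])
    fix i
    have "proj x i \<in> component M i" using that by simp
    thus "proj x i = \<zero>" using * by simp
  qed
  thus ?thesis by auto
qed

text \<open>Generation is stated as an induction principle over terms, that is, scalar times
  monomial times generator. Every term is homogeneous, so that statements about degrees can be
  checked term by term.\<close>

definition hgens :: "'m set \<Rightarrow> ('m \<Rightarrow> int) \<Rightarrow> bool" where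
  "hgens G \<delta> \<longleftrightarrow> finite G \<and> (\<forall>g\<in>G. g \<in> component M (\<delta> g)) \<and>
     (\<forall>Q. \<zero> \<in> Q \<longrightarrow> (\<forall>x\<in>Q. \<forall>y\<in>Q. x \<in> carrier M \<longrightarrow> y \<in> carrier M \<longrightarrow> x \<oplus> y \<in> Q) \<longrightarrow>
       (\<forall>m c. \<forall>g\<in>G. Poly_Mapping.keys m \<subseteq> {1..n} \<longrightarrow> Poly_Mapping.single m c \<odot> g \<in> Q) \<longrightarrow> carrier M \<subseteq> Q)"

lemma hgens_induct [consumes 2, case_names zero add mono]:
  assumes "hgens G \<delta>" "x \<in> carrier M"
    and "P \<zero>"
    and "\<And>x y. x \<in> carrier M \<Longrightarrow> y \<in> carrier M \<Longrightarrow> P x \<Longrightarrow> P y \<Longrightarrow> P (x \<oplus> y)"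
    and "\<And>m c g. g \<in> G \<Longrightarrow> Poly_Mapping.keys m \<subseteq> {1..n} \<Longrightarrow> P (Poly_Mapping.single m c \<odot> g)"
  shows "P x"
proof -
  have "carrier M \<subseteq> Collect P"
    using assms(1)[unfolded hgens_def, THEN conjunct2, THEN conjunct2, THEN spec, of "Collect P"] assms(3-5)
    by simp
  thus ?thesis using assms(2) by blast
qed

lemma hgens_comp: "hgens G \<delta> \<Longrightarrow> g \<in> G \<Longrightarrow> g \<in> component M (\<delta> g)"
  by (simp add: hgens_def)

lemma hgens_finite: "hgens G \<delta> \<Longrightarrow> finite G"
  by (simp add: hgens_def)

text \<open>Each of the given generators is the sum of its homogeneous components, and there are
  finitely many of these in all.\<close>

lemma hgens_exists:
  assumes "finitely_generated n M" shows "\<exists>G \<delta>. hgens G \<delta>"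
proof -
  obtain S where S: "finite S" "S \<subseteq> carrier M" "span S = carrier M"
    using assms unfolding finitely_generated_def by auto
  define G where "G = (\<Union>s\<in>S. proj s ` {i. proj s i \<noteq> \<zero>})"
  have "\<forall>g\<in>G. \<exists>i. g \<in> component M i"
    unfolding G_def using S(2) proj_comp by blast
  then obtain \<delta> where \<delta>: "\<And>g. g \<in> G \<Longrightarrow> g \<in> component M (\<delta> g)" by metis
  have finG: "finite G" unfolding G_def using S proj_finite by auto
  have "carrier M \<subseteq> Q" if Q: "\<zero> \<in> Q" "\<And>x y. x \<in> Q \<Longrightarrow> y \<in> Q \<Longrightarrow> x \<in> carrier M \<Longrightarrow> y \<in> carrier M \<Longrightarrow> x \<oplus> y \<in> Q"
    "\<And>m c g. g \<in> G \<Longrightarrow> Poly_Mapping.keys m \<subseteq> {1..n} \<Longrightarrow> Poly_Mapping.single m c \<odot> g \<in> Q" for Q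
  proof -
    have Qsum: "finsum M f A \<in> Q" if "finite A" "\<And>a. a \<in> A \<Longrightarrow> f a \<in> Q \<and> f a \<in> carrier M" for f :: "'z \<Rightarrow> 'm" and A
      using that
    proof (induction A)
      case (insert a A)
      hence "f \<in> A \<rightarrow> carrier M" by auto
      thus ?case using insert by (simp add: finsum_insert Q finsum_closed)
    qed (use Q in auto)
    \<comment> \<open>\<open>Q\<close> need not absorb scalars, so it cannot be compared with the
      span of \<open>S\<close> directly. \<open>N\<close> collects the elements all of whose
      multiples lie in \<open>Q\<close>; it is a submodule.\<close>
    define N where "N = {x \<in> carrier M. \<forall>p\<in>Rn n. p \<odot> x \<in> Q}"
    have GN: "g \<in> N" if g: "g \<in> G" for g
    proof -
      have gc: "g \<in> carrier M" using \<delta>[OF g] by simp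
      have "p \<odot> g \<in> Q" if p: "p \<in> Rn n" for p
      proof -
        let ?f = "\<lambda>m. Poly_Mapping.single m (Poly_Mapping.lookup p m)"
        have k: "Poly_Mapping.keys m \<subseteq> {1..n}" if "m \<in> Poly_Mapping.keys p" for m
          using p that by (auto simp: mem_Rn)
        have kR: "?f m \<in> Rn n" "?f m \<odot> g \<in> Q" if "m \<in> Poly_Mapping.keys p" for m
          using Rn_single[OF k[OF that]] Q(3)[OF g k[OF that]] by blast+
        have "p \<odot> g = (\<Sum>m\<in>Poly_Mapping.keys p. ?f m) \<odot> g" by (subst poly_eq_sum_monomials[of p]) simp
        also have "\<dots> = (\<Oplus>m\<in>Poly_Mapping.keys p. ?f m \<odot> g)"
          by (rule smult_sum) (use kR gc in auto)
        also have "\<dots> \<in> Q"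
          by (rule Qsum) (use kR gc smult_closed in auto)
        finally show ?thesis .
      qed
      thus ?thesis using gc by (simp add: N_def)
    qed
    have N0: "\<zero> \<in> N" using Q(1) by (simp add: N_def)
    have Nadd: "x \<oplus> y \<in> N" if "x \<in> N" "y \<in> N" for x y
      using that unfolding N_def by (auto simp: smult_r_distr intro!: Q(2))
    have Nsm: "p \<odot> x \<in> N" if "p \<in> Rn n" "x \<in> N" for p x
      using that unfolding N_def by (auto simp: smult_mult[symmetric])
    have sub: "submodule (poly_ring n) N M"
      unfolding submodule_def using module_axioms N0 Nadd Nsm by (auto simp: N_def)
    have NsumZ: "finsum M f A \<in> N" if "finite A" "\<And>a. a \<in> A \<Longrightarrow> f a \<in> N" for f :: "int \<Rightarrow> 'm" and A
      using that
    proof (induction A)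
      case (insert a A)
      hence "f \<in> A \<rightarrow> carrier M" "f a \<in> carrier M" by (auto simp: N_def)
      thus ?case using insert by (simp add: finsum_insert Nadd)
    qed (use N0 in auto)
    have "S \<subseteq> N"
    proof
      fix s assume s: "s \<in> S"
      hence sc: "s \<in> carrier M" using S by auto
      have "(\<Oplus>i\<in>{i. proj s i \<noteq> \<zero>}. proj s i) \<in> N"
        by (rule NsumZ) (use sc s proj_finite GN in \<open>auto simp: G_def\<close>)
      thus "s \<in> N" using proj_sum[OF sc] by simp
    qed
    hence "carrier M \<subseteq> N" using span_is_subset[OF _ sub, of S] S by auto
    thus ?thesis
    proof (intro subsetI)
      fix x assume x: "x \<in> carrier M"
      with \<open>carrier M \<subseteq> N\<close> have "1 \<odot> x \<in> Q" unfolding N_def using Rn_one by blast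
      thus "x \<in> Q" using x by simp
    qed
  qed
  hence "hgens G \<delta>" unfolding hgens_def using finG \<delta> by simp
  thus ?thesis by blast
qed

lemma hgens_submodule:
  assumes "hgens G \<delta>" "G \<subseteq> N" "\<zero> \<in> N"
    "\<And>x y. x \<in> N \<Longrightarrow> y \<in> N \<Longrightarrow> x \<oplus> y \<in> N" "\<And>p x. p \<in> Rn n \<Longrightarrow> x \<in> N \<Longrightarrow> p \<odot> x \<in> N"
  shows "carrier M \<subseteq> N"
proof
  fix x assume "x \<in> carrier M"
  with assms(1) show "x \<in> N"
    by (induction rule: hgens_induct) (use assms in \<open>auto intro!: assms(5) Rn_single\<close>)
qed

text \<open>The degree of a term is at least that of its generator.\<close>

lemma hgens_bounded_below:
  assumes G: "hgens G \<delta>" and a: "\<And>g. g \<in> G \<Longrightarrow> a \<le> \<delta> g" and "j < a"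
  shows "component M j = {\<zero>}"
proof -
  have "proj x j = \<zero>" if "x \<in> carrier M" for x
    using G that
  proof (induction rule: hgens_induct)
    case (mono m c g)
    have g: "g \<in> component M (\<delta> g)" using hgens_comp[OF G mono(1)] .
    have "Poly_Mapping.single m c \<odot> g \<in> component M (\<delta> g + int (monomial_degree m))"
      by (rule smult_comp[OF Hom_single[OF mono(2)] g]) simp
    thus ?case using proj_of_comp[of _ _ j] a[OF mono(1)] \<open>j < a\<close> by auto
  qed (auto simp: proj_add)
  hence "x = \<zero>" if "x \<in> component M j" for x
    using proj_of_comp[OF that, of j] comp_carrier[OF that] by simp
  thus ?thesis by auto
qed

lemma comp_bounded_below:
  assumes "finitely_generated n M" shows "\<exists>a. \<forall>j<a. component M j = {\<zero>}"
proof -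
  obtain G \<delta> where G: "hgens G \<delta>" using hgens_exists[OF assms] by blast
  show ?thesis
  proof (cases "G = {}")
    case True
    thus ?thesis using hgens_bounded_below[OF G, of 0] by auto
  next
    case False
    thus ?thesis using hgens_bounded_below[OF G, of "Min (\<delta> ` G)"] hgens_finite[OF G] by (intro exI[of _ "Min (\<delta> ` G)"]) auto
  qed
qed

text \<open>Induction over all of \<open>M\<close>, applied to the predicate on
  \<open>proj x j\<close>: a term of another degree projects to zero, so only the terms of degree
  \<open>j\<close> remain.\<close>

lemma comp_induct [consumes 2, case_names zero add mono]:
  assumes G: "hgens G \<delta>" and x: "x \<in> component M j"
    and "P \<zero>"
    and "\<And>x y. x \<in> component M j \<Longrightarrow> y \<in> component M j \<Longrightarrow> P x \<Longrightarrow> P y \<Longrightarrow> P (x \<oplus> y)"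
    and "\<And>m c g. g \<in> G \<Longrightarrow> Poly_Mapping.keys m \<subseteq> {1..n} \<Longrightarrow> \<delta> g + int (monomial_degree m) = j
       \<Longrightarrow> P (Poly_Mapping.single m c \<odot> g)"
  shows "P x"
proof -
  have "P (proj x j)" if "x \<in> carrier M" for x
    using G that
  proof (induction rule: hgens_induct)
    case (mono m c g)
    have g: "g \<in> component M (\<delta> g)" using hgens_comp[OF G mono(1)] .
    have *: "Poly_Mapping.single m c \<odot> g \<in> component M (\<delta> g + int (monomial_degree m))"
      by (rule smult_comp[OF Hom_single[OF mono(2)] g]) simp
    show ?case using proj_of_comp[OF *, of j] assms(3) assms(5)[OF mono, of c] by auto
  qed (use assms in \<open>auto simp: proj_add\<close>)
  hence "P (proj x j)" using x by simp
  thus ?thesis using proj_of_comp[OF x, of j] by simp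
qed

end

section \<open>Koszul complexes\<close>

definition sgn_at :: "nat \<Rightarrow> nat set \<Rightarrow> 'k::field mpol" where
  "sgn_at s T = (-1) ^ card {t \<in> T. t < s}"

lemma sgn_at_Hom: "sgn_at s T \<in> Hom n 0"
proof -
  have "(-1) ^ k \<in> Hom n 0" for k :: nat
    by (induction k) (auto simp: Hom_one Hom_uminus)
  thus ?thesis by (simp add: sgn_at_def)
qed

lemma sgn_at_Rn [simp]: "sgn_at s T \<in> Rn n"
  by (rule Hom_Rn[OF sgn_at_Hom])

lemma sgn_at_square [simp]: "sgn_at s T * sgn_at s T = 1"
  by (simp add: sgn_at_def power_mult_distrib[symmetric])

lemma sgn_at_remove_less:
  assumes "finite T" "s \<in> T" "s < t" shows "sgn_at t (T - {s}) = - sgn_at t T"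
proof -
  have "{r \<in> T. r < t} = insert s {r \<in> T - {s}. r < t}" using assms by auto
  hence "card {r \<in> T. r < t} = Suc (card {r \<in> T - {s}. r < t})" using assms by simp
  thus ?thesis by (simp add: sgn_at_def)
qed

lemma sgn_at_remove_ge:
  assumes "s \<ge> t" shows "sgn_at t (T - {s}) = sgn_at t T"
proof -
  have "{r \<in> T - {s}. r < t} = {r \<in> T. r < t}" using assms by auto
  thus ?thesis by (simp add: sgn_at_def)
qed

text \<open>Removing one of two elements changes the position of the other only if the other is
  larger, so exactly one of the two signs flips. This is what makes the differential square to
  zero.\<close>

lemma sgn_at_swap:
  assumes "finite T" "s \<in> T" "t \<in> T" "s \<noteq> t"
  shows "sgn_at s T * sgn_at t (T - {s}) = - (sgn_at t T * sgn_at s (T - {t}))"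
  using assms by (cases "s < t") (auto simp: sgn_at_remove_less sgn_at_remove_ge mult.commute)

text \<open>Cech cochains without fractions: at level \<open>k\<close>, a family \<open>x\<close> stands for the cochain with
  components \<open>x S / X_prod S ^ k\<close>. Then \<open>kd\<close> is the Cech differential, \<open>level_up\<close> rewrites the
  same cochain at level \<open>k + t\<close>, and \<open>vanishing n M i j\<close> says that the \<open>i\<close>-th local cohomology is
  zero in degree \<open>j\<close>. The index \<open>c\<close> of \<open>coch\<close> exceeds the cohomological degree by one, so that
  \<open>c = 0\<close> gives the zero term in degree \<open>- 1\<close>.\<close>

definition kd :: "('k::field mpol, 'm) graded_module \<Rightarrow> nat \<Rightarrow> (nat set \<Rightarrow> 'm) \<Rightarrow> nat set \<Rightarrow> 'm" where
  "kd M k x T = (\<Oplus>\<^bsub>M\<^esub>s\<in>T. (sgn_at s T * X_var s ^ k) \<odot>\<^bsub>M\<^esub> x (T - {s}))"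

definition level_up :: "('k::field mpol, 'm) graded_module \<Rightarrow> nat \<Rightarrow> (nat set \<Rightarrow> 'm) \<Rightarrow> nat set \<Rightarrow> 'm" where
  "level_up M t x S = X_prod S ^ t \<odot>\<^bsub>M\<^esub> x S"

definition coch :: "nat \<Rightarrow> ('k::field mpol, 'm) graded_module \<Rightarrow> nat \<Rightarrow> int \<Rightarrow> nat \<Rightarrow> (nat set \<Rightarrow> 'm) \<Rightarrow> bool" where
  "coch n M c j k x \<longleftrightarrow> (\<forall>S. S \<subseteq> {1..n} \<longrightarrow> Suc (card S) = c \<longrightarrow> x S \<in> component M (j + int (k * card S)))"

definition cocycle :: "nat \<Rightarrow> ('k::field mpol, 'm) graded_module \<Rightarrow> nat \<Rightarrow> nat \<Rightarrow> (nat set \<Rightarrow> 'm) \<Rightarrow> bool" where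
  "cocycle n M c k x \<longleftrightarrow> (\<forall>T. T \<subseteq> {1..n} \<longrightarrow> card T = c \<longrightarrow> kd M k x T = \<zero>\<^bsub>M\<^esub>)"

definition coboundary :: "nat \<Rightarrow> ('k::field mpol, 'm) graded_module \<Rightarrow> nat \<Rightarrow> int \<Rightarrow> nat \<Rightarrow> (nat set \<Rightarrow> 'm) \<Rightarrow> bool" where
  "coboundary n M i j k x \<longleftrightarrow> (\<exists>y. coch n M i j k y \<and>
     (\<forall>T. T \<subseteq> {1..n} \<longrightarrow> card T = i \<longrightarrow> kd M k y T = x T))"

definition vanishing :: "nat \<Rightarrow> ('k::field mpol, 'm) graded_module \<Rightarrow> nat \<Rightarrow> int \<Rightarrow> bool" where
  "vanishing n M i j \<longleftrightarrow> (\<forall>k x. coch n M (Suc i) j k x \<longrightarrow> cocycle n M (Suc i) k x \<longrightarrow>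
     (\<exists>t. coboundary n M i j (k + t) (level_up M t x)))"

context graded_poly_module
begin

text \<open>The terms at \<open>s t\<close> and \<open>t s\<close> cancel. Induction pairs the row
  of the new element \<open>a\<close> with its column, which avoids any division by two.\<close>

lemma finsum_antisym:
  assumes "finite T" "\<And>s t. s \<in> T \<Longrightarrow> t \<in> T \<Longrightarrow> s \<noteq> t \<Longrightarrow> g s t \<in> carrier M \<and> g s t \<oplus> g t s = \<zero>"
  shows "(\<Oplus>s\<in>T. \<Oplus>t\<in>T - {s}. g s t) = \<zero>"
  using assms
proof (induction T)
  case (insert a T)
  have ga: "g a t \<in> carrier M" "g t a \<in> carrier M" "g t a \<oplus> g a t = \<zero>" if "t \<in> T" for t
    using insert that by auto
  have g: "g s t \<in> carrier M" if "t \<in> T" "s \<in> T" "s \<noteq> t" for s t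
    using insert that by auto
  have inner: "(\<Oplus>t\<in>insert a T - {s}. g s t) = g s a \<oplus> (\<Oplus>t\<in>T - {s}. g s t)" if s: "s \<in> T" for s
  proof -
    have "insert a T - {s} = insert a (T - {s})" using insert s by auto
    moreover have "(\<Oplus>t\<in>insert a (T - {s}). g s t) = g s a \<oplus> (\<Oplus>t\<in>T - {s}. g s t)"
    proof (rule finsum_insert)
      show "g s \<in> T - {s} \<rightarrow> carrier M" by (intro Pi_I g) (use s in auto)
    qed (use insert.hyps s ga in auto)
    ultimately show ?thesis by simp
  qed
  have c1: "(\<Oplus>t\<in>T - {s}. g s t) \<in> carrier M" if "s \<in> T" for s
    by (rule finsum_closed) (use g that in auto)
  have "(\<Oplus>s\<in>insert a T. \<Oplus>t\<in>insert a T - {s}. g s t)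
      = (\<Oplus>t\<in>insert a T - {a}. g a t) \<oplus> (\<Oplus>s\<in>T. \<Oplus>t\<in>insert a T - {s}. g s t)"
  proof (subst finsum_insert[OF insert(1,2)])
    show "(\<lambda>s. \<Oplus>t\<in>insert a T - {s}. g s t) \<in> T \<rightarrow> carrier M"
      using inner ga c1 by auto
    show "(\<Oplus>t\<in>insert a T - {a}. g a t) \<in> carrier M"
      by (rule finsum_closed) (use ga in auto)
  qed simp
  also have "insert a T - {a} = T" using insert by auto
  also have "(\<Oplus>s\<in>T. \<Oplus>t\<in>insert a T - {s}. g s t) = (\<Oplus>s\<in>T. g s a \<oplus> (\<Oplus>t\<in>T - {s}. g s t))"
    by (rule finsum_cong') (use inner ga c1 in auto)
  also have "\<dots> = (\<Oplus>s\<in>T. g s a) \<oplus> (\<Oplus>s\<in>T. \<Oplus>t\<in>T - {s}. g s t)"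
    by (rule finsum_addf) (use ga c1 in auto)
  also have "(\<Oplus>s\<in>T. \<Oplus>t\<in>T - {s}. g s t) = \<zero>"
    by (rule insert.IH) (use insert.prems in auto)
  also have "(\<Oplus>t\<in>T. g a t) \<oplus> ((\<Oplus>s\<in>T. g s a) \<oplus> \<zero>) = (\<Oplus>s\<in>T. g a s \<oplus> g s a)"
    by (subst finsum_addf) (use ga in auto)
  also have "\<dots> = (\<Oplus>s\<in>T. \<zero>)"
    by (rule finsum_cong') (use ga a_comm in auto)
  finally show ?case by simp
qed simp

lemma X_pow_Rn: "T \<subseteq> {1..n} \<Longrightarrow> s \<in> T \<Longrightarrow> (X_var s ^ k :: 'k mpol) \<in> Rn n"
  by (intro Rn_power X_var_Rn) auto

lemma kd_scalar_Rn: "T \<subseteq> {1..n} \<Longrightarrow> s \<in> T \<Longrightarrow> (sgn_at s T * X_var s ^ k :: 'k mpol) \<in> Rn n"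
  by (intro Rn_mult sgn_at_Rn X_pow_Rn)

lemma kd_scalar_Hom: "T \<subseteq> {1..n} \<Longrightarrow> s \<in> T \<Longrightarrow> (sgn_at s T * X_var s ^ k :: 'k mpol) \<in> Hom n k"
  using Hom_mult[OF sgn_at_Hom Hom_power[OF X_var_Hom[of s n]], of s T k] by auto

lemma kd_closed:
  assumes "T \<subseteq> {1..n}" "\<And>s. s \<in> T \<Longrightarrow> x (T - {s}) \<in> carrier M"
  shows "kd M k x T \<in> carrier M"
  unfolding kd_def by (rule finsum_closed) (use assms kd_scalar_Rn in auto)

lemma kd_cong:
  assumes "T \<subseteq> {1..n}" "\<And>s. s \<in> T \<Longrightarrow> x (T - {s}) \<in> carrier M" "\<And>s. s \<in> T \<Longrightarrow> x (T - {s}) = y (T - {s})"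
  shows "kd M k x T = kd M k y T"
  unfolding kd_def by (rule finsum_cong') (use assms kd_scalar_Rn in auto)

lemma kd_add:
  assumes "T \<subseteq> {1..n}" "\<And>s. s \<in> T \<Longrightarrow> x (T - {s}) \<in> carrier M" "\<And>s. s \<in> T \<Longrightarrow> y (T - {s}) \<in> carrier M"
  shows "kd M k (\<lambda>S. x S \<oplus> y S) T = kd M k x T \<oplus> kd M k y T"
proof -
  have "kd M k (\<lambda>S. x S \<oplus> y S) T
    = (\<Oplus>s\<in>T. (sgn_at s T * X_var s ^ k) \<odot> x (T - {s}) \<oplus> (sgn_at s T * X_var s ^ k) \<odot> y (T - {s}))"
    unfolding kd_def by (rule finsum_cong') (use assms kd_scalar_Rn in \<open>auto simp: smult_r_distr\<close>)
  also have "\<dots> = kd M k x T \<oplus> kd M k y T"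
    unfolding kd_def by (rule finsum_addf) (use assms kd_scalar_Rn in auto)
  finally show ?thesis .
qed

lemma kd_smult:
  assumes "T \<subseteq> {1..n}" "\<And>s. s \<in> T \<Longrightarrow> x (T - {s}) \<in> carrier M" "p \<in> Rn n"
  shows "kd M k (\<lambda>S. p \<odot> x S) T = p \<odot> kd M k x T"
proof -
  have fin: "finite T" using assms(1) finite_subset by blast
  have "p \<odot> kd M k x T = (\<Oplus>s\<in>T. p \<odot> ((sgn_at s T * X_var s ^ k) \<odot> x (T - {s})))"
    unfolding kd_def by (rule finsum_smult_ldistr) (use assms kd_scalar_Rn fin in auto)
  also have "\<dots> = kd M k (\<lambda>S. p \<odot> x S) T"
    unfolding kd_def by (rule finsum_cong') (use assms kd_scalar_Rn in \<open>auto intro: smult_comm\<close>)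
  finally show ?thesis by simp
qed

lemma kd_minus:
  assumes "T \<subseteq> {1..n}" "\<And>s. s \<in> T \<Longrightarrow> x (T - {s}) \<in> carrier M" "\<And>s. s \<in> T \<Longrightarrow> y (T - {s}) \<in> carrier M"
  shows "kd M k (\<lambda>S. x S \<ominus> y S) T = kd M k x T \<ominus> kd M k y T"
proof -
  have m: "x S \<ominus> y S = x S \<oplus> (- 1) \<odot> y S" if "y S \<in> carrier M" for S
    using that smult_uminus[of 1 "y S"] by (simp add: a_minus_def)
  have "kd M k (\<lambda>S. x S \<ominus> y S) T = kd M k (\<lambda>S. x S \<oplus> (- 1) \<odot> y S) T"
    by (rule kd_cong) (use assms m in auto)
  also have "\<dots> = kd M k x T \<oplus> kd M k (\<lambda>S. (- 1) \<odot> y S) T"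
    by (rule kd_add) (use assms in auto)
  also have "\<dots> = kd M k x T \<oplus> (- 1) \<odot> kd M k y T"
    by (subst kd_smult) (use assms in auto)
  also have "\<dots> = kd M k x T \<ominus> kd M k y T"
    using smult_uminus[of 1 "kd M k y T"] kd_closed[of T y k] assms by (simp add: a_minus_def)
  finally show ?thesis .
qed

text \<open>\<open>X_prod T\<close> is \<open>X_var s\<close> times \<open>X_prod (T - {s})\<close>:
  the factor that raises the level at \<open>T\<close> splits into the one at \<open>T - {s}\<close>
  and the passage from \<open>X_var s ^ k\<close> to \<open>X_var s ^ (k + t)\<close>.\<close>

lemma kd_level_up:
  assumes T: "T \<subseteq> {1..n}" and x: "\<And>s. s \<in> T \<Longrightarrow> x (T - {s}) \<in> carrier M"
  shows "kd M (k + t) (level_up M t x) T = level_up M t (kd M k x) T"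
proof -
  have fin: "finite T" using T finite_subset by blast
  have Xs: "(X_prod (T - {s}) :: 'k mpol) \<in> Rn n" for s by (rule X_prod_Rn) (use T in auto)
  have "level_up M t (kd M k x) T = (\<Oplus>s\<in>T. X_prod T ^ t \<odot> ((sgn_at s T * X_var s ^ k) \<odot> x (T - {s})))"
    unfolding kd_def level_up_def
    by (rule finsum_smult_ldistr) (use T x kd_scalar_Rn fin in auto)
  also have "\<dots> = kd M (k + t) (level_up M t x) T"
    unfolding kd_def level_up_def
  proof (rule finsum_cong')
    fix s assume s: "s \<in> T"
    have eq: "(X_prod T ^ t * (sgn_at s T * X_var s ^ k) :: 'k mpol) = (sgn_at s T * X_var s ^ (k + t)) * X_prod (T - {s}) ^ t"
      by (simp add: X_prod_remove[OF fin s] power_mult_distrib power_add mult_ac)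
    show "X_prod T ^ t \<odot> ((sgn_at s T * X_var s ^ k) \<odot> x (T - {s})) =
      (sgn_at s T * X_var s ^ (k + t)) \<odot> (X_prod (T - {s}) ^ t \<odot> x (T - {s}))"
      using T s x[OF s] kd_scalar_Rn[OF T s] Xs[of s] by (simp only: smult_mult[symmetric] Rn_power X_prod_Rn eq)
  qed (use T x kd_scalar_Rn Xs in auto)
  finally show ?thesis by simp
qed

text \<open>Expansion gives a double sum over ordered pairs, which is antisymmetric by
  \<open>sgn_at_swap\<close>.\<close>

lemma kd_kd:
  assumes T: "T \<subseteq> {1..n}" and x: "\<And>S. S \<subseteq> {1..n} \<Longrightarrow> Suc (Suc (card S)) = card T \<Longrightarrow> x S \<in> carrier M"
  shows "kd M k (kd M k x) T = \<zero>"
proof -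
  have fin: "finite T" using T finite_subset by blast
  let ?g = "\<lambda>s t. (sgn_at s T * X_var s ^ k * (sgn_at t (T - {s}) * X_var t ^ k)) \<odot> x (T - {s} - {t})"
  have xc: "x (T - {s} - {t}) \<in> carrier M" if "s \<in> T" "t \<in> T" "s \<noteq> t" for s t
  proof (rule x)
    have "card T = Suc (card (T - {s}))" "card (T - {s}) = Suc (card (T - {s} - {t}))"
      using that fin by (metis card_Suc_Diff1 finite_Diff insert_Diff insert_iff)+
    thus "Suc (Suc (card (T - {s} - {t}))) = card T" by simp
  qed (use T in auto)
  have Ts: "T - {s} \<subseteq> {1..n}" for s using T by auto
  have gc: "?g s t \<in> carrier M" if "s \<in> T" "t \<in> T" "s \<noteq> t" for s t
    using that xc[OF that] kd_scalar_Rn[OF T that(1), of k] kd_scalar_Rn[OF Ts, of t s k] by (auto intro!: smult_closed)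
  have "kd M k (kd M k x) T = (\<Oplus>s\<in>T. \<Oplus>t\<in>T - {s}. ?g s t)"
    unfolding kd_def
  proof (rule finsum_cong')
    fix s assume s: "s \<in> T"
    have "(sgn_at s T * X_var s ^ k) \<odot> (\<Oplus>t\<in>T - {s}. (sgn_at t (T - {s}) * X_var t ^ k) \<odot> x (T - {s} - {t}))
      = (\<Oplus>t\<in>T - {s}. (sgn_at s T * X_var s ^ k) \<odot> ((sgn_at t (T - {s}) * X_var t ^ k) \<odot> x (T - {s} - {t})))"
    proof (rule finsum_smult_ldistr)
      show "(\<lambda>t. (sgn_at t (T - {s}) * X_var t ^ k) \<odot> x (T - {s} - {t})) \<in> T - {s} \<rightarrow> carrier M"
      proof
        fix t assume "t \<in> T - {s}"
        thus "(sgn_at t (T - {s}) * X_var t ^ k) \<odot> x (T - {s} - {t}) \<in> carrier M"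
          using xc[of s t] s kd_scalar_Rn[OF Ts, of t s k] by (intro smult_closed) auto
      qed
    qed (use fin kd_scalar_Rn[OF T s] in auto)
    also have "\<dots> = (\<Oplus>t\<in>T - {s}. ?g s t)"
    proof (rule finsum_cong')
      fix t assume "t \<in> T - {s}"
      thus "(sgn_at s T * X_var s ^ k) \<odot> ((sgn_at t (T - {s}) * X_var t ^ k) \<odot> x (T - {s} - {t})) = ?g s t"
        using xc[of s t] s kd_scalar_Rn[OF T s, of k] kd_scalar_Rn[OF Ts, of t s k]
        by (subst smult_mult) auto
    qed (use gc s in auto)
    finally show "(sgn_at s T * X_var s ^ k) \<odot> (\<Oplus>t\<in>T - {s}. (sgn_at t (T - {s}) * X_var t ^ k) \<odot> x (T - {s} - {t})) = (\<Oplus>t\<in>T - {s}. ?g s t)" .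
  next
    show "(\<lambda>s. \<Oplus>t\<in>T - {s}. ?g s t) \<in> T \<rightarrow> carrier M"
      using gc by (auto intro!: finsum_closed)
  qed simp
  also have "\<dots> = \<zero>"
  proof (rule finsum_antisym[OF fin])
    fix s t assume st: "s \<in> T" "t \<in> T" "s \<noteq> t"
    let ?A = "\<lambda>s t. (sgn_at s T * X_var s ^ k * (sgn_at t (T - {s}) * X_var t ^ k) :: 'k mpol)"
    have "?A s t = (sgn_at s T * sgn_at t (T - {s})) * (X_var s ^ k * X_var t ^ k)" by (simp add: mult_ac)
    also have "\<dots> = - ?A t s" by (simp add: sgn_at_swap[OF fin st] mult_ac)
    finally have "?A s t = - ?A t s" .
    moreover have "T - {t} - {s} = T - {s} - {t}" by auto
    moreover have "?A t s \<in> Rn n"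
      using kd_scalar_Rn[OF T st(2), of k] kd_scalar_Rn[OF Ts, of s t k] st by auto
    ultimately show "?g s t \<in> carrier M \<and> ?g s t \<oplus> ?g t s = \<zero>"
      using gc[OF st] gc[of t s] st xc[OF st] by (simp add: smult_uminus l_neg)
  qed
  finally show ?thesis .
qed

end

section \<open>A homotopy up to a power of a variable, and torsion of cohomology\<close>

lemma single_X_var_factor:
  assumes "k \<le> Poly_Mapping.lookup m t"
  shows "Poly_Mapping.single m c = X_var t ^ k * Poly_Mapping.single (m - Poly_Mapping.single t k) (c :: 'k::field)"
proof -
  have p: "X_var t ^ k = (Poly_Mapping.single (Poly_Mapping.single t k) 1 :: 'k mpol)"
    by (induction k) (auto simp: X_var_def mult_single single_add[symmetric] simp flip: single_one)
  have "m = Poly_Mapping.single t k + (m - Poly_Mapping.single t k)"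
    using assms by (intro poly_mapping_eqI) (auto simp: lookup_add lookup_minus lookup_single when_def)
  thus ?thesis unfolding p by (simp add: mult_single)
qed

text \<open>Pigeonhole: exponents below \<open>k\<close> would bound the degree by
  \<open>n * k\<close>. The strict inequality also rules out \<open>n = 0\<close>.\<close>

lemma monomial_degree_ge_imp_large_exponent:
  assumes "Poly_Mapping.keys m \<subseteq> {1..n}" "n * k < monomial_degree m"
  shows "\<exists>t\<in>{1..n}. k \<le> Poly_Mapping.lookup m t"
proof (rule ccontr)
  assume "\<not> ?thesis"
  hence "monomial_degree m \<le> (\<Sum>i\<in>{1..n}. k)"
    unfolding monomial_degree_alt[OF finite_atLeastAtMost assms(1)] by (intro sum_mono) force
  thus False using assms(2) by simp
qed

text \<open>Interior multiplication by \<open>t\<close> on the Koszul complex. Dividing by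
  \<open>X_var t ^ k\<close> would turn it into a contracting homotopy; leaving the division out
  keeps the values in \<open>M\<close> at the price of this factor.\<close>

definition contraction :: "('k::field mpol, 'm) graded_module \<Rightarrow> nat \<Rightarrow> (nat set \<Rightarrow> 'm) \<Rightarrow> nat set \<Rightarrow> 'm" where
  "contraction M t u S = (if t \<in> S then \<zero>\<^bsub>M\<^esub> else sgn_at t S \<odot>\<^bsub>M\<^esub> u (insert t S))"

lemma sgn_at_insert_self [simp]: "sgn_at t (insert t S) = sgn_at t S"
proof -
  have "{r \<in> insert t S. r < t} = {r \<in> S. r < t}" by auto
  thus ?thesis by (simp add: sgn_at_def)
qed

lemma sgn_at_remove_self [simp]: "sgn_at t (T - {t}) = sgn_at t T"
  by (rule sgn_at_remove_ge) simp

context graded_poly_module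
begin

lemma coch_comp: "coch n M c j k x \<Longrightarrow> S \<subseteq> {1..n} \<Longrightarrow> Suc (card S) = c \<Longrightarrow> x S \<in> component M (j + int (k * card S))"
  by (simp add: coch_def)

lemma coch_carrier: "coch n M c j k x \<Longrightarrow> S \<subseteq> {1..n} \<Longrightarrow> Suc (card S) = c \<Longrightarrow> x S \<in> carrier M"
  using coch_comp comp_carrier by blast

lemma coch_remove_comp:
  assumes "coch n M c j k x" "T \<subseteq> {1..n}" "card T = c" "s \<in> T"
  shows "x (T - {s}) \<in> component M (j + int (k * (card T - 1)))"
proof -
  have "finite T" using assms finite_subset by blast
  hence c: "card (T - {s}) = card T - 1" "card T > 0" using assms(4) by (auto simp: card_gt_0_iff)
  hence "Suc (card (T - {s})) = c" using assms(3) by simp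
  thus ?thesis using coch_comp[OF assms(1), of "T - {s}"] assms(2) c by auto
qed

lemma coch_remove:
  assumes "coch n M c j k x" "T \<subseteq> {1..n}" "card T = c" "s \<in> T" shows "x (T - {s}) \<in> carrier M"
  using coch_remove_comp[OF assms] by simp

lemma kd_comp:
  assumes "coch n M c j k x" "T \<subseteq> {1..n}" "card T = c"
  shows "kd M k x T \<in> component M (j + int (k * card T))"
  unfolding kd_def
proof (rule comp_finsum)
  fix s assume s: "s \<in> T"
  have "finite T" using assms finite_subset by blast
  hence "card T > 0" using s by (auto simp: card_gt_0_iff)
  hence "j + int (k * card T) = j + int (k * (card T - 1)) + int k"
    by (cases "card T") (auto simp: algebra_simps)
  thus "(sgn_at s T * X_var s ^ k) \<odot> x (T - {s}) \<in> component M (j + int (k * card T))"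
    using smult_comp[OF kd_scalar_Hom[OF assms(2) s, of k] coch_remove_comp[OF assms s]] by (simp add: add.assoc)
qed

lemma kd_kd_coch:
  assumes "coch n M c j k x" "T \<subseteq> {1..n}" "card T = Suc c" shows "kd M k (kd M k x) T = \<zero>"
  by (rule kd_kd[OF assms(2)]) (use assms coch_carrier in auto)

lemma level_up_closed: "S \<subseteq> {1..n} \<Longrightarrow> x S \<in> carrier M \<Longrightarrow> level_up M t x S \<in> carrier M"
  unfolding level_up_def by (intro smult_closed Rn_power X_prod_Rn)

lemma coch_level_up: "coch n M c j k x \<Longrightarrow> coch n M c j (k + t) (level_up M t x)"
  unfolding coch_def level_up_def
  by (auto intro!: smult_comp[OF Hom_power[OF X_prod_Hom]] simp: algebra_simps)

lemma coch_add: "coch n M c j k x \<Longrightarrow> coch n M c j k y \<Longrightarrow> coch n M c j k (\<lambda>S. x S \<oplus> y S)"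
  and coch_minus: "coch n M c j k x \<Longrightarrow> coch n M c j k y \<Longrightarrow> coch n M c j k (\<lambda>S. x S \<ominus> y S)"
  by (auto simp: coch_def)

lemma coch_smult: "p \<in> Hom n D \<Longrightarrow> coch n M c j k x \<Longrightarrow> coch n M c (j + int D) k (\<lambda>S. p \<odot> x S)"
  unfolding coch_def by (auto intro!: smult_comp)

lemma coch_kd: "coch n M c j k x \<Longrightarrow> coch n M (Suc c) j k (kd M k x)"
  using kd_comp unfolding coch_def[of n M "Suc c"] by auto

lemma level_up_level_up:
  "S \<subseteq> {1..n} \<Longrightarrow> x S \<in> carrier M \<Longrightarrow> level_up M t (level_up M s x) S = level_up M (s + t) x S"
  unfolding level_up_def by (simp add: smult_mult[symmetric] power_add mult.commute)

lemma level_up_smult: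
  "S \<subseteq> {1..n} \<Longrightarrow> x S \<in> carrier M \<Longrightarrow> p \<in> Rn n \<Longrightarrow> level_up M t (\<lambda>S. p \<odot> x S) S = p \<odot> level_up M t x S"
  unfolding level_up_def by (rule smult_comm) auto

lemma level_up_minus:
  "S \<subseteq> {1..n} \<Longrightarrow> x S \<in> carrier M \<Longrightarrow> y S \<in> carrier M \<Longrightarrow> level_up M t (\<lambda>S. x S \<ominus> y S) S = level_up M t x S \<ominus> level_up M t y S"
  unfolding level_up_def by (rule smult_minus) auto

lemma contraction_coch:
  assumes "coch n M (Suc i) j k u" "t \<in> {1..n}"
  shows "coch n M i (j + int k) k (contraction M t u)"
  unfolding coch_def
proof (intro allI impI)
  fix S assume S: "S \<subseteq> {1..n}" "Suc (card S) = i"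
  have fin: "finite S" using S finite_subset by blast
  show "contraction M t u S \<in> component M (j + int k + int (k * card S))"
  proof (cases "t \<in> S")
    case False
    have "u (insert t S) \<in> component M (j + int (k * card (insert t S)))"
      by (rule coch_comp[OF assms(1)]) (use S assms(2) False fin in auto)
    hence "u (insert t S) \<in> component M (j + int k + int (k * card S))"
      using fin False by (simp add: algebra_simps)
    thus ?thesis using False smult_comp[OF sgn_at_Hom] by (simp add: contraction_def)
  qed (simp add: contraction_def)
qed

text \<open>The homotopy formula on cocycles. For \<open>t\<close> in \<open>T\<close> only the
  summand \<open>s = t\<close> survives, as \<open>contraction\<close> vanishes on sets containing
  \<open>t\<close>; for \<open>t\<close> outside \<open>T\<close> the cocycle condition at
  \<open>insert t T\<close> is solved for the term with \<open>u T\<close>.\<close>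

lemma contraction_homotopy:
  assumes u: "coch n M (Suc i) j k u" and z: "cocycle n M (Suc i) k u" and t: "t \<in> {1..n}"
    and T: "T \<subseteq> {1..n}" "card T = i"
  shows "kd M k (contraction M t u) T = X_var t ^ k \<odot> u T"
proof -
  have fin: "finite T" using T finite_subset by blast
  have uT: "u T \<in> carrier M" using coch_carrier[OF u T(1)] T(2) by simp
  have hc: "contraction M t u (T - {s}) \<in> carrier M" if "s \<in> T" for s
    by (rule coch_remove[OF contraction_coch[OF u t] T that])
  have Xt: "(X_var t ^ k :: 'k mpol) \<in> Rn n" using t by simp
  show ?thesis
  proof (cases "t \<in> T")
    case True
    have "kd M k (contraction M t u) T = (\<Oplus>s\<in>{t}. (sgn_at s T * X_var s ^ k) \<odot> contraction M t u (T - {s}))"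
      unfolding kd_def
    proof (rule finsum_mono_neutral[symmetric])
      fix s assume "s \<in> T - {t}"
      thus "(sgn_at s T * X_var s ^ k) \<odot> contraction M t u (T - {s}) = \<zero>"
        using True kd_scalar_Rn[OF T(1), of s k] by (auto simp: contraction_def)
    next
      fix s assume "s \<in> {t}"
      thus "(sgn_at s T * X_var s ^ k) \<odot> contraction M t u (T - {s}) \<in> carrier M"
        using hc[of s] kd_scalar_Rn[OF T(1), of s k] True by auto
    qed (use fin True in auto)
    also have "\<dots> = (sgn_at t T * X_var t ^ k) \<odot> contraction M t u (T - {t})"
      using hc[of t] kd_scalar_Rn[OF T(1), of t k] True by auto
    also have "contraction M t u (T - {t}) = sgn_at t T \<odot> u T"
      using True by (simp add: contraction_def insert_absorb)
    also have "(sgn_at t T * X_var t ^ k) \<odot> (sgn_at t T \<odot> u T) = (sgn_at t T * X_var t ^ k * sgn_at t T) \<odot> u T"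
      by (rule smult_mult[symmetric]) (use uT Xt in auto)
    also have "sgn_at t T * X_var t ^ k * sgn_at t T = (sgn_at t T * sgn_at t T) * (X_var t ^ k :: 'k mpol)"
      by (simp only: mult_ac)
    finally show ?thesis by simp
  next
    case False
    let ?T = "insert t T"
    have T': "?T \<subseteq> {1..n}" "card ?T = Suc i" using T t fin False by auto
    have uc: "u (?T - {s}) \<in> carrier M" if "s \<in> ?T" for s
      by (rule coch_remove[OF u T' that])
    have c: "(\<lambda>s. (sgn_at s ?T * X_var s ^ k) \<odot> u (?T - {s})) \<in> T \<rightarrow> carrier M"
      using uc kd_scalar_Rn[OF T'(1)] by auto
    have "\<zero> = kd M k u ?T" using z T' by (simp add: cocycle_def)
    also have "\<dots> = (sgn_at t ?T * X_var t ^ k) \<odot> u (?T - {t}) \<oplus> (\<Oplus>s\<in>T. (sgn_at s ?T * X_var s ^ k) \<odot> u (?T - {s}))"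
      unfolding kd_def using c False fin uc[of t] kd_scalar_Rn[OF T'(1), of t k] by (intro finsum_insert) auto
    also have "?T - {t} = T" using False by auto
    finally have 0: "\<zero> = (sgn_at t T * X_var t ^ k) \<odot> u T \<oplus> (\<Oplus>s\<in>T. (sgn_at s ?T * X_var s ^ k) \<odot> u (?T - {s}))"
      by simp
    have "kd M k (contraction M t u) T = (\<Oplus>s\<in>T. (- sgn_at t T) \<odot> ((sgn_at s ?T * X_var s ^ k) \<odot> u (?T - {s})))"
      unfolding kd_def
    proof (rule finsum_cong')
      fix s assume s: "s \<in> T"
      have st: "s \<noteq> t" using s False by auto
      have Ts: "?T - {s} = insert t (T - {s})" "?T - {t} = T" using st False by auto
      have "contraction M t u (T - {s}) = sgn_at t (T - {s}) \<odot> u (?T - {s})"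
        using False Ts by (simp add: contraction_def)
      \<comment> \<open>Up to the sign \<open>- sgn_at t T\<close>, which is the same for all
        \<open>s\<close>, this is the scalar occurring in the cocycle condition at
        \<open>insert t T\<close>.\<close>
      moreover have "sgn_at s T * X_var s ^ k * sgn_at t (T - {s}) = - sgn_at t T * (sgn_at s ?T * X_var s ^ k :: 'k mpol)"
      proof -
        have sw: "sgn_at s ?T * sgn_at t (T - {s}) = - (sgn_at t T * sgn_at s T :: 'k mpol)"
          using sgn_at_swap[of ?T s t] fin s st Ts by simp
        have "sgn_at t (T - {s}) = (sgn_at s ?T * sgn_at s ?T) * (sgn_at t (T - {s}) :: 'k mpol)" by simp
        also have "\<dots> = - (sgn_at s ?T * sgn_at t T * sgn_at s T)"
          using sw by (metis (no_types, lifting) mult.assoc mult_minus_right)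
        finally have e: "sgn_at t (T - {s}) = - (sgn_at s ?T * sgn_at t T * (sgn_at s T :: 'k mpol))" .
        have "sgn_at s T * X_var s ^ k * sgn_at t (T - {s}) = - ((sgn_at s T * sgn_at s T) * (sgn_at t T * (sgn_at s ?T * X_var s ^ k) :: 'k mpol))"
          unfolding e by (simp only: mult_ac mult_minus_right mult_minus_left)
        thus ?thesis by simp
      qed
      ultimately show "(sgn_at s T * X_var s ^ k) \<odot> contraction M t u (T - {s}) = (- sgn_at t T) \<odot> ((sgn_at s ?T * X_var s ^ k) \<odot> u (?T - {s}))"
        using uc[of s] s kd_scalar_Rn[OF T'(1), of s k] kd_scalar_Rn[OF T(1), of s k]
        by (simp add: smult_mult[symmetric] del: Rn_mult)
    qed (use c in auto)
    also have "\<dots> = (- sgn_at t T) \<odot> (\<Oplus>s\<in>T. (sgn_at s ?T * X_var s ^ k) \<odot> u (?T - {s}))"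
      by (rule finsum_smult_ldistr[symmetric]) (use fin c in auto)
    also have "(\<Oplus>s\<in>T. (sgn_at s ?T * X_var s ^ k) \<odot> u (?T - {s})) = \<ominus> ((sgn_at t T * X_var t ^ k) \<odot> u T)"
    proof (rule minus_equality[symmetric])
      show "(\<Oplus>s\<in>T. (sgn_at s ?T * X_var s ^ k) \<odot> u (?T - {s})) \<oplus> (sgn_at t T * X_var t ^ k) \<odot> u T = \<zero>"
        using 0 c uT Xt by (subst a_comm) auto
    qed (use c uT Xt in auto)
    also have "\<dots> = (- (sgn_at t T * X_var t ^ k)) \<odot> u T"
      using uT Xt by (simp add: smult_uminus)
    also have "(- sgn_at t T) \<odot> ((- (sgn_at t T * X_var t ^ k)) \<odot> u T) = ((- sgn_at t T) * (- (sgn_at t T * X_var t ^ k))) \<odot> u T"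
      by (rule smult_mult[symmetric]) (use uT Xt in auto)
    also have "(- sgn_at t T) * (- (sgn_at t T * X_var t ^ k)) = (sgn_at t T * sgn_at t T) * (X_var t ^ k :: 'k mpol)"
      by (simp add: mult.assoc)
    finally show ?thesis by simp
  qed
qed

text \<open>A monomial of degree above \<open>n * k\<close> is divisible by some
  \<open>X_var t ^ k\<close>, and contraction along this \<open>t\<close> exhibits its multiple of
  the cocycle as a coboundary at the same level. Summing over the terms of \<open>q\<close> gives
  the claim.\<close>

lemma torsion:
  assumes u: "coch n M (Suc i) j k u" and z: "cocycle n M (Suc i) k u" and q: "q \<in> Hom n E" "n * k < E"
  shows "coboundary n M i (j + int E) k (\<lambda>S. q \<odot> u S)"
proof -
  have uc: "u T \<in> carrier M" if "T \<subseteq> {1..n}" "card T = i" for T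
    using coch_carrier[OF u that(1)] that(2) by simp
  have one: "coboundary n M i (j + int E) k (\<lambda>S. Poly_Mapping.single m c \<odot> u S)"
    if m: "Poly_Mapping.keys m \<subseteq> {1..n}" "monomial_degree m = E" for m c
  proof -
    obtain t where t: "t \<in> {1..n}" "k \<le> Poly_Mapping.lookup m t"
      using monomial_degree_ge_imp_large_exponent[OF m(1)] m(2) q(2) by blast
    define r where "r = m - Poly_Mapping.single t k"
    have mr: "m = r + Poly_Mapping.single t k"
      unfolding r_def using t(2) by (intro poly_mapping_eqI) (auto simp: lookup_add lookup_minus lookup_single when_def)
    hence rk: "Poly_Mapping.keys r \<subseteq> {1..n}" using m(1) by (auto simp: keys_add_nat)
    have rd: "E = monomial_degree r + k" using m(2) mr by (simp add: monomial_degree_add)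
    let ?r = "Poly_Mapping.single r c"
    have rR: "?r \<in> Rn n" by (rule Rn_single[OF rk])
    have "coch n M i (j + int E) k (\<lambda>S. ?r \<odot> contraction M t u S)"
      using coch_smult[OF Hom_single[OF rk, of c] contraction_coch[OF u t(1)]] rd by (simp add: algebra_simps)
    moreover have "kd M k (\<lambda>S. ?r \<odot> contraction M t u S) T = Poly_Mapping.single m c \<odot> u T"
      if T: "T \<subseteq> {1..n}" "card T = i" for T
    proof -
      have "kd M k (\<lambda>S. ?r \<odot> contraction M t u S) T = ?r \<odot> (X_var t ^ k \<odot> u T)"
        by (subst kd_smult) (use T rR coch_remove[OF contraction_coch[OF u t(1)]] contraction_homotopy[OF u z t(1) T] in auto)
      also have "\<dots> = (X_var t ^ k * ?r) \<odot> u T"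
        using rR uc[OF T] t by (subst mult.commute) (simp add: smult_mult)
      finally show ?thesis using single_X_var_factor[OF t(2), of c] by (simp add: r_def)
    qed
    ultimately show ?thesis unfolding coboundary_def by blast
  qed
  have all: "coboundary n M i (j + int E) k (\<lambda>S. (\<Sum>m\<in>A. Poly_Mapping.single m (Poly_Mapping.lookup q m)) \<odot> u S)"
    if "finite A" "A \<subseteq> Poly_Mapping.keys q" for A
    using that
  proof (induction A)
    case empty
    have "kd M k (\<lambda>S. \<zero>) T = \<zero>" if "T \<subseteq> {1..n}" for T :: "nat set"
      unfolding kd_def using kd_scalar_Rn[OF that] by (intro add.finprod_one_eqI) auto
    thus ?case unfolding coboundary_def using uc by (intro exI[of _ "\<lambda>S. \<zero>"]) (auto simp: coch_def)
  next
    case (insert m A)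
    let ?s = "\<Sum>m\<in>A. Poly_Mapping.single m (Poly_Mapping.lookup q m)"
    let ?m = "Poly_Mapping.single m (Poly_Mapping.lookup q m)"
    have m: "Poly_Mapping.keys m \<subseteq> {1..n}" "monomial_degree m = E"
      using insert.prems q(1) by (auto simp: homogeneous_polys_def mem_Rn)
    have kR: "Poly_Mapping.single m' (Poly_Mapping.lookup q m') \<in> Rn n" if "m' \<in> Poly_Mapping.keys q" for m'
      by (rule Rn_single) (use that q(1) in \<open>auto simp: homogeneous_polys_def mem_Rn\<close>)
    have R: "?s \<in> Rn n" "?m \<in> Rn n"
      by (rule Rn_sum kR, use insert.prems in auto)+
    obtain y where y: "coch n M i (j + int E) k y" "\<And>T. T \<subseteq> {1..n} \<Longrightarrow> card T = i \<Longrightarrow> kd M k y T = ?s \<odot> u T"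
      using insert unfolding coboundary_def by auto
    obtain w where w: "coch n M i (j + int E) k w" "\<And>T. T \<subseteq> {1..n} \<Longrightarrow> card T = i \<Longrightarrow> kd M k w T = ?m \<odot> u T"
      using one[OF m] unfolding coboundary_def by auto
    have "kd M k (\<lambda>S. w S \<oplus> y S) T = (?m + ?s) \<odot> u T" if T: "T \<subseteq> {1..n}" "card T = i" for T
      using kd_add[OF T(1), of w y k] coch_remove[OF w(1) T] coch_remove[OF y(1) T] w(2)[OF T] y(2)[OF T] R uc[OF T]
      by (simp add: smult_add)
    thus ?case using coch_add[OF w(1) y(1)] insert.hyps unfolding coboundary_def by auto
  qed
  show ?thesis
    using all[OF finite_keys subset_refl] by (simp flip: poly_eq_sum_monomials)
qed

end

text \<open>An upper bound for the regularity, with vanishing in its fraction-free form. Treating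
  all bounds \<open>m\<close> at once turns a formula for a minimum into an equivalence that
  induction can prove.\<close>

definition reg_bound :: "nat \<Rightarrow> ('k::field mpol, 'm) graded_module \<Rightarrow> int \<Rightarrow> bool" where
  "reg_bound n M m \<longleftrightarrow> (\<forall>i\<le>n. \<forall>j>m - int i. vanishing n M i j)"

lemma coboundary_cong:
  "(\<And>T. T \<subseteq> {1..n} \<Longrightarrow> card T = i \<Longrightarrow> x T = y T) \<Longrightarrow> coboundary n M i j k x \<longleftrightarrow> coboundary n M i j k y"
  unfolding coboundary_def by auto

context graded_poly_module
begin

lemma minus_zero_right: "x \<in> carrier M \<Longrightarrow> x \<ominus> \<zero> = x"
  using minus_equality[of \<zero> \<zero>] by (simp add: a_minus_def)

lemma level_up_0 [simp]: "x S \<in> carrier M \<Longrightarrow> level_up M 0 x S = x S"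
  by (simp add: level_up_def)

lemma kd_empty [simp]: "kd M k x {} = \<zero>"
  by (simp add: kd_def)

lemma kd_zero: "T \<subseteq> {1..n} \<Longrightarrow> kd M k (\<lambda>S. \<zero>) T = \<zero>"
  unfolding kd_def using kd_scalar_Rn[of T] by (intro add.finprod_one_eqI) auto

lemma coch_zero: "coch n M c j k (\<lambda>S. \<zero>)"
  by (simp add: coch_def)

lemma kd_singleton: "s \<in> {1..n} \<Longrightarrow> x {} \<in> carrier M \<Longrightarrow> kd M k x {s} = X_var s ^ k \<odot> x {}"
proof -
  assume s: "s \<in> {1..n}" and x: "x {} \<in> carrier M"
  have "{t \<in> {s}. t < s} = {}" by auto
  hence "sgn_at s {s} = (1 :: 'k mpol)" unfolding sgn_at_def by (simp only: card.empty power_0)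
  thus ?thesis unfolding kd_def using s x kd_scalar_Rn[of "{s}" s k] by simp
qed

text \<open>\<open>{1..n}\<close> has no subset with more than \<open>n\<close> elements, so the
  condition on coboundaries is empty.\<close>

lemma vanishing_above: "n < i \<Longrightarrow> vanishing n M i j"
proof -
  assume i: "n < i"
  have "card T \<noteq> i" if "T \<subseteq> {1..n}" for T
    using card_mono[OF _ that] i by simp
  thus ?thesis unfolding vanishing_def coboundary_def using coch_zero by blast
qed

lemma reg_bound_vanishing: "reg_bound n M m \<Longrightarrow> j > m - int i \<Longrightarrow> vanishing n M i j"
  using vanishing_above by (cases "i \<le> n") (auto simp: reg_bound_def)

text \<open>In cohomological degree zero the cochains are elements of degree \<open>j > m\<close>;
  in positive degree, raising the level moves every entry past \<open>j0\<close>. Either way the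
  cochain becomes zero.\<close>

lemma reg_bound_bounded:
  assumes fin: "\<And>j. j \<ge> j0 \<Longrightarrow> component M j = {\<zero>}" and m: "\<And>j. j > m \<Longrightarrow> component M j = {\<zero>}"
  shows "reg_bound n M m"
  unfolding reg_bound_def vanishing_def
proof (intro allI impI)
  fix i j k x assume ij: "i \<le> n" "m - int i < j" and x: "coch n M (Suc i) j k x"
  \<comment> \<open>Each unit of level adds \<open>card T\<close>, which is at least one for
    \<open>i > 0\<close>, to the internal degree; so \<open>nat (j0 - j)\<close> units reach
    \<open>j0\<close>.\<close>
  have xT: "level_up M (nat (j0 - j)) x T = \<zero>" if T: "T \<subseteq> {1..n}" "card T = i" for T
  proof -
    have "level_up M (nat (j0 - j)) x T \<in> component M (j + int ((k + nat (j0 - j)) * card T))"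
      by (rule coch_comp[OF coch_level_up[OF x]]) (use T in auto)
    also have "component M (j + int ((k + nat (j0 - j)) * card T)) = {\<zero>}"
    proof (cases "i = 0")
      case True
      thus ?thesis using m[of j] ij T by simp
    next
      case False
      hence "int ((k + nat (j0 - j)) * card T) \<ge> int (nat (j0 - j))"
        unfolding zle_int using T by (cases i) auto
      thus ?thesis by (intro fin) linarith
    qed
    finally show ?thesis by simp
  qed
  show "\<exists>t. coboundary n M i j (k + t) (level_up M t x)"
    unfolding coboundary_def using xT kd_zero coch_zero
    by (intro exI[of _ "nat (j0 - j)"] exI[of _ "\<lambda>S. \<zero>"]) auto
qed

end

section \<open>Multiplication by a homogeneous element and its cokernel\<close>

text \<open>The map \<open>\<pi>\<close> identifies \<open>N\<close> with \<open>M / lM\<close>; \<open>l = 0\<close> is allowed and makes \<open>\<pi>\<close> an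
  isomorphism.\<close>

locale graded_quotient_map = M: graded_poly_module n M + N: graded_poly_module n N
  for n :: nat and M :: "('k::field mpol, 'm) graded_module" and N :: "('k mpol, 'p) graded_module" +
  fixes \<pi> :: "'m \<Rightarrow> 'p" and l :: "'k mpol" and D :: nat
  assumes pi_closed [simp]: "x \<in> carrier M \<Longrightarrow> \<pi> x \<in> carrier N"
    and pi_add: "x \<in> carrier M \<Longrightarrow> y \<in> carrier M \<Longrightarrow> \<pi> (x \<oplus>\<^bsub>M\<^esub> y) = \<pi> x \<oplus>\<^bsub>N\<^esub> \<pi> y"
    and pi_smult: "p \<in> Rn n \<Longrightarrow> x \<in> carrier M \<Longrightarrow> \<pi> (p \<odot>\<^bsub>M\<^esub> x) = p \<odot>\<^bsub>N\<^esub> \<pi> x"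
    and pi_comp: "x \<in> component M j \<Longrightarrow> \<pi> x \<in> component N j"
    and pi_surj: "z \<in> component N j \<Longrightarrow> \<exists>x\<in>component M j. \<pi> x = z"
    and pi_ker: "x \<in> carrier M \<Longrightarrow> \<pi> x = \<zero>\<^bsub>N\<^esub> \<longleftrightarrow> (\<exists>y\<in>carrier M. x = l \<odot>\<^bsub>M\<^esub> y)"
    and l_Hom: "l \<in> Hom n D"
begin

lemma l_Rn [simp]: "l \<in> Rn n"
  using l_Hom by (rule Hom_Rn)

lemma pi_zero [simp]: "\<pi> \<zero>\<^bsub>M\<^esub> = \<zero>\<^bsub>N\<^esub>"
  using pi_smult[of 0 "\<zero>\<^bsub>M\<^esub>"] by simp

lemma pi_l [simp]: "x \<in> carrier M \<Longrightarrow> \<pi> (l \<odot>\<^bsub>M\<^esub> x) = \<zero>\<^bsub>N\<^esub>"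
  using pi_ker[of "l \<odot>\<^bsub>M\<^esub> x"] by auto

lemma pi_minus: "x \<in> carrier M \<Longrightarrow> y \<in> carrier M \<Longrightarrow> \<pi> (x \<ominus>\<^bsub>M\<^esub> y) = \<pi> x \<ominus>\<^bsub>N\<^esub> \<pi> y"
proof -
  assume xy: "x \<in> carrier M" "y \<in> carrier M"
  have "\<pi> (\<ominus>\<^bsub>M\<^esub> y) = \<ominus>\<^bsub>N\<^esub> \<pi> y"
    using pi_smult[of "- 1" y] xy M.smult_uminus[of 1 y] N.smult_uminus[of 1 "\<pi> y"] by simp
  thus ?thesis using xy by (simp add: a_minus_def pi_add)
qed

text \<open>Any cofactor of \<open>l\<close> can be replaced by its component of degree
  \<open>j - D\<close>.\<close>

lemma pi_ker_comp:
  assumes "x \<in> component M j" "\<pi> x = \<zero>\<^bsub>N\<^esub>"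
  shows "\<exists>y\<in>component M (j - int D). x = l \<odot>\<^bsub>M\<^esub> y"
proof -
  have xc: "x \<in> carrier M" using assms(1) by simp
  obtain y where y: "y \<in> carrier M" "x = l \<odot>\<^bsub>M\<^esub> y" using pi_ker[OF xc] assms(2) by auto
  have "x = M.proj x j" using M.proj_of_comp[OF assms(1), of j] by simp
  also have "\<dots> = l \<odot>\<^bsub>M\<^esub> M.proj y (j - int D)" unfolding y(2) by (rule M.proj_smult[OF y(1) l_Hom])
  finally show ?thesis using y(1) by (intro bexI[of _ "M.proj y (j - int D)"]) auto
qed

lemma pi_finsum: "(\<And>a. a \<in> A \<Longrightarrow> f a \<in> carrier M) \<Longrightarrow> \<pi> (finsum M f A) = finsum N (\<lambda>a. \<pi> (f a)) A"
proof (induction A rule: infinite_finite_induct)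
  case (insert a A)
  hence "f \<in> A \<rightarrow> carrier M" "(\<lambda>a. \<pi> (f a)) \<in> A \<rightarrow> carrier N" "f a \<in> carrier M" by auto
  thus ?case using insert by (simp add: M.finsum_insert N.finsum_insert pi_add M.finsum_closed)
qed auto

lemma pi_kd:
  assumes "T \<subseteq> {1..n}" "\<And>s. s \<in> T \<Longrightarrow> x (T - {s}) \<in> carrier M"
  shows "\<pi> (kd M k x T) = kd N k (\<lambda>S. \<pi> (x S)) T"
  unfolding kd_def
  by (subst pi_finsum, use assms M.kd_scalar_Rn in simp)
    (rule N.finsum_cong', use assms M.kd_scalar_Rn in \<open>auto simp: pi_smult\<close>)

lemma pi_level_up: "S \<subseteq> {1..n} \<Longrightarrow> x S \<in> carrier M \<Longrightarrow> \<pi> (level_up M t x S) = level_up N t (\<lambda>S. \<pi> (x S)) S"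
  unfolding level_up_def by (rule pi_smult) auto

lemma coch_pi: "coch n M c j k x \<Longrightarrow> coch n N c j k (\<lambda>S. \<pi> (x S))"
  unfolding coch_def using pi_comp by blast

lemma coch_lift:
  assumes "coch n N c j k z"
  shows "\<exists>w. coch n M c j k w \<and> (\<forall>S. S \<subseteq> {1..n} \<longrightarrow> Suc (card S) = c \<longrightarrow> \<pi> (w S) = z S)"
proof -
  have "\<forall>S. \<exists>x. S \<subseteq> {1..n} \<and> Suc (card S) = c \<longrightarrow> x \<in> component M (j + int (k * card S)) \<and> \<pi> x = z S"
    using assms pi_surj unfolding coch_def by meson
  then obtain w where "\<forall>S. S \<subseteq> {1..n} \<and> Suc (card S) = c \<longrightarrow> w S \<in> component M (j + int (k * card S)) \<and> \<pi> (w S) = z S"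
    by metis
  thus ?thesis unfolding coch_def by blast
qed

lemma coch_divide:
  assumes "coch n M c j k x" "\<And>S. S \<subseteq> {1..n} \<Longrightarrow> Suc (card S) = c \<Longrightarrow> \<pi> (x S) = \<zero>\<^bsub>N\<^esub>"
  shows "\<exists>y. coch n M c (j - int D) k y \<and> (\<forall>S. S \<subseteq> {1..n} \<longrightarrow> Suc (card S) = c \<longrightarrow> x S = l \<odot>\<^bsub>M\<^esub> y S)"
proof -
  have "\<forall>S. \<exists>y. S \<subseteq> {1..n} \<and> Suc (card S) = c \<longrightarrow> y \<in> component M (j - int D + int (k * card S)) \<and> x S = l \<odot>\<^bsub>M\<^esub> y"
  proof
    fix S
    show "\<exists>y. S \<subseteq> {1..n} \<and> Suc (card S) = c \<longrightarrow> y \<in> component M (j - int D + int (k * card S)) \<and> x S = l \<odot>\<^bsub>M\<^esub> y"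
    proof (cases "S \<subseteq> {1..n} \<and> Suc (card S) = c")
      case True
      moreover have "j + int (k * card S) - int D = j - int D + int (k * card S)" by simp
      ultimately show ?thesis using pi_ker_comp[OF M.coch_comp[OF assms(1), of S]] assms(2)[of S] by metis
    qed auto
  qed
  then obtain y where "\<forall>S. S \<subseteq> {1..n} \<and> Suc (card S) = c \<longrightarrow> y S \<in> component M (j - int D + int (k * card S)) \<and> x S = l \<odot>\<^bsub>M\<^esub> y S"
    by metis
  thus ?thesis unfolding coch_def by blast
qed

end

section \<open>Diagram chases for a filter regular element\<close>

locale filter_regular_quotient = graded_quotient_map n M N \<pi> l D
  for n and M :: "('k::field mpol, 'm) graded_module" and N :: "('k mpol, 'p) graded_module" and \<pi> l D +
  fixes j0 :: int
  assumes D_pos: "D > 0"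
    and l_regular: "j \<ge> j0 \<Longrightarrow> x \<in> component M j \<Longrightarrow> l \<odot>\<^bsub>M\<^esub> x = \<zero>\<^bsub>M\<^esub> \<Longrightarrow> x = \<zero>\<^bsub>M\<^esub>"
begin

text \<open>This takes the place of the vanishing of the positive local cohomology of the kernel of
  \<open>l\<close>: multiplication by \<open>X_prod T ^ t\<close> moves the entry to a degree at
  least \<open>j0\<close>, where \<open>l\<close> is injective. For \<open>i = 0\<close> the factor
  would be \<open>1\<close> and nothing would move.\<close>

lemma level_up_annihilated:
  assumes x: "coch n M (Suc i) j k x" and l: "l \<odot>\<^bsub>M\<^esub> x T = \<zero>\<^bsub>M\<^esub>"
    and T: "T \<subseteq> {1..n}" "card T = i" "i > 0" and t: "t \<ge> nat (j0 - j)"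
  shows "level_up M t x T = \<zero>\<^bsub>M\<^esub>"
proof (rule l_regular)
  show "level_up M t x T \<in> component M (j + int ((k + t) * card T))"
    by (rule M.coch_comp[OF M.coch_level_up[OF x]]) (use T in auto)
  have "int ((k + t) * card T) \<ge> int t" unfolding zle_int using T by (cases i) auto
  thus "j0 \<le> j + int ((k + t) * card T)" using t by linarith
  have xT: "x T \<in> carrier M" using M.coch_carrier[OF x] T by simp
  have "l \<odot>\<^bsub>M\<^esub> level_up M t x T = X_prod T ^ t \<odot>\<^bsub>M\<^esub> (l \<odot>\<^bsub>M\<^esub> x T)"
    unfolding level_up_def by (rule M.smult_comm) (use T xT in auto)
  thus "l \<odot>\<^bsub>M\<^esub> level_up M t x T = \<zero>\<^bsub>M\<^esub>" using l T by simp
qed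

text \<open>Exactness at the cohomology of \<open>N\<close>, between degrees \<open>i\<close> and
  \<open>Suc i\<close> of \<open>M\<close>. Lift a cocycle z to w; its differential is l y, and y is
  a cocycle after a level shift, hence the differential of some v. Then w - l v is a cocycle that
  still lifts z, so it is the differential of some u, and the image of u bounds z.\<close>

lemma vanishing_quotient:
  assumes v1: "vanishing n M i j" and v2: "vanishing n M (Suc i) (j - int D)"
  shows "vanishing n N i j"
  unfolding vanishing_def
proof (intro allI impI)
  fix k z assume z: "coch n N (Suc i) j k z" and zc: "cocycle n N (Suc i) k z"
  obtain w where w: "coch n M (Suc i) j k w" "\<And>S. S \<subseteq> {1..n} \<Longrightarrow> card S = i \<Longrightarrow> \<pi> (w S) = z S"
    using coch_lift[OF z] by auto
  have wr: "w (T - {s}) \<in> carrier M" if "T \<subseteq> {1..n}" "card T = Suc i" "s \<in> T" for T s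
    by (rule M.coch_remove[OF w(1) that])
  have card_remove: "card (T - {s}) = i" "T - {s} \<subseteq> {1..n}" if "T \<subseteq> {1..n}" "card T = Suc i" "s \<in> T" for T s i
    using that finite_subset[OF that(1)] by auto
  have "\<pi> (kd M k w T) = \<zero>\<^bsub>N\<^esub>" if T: "T \<subseteq> {1..n}" "card T = Suc i" for T
  proof -
    have "\<pi> (kd M k w T) = kd N k (\<lambda>S. \<pi> (w S)) T"
      by (rule pi_kd) (use T wr in auto)
    also have "\<dots> = kd N k z T"
      by (rule N.kd_cong) (use T wr[OF T] w(2) card_remove[OF T] N.coch_remove[OF z T] in auto)
    finally show ?thesis using zc T by (simp add: cocycle_def)
  qed
  then obtain y where y: "coch n M (Suc (Suc i)) (j - int D) k y"
    "\<And>T. T \<subseteq> {1..n} \<Longrightarrow> card T = Suc i \<Longrightarrow> kd M k w T = l \<odot>\<^bsub>M\<^esub> y T"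
    using coch_divide[OF M.coch_kd[OF w(1)]] by auto
  have yr: "y (T - {s}) \<in> carrier M" if "T \<subseteq> {1..n}" "card T = Suc (Suc i)" "s \<in> T" for T s
    by (rule M.coch_remove[OF y(1) that])
  have yc: "y T \<in> carrier M" if "T \<subseteq> {1..n}" "card T = Suc i" for T
    using M.coch_carrier[OF y(1)] that by simp
  have wc: "w T \<in> carrier M" if "T \<subseteq> {1..n}" "card T = i" for T
    using M.coch_carrier[OF w(1)] that by simp
  \<comment> \<open>\<open>y\<close> has internal degree \<open>j - D\<close>. Its differential is
    killed by \<open>l\<close>, hence vanishes after this level shift.\<close>
  define t0 where "t0 = nat (j0 - (j - int D))"
  define y1 where "y1 = level_up M t0 y"
  have y1: "coch n M (Suc (Suc i)) (j - int D) (k + t0) y1"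
    unfolding y1_def by (rule M.coch_level_up[OF y(1)])
  have y1c: "cocycle n M (Suc (Suc i)) (k + t0) y1"
    unfolding cocycle_def
  proof (intro allI impI)
    fix R assume R: "R \<subseteq> {1..n}" "card R = Suc (Suc i)"
    have "l \<odot>\<^bsub>M\<^esub> kd M k y R = kd M k (\<lambda>S. l \<odot>\<^bsub>M\<^esub> y S) R"
      by (rule M.kd_smult[symmetric]) (use R yr in auto)
    also have "\<dots> = kd M k (kd M k w) R"
      by (rule M.kd_cong) (use R yr card_remove[OF R] y(2) in auto)
    also have "\<dots> = \<zero>\<^bsub>M\<^esub>" by (rule M.kd_kd_coch[OF w(1) R])
    finally have l0: "l \<odot>\<^bsub>M\<^esub> kd M k y R = \<zero>\<^bsub>M\<^esub>" .
    have "kd M (k + t0) y1 R = level_up M t0 (kd M k y) R"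
      unfolding y1_def by (rule M.kd_level_up) (use R yr in auto)
    also have "\<dots> = \<zero>\<^bsub>M\<^esub>"
      by (rule level_up_annihilated[where T = R, OF M.coch_kd[OF y(1)] l0]) (use R t0_def in auto)
    finally show "kd M (k + t0) y1 R = \<zero>\<^bsub>M\<^esub>" .
  qed
  obtain t1 v where v: "coch n M (Suc i) (j - int D) (k + t0 + t1) v"
    "\<And>T. T \<subseteq> {1..n} \<Longrightarrow> card T = Suc i \<Longrightarrow> kd M (k + t0 + t1) v T = level_up M t1 y1 T"
    using v2 y1 y1c unfolding vanishing_def coboundary_def by meson
  define K where "K = k + t0 + t1"
  have v': "coch n M (Suc i) j K (\<lambda>S. l \<odot>\<^bsub>M\<^esub> v S)"
    using M.coch_smult[OF l_Hom v(1)] by (simp add: K_def)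
  have vr: "v (T - {s}) \<in> carrier M" if "T \<subseteq> {1..n}" "card T = Suc i" "s \<in> T" for T s
    by (rule M.coch_remove[OF v(1) that])
  have vc: "v T \<in> carrier M" if "T \<subseteq> {1..n}" "card T = i" for T
    using M.coch_carrier[OF v(1)] that by simp
  \<comment> \<open>Subtracting a multiple of \<open>l\<close> leaves the image in \<open>N\<close>
    unchanged and makes the differential zero.\<close>
  define w2 where "w2 = (\<lambda>S. level_up M (t0 + t1) w S \<ominus>\<^bsub>M\<^esub> l \<odot>\<^bsub>M\<^esub> v S)"
  have lw: "coch n M (Suc i) j K (level_up M (t0 + t1) w)"
    using M.coch_level_up[OF w(1), of "t0 + t1"] by (simp add: K_def add.assoc)
  have w2: "coch n M (Suc i) j K w2"
    unfolding w2_def by (rule M.coch_minus[OF lw v'])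
  have w2c: "cocycle n M (Suc i) K w2"
    unfolding cocycle_def
  proof (intro allI impI)
    fix T assume T: "T \<subseteq> {1..n}" "card T = Suc i"
    have "kd M K w2 T = kd M K (level_up M (t0 + t1) w) T \<ominus>\<^bsub>M\<^esub> kd M K (\<lambda>S. l \<odot>\<^bsub>M\<^esub> v S) T"
      unfolding w2_def by (rule M.kd_minus) (use T M.coch_remove[OF lw T] M.coch_remove[OF v' T] in auto)
    also have "kd M K (level_up M (t0 + t1) w) T = level_up M (t0 + t1) (kd M k w) T"
      using M.kd_level_up[of T w k "t0 + t1"] wr T by (simp add: K_def add.assoc)
    also have "\<dots> = l \<odot>\<^bsub>M\<^esub> level_up M (t0 + t1) y T"
      using M.level_up_smult[of T y l "t0 + t1"] yc T y(2)[OF T] by (simp add: level_up_def)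
    also have "kd M K (\<lambda>S. l \<odot>\<^bsub>M\<^esub> v S) T = l \<odot>\<^bsub>M\<^esub> kd M K v T"
      by (rule M.kd_smult) (use T vr in auto)
    also have "kd M K v T = level_up M (t0 + t1) y T"
      using v(2)[OF T] M.level_up_level_up[of T y t1 t0] yc T by (simp add: K_def y1_def)
    finally show "kd M K w2 T = \<zero>\<^bsub>M\<^esub>"
      using M.level_up_closed[of T y "t0 + t1"] yc[OF T] T by (simp add: M.r_neg a_minus_def)
  qed
  obtain t2 u where u: "coch n M i j (K + t2) u"
    "\<And>T. T \<subseteq> {1..n} \<Longrightarrow> card T = i \<Longrightarrow> kd M (K + t2) u T = level_up M t2 w2 T"
    using v1 w2 w2c unfolding vanishing_def coboundary_def by meson
  have "kd N (K + t2) (\<lambda>S. \<pi> (u S)) T = level_up N (t0 + t1 + t2) z T" if T: "T \<subseteq> {1..n}" "card T = i" for T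
  proof -
    have "kd N (K + t2) (\<lambda>S. \<pi> (u S)) T = \<pi> (kd M (K + t2) u T)"
      by (rule pi_kd[symmetric]) (use T M.coch_remove[OF u(1) T] in auto)
    also have "\<dots> = level_up N t2 (\<lambda>S. \<pi> (w2 S)) T"
      using u(2)[OF T] pi_level_up[of T w2 t2] M.coch_carrier[OF w2, of T] T by simp
    also have "\<dots> = level_up N t2 (level_up N (t0 + t1) z) T"
      using pi_minus[of "level_up M (t0 + t1) w T" "l \<odot>\<^bsub>M\<^esub> v T"] vc[OF T] wc[OF T] w(2)[OF T] T
        pi_level_up[of T w "t0 + t1"] M.level_up_closed[of T w "t0 + t1"] N.coch_carrier[OF z, of T] N.level_up_closed[of T z "t0 + t1"]
      by (simp add: w2_def level_up_def N.minus_zero_right)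
    also have "\<dots> = level_up N (t0 + t1 + t2) z T"
      using N.level_up_level_up[of T z t2 "t0 + t1"] N.coch_carrier[OF z, of T] T by simp
    finally show ?thesis .
  qed
  thus "\<exists>t. coboundary n N i j (k + t) (level_up N t z)"
    unfolding coboundary_def using coch_pi[OF u(1)]
    by (intro exI[of _ "t0 + t1 + t2"] exI[of _ "\<lambda>S. \<pi> (u S)"]) (auto simp: K_def add.assoc)
qed

text \<open>A class killed by \<open>l\<close> comes from the connecting map, whose source is the
  vanishing cohomology of \<open>N\<close> in degree \<open>j + D\<close>. Concretely: if l x is the
  differential of v, the image of v in \<open>N\<close> is a cocycle, hence the differential of some
  b. With a lift w of b, the family v - d w is divisible by \<open>l\<close>, and its quotient y
  satisfies l (d y - x) = 0, up to level shifts.\<close>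

lemma coboundary_cancel_l:
  assumes vN: "vanishing n N i (j + int D)"
    and x: "coch n M (Suc (Suc i)) j k x"
    and lx: "coboundary n M (Suc i) (j + int D) (k + t) (level_up M t (\<lambda>S. l \<odot>\<^bsub>M\<^esub> x S))"
  shows "\<exists>t. coboundary n M (Suc i) j (k + t) (level_up M t x)"
proof -
  obtain v where v: "coch n M (Suc i) (j + int D) (k + t) v"
    "\<And>T. T \<subseteq> {1..n} \<Longrightarrow> card T = Suc i \<Longrightarrow> kd M (k + t) v T = level_up M t (\<lambda>S. l \<odot>\<^bsub>M\<^esub> x S) T"
    using lx unfolding coboundary_def by auto
  have xc: "x T \<in> carrier M" if "T \<subseteq> {1..n}" "card T = Suc i" for T
    using M.coch_carrier[OF x] that by simp
  have vc: "v T \<in> carrier M" if "T \<subseteq> {1..n}" "card T = i" for T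
    using M.coch_carrier[OF v(1)] that by simp
  have llx: "level_up M t (\<lambda>S. l \<odot>\<^bsub>M\<^esub> x S) T = l \<odot>\<^bsub>M\<^esub> level_up M t x T" if "T \<subseteq> {1..n}" "card T = Suc i" for T t
    by (rule M.level_up_smult) (use that xc in auto)
  have pvc: "cocycle n N (Suc i) (k + t) (\<lambda>S. \<pi> (v S))"
    unfolding cocycle_def
  proof (intro allI impI)
    fix T assume T: "T \<subseteq> {1..n}" "card T = Suc i"
    have "kd N (k + t) (\<lambda>S. \<pi> (v S)) T = \<pi> (kd M (k + t) v T)"
      by (rule pi_kd[symmetric]) (use T M.coch_remove[OF v(1) T] in auto)
    thus "kd N (k + t) (\<lambda>S. \<pi> (v S)) T = \<zero>\<^bsub>N\<^esub>"
      using v(2)[OF T] llx[OF T] M.level_up_closed[of T x t] xc[OF T] T by simp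
  qed
  obtain t1 b where b: "coch n N i (j + int D) (k + t + t1) b"
    "\<And>T. T \<subseteq> {1..n} \<Longrightarrow> card T = i \<Longrightarrow> kd N (k + t + t1) b T = level_up N t1 (\<lambda>S. \<pi> (v S)) T"
    using vN coch_pi[OF v(1)] pvc unfolding vanishing_def coboundary_def by meson
  define K where "K = k + t + t1"
  obtain w where w: "coch n M i (j + int D) K w" "\<And>S. S \<subseteq> {1..n} \<Longrightarrow> Suc (card S) = i \<Longrightarrow> \<pi> (w S) = b S"
    using coch_lift[OF b(1)] by (auto simp: K_def)
  have lv: "coch n M (Suc i) (j + int D) K (level_up M t1 v)"
    using M.coch_level_up[OF v(1), of t1] by (simp add: K_def)
  define e where "e = (\<lambda>S. level_up M t1 v S \<ominus>\<^bsub>M\<^esub> kd M K w S)"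
  have e: "coch n M (Suc i) (j + int D) K e"
    unfolding e_def by (rule M.coch_minus[OF lv M.coch_kd[OF w(1)]])
  have "\<pi> (e S) = \<zero>\<^bsub>N\<^esub>" if S: "S \<subseteq> {1..n}" "card S = i" for S
  proof -
    have wr: "w (S - {s}) \<in> carrier M" if "s \<in> S" for s
      by (rule M.coch_remove[OF w(1) S that])
    have "\<pi> (kd M K w S) = kd N K (\<lambda>S. \<pi> (w S)) S"
      by (rule pi_kd) (use S wr in auto)
    also have "\<dots> = kd N K b S"
    proof (rule N.kd_cong)
      fix s assume s: "s \<in> S"
      have fS: "finite S" using S(1) finite_subset by blast
      have "Suc (card (S - {s})) = i" "S - {s} \<subseteq> {1..n}" using s S card_Suc_Diff1[OF fS s] by auto
      thus "\<pi> (w (S - {s})) = b (S - {s})" using w(2) by blast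
    qed (use S wr in auto)
    also have "\<dots> = \<pi> (level_up M t1 v S)"
      using b(2)[OF S] pi_level_up[of S v t1] vc[OF S] S by (simp add: K_def)
    finally show ?thesis
      unfolding e_def using pi_minus[of "level_up M t1 v S" "kd M K w S"] M.level_up_closed[of S v t1] vc[OF S] S M.kd_closed[OF S(1), of w K] wr
      by (simp add: N.r_neg a_minus_def)
  qed
  then obtain y where y: "coch n M (Suc i) j K y" "\<And>S. S \<subseteq> {1..n} \<Longrightarrow> card S = i \<Longrightarrow> e S = l \<odot>\<^bsub>M\<^esub> y S"
    using coch_divide[OF e] by auto
  define f where "f = (\<lambda>T. kd M K y T \<ominus>\<^bsub>M\<^esub> level_up M (t + t1) x T)"
  have lx': "coch n M (Suc (Suc i)) j K (level_up M (t + t1) x)"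
    using M.coch_level_up[OF x, of "t + t1"] by (simp add: K_def add.assoc)
  have f: "coch n M (Suc (Suc i)) j K f"
    unfolding f_def by (rule M.coch_minus[OF M.coch_kd[OF y(1)] lx'])
  \<comment> \<open>A last level shift removes \<open>f\<close>, which is killed by \<open>l\<close>
    and has internal degree \<open>j\<close>.\<close>
  define t2 where "t2 = nat (j0 - j)"
  have "kd M (K + t2) (level_up M t2 y) T = level_up M (t + t1 + t2) x T" if T: "T \<subseteq> {1..n}" "card T = Suc i" for T
  proof -
    have yr: "y (T - {s}) \<in> carrier M" if "s \<in> T" for s by (rule M.coch_remove[OF y(1) T that])
    have ler: "e (T - {s}) = l \<odot>\<^bsub>M\<^esub> y (T - {s})" if "s \<in> T" for s
      by (rule y(2)) (use T that finite_subset[OF T(1)] in auto)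
    have kyc: "kd M K y T \<in> carrier M" by (rule M.kd_closed[OF T(1)]) (rule yr)
    have lxc: "level_up M (t + t1) x T \<in> carrier M" using M.level_up_closed xc T by blast
    have kv: "kd M (k + t) v T \<in> carrier M" using M.kd_comp[OF v(1) T] by simp
    have "l \<odot>\<^bsub>M\<^esub> kd M K y T = kd M K (\<lambda>S. l \<odot>\<^bsub>M\<^esub> y S) T"
      by (rule M.kd_smult[symmetric]) (use T yr in auto)
    also have "\<dots> = kd M K e T"
      by (rule M.kd_cong) (use T yr ler in auto)
    also have "\<dots> = kd M K (level_up M t1 v) T \<ominus>\<^bsub>M\<^esub> kd M K (kd M K w) T"
      unfolding e_def by (rule M.kd_minus) (use T M.coch_remove[OF lv T] M.coch_remove[OF M.coch_kd[OF w(1)] T] in auto)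
    also have "kd M K (kd M K w) T = \<zero>\<^bsub>M\<^esub>" by (rule M.kd_kd_coch[OF w(1) T])
    also have "kd M K (level_up M t1 v) T = level_up M t1 (kd M (k + t) v) T"
      using M.kd_level_up[of T v "k + t" t1] M.coch_remove[OF v(1) T] T by (simp add: K_def)
    also have "\<dots> = level_up M t1 (\<lambda>S. l \<odot>\<^bsub>M\<^esub> level_up M t x S) T"
      using v(2)[OF T] llx[OF T] by (simp add: level_up_def)
    also have "\<dots> = l \<odot>\<^bsub>M\<^esub> level_up M t1 (level_up M t x) T"
      by (rule M.level_up_smult) (use T xc[OF T] M.level_up_closed in auto)
    also have "level_up M t1 (level_up M t x) T = level_up M (t + t1) x T"
      by (rule M.level_up_level_up) (use T xc[OF T] in auto)
    finally have "l \<odot>\<^bsub>M\<^esub> kd M K y T = l \<odot>\<^bsub>M\<^esub> level_up M (t + t1) x T"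
      using lxc by (simp add: a_minus_def)
    moreover have "l \<odot>\<^bsub>M\<^esub> f T = l \<odot>\<^bsub>M\<^esub> kd M K y T \<ominus>\<^bsub>M\<^esub> l \<odot>\<^bsub>M\<^esub> level_up M (t + t1) x T"
      unfolding f_def by (rule M.smult_minus) (use kyc lxc in auto)
    ultimately have "l \<odot>\<^bsub>M\<^esub> f T = \<zero>\<^bsub>M\<^esub>"
      using lxc by simp
    hence "level_up M t2 f T = \<zero>\<^bsub>M\<^esub>"
      by (rule level_up_annihilated[OF f]) (use T t2_def in auto)
    hence "level_up M t2 (kd M K y) T = level_up M t2 (level_up M (t + t1) x) T"
      unfolding f_def using M.level_up_minus[of T "kd M K y" "level_up M (t + t1) x" t2] T kyc lxc
        M.level_up_closed[of T "kd M K y" t2] M.level_up_closed[of T "level_up M (t + t1) x" t2]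
        M.minus_other_side[of "level_up M t2 (kd M K y) T" "level_up M t2 (level_up M (t + t1) x) T"]
      by metis
    also have "\<dots> = level_up M (t + t1 + t2) x T"
      by (rule M.level_up_level_up) (use T xc[OF T] in auto)
    finally show ?thesis using M.kd_level_up[of T y K t2] yr T by simp
  qed
  thus ?thesis
    unfolding coboundary_def using M.coch_level_up[OF y(1), of t2]
    by (intro exI[of _ "t + t1 + t2"] exI[of _ "level_up M t2 y"]) (auto simp: K_def add.assoc)
qed

lemma l_pow_Hom: "l ^ p \<in> Hom n (D * p)"
  by (rule Hom_power[OF l_Hom])

text \<open>By torsion some power of \<open>l\<close> kills the class, and the factors
  \<open>l\<close> are cancelled one at a time. The intermediate classes live in the degrees
  \<open>j + int (D * p)\<close>, whence the assumption for all \<open>j' \<ge> j\<close>.\<close>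

lemma vanishing_of_quotient:
  assumes vN: "\<And>j'. j' \<ge> j \<Longrightarrow> vanishing n N i (j' + int D)"
  shows "vanishing n M (Suc i) j"
  unfolding vanishing_def
proof (intro allI impI)
  fix k x assume x: "coch n M (Suc (Suc i)) j k x" and xc: "cocycle n M (Suc (Suc i)) k x"
  define P where "P p \<longleftrightarrow> (\<exists>t. coboundary n M (Suc i) (j + int (D * p)) (k + t) (level_up M t (\<lambda>S. l ^ p \<odot>\<^bsub>M\<^esub> x S)))" for p
  have xT: "x T \<in> carrier M" if "T \<subseteq> {1..n}" "card T = Suc i" for T
    using M.coch_carrier[OF x] that by simp
  \<comment> \<open>The degree \<open>D * Suc (n * k)\<close> of this power exceeds
    \<open>n * k\<close> because \<open>D > 0\<close>, as \<open>torsion\<close> requires.\<close>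
  have top: "P (Suc (n * k))"
  proof -
    have "n * k < D * Suc (n * k)" using D_pos by (cases D) auto
    hence "coboundary n M (Suc i) (j + int (D * Suc (n * k))) k (\<lambda>S. l ^ Suc (n * k) \<odot>\<^bsub>M\<^esub> x S)"
      by (rule M.torsion[OF x xc l_pow_Hom])
    hence "coboundary n M (Suc i) (j + int (D * Suc (n * k))) (k + 0) (level_up M 0 (\<lambda>S. l ^ Suc (n * k) \<odot>\<^bsub>M\<^esub> x S))"
      by (subst coboundary_cong[where y = "\<lambda>S. l ^ Suc (n * k) \<odot>\<^bsub>M\<^esub> x S"]) (use xT M.level_up_0 in \<open>auto simp del: power_Suc\<close>)
    thus ?thesis unfolding P_def by blast
  qed
  have step: "P p" if P: "P (Suc p)" for p
  proof -
    let ?x = "\<lambda>S. l ^ p \<odot>\<^bsub>M\<^esub> x S"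
    obtain t where t: "coboundary n M (Suc i) (j + int (D * Suc p)) (k + t) (level_up M t (\<lambda>S. l ^ Suc p \<odot>\<^bsub>M\<^esub> x S))"
      using P unfolding P_def by blast
    have cx: "coch n M (Suc (Suc i)) (j + int (D * p)) k ?x"
      by (rule M.coch_smult[OF l_pow_Hom x])
    have "coboundary n M (Suc i) (j + int (D * p) + int D) (k + t) (level_up M t (\<lambda>S. l \<odot>\<^bsub>M\<^esub> ?x S))"
    proof -
      have "level_up M t (\<lambda>S. l \<odot>\<^bsub>M\<^esub> ?x S) T = level_up M t (\<lambda>S. l ^ Suc p \<odot>\<^bsub>M\<^esub> x S) T"
        if "T \<subseteq> {1..n}" "card T = Suc i" for T
        using xT[OF that] by (simp add: level_up_def M.smult_mult)
      moreover have "j + int (D * Suc p) = j + int (D * p) + int D" by (simp add: algebra_simps)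
      ultimately show ?thesis
        using t by (simp only: coboundary_cong[of n "Suc i" "level_up M t (\<lambda>S. l \<odot>\<^bsub>M\<^esub> ?x S)" "level_up M t (\<lambda>S. l ^ Suc p \<odot>\<^bsub>M\<^esub> x S)"])
    qed
    thus ?thesis unfolding P_def by (rule coboundary_cancel_l[rotated 2]) (use cx vN in auto)
  qed
  have "P q" if "q \<le> Suc (n * k)" for q
    using that by (induction rule: inc_induct) (use top step in auto)
  hence "P 0" by simp
  then obtain t where t: "coboundary n M (Suc i) j (k + t) (level_up M t (\<lambda>S. l ^ 0 \<odot>\<^bsub>M\<^esub> x S))"
    unfolding P_def by auto
  have "coboundary n M (Suc i) j (k + t) (level_up M t x)"
    using t by (subst coboundary_cong[where y = "level_up M t (\<lambda>S. l ^ 0 \<odot>\<^bsub>M\<^esub> x S)"]) (use xT in \<open>auto simp: level_up_def\<close>)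
  thus "\<exists>t. coboundary n M (Suc i) j (k + t) (level_up M t x)" by blast
qed

text \<open>The analogue in cohomological degree zero, where coboundaries are zero: torsion makes a
  power of \<open>l\<close> kill the element itself, and injectivity from degree \<open>j\<close> on
  removes the factors.\<close>

lemma vanishing_0:
  assumes inj: "\<And>j' x. j' \<ge> j \<Longrightarrow> x \<in> component M j' \<Longrightarrow> l \<odot>\<^bsub>M\<^esub> x = \<zero>\<^bsub>M\<^esub> \<Longrightarrow> x = \<zero>\<^bsub>M\<^esub>"
  shows "vanishing n M 0 j"
  unfolding vanishing_def
proof (intro allI impI)
  fix k x assume x: "coch n M (Suc 0) j k x" and xc: "cocycle n M (Suc 0) k x"
  have x0: "x {} \<in> component M j" using M.coch_comp[OF x, of "{}"] by simp
  have "n * k < D * Suc (n * k)" using D_pos by (cases D) auto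
  hence "coboundary n M 0 (j + int (D * Suc (n * k))) k (\<lambda>S. l ^ Suc (n * k) \<odot>\<^bsub>M\<^esub> x S)"
    by (rule M.torsion[OF x xc l_pow_Hom])
  hence top: "l ^ Suc (n * k) \<odot>\<^bsub>M\<^esub> x {} = \<zero>\<^bsub>M\<^esub>" unfolding coboundary_def by fastforce
  have "l ^ q \<odot>\<^bsub>M\<^esub> x {} = \<zero>\<^bsub>M\<^esub>" if "q \<le> Suc (n * k)" for q
    using that
  proof (induction rule: inc_induct)
    case (step p)
    have "l ^ p \<odot>\<^bsub>M\<^esub> x {} \<in> component M (j + int (D * p))"
      by (rule M.smult_comp[OF l_pow_Hom x0]) simp
    thus ?case by (rule inj[rotated]) (use step.IH x0 in \<open>auto simp: M.smult_mult\<close>)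
  qed (use top in simp)
  from this[of 0] have "x {} = \<zero>\<^bsub>M\<^esub>" using x0 by simp
  hence "coboundary n M 0 j (k + 0) (level_up M 0 x)"
    unfolding coboundary_def using M.coch_zero
    by (intro exI[of _ "\<lambda>S. \<zero>\<^bsub>M\<^esub>"]) (auto simp: card_eq_0_iff finite_subset level_up_def)
  thus "\<exists>t. coboundary n M 0 j (k + t) (level_up M t x)" by blast
qed

text \<open>At a level \<open>k\<close> so large that \<open>X_var s ^ k\<close> moves the element
  past \<open>j0\<close>, an element killed by \<open>l\<close> is a 0-cocycle, because
  \<open>l\<close> is injective there. Vanishing forces it to be zero: coboundaries are empty sums,
  and \<open>X_prod {}\<close> is \<open>1\<close>, so that raising the level changes
  nothing.\<close>

lemma annihilated_of_vanishing_0: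
  assumes v: "vanishing n M 0 j" and x: "x \<in> component M j" "l \<odot>\<^bsub>M\<^esub> x = \<zero>\<^bsub>M\<^esub>"
  shows "x = \<zero>\<^bsub>M\<^esub>"
proof -
  let ?x = "\<lambda>S :: nat set. x"
  define k where "k = nat (j0 - j)"
  have c: "coch n M (Suc 0) j k ?x" using x(1) by (auto simp: coch_def card_eq_0_iff finite_subset)
  have "cocycle n M (Suc 0) k ?x"
    unfolding cocycle_def
  proof (intro allI impI)
    fix T assume T: "T \<subseteq> {1..n}" "card T = Suc 0"
    then obtain s where s: "T = {s}" by (auto simp: card_Suc_eq)
    have sn: "s \<in> {1..n}" using s T by auto
    have X: "(X_var s ^ k :: 'k mpol) \<in> Hom n k" using Hom_power[OF X_var_Hom[OF sn]] by simp
    have "X_var s ^ k \<odot>\<^bsub>M\<^esub> x = \<zero>\<^bsub>M\<^esub>"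
    proof (rule l_regular)
      show "X_var s ^ k \<odot>\<^bsub>M\<^esub> x \<in> component M (j + int k)" by (rule M.smult_comp[OF X x(1)]) simp
      show "l \<odot>\<^bsub>M\<^esub> (X_var s ^ k \<odot>\<^bsub>M\<^esub> x) = \<zero>\<^bsub>M\<^esub>"
        using M.smult_comm[OF l_Rn Hom_Rn[OF X], of x] x Hom_Rn[OF X] by simp
    qed (simp add: k_def)
    thus "kd M k ?x T = \<zero>\<^bsub>M\<^esub>" using s sn x by (simp add: M.kd_singleton)
  qed
  with c v obtain t y where "kd M (k + t) y {} = level_up M t ?x {}"
    unfolding vanishing_def coboundary_def by (metis card.empty empty_subsetI)
  thus ?thesis using x(1) by (simp add: level_up_def)
qed

text \<open>The shift by \<open>D - 1\<close> is a matter of degrees: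
  \<open>j > m + D - 1 - i\<close> says exactly that \<open>j - D > m - Suc i\<close>, the range of
  vanishing for \<open>M\<close> in cohomological degree \<open>Suc i\<close>, and it implies
  \<open>j > m - i\<close> since \<open>D > 0\<close>. Conversely, \<open>j > m - Suc i\<close>
  gives \<open>j + D > m + D - 1 - i\<close>.\<close>

theorem reg_bound_step:
  "reg_bound n M m \<longleftrightarrow>
     (\<forall>j>m. \<forall>x\<in>component M j. l \<odot>\<^bsub>M\<^esub> x = \<zero>\<^bsub>M\<^esub> \<longrightarrow> x = \<zero>\<^bsub>M\<^esub>) \<and> reg_bound n N (m + int D - 1)"
proof (intro iffI conjI)
  assume r: "reg_bound n M m"
  show "\<forall>j>m. \<forall>x\<in>component M j. l \<odot>\<^bsub>M\<^esub> x = \<zero>\<^bsub>M\<^esub> \<longrightarrow> x = \<zero>\<^bsub>M\<^esub>"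
    using annihilated_of_vanishing_0 M.reg_bound_vanishing[OF r, of 0] by auto
  show "reg_bound n N (m + int D - 1)"
    unfolding reg_bound_def
    using vanishing_quotient M.reg_bound_vanishing[OF r] D_pos by simp
next
  assume a: "(\<forall>j>m. \<forall>x\<in>component M j. l \<odot>\<^bsub>M\<^esub> x = \<zero>\<^bsub>M\<^esub> \<longrightarrow> x = \<zero>\<^bsub>M\<^esub>) \<and> reg_bound n N (m + int D - 1)"
  show "reg_bound n M m"
    unfolding reg_bound_def
  proof (intro allI impI)
    fix i j assume ij: "i \<le> n" "m - int i < j"
    show "vanishing n M i j"
    proof (cases i)
      case 0
      show ?thesis
        unfolding 0
      proof (rule vanishing_0)
        fix j' x assume "j' \<ge> j" "x \<in> component M j'" "l \<odot>\<^bsub>M\<^esub> x = \<zero>\<^bsub>M\<^esub>"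
        moreover from this have "j' > m" using ij 0 by simp
        ultimately show "x = \<zero>\<^bsub>M\<^esub>" using a by blast
      qed
    next
      case (Suc i')
      show ?thesis unfolding Suc
        by (rule vanishing_of_quotient, rule N.reg_bound_vanishing[OF a[THEN conjunct2]]) (use ij Suc in auto)
    qed
  qed
qed

end

section \<open>Comparison with the Cech complex\<close>

context graded_poly_module
begin

lemma pow_smult_mult: "f \<in> Rn n \<Longrightarrow> x \<in> carrier M \<Longrightarrow> f ^ a \<odot> (f ^ b \<odot> x) = f ^ (a + b) \<odot> x"
  by (simp add: smult_mult[symmetric] power_add)

lemma fraction_self: "x \<in> carrier M \<Longrightarrow> (x, k) \<in> fraction M f x k"
  by (simp add: fraction_def)

text \<open>The substantial point is transitivity, where the two witnesses combine to the exponent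
  \<open>s + t + l\<close>.\<close>

lemma fraction_eq_iff:
  assumes f: "f \<in> Rn n" and xy: "x \<in> carrier M" "y \<in> carrier M"
  shows "fraction M f x k = fraction M f y l \<longleftrightarrow> (\<exists>t. f ^ (t + l) \<odot> x = f ^ (t + k) \<odot> y)"
proof
  assume "fraction M f x k = fraction M f y l"
  hence "(y, l) \<in> fraction M f x k" using fraction_self[OF xy(2)] by simp
  thus "\<exists>t. f ^ (t + l) \<odot> x = f ^ (t + k) \<odot> y" by (simp add: fraction_def)
next
  have trans: "\<exists>t. f ^ (t + m) \<odot> x = f ^ (t + k) \<odot> z"
    if 1: "f ^ (t + l) \<odot> x = f ^ (t + k) \<odot> y" and 2: "f ^ (s + m) \<odot> y = f ^ (s + l) \<odot> z"
      and c: "x \<in> carrier M" "y \<in> carrier M" "z \<in> carrier M" for x y z k l m t s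
  proof -
    have "f ^ (s + m) \<odot> (f ^ (t + l) \<odot> x) = f ^ (t + k) \<odot> (f ^ (s + m) \<odot> y)"
      using 1 smult_comm[of "f ^ (s + m)" "f ^ (t + k)" y] f c by simp
    also have "\<dots> = f ^ (t + k) \<odot> (f ^ (s + l) \<odot> z)" using 2 by simp
    finally have "f ^ ((s + t + l) + m) \<odot> x = f ^ ((s + t + l) + k) \<odot> z"
      using f c by (simp add: pow_smult_mult add_ac)
    thus ?thesis by blast
  qed
  assume "\<exists>t. f ^ (t + l) \<odot> x = f ^ (t + k) \<odot> y"
  then obtain t where t: "f ^ (t + l) \<odot> x = f ^ (t + k) \<odot> y" by blast
  show "fraction M f x k = fraction M f y l"
  proof (rule Set.set_eqI)
    fix p :: "'m \<times> nat"
    obtain z m where p: "p = (z, m)" by (cases p)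
    show "p \<in> fraction M f x k \<longleftrightarrow> p \<in> fraction M f y l"
      unfolding p fraction_def using trans[OF t _ xy] trans[OF t[symmetric] _ xy(2,1)] by auto
  qed
qed

lemma fraction_mem_iff:
  assumes f: "f \<in> Rn n" and x: "x \<in> carrier M"
  shows "(y, l) \<in> fraction M f x k \<longleftrightarrow> y \<in> carrier M \<and> fraction M f y l = fraction M f x k"
  using fraction_eq_iff[OF f x, of y k l] by (auto simp: fraction_def)

lemma fraction_eq_iff_same:
  assumes f: "f \<in> Rn n" and xy: "x \<in> carrier M" "y \<in> carrier M"
  shows "fraction M f x k = fraction M f y k \<longleftrightarrow> (\<exists>t. f ^ t \<odot> x = f ^ t \<odot> y)"
proof
  assume "\<exists>t. f ^ t \<odot> x = f ^ t \<odot> y"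
  then obtain t where "f ^ t \<odot> x = f ^ t \<odot> y" by blast
  hence "f ^ k \<odot> (f ^ t \<odot> x) = f ^ k \<odot> (f ^ t \<odot> y)" by simp
  hence "f ^ (t + k) \<odot> x = f ^ (t + k) \<odot> y" using f xy by (simp add: pow_smult_mult add.commute)
  thus "fraction M f x k = fraction M f y k" using fraction_eq_iff[OF f xy] by blast
qed (use fraction_eq_iff[OF f xy, of k k] in blast)

lemma fraction_level:
  assumes f: "f \<in> Rn n" and x: "x \<in> carrier M"
  shows "fraction M f (f ^ t \<odot> x) (k + t) = fraction M f x k"
  using f x by (subst fraction_eq_iff) (auto simp: pow_smult_mult add_ac intro!: exI[of _ 0])

text \<open>Operations on fractions are unions over all representatives. When the value does not
  depend on the representative, the union collapses to it; addition, scalar multiplication and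
  restriction are all computed in this way.\<close>

lemma fraction_UN:
  assumes f: "f \<in> Rn n" and x: "x \<in> carrier M"
    and h: "\<And>y l. y \<in> carrier M \<Longrightarrow> fraction M f y l = fraction M f x k \<Longrightarrow> h y l = h x k"
  shows "(\<Union>(y, l)\<in>fraction M f x k. h y l) = h x k"
proof
  show "h x k \<subseteq> (\<Union>(y, l)\<in>fraction M f x k. h y l)" using fraction_self[OF x] by auto
  show "(\<Union>(y, l)\<in>fraction M f x k. h y l) \<subseteq> h x k" using fraction_mem_iff[OF f x] h by auto
qed

lemma fraction_add_cong:
  assumes f: "f \<in> Rn n" and c: "x \<in> carrier M" "y \<in> carrier M" "x' \<in> carrier M" "y' \<in> carrier M"
    and e: "fraction M f x' k' = fraction M f x k" "fraction M f y' l' = fraction M f y l"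
  shows "fraction M f (f ^ l' \<odot> x' \<oplus> f ^ k' \<odot> y') (k' + l') = fraction M f (f ^ l \<odot> x \<oplus> f ^ k \<odot> y) (k + l)"
proof -
  obtain t where t: "f ^ (t + k) \<odot> x' = f ^ (t + k') \<odot> x" using e(1) fraction_eq_iff[OF f c(3,1)] by blast
  obtain s where s: "f ^ (s + l) \<odot> y' = f ^ (s + l') \<odot> y" using e(2) fraction_eq_iff[OF f c(4,2)] by blast
  have "f ^ (s + l + l') \<odot> (f ^ (t + k) \<odot> x') = f ^ (s + l + l') \<odot> (f ^ (t + k') \<odot> x)" using t by simp
  hence 1: "f ^ ((t + s) + (k + l) + l') \<odot> x' = f ^ ((t + s) + (k' + l') + l) \<odot> x"
    using f c by (simp add: pow_smult_mult add_ac)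
  have "f ^ (t + k + k') \<odot> (f ^ (s + l) \<odot> y') = f ^ (t + k + k') \<odot> (f ^ (s + l') \<odot> y)" using s by simp
  hence 2: "f ^ ((t + s) + (k + l) + k') \<odot> y' = f ^ ((t + s) + (k' + l') + k) \<odot> y"
    using f c by (simp add: pow_smult_mult add_ac)
  have "f ^ ((t + s) + (k + l)) \<odot> (f ^ l' \<odot> x' \<oplus> f ^ k' \<odot> y') = f ^ ((t + s) + (k' + l')) \<odot> (f ^ l \<odot> x \<oplus> f ^ k \<odot> y)"
    using f c 1 2 by (simp add: smult_r_distr pow_smult_mult)
  thus ?thesis using f c by (subst fraction_eq_iff) auto
qed

lemma localization_add:
  assumes f: "f \<in> Rn n" and c: "x \<in> carrier M" "y \<in> carrier M"
  shows "fraction M f x k \<oplus>\<^bsub>localization M f e\<^esub> fraction M f y l = fraction M f (f ^ l \<odot> x \<oplus> f ^ k \<odot> y) (k + l)"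
proof -
  have "(\<Union>(x', k')\<in>fraction M f x k. \<Union>(y', l')\<in>fraction M f y l. fraction M f (f ^ l' \<odot> x' \<oplus> f ^ k' \<odot> y') (k' + l'))
    = (\<Union>(y', l')\<in>fraction M f y l. fraction M f (f ^ l' \<odot> x \<oplus> f ^ k \<odot> y') (k + l'))"
  proof (rule fraction_UN[OF f c(1)])
    fix x' k' assume x': "x' \<in> carrier M" "fraction M f x' k' = fraction M f x k"
    have "fraction M f (f ^ l' \<odot> x' \<oplus> f ^ k' \<odot> y') (k' + l') = fraction M f (f ^ l' \<odot> x \<oplus> f ^ k \<odot> y') (k + l')"
      if "(y', l') \<in> fraction M f y l" for y' l'
    proof -
      have y': "y' \<in> carrier M" using that fraction_mem_iff[OF f c(2)] by blast
      show ?thesis by (rule fraction_add_cong[OF f c(1) y' x'(1) y' x'(2) refl])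
    qed
    thus "(\<Union>(y', l')\<in>fraction M f y l. fraction M f (f ^ l' \<odot> x' \<oplus> f ^ k' \<odot> y') (k' + l'))
      = (\<Union>(y', l')\<in>fraction M f y l. fraction M f (f ^ l' \<odot> x \<oplus> f ^ k \<odot> y') (k + l'))"
      by auto
  qed
  also have "\<dots> = fraction M f (f ^ l \<odot> x \<oplus> f ^ k \<odot> y) (k + l)"
    by (rule fraction_UN[OF f c(2)]) (rule fraction_add_cong[OF f c(1,2,1)], auto)
  finally show ?thesis by (simp add: localization_def)
qed

lemma localization_add_same:
  assumes f: "f \<in> Rn n" and c: "x \<in> carrier M" "y \<in> carrier M"
  shows "fraction M f x k \<oplus>\<^bsub>localization M f e\<^esub> fraction M f y k = fraction M f (x \<oplus> y) k"
proof -
  have "fraction M f x k \<oplus>\<^bsub>localization M f e\<^esub> fraction M f y k = fraction M f (f ^ k \<odot> (x \<oplus> y)) (k + k)"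
    using localization_add[OF f c] f c by (simp add: smult_r_distr)
  also have "\<dots> = fraction M f (x \<oplus> y) k" by (rule fraction_level) (use f c in auto)
  finally show ?thesis .
qed

lemma localization_smult:
  assumes f: "f \<in> Rn n" and x: "x \<in> carrier M" and a: "a \<in> Rn n"
  shows "a \<odot>\<^bsub>localization M f e\<^esub> fraction M f x k = fraction M f (a \<odot> x) k"
proof -
  have "(\<Union>(y, l)\<in>fraction M f x k. fraction M f (a \<odot> y) l) = fraction M f (a \<odot> x) k"
  proof (rule fraction_UN[OF f x])
    fix y l assume y: "y \<in> carrier M" and e: "fraction M f y l = fraction M f x k"
    then obtain t where "f ^ (t + k) \<odot> y = f ^ (t + l) \<odot> x" using fraction_eq_iff[OF f y x] by blast
    hence "a \<odot> (f ^ (t + k) \<odot> y) = a \<odot> (f ^ (t + l) \<odot> x)" by simp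
    hence "f ^ (t + k) \<odot> (a \<odot> y) = f ^ (t + l) \<odot> (a \<odot> x)"
      using smult_comm[of a "f ^ (t + k)" y] smult_comm[of a "f ^ (t + l)" x] a f x y by simp
    thus "fraction M f (a \<odot> y) l = fraction M f (a \<odot> x) k" using f a x y by (subst fraction_eq_iff) auto
  qed
  thus ?thesis by (simp add: localization_def)
qed

lemma localization_zero:
  assumes f: "f \<in> Rn n" shows "\<zero>\<^bsub>localization M f e\<^esub> = fraction M f \<zero> k"
proof -
  have "fraction M f \<zero> 0 = fraction M f \<zero> k" using f by (subst fraction_eq_iff) auto
  thus ?thesis by (simp add: localization_def)
qed

lemma localization_carrier: "A \<in> carrier (localization M f e) \<longleftrightarrow> (\<exists>x k. x \<in> carrier M \<and> A = fraction M f x k)"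
  by (auto simp: localization_def)

lemma fraction_closed [simp]: "x \<in> carrier M \<Longrightarrow> fraction M f x k \<in> carrier (localization M f e)"
  by (auto simp: localization_carrier)

text \<open>Common denominators reduce addition to \<open>localization_add_same\<close>, from which
  the monoid laws follow.\<close>

lemma localization_common_level:
  assumes f: "f \<in> Rn n" and A: "finite \<A>" "\<A> \<subseteq> carrier (localization M f e)"
  shows "\<exists>k. \<forall>A\<in>\<A>. \<exists>x\<in>carrier M. A = fraction M f x k"
  using A
proof (induction \<A>)
  case (insert A \<A>)
  then obtain k where k: "\<forall>B\<in>\<A>. \<exists>x\<in>carrier M. B = fraction M f x k" by auto
  obtain x l where x: "x \<in> carrier M" "A = fraction M f x l" using insert.prems localization_carrier by auto
  have "\<exists>x\<in>carrier M. B = fraction M f x (k + l)" if B: "B \<in> insert A \<A>" for B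
  proof (cases "B = A")
    case True
    thus ?thesis using fraction_level[OF f x(1), of k l] x f by (intro bexI[of _ "f ^ k \<odot> x"]) (auto simp: add.commute)
  next
    case False
    then obtain y where y: "y \<in> carrier M" "B = fraction M f y k" using k B by auto
    thus ?thesis using fraction_level[OF f y(1), of l k] f by (intro bexI[of _ "f ^ l \<odot> y"]) auto
  qed
  thus ?case by blast
qed auto

lemma localization_abelian_monoid:
  assumes f: "f \<in> Rn n" shows "abelian_monoid (localization M f e)"
proof (rule abelian_monoidI)
  let ?L = "localization M f e"
  have lvl: "\<exists>k. \<forall>A\<in>{A, B, C}. \<exists>x\<in>carrier M. A = fraction M f x k"
    if "A \<in> carrier ?L" "B \<in> carrier ?L" "C \<in> carrier ?L" for A B C
    by (rule localization_common_level[OF f]) (use that in auto)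
  have z: "\<zero>\<^bsub>?L\<^esub> \<in> carrier ?L" using localization_zero[OF f, of e 0] by simp
  show "\<zero>\<^bsub>?L\<^esub> \<in> carrier ?L" by (rule z)
  fix A B assume AB: "A \<in> carrier ?L" "B \<in> carrier ?L"
  obtain k x y where xy: "x \<in> carrier M" "y \<in> carrier M" "A = fraction M f x k" "B = fraction M f y k"
    using lvl[OF AB AB(2)] by auto
  show "A \<oplus>\<^bsub>?L\<^esub> B \<in> carrier ?L" using xy by (simp add: localization_add_same[OF f])
  show "A \<oplus>\<^bsub>?L\<^esub> B = B \<oplus>\<^bsub>?L\<^esub> A" using xy by (simp add: localization_add_same[OF f] a_comm)
  show "\<zero>\<^bsub>?L\<^esub> \<oplus>\<^bsub>?L\<^esub> A = A" using xy by (simp add: localization_zero[OF f, of e k] localization_add_same[OF f])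
next
  let ?L = "localization M f e"
  fix A B C assume ABC: "A \<in> carrier ?L" "B \<in> carrier ?L" "C \<in> carrier ?L"
  have "\<exists>k. \<forall>A\<in>{A, B, C}. \<exists>x\<in>carrier M. A = fraction M f x k"
    by (rule localization_common_level[OF f]) (use ABC in auto)
  then obtain k x y z where xy: "x \<in> carrier M" "y \<in> carrier M" "z \<in> carrier M"
    "A = fraction M f x k" "B = fraction M f y k" "C = fraction M f z k"
    by auto
  show "A \<oplus>\<^bsub>?L\<^esub> B \<oplus>\<^bsub>?L\<^esub> C = A \<oplus>\<^bsub>?L\<^esub> (B \<oplus>\<^bsub>?L\<^esub> C)"
    using xy by (simp add: localization_add_same[OF f] a_assoc)
qed

lemma localization_finsum:
  assumes f: "f \<in> Rn n" and g: "finite A" "\<And>a. a \<in> A \<Longrightarrow> g a \<in> carrier M"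
  shows "(\<Oplus>\<^bsub>localization M f e\<^esub>a\<in>A. fraction M f (g a) k) = fraction M f (\<Oplus>a\<in>A. g a) k"
proof -
  interpret L: abelian_monoid "localization M f e" by (rule localization_abelian_monoid[OF f])
  show ?thesis using g
  proof (induction A)
    case empty
    thus ?case using localization_zero[OF f, of e k] by simp
  next
    case (insert a A)
    have "g \<in> A \<rightarrow> carrier M" "(\<lambda>a. fraction M f (g a) k) \<in> A \<rightarrow> carrier (localization M f e)" using insert.prems by auto
    thus ?case using insert by (simp add: finsum_insert L.finsum_insert localization_add_same[OF f] finsum_closed)
  qed
qed

lemma restriction_fraction:
  assumes T: "T \<subseteq> {1..n}" and S: "S \<subseteq> T" and x: "x \<in> carrier M"
  shows "cech_restriction M S T (fraction M (X_prod S) x k) = fraction M (X_prod T) (X_prod (T - S) ^ k \<odot> x) k"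
proof -
  have fin: "finite T" using T finite_subset by blast
  have R: "(X_prod S :: 'k mpol) \<in> Rn n" "(X_prod (T - S) :: 'k mpol) \<in> Rn n" "(X_prod T :: 'k mpol) \<in> Rn n"
    by (rule X_prod_Rn, use S T in auto)+
  have XT: "(X_prod T :: 'k mpol) = X_prod S * X_prod (T - S)" by (rule X_prod_mult[OF fin S, symmetric])
  show ?thesis
    unfolding cech_restriction_def
  proof (rule fraction_UN[OF R(1) x])
    fix y l assume y: "y \<in> carrier M" and e: "fraction M (X_prod S) y l = fraction M (X_prod S) x k"
    then obtain t where t: "X_prod S ^ (t + k) \<odot> y = X_prod S ^ (t + l) \<odot> x" using fraction_eq_iff[OF R(1) y x] by blast
    have e1: "X_prod T ^ (t + k) \<odot> (X_prod (T - S) ^ l \<odot> y) = X_prod (T - S) ^ (t + k + l) \<odot> (X_prod S ^ (t + k) \<odot> y)"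
      using R y by (simp add: smult_mult[symmetric] XT power_mult_distrib power_add mult_ac)
    have e2: "X_prod T ^ (t + l) \<odot> (X_prod (T - S) ^ k \<odot> x) = X_prod (T - S) ^ (t + k + l) \<odot> (X_prod S ^ (t + l) \<odot> x)"
      using R x by (simp add: smult_mult[symmetric] XT power_mult_distrib power_add mult_ac)
    have "X_prod T ^ (t + k) \<odot> (X_prod (T - S) ^ l \<odot> y) = X_prod T ^ (t + l) \<odot> (X_prod (T - S) ^ k \<odot> x)"
      unfolding e1 e2 t ..
    thus "fraction M (X_prod T) (X_prod (T - S) ^ l \<odot> y) l = fraction M (X_prod T) (X_prod (T - S) ^ k \<odot> x) k"
      using R x y by (subst fraction_eq_iff) auto
  qed
qed

section \<open>From families of module elements to Cech cochains\<close>

definition cech_of :: "nat \<Rightarrow> nat \<Rightarrow> (nat set \<Rightarrow> 'm) \<Rightarrow> nat set \<Rightarrow> ('m \<times> nat) set" where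
  "cech_of i k x = (\<lambda>S\<in>cech_index n i. fraction M (X_prod S) (x S) k)"

lemma cech_index_iff: "S \<in> cech_index n i \<longleftrightarrow> S \<subseteq> {1..n} \<and> card S = i"
  by (auto simp: cech_index_def)

lemma cech_index_Rn: "S \<in> cech_index n i \<Longrightarrow> (X_prod S :: 'k mpol) \<in> Rn n"
  by (rule X_prod_Rn) (simp add: cech_index_iff)

lemma finite_cech_index: "finite (cech_index n i)"
  by (rule finite_subset[of _ "Pow {1..n}"]) (unfold cech_index_def, blast, simp)

definition fam :: "nat \<Rightarrow> (nat set \<Rightarrow> 'm) \<Rightarrow> bool" where
  "fam i x \<longleftrightarrow> (\<forall>S\<in>cech_index n i. x S \<in> carrier M)"

lemma fam_coch: "coch n M (Suc i) j k x \<Longrightarrow> fam i x"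
  using coch_carrier by (auto simp: fam_def cech_index_iff)

lemma fam_level_up: "fam i x \<Longrightarrow> fam i (level_up M t x)"
  using level_up_closed by (auto simp: fam_def cech_index_iff)

lemma cech_index_remove:
  assumes "T \<in> cech_index n (Suc i)" "s \<in> T" shows "T - {s} \<in> cech_index n i"
  using assms finite_subset[of T "{1..n}"] by (auto simp: cech_index_iff)

lemma fam_remove: "fam i x \<Longrightarrow> T \<in> cech_index n (Suc i) \<Longrightarrow> s \<in> T \<Longrightarrow> x (T - {s}) \<in> carrier M"
  using cech_index_remove by (auto simp: fam_def)

lemma fam_kd: "fam i x \<Longrightarrow> fam (Suc i) (kd M k x)"
  unfolding fam_def[of "Suc i"] using kd_closed fam_remove by (auto simp: cech_index_iff)

lemma cech_of_level_up: "fam i x \<Longrightarrow> cech_of i (k + t) (level_up M t x) = cech_of i k x"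
  unfolding cech_of_def level_up_def
  by (rule restrict_ext) (simp add: fam_def fraction_level cech_index_Rn)

text \<open>Equality of fractions has a separate witness for each \<open>S\<close>; the maximum over
  the finitely many index sets serves for all.\<close>

lemma cech_of_eq_iff:
  assumes "fam i x" "fam i y"
  shows "cech_of i k x = cech_of i k y \<longleftrightarrow> (\<exists>t. \<forall>S\<in>cech_index n i. level_up M t x S = level_up M t y S)"
proof
  assume eq: "cech_of i k x = cech_of i k y"
  have "\<forall>S\<in>cech_index n i. \<exists>t. level_up M t x S = level_up M t y S"
  proof
    fix S assume S: "S \<in> cech_index n i"
    hence "fraction M (X_prod S) (x S) k = fraction M (X_prod S) (y S) k"
      using fun_cong[OF eq, of S] by (simp add: cech_of_def)
    thus "\<exists>t. level_up M t x S = level_up M t y S"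
      using fraction_eq_iff_same[OF cech_index_Rn[OF S]] assms S by (auto simp: fam_def level_up_def)
  qed
  then obtain t where t: "\<And>S. S \<in> cech_index n i \<Longrightarrow> level_up M (t S) x S = level_up M (t S) y S" by metis
  define u where "u = Max (insert 0 (t ` cech_index n i))"
  have "level_up M u x S = level_up M u y S" if S: "S \<in> cech_index n i" for S
  proof -
    have "t S \<le> u" unfolding u_def using S finite_cech_index by (intro Max_ge) auto
    then obtain v where v: "u = t S + v" using le_Suc_ex by blast
    have c: "S \<subseteq> {1..n}" "x S \<in> carrier M" "y S \<in> carrier M" using S assms by (auto simp: cech_index_iff fam_def)
    have "level_up M v (level_up M (t S) x) S = level_up M v (level_up M (t S) y) S"
      using t[OF S] by (simp add: level_up_def)
    thus ?thesis using c by (simp add: level_up_level_up v)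
  qed
  thus "\<exists>t. \<forall>S\<in>cech_index n i. level_up M t x S = level_up M t y S" by blast
next
  assume "\<exists>t. \<forall>S\<in>cech_index n i. level_up M t x S = level_up M t y S"
  then obtain t where t: "\<forall>S\<in>cech_index n i. level_up M t x S = level_up M t y S" by blast
  have "cech_of i (k + t) (level_up M t x) = cech_of i (k + t) (level_up M t y)"
    unfolding cech_of_def by (rule restrict_ext) (use t in simp)
  thus "cech_of i k x = cech_of i k y" by (simp add: cech_of_level_up assms)
qed

lemma cech_of_add:
  assumes "fam i x" "fam i y"
  shows "cech_of i k x \<oplus>\<^bsub>cech_module n M i\<^esub> cech_of i k y = cech_of i k (\<lambda>S. x S \<oplus> y S)"
  unfolding cech_of_def cech_module_def
  by (auto intro!: restrict_ext simp: cech_localization_def localization_add_same cech_index_Rn assms[unfolded fam_def])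

lemma cech_zero: "\<zero>\<^bsub>cech_module n M i\<^esub> = cech_of i k (\<lambda>S. \<zero>)"
  unfolding cech_of_def cech_module_def
  by (auto intro!: restrict_ext simp: cech_localization_def localization_zero[where k = k] cech_index_Rn)

lemma cech_of_closed: "fam i x \<Longrightarrow> cech_of i k x \<in> carrier (cech_module n M i)"
  by (auto simp: cech_of_def cech_module_def cech_localization_def fam_def)

lemma cech_of_component: "coch n M (Suc i) j k x \<Longrightarrow> cech_of i k x \<in> component (cech_module n M i) j"
proof -
  assume x: "coch n M (Suc i) j k x"
  have "fraction M (X_prod S) (x S) k \<in> component (cech_localization M S) j" if S: "S \<in> cech_index n i" for S
  proof -
    have "x S \<in> component M (j + int (k * card S))" by (rule coch_comp[OF x]) (use S in \<open>auto simp: cech_index_iff\<close>)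
    thus ?thesis unfolding cech_localization_def localization_def by auto
  qed
  thus ?thesis unfolding cech_of_def cech_module_def by auto
qed

text \<open>A common denominator for all entries. \<open>C\<close> stands for the set in which
  numerators are sought, so that one argument yields families in the whole module and families of
  fixed internal degree.\<close>

lemma cech_of_exists_aux:
  assumes u: "u \<in> extensional (cech_index n i)"
    and C: "\<And>S k t x. S \<in> cech_index n i \<Longrightarrow> x \<in> C S k \<Longrightarrow> x \<in> carrier M \<and> X_prod S ^ t \<odot> x \<in> C S (k + t)"
    and uS: "\<And>S. S \<in> cech_index n i \<Longrightarrow> \<exists>x k. x \<in> C S k \<and> u S = fraction M (X_prod S) x k"
  shows "\<exists>k x. (\<forall>S\<in>cech_index n i. x S \<in> C S k) \<and> u = cech_of i k x"
proof -
  obtain x k where xk: "\<And>S. S \<in> cech_index n i \<Longrightarrow> x S \<in> C S (k S) \<and> u S = fraction M (X_prod S) (x S) (k S)"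
    using uS by metis
  define K where "K = Max (insert 0 (k ` cech_index n i))"
  define y where "y S = X_prod S ^ (K - k S) \<odot> x S" for S
  have y: "y S \<in> C S K \<and> u S = fraction M (X_prod S) (y S) K" if S: "S \<in> cech_index n i" for S
  proof -
    have "k S \<le> K" unfolding K_def using S finite_cech_index by (intro Max_ge) auto
    hence e: "k S + (K - k S) = K" by simp
    have xc: "x S \<in> carrier M" using C[OF S] xk[OF S] by blast
    have "y S \<in> C S (k S + (K - k S))" unfolding y_def using C[OF S] xk[OF S] by blast
    thus ?thesis
      using fraction_level[OF cech_index_Rn[OF S] xc, of "K - k S" "k S"] xk[OF S] unfolding e y_def by auto
  qed
  have "u = cech_of i K y"
    unfolding cech_of_def using u y by (intro extensionalityI[of _ "cech_index n i"]) auto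
  thus ?thesis using y by blast
qed

lemma cech_of_exists:
  assumes "u \<in> carrier (cech_module n M i)" shows "\<exists>k x. fam i x \<and> u = cech_of i k x"
proof -
  have u: "u \<in> (\<Pi>\<^sub>E S\<in>cech_index n i. carrier (localization M (X_prod S) (card S)))"
    using assms by (simp add: cech_module_def cech_localization_def)
  have "\<exists>k x. (\<forall>S\<in>cech_index n i. x S \<in> carrier M) \<and> u = cech_of i k x"
  proof (rule cech_of_exists_aux[where C = "\<lambda>S k. carrier M"])
    show "u \<in> extensional (cech_index n i)" using u by (simp add: PiE_def)
    fix S assume S: "S \<in> cech_index n i"
    show "\<exists>x k. x \<in> carrier M \<and> u S = fraction M (X_prod S) x k"
      using PiE_mem[OF u S] by (auto simp: localization_carrier)
    fix k t x assume "x \<in> carrier M"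
    thus "x \<in> carrier M \<and> X_prod S ^ t \<odot> x \<in> carrier M" using cech_index_Rn[OF S] by simp
  qed
  thus ?thesis by (simp add: fam_def)
qed

lemma cech_of_exists_component:
  assumes "u \<in> component (cech_module n M i) j" shows "\<exists>k x. coch n M (Suc i) j k x \<and> u = cech_of i k x"
proof -
  have u: "u \<in> (\<Pi>\<^sub>E S\<in>cech_index n i. component (localization M (X_prod S) (card S)) j)"
    using assms by (simp add: cech_module_def cech_localization_def)
  have "\<exists>k x. (\<forall>S\<in>cech_index n i. x S \<in> component M (j + int (k * card S))) \<and> u = cech_of i k x"
  proof (rule cech_of_exists_aux[where C = "\<lambda>S k. component M (j + int (k * card S))"])
    show "u \<in> extensional (cech_index n i)" using u by (simp add: PiE_def)
    fix S assume S: "S \<in> cech_index n i"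
    show "\<exists>x k. x \<in> component M (j + int (k * card S)) \<and> u S = fraction M (X_prod S) x k"
      using PiE_mem[OF u S] by (auto simp: localization_def)
    fix k t x assume x: "x \<in> component M (j + int (k * card S))"
    have "X_prod S ^ t \<odot> x \<in> component M (j + int ((k + t) * card S))"
      by (rule smult_comp[OF Hom_power[OF X_prod_Hom] x]) (use S in \<open>auto simp: cech_index_iff algebra_simps\<close>)
    thus "x \<in> carrier M \<and> X_prod S ^ t \<odot> x \<in> component M (j + int ((k + t) * card S))" using x by simp
  qed
  then obtain k x where kx: "\<forall>S\<in>cech_index n i. x S \<in> component M (j + int (k * card S))" "u = cech_of i k x" by blast
  have "coch n M (Suc i) j k x" using kx(1) unfolding coch_def by (simp only: cech_index_iff Ball_def nat.inject) blast
  thus ?thesis using kx(2) by blast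
qed

text \<open>Restriction from \<open>T - {s}\<close> to \<open>T\<close> multiplies a numerator at
  level \<open>k\<close> by \<open>X_var s ^ k\<close>, which is where the scalars in
  \<open>kd\<close> come from.\<close>

lemma cech_differential_cech_of:
  assumes x: "fam i x"
  shows "cech_differential n M i (cech_of i k x) = cech_of (Suc i) k (kd M k x)"
  unfolding cech_differential_def cech_of_def
proof (rule restrict_ext)
  fix T assume T: "T \<in> cech_index n (Suc i)"
  have Tn: "T \<subseteq> {1..n}" and fin: "finite T" using T finite_subset[of T "{1..n}"] by (auto simp: cech_index_iff)
  interpret L: abelian_monoid "cech_localization M T"
    unfolding cech_localization_def by (rule localization_abelian_monoid[OF cech_index_Rn[OF T]])
  have term_eq: "((-1) ^ card {t \<in> T. t < s}) \<odot>\<^bsub>cech_localization M T\<^esub>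
      cech_restriction M (T - {s}) T ((\<lambda>S\<in>cech_index n i. fraction M (X_prod S) (x S) k) (T - {s}))
    = fraction M (X_prod T) ((sgn_at s T * X_var s ^ k) \<odot> x (T - {s})) k" if s: "s \<in> T" for s
  proof -
    have xs: "x (T - {s}) \<in> carrier M" by (rule fam_remove[OF x T s])
    have Ts: "T - (T - {s}) = {s}" using s by auto
    have Xs: "(X_var s ^ k :: 'k mpol) \<in> Rn n" by (rule X_pow_Rn[OF Tn s])
    have "cech_restriction M (T - {s}) T ((\<lambda>S\<in>cech_index n i. fraction M (X_prod S) (x S) k) (T - {s}))
      = fraction M (X_prod T) (X_var s ^ k \<odot> x (T - {s})) k"
      using restriction_fraction[OF Tn, of "T - {s}" "x (T - {s})" k] cech_index_remove[OF T s] xs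
      by (simp add: Ts X_prod_def)
    thus ?thesis
      using localization_smult[OF cech_index_Rn[OF T], of "X_var s ^ k \<odot> x (T - {s})" "sgn_at s T" "card T" k] xs Xs
      by (simp add: cech_localization_def sgn_at_def[symmetric] smult_mult)
  qed
  have c: "(sgn_at s T * X_var s ^ k) \<odot> x (T - {s}) \<in> carrier M" if "s \<in> T" for s
    using kd_scalar_Rn[OF Tn that] fam_remove[OF x T that] by simp
  have "(\<Oplus>\<^bsub>cech_localization M T\<^esub>s\<in>T. ((-1) ^ card {t \<in> T. t < s}) \<odot>\<^bsub>cech_localization M T\<^esub>
      cech_restriction M (T - {s}) T ((\<lambda>S\<in>cech_index n i. fraction M (X_prod S) (x S) k) (T - {s})))
    = (\<Oplus>\<^bsub>cech_localization M T\<^esub>s\<in>T. fraction M (X_prod T) ((sgn_at s T * X_var s ^ k) \<odot> x (T - {s})) k)"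
    by (rule L.finsum_cong') (use term_eq c in \<open>auto simp: cech_localization_def\<close>)
  also have "\<dots> = fraction M (X_prod T) (kd M k x T) k"
    unfolding kd_def cech_localization_def by (rule localization_finsum[OF cech_index_Rn[OF T] fin c])
  finally show "(\<Oplus>\<^bsub>cech_localization M T\<^esub>s\<in>T. ((-1) ^ card {t \<in> T. t < s}) \<odot>\<^bsub>cech_localization M T\<^esub>
      cech_restriction M (T - {s}) T ((\<lambda>S\<in>cech_index n i. fraction M (X_prod S) (x S) k) (T - {s})))
    = fraction M (X_prod T) (kd M k x T) k" .
qed

text \<open>Families one cohomological degree below \<open>i\<close>. No set satisfies
  \<open>Suc (card S) = 0\<close>, so \<open>i = 0\<close> fits in without a case
  distinction.\<close>

definition prefam :: "nat \<Rightarrow> (nat set \<Rightarrow> 'm) \<Rightarrow> bool" where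
  "prefam i y \<longleftrightarrow> (\<forall>S. S \<subseteq> {1..n} \<longrightarrow> Suc (card S) = i \<longrightarrow> y S \<in> carrier M)"

lemma prefam_remove:
  assumes "prefam i y" "T \<in> cech_index n i" "s \<in> T" shows "y (T - {s}) \<in> carrier M"
proof -
  have "finite T" using assms finite_subset[of T "{1..n}"] by (auto simp: cech_index_iff)
  hence "Suc (card (T - {s})) = i" "T - {s} \<subseteq> {1..n}"
    using assms card_Suc_Diff1[of T s] by (auto simp: cech_index_iff simp del: card_Diff_insert)
  thus ?thesis using assms(1) unfolding prefam_def by blast
qed

lemma prefam_level_up: "prefam i y \<Longrightarrow> prefam i (level_up M t y)"
  unfolding prefam_def using level_up_closed by blast

lemma prefam_fam_kd: "prefam i y \<Longrightarrow> fam i (kd M k y)"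
  unfolding fam_def using kd_closed prefam_remove by (auto simp: cech_index_iff)

lemma cech_of_kd_level_up:
  assumes "prefam i y" shows "cech_of i (k + t) (kd M (k + t) (level_up M t y)) = cech_of i k (kd M k y)"
proof -
  have "cech_of i (k + t) (kd M (k + t) (level_up M t y)) = cech_of i (k + t) (level_up M t (kd M k y))"
    unfolding cech_of_def
    by (rule restrict_ext) (use kd_level_up prefam_remove[OF assms] in \<open>auto simp: cech_index_iff\<close>)
  thus ?thesis using cech_of_level_up[OF prefam_fam_kd[OF assms]] by simp
qed

text \<open>For \<open>i = 0\<close> both sides consist of the zero cochain: \<open>kd\<close> at
  the empty set is an empty sum.\<close>

lemma cech_coboundaries_alt:
  "cech_coboundaries n M i = {cech_of i k (kd M k y) | k y. prefam i y}"
proof (cases i)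
  case 0
  have "cech_of 0 k (kd M k y) = \<zero>\<^bsub>cech_module n M 0\<^esub>" for k y
    unfolding cech_zero[of 0 k] cech_of_def
    by (rule restrict_ext) (auto simp: cech_index_iff card_eq_0_iff finite_subset)
  thus ?thesis unfolding 0 cech_coboundaries_def by (auto simp: prefam_def)
next
  case (Suc i')
  have pf: "prefam (Suc i') y \<longleftrightarrow> fam i' y" for y by (auto simp: prefam_def fam_def cech_index_iff)
  show ?thesis
    unfolding Suc cech_coboundaries_def pf nat.case
  proof (rule Set.set_eqI, rule iffI)
    fix u assume "u \<in> cech_differential n M i' ` carrier (cech_module n M i')"
    then obtain w where "w \<in> carrier (cech_module n M i')" "u = cech_differential n M i' w" by auto
    thus "u \<in> {cech_of (Suc i') k (kd M k y) | k y. fam i' y}"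
      using cech_of_exists[of w i'] cech_differential_cech_of by blast
  next
    fix u assume "u \<in> {cech_of (Suc i') k (kd M k y) | k y. fam i' y}"
    then obtain k y where "fam i' y" "u = cech_of (Suc i') k (kd M k y)" by auto
    thus "u \<in> cech_differential n M i' ` carrier (cech_module n M i')"
      using cech_differential_cech_of[of i' y k] cech_of_closed[of i' y k] by (metis imageI)
  qed
qed

text \<open>The usual argument with subgroups and cosets, carried out on families that have been
  brought to a common level.\<close>

lemma coboundary_coset:
  assumes x: "x \<in> carrier (cech_module n M i)"
  shows "(\<Union>h\<in>cech_coboundaries n M i. {h \<oplus>\<^bsub>cech_module n M i\<^esub> x}) = cech_coboundaries n M i
    \<longleftrightarrow> x \<in> cech_coboundaries n M i"
proof
  assume eq: "(\<Union>h\<in>cech_coboundaries n M i. {h \<oplus>\<^bsub>cech_module n M i\<^esub> x}) = cech_coboundaries n M i"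
  obtain k f where f: "fam i f" "x = cech_of i k f" using cech_of_exists[OF x] by blast
  have "prefam i (\<lambda>S. \<zero>)" by (simp add: prefam_def)
  hence "cech_of i k (kd M k (\<lambda>S. \<zero>)) \<in> cech_coboundaries n M i" unfolding cech_coboundaries_alt by blast
  moreover have "cech_of i k (kd M k (\<lambda>S. \<zero>)) = cech_of i k (\<lambda>S. \<zero>)"
    unfolding cech_of_def by (rule restrict_ext) (simp add: kd_zero cech_index_iff)
  ultimately have "cech_of i k (\<lambda>S. \<zero>) \<oplus>\<^bsub>cech_module n M i\<^esub> x \<in> cech_coboundaries n M i" using eq by auto
  moreover have "cech_of i k (\<lambda>S. \<zero>) \<oplus>\<^bsub>cech_module n M i\<^esub> x = x"
    unfolding f(2) by (subst cech_of_add) (use f(1) in \<open>auto simp: fam_def cech_of_def intro!: restrict_ext\<close>)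
  ultimately show "x \<in> cech_coboundaries n M i" by simp
next
  assume "x \<in> cech_coboundaries n M i"
  then obtain k y where y: "prefam i y" "x = cech_of i k (kd M k y)" unfolding cech_coboundaries_alt by blast
  have lvl: "\<exists>K w v. prefam i w \<and> prefam i v \<and> h = cech_of i K (kd M K w) \<and> x = cech_of i K (kd M K v)"
    if h: "h \<in> cech_coboundaries n M i" for h
  proof -
    obtain l w where w: "prefam i w" "h = cech_of i l (kd M l w)" using h unfolding cech_coboundaries_alt by blast
    show ?thesis
      using cech_of_kd_level_up[OF w(1), of l k] cech_of_kd_level_up[OF y(1), of k l] y w
        prefam_level_up[OF w(1), of k] prefam_level_up[OF y(1), of l]
      by (intro exI[of _ "l + k"] exI[of _ "level_up M k w"] exI[of _ "level_up M l y"]) (auto simp: add.commute)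
  qed
  have kdadd: "cech_of i K (kd M K w) \<oplus>\<^bsub>cech_module n M i\<^esub> cech_of i K (kd M K v) = cech_of i K (kd M K (\<lambda>S. w S \<oplus> v S))"
    if "prefam i w" "prefam i v" for K w v
  proof -
    have "cech_of i K (kd M K w) \<oplus>\<^bsub>cech_module n M i\<^esub> cech_of i K (kd M K v) = cech_of i K (\<lambda>S. kd M K w S \<oplus> kd M K v S)"
      by (rule cech_of_add) (use prefam_fam_kd that in auto)
    also have "\<dots> = cech_of i K (kd M K (\<lambda>S. w S \<oplus> v S))"
      unfolding cech_of_def
    proof (rule restrict_ext)
      fix T assume T: "T \<in> cech_index n i"
      have "kd M K (\<lambda>S. w S \<oplus> v S) T = kd M K w T \<oplus> kd M K v T"
        by (rule kd_add) (use T prefam_remove[OF that(1) T] prefam_remove[OF that(2) T] in \<open>auto simp: cech_index_iff\<close>)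
      thus "fraction M (X_prod T) (kd M K w T \<oplus> kd M K v T) K = fraction M (X_prod T) (kd M K (\<lambda>S. w S \<oplus> v S) T) K" by simp
    qed
    finally show ?thesis .
  qed
  show "(\<Union>h\<in>cech_coboundaries n M i. {h \<oplus>\<^bsub>cech_module n M i\<^esub> x}) = cech_coboundaries n M i"
  proof (intro equalityI subsetI)
    fix u assume "u \<in> (\<Union>h\<in>cech_coboundaries n M i. {h \<oplus>\<^bsub>cech_module n M i\<^esub> x})"
    then obtain h where h: "h \<in> cech_coboundaries n M i" "u = h \<oplus>\<^bsub>cech_module n M i\<^esub> x" by auto
    obtain K w v where w: "prefam i w" "prefam i v" "h = cech_of i K (kd M K w)" "x = cech_of i K (kd M K v)"
      using lvl[OF h(1)] by blast
    have "prefam i (\<lambda>S. w S \<oplus> v S)" using w(1,2) by (auto simp: prefam_def)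
    thus "u \<in> cech_coboundaries n M i" unfolding h(2) w(3,4) kdadd[OF w(1,2)] cech_coboundaries_alt by blast
  next
    fix u assume u: "u \<in> cech_coboundaries n M i"
    obtain K w v where w: "prefam i w" "prefam i v" "u = cech_of i K (kd M K w)" "x = cech_of i K (kd M K v)"
      using lvl[OF u] by blast
    have p: "prefam i (\<lambda>S. w S \<ominus> v S)" using w(1,2) by (auto simp: prefam_def)
    have "cech_of i K (kd M K (\<lambda>S. w S \<ominus> v S)) \<oplus>\<^bsub>cech_module n M i\<^esub> x = cech_of i K (kd M K (\<lambda>S. (w S \<ominus> v S) \<oplus> v S))"
      unfolding w(4) by (rule kdadd[OF p w(2)])
    also have "\<dots> = u"
      unfolding w(3) cech_of_def
    proof (rule restrict_ext)
      fix T assume T: "T \<in> cech_index n i"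
      have "kd M K (\<lambda>S. (w S \<ominus> v S) \<oplus> v S) T = kd M K w T"
        by (rule kd_cong)
          (use T prefam_remove[OF w(1) T] prefam_remove[OF w(2) T] in \<open>auto simp: cech_index_iff a_minus_def a_assoc l_neg\<close>)
      thus "fraction M (X_prod T) (kd M K (\<lambda>S. (w S \<ominus> v S) \<oplus> v S) T) K = fraction M (X_prod T) (kd M K w T) K" by simp
    qed
    finally show "u \<in> (\<Union>h\<in>cech_coboundaries n M i. {h \<oplus>\<^bsub>cech_module n M i\<^esub> x})"
      using p unfolding cech_coboundaries_alt by blast
  qed
qed

text \<open>A coboundary is given with a preimage of mixed degrees, whereas
  \<open>coboundary\<close> asks for a homogeneous one. The differential respects the grading, so
  the component of the right degree serves as preimage.\<close>

lemma kd_proj: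
  assumes y: "prefam i y" and T: "T \<in> cech_index n i"
  shows "kd M k (\<lambda>S. proj (y S) (j + int (k * card S))) T = proj (kd M k y T) (j + int (k * card T))"
proof -
  have Tn: "T \<subseteq> {1..n}" and fin: "finite T" using T finite_subset[of T "{1..n}"] by (auto simp: cech_index_iff)
  have "proj (kd M k y T) (j + int (k * card T)) = (\<Oplus>s\<in>T. proj ((sgn_at s T * X_var s ^ k) \<odot> y (T - {s})) (j + int (k * card T)))"
    unfolding kd_def by (rule proj_finsum) (use kd_scalar_Rn[OF Tn] prefam_remove[OF y T] in auto)
  also have "\<dots> = kd M k (\<lambda>S. proj (y S) (j + int (k * card S))) T"
    unfolding kd_def
  proof (rule finsum_cong')
    fix s assume s: "s \<in> T"
    have "card T = Suc (card (T - {s}))" using card_Suc_Diff1[OF fin s] by simp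
    hence e: "j + int (k * card T) - int k = j + int (k * card (T - {s}))" by (simp add: algebra_simps)
    show "proj ((sgn_at s T * X_var s ^ k) \<odot> y (T - {s})) (j + int (k * card T))
      = (sgn_at s T * X_var s ^ k) \<odot> proj (y (T - {s})) (j + int (k * card (T - {s})))"
      unfolding e[symmetric] by (rule proj_smult[OF prefam_remove[OF y T s] kd_scalar_Hom[OF Tn s]])
  qed (use kd_scalar_Rn[OF Tn] prefam_remove[OF y T] in auto)
  finally show ?thesis by simp
qed

text \<open>The degree \<open>j\<close> part consists of the cosets of the cocycles of degree
  \<open>j\<close>. The zero cochain is one of them, so the part equals the zero set iff every such
  coset is trivial.\<close>

lemma local_cohomology_component_zero_iff:
  "component (local_cohomology n M i) j = {\<zero>\<^bsub>local_cohomology n M i\<^esub>} \<longleftrightarrow>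
     cech_cocycles n M i \<inter> component (cech_module n M i) j \<subseteq> cech_coboundaries n M i"
proof -
  let ?B = "cech_coboundaries n M i" and ?Z = "cech_cocycles n M i \<inter> component (cech_module n M i) j"
  let ?c = "\<lambda>x. \<Union>h\<in>?B. {h \<oplus>\<^bsub>cech_module n M i\<^esub> x}"
  have z: "\<zero>\<^bsub>cech_module n M i\<^esub> \<in> ?Z"
  proof -
    have "cech_of i 0 (\<lambda>S. \<zero>) \<in> component (cech_module n M i) j" by (rule cech_of_component[OF coch_zero])
    moreover have fz: "fam i (\<lambda>S. \<zero>)" by (simp add: fam_def)
    moreover have "cech_of (Suc i) 0 (kd M 0 (\<lambda>S. \<zero>)) = cech_of (Suc i) 0 (\<lambda>S. \<zero>)"
      unfolding cech_of_def by (rule restrict_ext) (simp add: kd_zero cech_index_iff)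
    ultimately show ?thesis
      using cech_of_closed[OF fz, of 0] cech_differential_cech_of[OF fz, of 0]
      unfolding cech_cocycles_def cech_zero[where k = 0] by auto
  qed
  have 1: "component (local_cohomology n M i) j = ?c ` ?Z" "\<zero>\<^bsub>local_cohomology n M i\<^esub> = ?B"
    by (simp_all add: local_cohomology_def quotient_module_def a_r_coset_def')
  have 2: "?c x = ?B \<longleftrightarrow> x \<in> ?B" if "x \<in> ?Z" for x
    by (rule coboundary_coset) (use that in \<open>simp add: cech_cocycles_def\<close>)
  have 3: "f ` Z = {b} \<longleftrightarrow> (\<forall>x\<in>Z. f x = b)" if "z \<in> Z"
    for f :: "(nat set \<Rightarrow> ('m \<times> nat) set) \<Rightarrow> (nat set \<Rightarrow> ('m \<times> nat) set) set" and Z b z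
    using that by blast
  show ?thesis unfolding 1 3[OF z] subset_eq by (rule ball_cong[OF refl 2])
qed

text \<open>Both sides say that cocycles of degree \<open>j\<close> are coboundaries. Equality of
  cochains with fractions is equality of families at a higher level, and this is the origin of the
  \<open>t\<close> in \<open>vanishing\<close>.\<close>

theorem local_cohomology_vanishing_iff:
  "component (local_cohomology n M i) j = {\<zero>\<^bsub>local_cohomology n M i\<^esub>} \<longleftrightarrow> vanishing n M i j"
  unfolding local_cohomology_component_zero_iff
proof
  assume sub: "cech_cocycles n M i \<inter> component (cech_module n M i) j \<subseteq> cech_coboundaries n M i"
  show "vanishing n M i j"
    unfolding vanishing_def
  proof (intro allI impI)
    fix k x assume x: "coch n M (Suc i) j k x" and xc: "cocycle n M (Suc i) k x"
    have fx: "fam i x" by (rule fam_coch[OF x])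
    have "cech_of (Suc i) k (kd M k x) = cech_of (Suc i) k (\<lambda>S. \<zero>)"
      unfolding cech_of_def by (rule restrict_ext) (use xc in \<open>auto simp: cocycle_def cech_index_iff\<close>)
    hence "cech_of i k x \<in> cech_cocycles n M i"
      unfolding cech_cocycles_def cech_zero[where k = k] using cech_of_closed[OF fx] cech_differential_cech_of[OF fx] by simp
    hence "cech_of i k x \<in> cech_coboundaries n M i" using sub cech_of_component[OF x] by blast
    then obtain k' y where y: "prefam i y" "cech_of i k x = cech_of i k' (kd M k' y)" unfolding cech_coboundaries_alt by blast
    have "cech_of i (k + k') (level_up M k' x) = cech_of i (k + k') (kd M (k + k') (level_up M k y))"
      using y(2) cech_of_level_up[OF fx, of k k'] cech_of_kd_level_up[OF y(1), of k' k] by (simp add: add.commute)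
    then obtain s where s: "\<And>S. S \<in> cech_index n i \<Longrightarrow>
        level_up M s (level_up M k' x) S = level_up M s (kd M (k + k') (level_up M k y)) S"
      using cech_of_eq_iff[OF fam_level_up[OF fx] prefam_fam_kd[OF prefam_level_up[OF y(1)]]] by blast
    define K where "K = k + k' + s"
    define w where "w = level_up M s (level_up M k y)"
    have w: "prefam i w" unfolding w_def by (intro prefam_level_up y)
    have kw: "kd M K w T = level_up M (k' + s) x T" if T: "T \<in> cech_index n i" for T
    proof -
      have "kd M K w T = level_up M s (kd M (k + k') (level_up M k y)) T"
        unfolding K_def w_def
        by (rule kd_level_up) (use T prefam_remove[OF prefam_level_up[OF y(1)] T] in \<open>auto simp: cech_index_iff\<close>)
      also have "\<dots> = level_up M s (level_up M k' x) T" using s[OF T] by simp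
      also have "\<dots> = level_up M (k' + s) x T"
        by (rule level_up_level_up) (use T fx in \<open>auto simp: fam_def cech_index_iff\<close>)
      finally show ?thesis .
    qed
    have lx: "coch n M (Suc i) j K (level_up M (k' + s) x)"
      using coch_level_up[OF x, of "k' + s"] by (simp add: K_def add.assoc)
    \<comment> \<open>\<open>w\<close> may have components in several degrees; the one belonging to
      degree \<open>j\<close> still maps to the given homogeneous cocycle.\<close>
    have "kd M K (\<lambda>S. proj (w S) (j + int (K * card S))) T = level_up M (k' + s) x T" if T: "T \<subseteq> {1..n}" "card T = i" for T
    proof -
      have T': "T \<in> cech_index n i" using T by (simp add: cech_index_iff)
      have "level_up M (k' + s) x T \<in> component M (j + int (K * card T))"
        by (rule coch_comp[OF lx]) (use T in auto)
      from proj_of_comp[OF this] show ?thesis using kd_proj[OF w T'] kw[OF T'] by simp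
    qed
    moreover have "coch n M i j K (\<lambda>S. proj (w S) (j + int (K * card S)))"
      using w by (auto simp: coch_def prefam_def)
    ultimately show "\<exists>t. coboundary n M i j (k + t) (level_up M t x)"
      unfolding coboundary_def
      by (intro exI[of _ "k' + s"] exI[of _ "\<lambda>S. proj (w S) (j + int (K * card S))"]) (auto simp: K_def add.assoc)
  qed
next
  assume v: "vanishing n M i j"
  show "cech_cocycles n M i \<inter> component (cech_module n M i) j \<subseteq> cech_coboundaries n M i"
  proof
    fix u assume u: "u \<in> cech_cocycles n M i \<inter> component (cech_module n M i) j"
    obtain k x where x: "coch n M (Suc i) j k x" "u = cech_of i k x" using cech_of_exists_component u by blast
    have fx: "fam i x" by (rule fam_coch[OF x(1)])
    have "cech_of (Suc i) k (kd M k x) = cech_of (Suc i) k (\<lambda>S. \<zero>)"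
      using u x(2) cech_differential_cech_of[OF fx, of k] cech_zero[of "Suc i" k] by (auto simp: cech_cocycles_def)
    moreover have "fam (Suc i) (\<lambda>S. \<zero>)" by (simp add: fam_def)
    \<comment> \<open>The differential vanishes as a cochain with fractions; at the level raised by
      \<open>t\<close> it vanishes as a family.\<close>
    ultimately obtain t where t: "\<And>S. S \<in> cech_index n (Suc i) \<Longrightarrow> level_up M t (kd M k x) S = level_up M t (\<lambda>S. \<zero>) S"
      using cech_of_eq_iff[OF fam_kd[OF fx]] by blast
    have "cocycle n M (Suc i) (k + t) (level_up M t x)"
      unfolding cocycle_def
    proof (intro allI impI)
      fix T assume T: "T \<subseteq> {1..n}" "card T = Suc i"
      have "kd M (k + t) (level_up M t x) T = level_up M t (kd M k x) T"
        by (rule kd_level_up) (use T coch_remove[OF x(1)] in auto)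
      thus "kd M (k + t) (level_up M t x) T = \<zero>" using t[of T] T by (simp add: cech_index_iff level_up_def)
    qed
    then obtain s y where y: "coch n M i j (k + t + s) y"
      "\<And>T. T \<subseteq> {1..n} \<Longrightarrow> card T = i \<Longrightarrow> kd M (k + t + s) y T = level_up M s (level_up M t x) T"
      using v coch_level_up[OF x(1)] unfolding vanishing_def coboundary_def by meson
    have "u = cech_of i (k + t + s) (level_up M s (level_up M t x))"
      using x(2) cech_of_level_up[OF fx] cech_of_level_up[OF fam_level_up[OF fx]] by simp
    also have "\<dots> = cech_of i (k + t + s) (kd M (k + t + s) y)"
      unfolding cech_of_def by (rule restrict_ext) (use y(2) in \<open>auto simp: cech_index_iff\<close>)
    finally show "u \<in> cech_coboundaries n M i"
      unfolding cech_coboundaries_alt using coch_carrier[OF y(1)] by (auto simp: prefam_def)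
  qed
qed

lemma regularity_reg_bound: "regularity n M = (LEAST m. reg_bound n M m)"
  unfolding regularity_def reg_bound_def local_cohomology_vanishing_iff by (simp add: Ball_def)

end

section \<open>Quotients by homogeneous submodules\<close>

context graded_poly_module
begin

definition graded_sub :: "'m set \<Rightarrow> bool" where
  "graded_sub N \<longleftrightarrow> N \<subseteq> carrier M \<and> \<zero> \<in> N \<and> (\<forall>x\<in>N. \<forall>y\<in>N. x \<oplus> y \<in> N) \<and>
     (\<forall>p\<in>Rn n. \<forall>x\<in>N. p \<odot> x \<in> N) \<and> (\<forall>x\<in>N. \<forall>i. proj x i \<in> N)"

lemma graded_subD:
  assumes "graded_sub N"
  shows "x \<in> N \<Longrightarrow> x \<in> carrier M" "\<zero> \<in> N" "x \<in> N \<Longrightarrow> y \<in> N \<Longrightarrow> x \<oplus> y \<in> N"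
    "p \<in> Rn n \<Longrightarrow> x \<in> N \<Longrightarrow> p \<odot> x \<in> N" "x \<in> N \<Longrightarrow> proj x i \<in> N"
  using assms by (auto simp: graded_sub_def)

lemma graded_sub_neg: "graded_sub N \<Longrightarrow> x \<in> N \<Longrightarrow> \<ominus> x \<in> N"
  using graded_subD(4)[of N "- 1" x] smult_uminus[of 1 x] graded_subD(1)[of N x] by simp

lemma minus_swap_eq: "x \<in> carrier M \<Longrightarrow> y \<in> carrier M \<Longrightarrow> \<ominus> (x \<ominus> y) = y \<ominus> x"
  by (simp add: a_minus_def minus_add a_comm)

lemma minus_trans: "x \<in> carrier M \<Longrightarrow> y \<in> carrier M \<Longrightarrow> z \<in> carrier M \<Longrightarrow> (x \<ominus> y) \<oplus> (y \<ominus> z) = x \<ominus> z"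
  by (simp add: a_minus_def a_assoc r_neg2 r_neg1)

lemma minus_add_minus: "x \<in> carrier M \<Longrightarrow> y \<in> carrier M \<Longrightarrow> x' \<in> carrier M \<Longrightarrow> y' \<in> carrier M \<Longrightarrow>
  (x \<oplus> y) \<ominus> (x' \<oplus> y') = (x \<ominus> x') \<oplus> (y \<ominus> y')"
  by (simp add: a_minus_def minus_add a_ac)

lemma coset_mem_iff:
  assumes N: "graded_sub N" and x: "x \<in> carrier M"
  shows "y \<in> N +>\<^bsub>M\<^esub> x \<longleftrightarrow> y \<in> carrier M \<and> y \<ominus> x \<in> N"
proof
  assume "y \<in> N +>\<^bsub>M\<^esub> x"
  then obtain h where h: "h \<in> N" "y = h \<oplus> x" by (auto simp: a_r_coset_def')
  have "h \<in> carrier M" using graded_subD(1)[OF N] h by blast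
  thus "y \<in> carrier M \<and> y \<ominus> x \<in> N" using h x by (simp add: a_minus_def a_assoc r_neg)
next
  assume y: "y \<in> carrier M \<and> y \<ominus> x \<in> N"
  hence "y = (y \<ominus> x) \<oplus> x" using x by (simp add: a_minus_def a_assoc l_neg)
  thus "y \<in> N +>\<^bsub>M\<^esub> x" using y by (auto simp: a_r_coset_def')
qed

lemma coset_self: "graded_sub N \<Longrightarrow> x \<in> carrier M \<Longrightarrow> x \<in> N +>\<^bsub>M\<^esub> x"
  by (simp add: coset_mem_iff graded_subD(2) a_minus_def r_neg)

lemma coset_eq_iff:
  assumes N: "graded_sub N" and x: "x \<in> carrier M" "y \<in> carrier M"
  shows "N +>\<^bsub>M\<^esub> x = N +>\<^bsub>M\<^esub> y \<longleftrightarrow> x \<ominus> y \<in> N"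
proof
  assume "N +>\<^bsub>M\<^esub> x = N +>\<^bsub>M\<^esub> y"
  thus "x \<ominus> y \<in> N" using coset_self[OF N x(1)] coset_mem_iff[OF N x(2)] by simp
next
  have sub: "N +>\<^bsub>M\<^esub> x \<subseteq> N +>\<^bsub>M\<^esub> y" if x: "x \<in> carrier M" "y \<in> carrier M" and d: "x \<ominus> y \<in> N" for x y
  proof
    fix z assume "z \<in> N +>\<^bsub>M\<^esub> x"
    hence z: "z \<in> carrier M" "z \<ominus> x \<in> N" using coset_mem_iff[OF N x(1)] by auto
    hence "(z \<ominus> x) \<oplus> (x \<ominus> y) \<in> N" using d graded_subD(3)[OF N] by blast
    thus "z \<in> N +>\<^bsub>M\<^esub> y" using z x by (simp add: minus_trans coset_mem_iff[OF N x(2)])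
  qed
  assume d: "x \<ominus> y \<in> N"
  hence "y \<ominus> x \<in> N" using graded_sub_neg[OF N d] x by (simp add: minus_swap_eq)
  thus "N +>\<^bsub>M\<^esub> x = N +>\<^bsub>M\<^esub> y" using sub x d by blast
qed

lemma coset_zero: "graded_sub N \<Longrightarrow> N +>\<^bsub>M\<^esub> \<zero> = N"
  using graded_subD(1) by (auto simp: coset_mem_iff minus_zero_right)

lemma coset_UN:
  assumes N: "graded_sub N" and x: "x \<in> carrier M"
    and h: "\<And>y. y \<in> carrier M \<Longrightarrow> y \<ominus> x \<in> N \<Longrightarrow> h y = h x"
  shows "(\<Union>y\<in>N +>\<^bsub>M\<^esub> x. h y) = h x"
proof (intro equalityI subsetI)
  fix z assume "z \<in> (\<Union>y\<in>N +>\<^bsub>M\<^esub> x. h y)"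
  then obtain y where y: "y \<in> N +>\<^bsub>M\<^esub> x" "z \<in> h y" by blast
  thus "z \<in> h x" using h[of y] coset_mem_iff[OF N x, of y] by simp
next
  fix z assume "z \<in> h x"
  thus "z \<in> (\<Union>y\<in>N +>\<^bsub>M\<^esub> x. h y)" using coset_self[OF N x] by blast
qed

lemma quotient_carrier: "A \<in> carrier (quotient_module M N) \<longleftrightarrow> (\<exists>x\<in>carrier M. A = N +>\<^bsub>M\<^esub> x)"
  by (auto simp: quotient_module_def A_RCOSETS_def')

lemma coset_closed [simp]: "x \<in> carrier M \<Longrightarrow> N +>\<^bsub>M\<^esub> x \<in> carrier (quotient_module M N)"
  by (auto simp: quotient_carrier)

lemma quotient_add:
  assumes N: "graded_sub N" and x: "x \<in> carrier M" "y \<in> carrier M"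
  shows "(N +>\<^bsub>M\<^esub> x) \<oplus>\<^bsub>quotient_module M N\<^esub> (N +>\<^bsub>M\<^esub> y) = N +>\<^bsub>M\<^esub> (x \<oplus> y)"
proof -
  have "(N +>\<^bsub>M\<^esub> x) <+>\<^bsub>M\<^esub> (N +>\<^bsub>M\<^esub> y) = N +>\<^bsub>M\<^esub> (x \<oplus> y)"
  proof (intro equalityI subsetI)
    fix z assume "z \<in> (N +>\<^bsub>M\<^esub> x) <+>\<^bsub>M\<^esub> (N +>\<^bsub>M\<^esub> y)"
    then obtain a b where ab: "a \<in> N +>\<^bsub>M\<^esub> x" "b \<in> N +>\<^bsub>M\<^esub> y" "z = a \<oplus> b" by (auto simp: set_add_def')
    hence c: "a \<in> carrier M" "b \<in> carrier M" "a \<ominus> x \<in> N" "b \<ominus> y \<in> N" using x coset_mem_iff[OF N] by auto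
    hence "(a \<ominus> x) \<oplus> (b \<ominus> y) \<in> N" using graded_subD(3)[OF N] by blast
    thus "z \<in> N +>\<^bsub>M\<^esub> (x \<oplus> y)" using c x ab by (simp add: coset_mem_iff[OF N] minus_add_minus)
  next
    fix z assume "z \<in> N +>\<^bsub>M\<^esub> (x \<oplus> y)"
    then obtain h where h: "h \<in> N" "z = h \<oplus> (x \<oplus> y)" by (auto simp: a_r_coset_def')
    hence "z = (h \<oplus> x) \<oplus> y" using x graded_subD(1)[OF N] by (simp add: a_assoc)
    moreover have "h \<oplus> x \<in> N +>\<^bsub>M\<^esub> x" using h by (auto simp: a_r_coset_def')
    ultimately show "z \<in> (N +>\<^bsub>M\<^esub> x) <+>\<^bsub>M\<^esub> (N +>\<^bsub>M\<^esub> y)" using coset_self[OF N x(2)] by (auto simp: set_add_def')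
  qed
  thus ?thesis by (simp add: quotient_module_def)
qed

lemma quotient_smult:
  assumes N: "graded_sub N" and x: "x \<in> carrier M" and a: "a \<in> Rn n"
  shows "a \<odot>\<^bsub>quotient_module M N\<^esub> (N +>\<^bsub>M\<^esub> x) = N +>\<^bsub>M\<^esub> (a \<odot> x)"
proof -
  have "(\<Union>y\<in>N +>\<^bsub>M\<^esub> x. N +>\<^bsub>M\<^esub> (a \<odot> y)) = N +>\<^bsub>M\<^esub> (a \<odot> x)"
  proof (rule coset_UN[OF N x])
    fix y assume y: "y \<in> carrier M" "y \<ominus> x \<in> N"
    hence "a \<odot> (y \<ominus> x) \<in> N" using graded_subD(4)[OF N a] by blast
    thus "N +>\<^bsub>M\<^esub> (a \<odot> y) = N +>\<^bsub>M\<^esub> (a \<odot> x)" using x y a by (simp add: coset_eq_iff[OF N] smult_minus)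
  qed
  thus ?thesis by (simp add: quotient_module_def)
qed

lemma quotient_zero: "\<zero>\<^bsub>quotient_module M N\<^esub> = N"
  by (simp add: quotient_module_def)

lemma quotient_component: "component (quotient_module M N) i = (\<lambda>x. N +>\<^bsub>M\<^esub> x) ` component M i"
  by (simp add: quotient_module_def)

lemma quotient_is_module:
  assumes N: "graded_sub N" shows "Module.module (poly_ring n) (quotient_module M N)"
proof (rule moduleI)
  let ?Q = "quotient_module M N"
  note simps = quotient_add[OF N] quotient_smult[OF N]
  show "cring (poly_ring n :: 'k mpol ring)" by (rule cring_poly_ring)
  show "abelian_group ?Q"
  proof (rule abelian_groupI)
    show "\<zero>\<^bsub>?Q\<^esub> \<in> carrier ?Q" using coset_zero[OF N] coset_closed[of \<zero> N] by (simp add: quotient_zero)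
    fix A assume "A \<in> carrier ?Q"
    then obtain x where x: "x \<in> carrier M" "A = N +>\<^bsub>M\<^esub> x" by (auto simp: quotient_carrier)
    show "\<zero>\<^bsub>?Q\<^esub> \<oplus>\<^bsub>?Q\<^esub> A = A" using x simps(1)[of \<zero> x] by (simp add: quotient_zero coset_zero[OF N])
    show "\<exists>B\<in>carrier ?Q. B \<oplus>\<^bsub>?Q\<^esub> A = \<zero>\<^bsub>?Q\<^esub>"
      using x simps(1)[of "\<ominus> x" x] by (intro bexI[of _ "N +>\<^bsub>M\<^esub> (\<ominus> x)"]) (auto simp: quotient_zero coset_zero[OF N] l_neg)
    fix B assume "B \<in> carrier ?Q"
    then obtain y where y: "y \<in> carrier M" "B = N +>\<^bsub>M\<^esub> y" by (auto simp: quotient_carrier)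
    show "A \<oplus>\<^bsub>?Q\<^esub> B \<in> carrier ?Q" using x y simps(1)[of x y] by simp
    show "A \<oplus>\<^bsub>?Q\<^esub> B = B \<oplus>\<^bsub>?Q\<^esub> A" using x y simps(1)[of x y] simps(1)[of y x] a_comm[of x y] by simp
    fix C assume "C \<in> carrier ?Q"
    then obtain z where z: "z \<in> carrier M" "C = N +>\<^bsub>M\<^esub> z" by (auto simp: quotient_carrier)
    show "A \<oplus>\<^bsub>?Q\<^esub> B \<oplus>\<^bsub>?Q\<^esub> C = A \<oplus>\<^bsub>?Q\<^esub> (B \<oplus>\<^bsub>?Q\<^esub> C)"
      using x y z simps(1) by (simp add: a_assoc)
  qed
  fix a :: "'k mpol" and A assume a: "a \<in> Rn n" and "A \<in> carrier ?Q"
  then obtain x where x: "x \<in> carrier M" "A = N +>\<^bsub>M\<^esub> x" by (auto simp: quotient_carrier)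
  show "a \<odot>\<^bsub>?Q\<^esub> A \<in> carrier ?Q" using x a simps(2)[of x a] by simp
  fix b :: "'k mpol" assume b: "b \<in> Rn n"
  show "(a \<oplus>\<^bsub>poly_ring n\<^esub> b) \<odot>\<^bsub>?Q\<^esub> A = (a \<odot>\<^bsub>?Q\<^esub> A) \<oplus>\<^bsub>?Q\<^esub> (b \<odot>\<^bsub>?Q\<^esub> A)"
    using x a b by (simp add: simps smult_add)
  show "(a \<otimes>\<^bsub>poly_ring n\<^esub> b) \<odot>\<^bsub>?Q\<^esub> A = a \<odot>\<^bsub>?Q\<^esub> (b \<odot>\<^bsub>?Q\<^esub> A)"
    using x a b by (simp add: simps smult_mult)
next
  let ?Q = "quotient_module M N"
  note simps = quotient_add[OF N] quotient_smult[OF N]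
  fix A assume "A \<in> carrier ?Q"
  then obtain x where x: "x \<in> carrier M" "A = N +>\<^bsub>M\<^esub> x" by (auto simp: quotient_carrier)
  show "\<one>\<^bsub>poly_ring n\<^esub> \<odot>\<^bsub>?Q\<^esub> A = A" using x by (simp add: simps)
  fix a :: "'k mpol" and B assume a: "a \<in> Rn n" and "B \<in> carrier ?Q"
  then obtain y where y: "y \<in> carrier M" "B = N +>\<^bsub>M\<^esub> y" by (auto simp: quotient_carrier)
  show "a \<odot>\<^bsub>?Q\<^esub> (A \<oplus>\<^bsub>?Q\<^esub> B) = (a \<odot>\<^bsub>?Q\<^esub> A) \<oplus>\<^bsub>?Q\<^esub> (a \<odot>\<^bsub>?Q\<^esub> B)"
    using x y a by (simp add: simps smult_r_distr)
qed

lemma coset_eq_zero_iff: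
  "graded_sub N \<Longrightarrow> x \<in> carrier M \<Longrightarrow> N +>\<^bsub>M\<^esub> x = \<zero>\<^bsub>quotient_module M N\<^esub> \<longleftrightarrow> x \<in> N"
  using coset_eq_iff[of N x \<zero>] by (simp add: quotient_zero coset_zero minus_zero_right)

lemma quotient_finsum:
  assumes N: "graded_sub N" and g: "finite A" "\<And>a. a \<in> A \<Longrightarrow> g a \<in> carrier M"
  shows "(\<Oplus>\<^bsub>quotient_module M N\<^esub>a\<in>A. N +>\<^bsub>M\<^esub> g a) = N +>\<^bsub>M\<^esub> (\<Oplus>a\<in>A. g a)"
proof -
  interpret Q: Module.module "poly_ring n" "quotient_module M N" by (rule quotient_is_module[OF N])
  show ?thesis using g
  proof (induction A)
    case empty
    thus ?case by (simp add: coset_zero[OF N] quotient_zero)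
  next
    case (insert a A)
    have "g \<in> A \<rightarrow> carrier M" "(\<lambda>a. N +>\<^bsub>M\<^esub> g a) \<in> A \<rightarrow> carrier (quotient_module M N)" using insert.prems by auto
    thus ?case using insert by (simp add: finsum_insert Q.finsum_insert quotient_add[OF N] finsum_closed)
  qed
qed

text \<open>Existence projects the decomposition in \<open>M\<close>. For uniqueness the components
  are lifted to \<open>M\<close>; the sum of the lifts differs from \<open>x\<close> by an element
  of \<open>N\<close>, all of whose components lie in \<open>N\<close> because \<open>N\<close> is
  homogeneous.\<close>

lemma quotient_graded:
  assumes N: "graded_sub N" shows "graded_poly_module n (quotient_module M N)"
proof -
  let ?Q = "quotient_module M N"
  interpret Q: Module.module "poly_ring n" ?Q by (rule quotient_is_module[OF N])
  have neg: "\<ominus>\<^bsub>?Q\<^esub> (N +>\<^bsub>M\<^esub> x) = N +>\<^bsub>M\<^esub> (\<ominus> x)" if "x \<in> carrier M" for x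
    using that quotient_add[OF N, of "\<ominus> x" x] by (intro Q.minus_equality) (auto simp: l_neg coset_eq_zero_iff[OF N] graded_subD(2)[OF N])
  show ?thesis
  proof (intro graded_poly_module.intro graded_poly_module_axioms.intro)
    show "Module.module (poly_ring n) ?Q" by (rule Q.module_axioms)
    show "additive_subgroup (component ?Q i) ?Q" for i
    proof (intro additive_subgroup.intro subgroup.intro)
      show "component ?Q i \<subseteq> carrier (add_monoid ?Q)" by (auto simp: quotient_component)
      show "\<one>\<^bsub>add_monoid ?Q\<^esub> \<in> component ?Q i"
        using coset_zero[OF N] by (auto simp: quotient_component quotient_zero intro!: image_eqI[of _ _ \<zero>])
      fix A assume "A \<in> component ?Q i"
      then obtain x where x: "x \<in> component M i" "A = N +>\<^bsub>M\<^esub> x" by (auto simp: quotient_component)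
      hence "\<ominus>\<^bsub>?Q\<^esub> A \<in> component ?Q i" using neg[of x] by (auto simp: quotient_component)
      thus "inv\<^bsub>add_monoid ?Q\<^esub> A \<in> component ?Q i" by (simp add: a_inv_def)
      fix B assume "B \<in> component ?Q i"
      then obtain y where y: "y \<in> component M i" "B = N +>\<^bsub>M\<^esub> y" by (auto simp: quotient_component)
      show "A \<otimes>\<^bsub>add_monoid ?Q\<^esub> B \<in> component ?Q i" using x y by (auto simp: quotient_component quotient_add[OF N])
    qed
    show "p \<odot>\<^bsub>?Q\<^esub> A \<in> component ?Q (i + int D)" if "p \<in> homogeneous_polys n D" "A \<in> component ?Q i" for p D A i
      using that smult_component[OF that(1)] by (auto simp: quotient_component quotient_smult[OF N] Hom_Rn)
    fix A assume "A \<in> carrier ?Q"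
    then obtain x where x: "x \<in> carrier M" "A = N +>\<^bsub>M\<^esub> x" by (auto simp: quotient_carrier)
    let ?P = "\<lambda>f. (\<forall>i. f i \<in> component ?Q i) \<and> finite {i. f i \<noteq> \<zero>\<^bsub>?Q\<^esub>} \<and> A = (\<Oplus>\<^bsub>?Q\<^esub>i\<in>{i. f i \<noteq> \<zero>\<^bsub>?Q\<^esub>}. f i)"
    show "\<exists>!f. ?P f"
    proof (rule ex1I[of _ "\<lambda>i. N +>\<^bsub>M\<^esub> proj x i"])
      let ?f = "\<lambda>i. N +>\<^bsub>M\<^esub> proj x i"
      have sub: "{i. ?f i \<noteq> \<zero>\<^bsub>?Q\<^esub>} \<subseteq> {i. proj x i \<noteq> \<zero>}"
        using coset_zero[OF N] quotient_zero[of N] by force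
      have "A = N +>\<^bsub>M\<^esub> (\<Oplus>i\<in>{i. proj x i \<noteq> \<zero>}. proj x i)" using x(2) proj_sum[OF x(1)] by simp
      also have "\<dots> = (\<Oplus>\<^bsub>?Q\<^esub>i\<in>{i. proj x i \<noteq> \<zero>}. ?f i)"
        by (rule quotient_finsum[OF N, symmetric]) (use x proj_finite in auto)
      also have "\<dots> = (\<Oplus>\<^bsub>?Q\<^esub>i\<in>{i. ?f i \<noteq> \<zero>\<^bsub>?Q\<^esub>}. ?f i)"
        by (rule Q.add.finprod_mono_neutral_cong_left[symmetric, simplified]) (use sub x proj_finite in auto)
      finally show "?P ?f"
        using x finite_subset[OF sub proj_finite[OF x(1)]] by (auto simp: quotient_component)
    next
      fix f assume f: "?P f"
      \<comment> \<open>Zero components are lifted to zero, so that the lifts have finite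
        support.\<close>
      have "\<forall>i. \<exists>y. y \<in> component M i \<and> f i = N +>\<^bsub>M\<^esub> y \<and> (f i = \<zero>\<^bsub>?Q\<^esub> \<longrightarrow> y = \<zero>)"
      proof
        fix i
        obtain y where "y \<in> component M i" "f i = N +>\<^bsub>M\<^esub> y" using f by (auto simp: quotient_component)
        thus "\<exists>y. y \<in> component M i \<and> f i = N +>\<^bsub>M\<^esub> y \<and> (f i = \<zero>\<^bsub>?Q\<^esub> \<longrightarrow> y = \<zero>)"
          using coset_zero[OF N] by (cases "f i = \<zero>\<^bsub>?Q\<^esub>") (auto simp: quotient_zero intro: exI[of _ \<zero>])
      qed
      then obtain y where y: "\<And>i. y i \<in> component M i" "\<And>i. f i = N +>\<^bsub>M\<^esub> y i" "\<And>i. f i = \<zero>\<^bsub>?Q\<^esub> \<Longrightarrow> y i = \<zero>"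
        by metis
      let ?S = "{i. f i \<noteq> \<zero>\<^bsub>?Q\<^esub>}"
      let ?s = "\<Oplus>i\<in>?S. y i"
      have yc: "y i \<in> carrier M" for i using comp_carrier[OF y(1)] .
      have sc: "?s \<in> carrier M" by (rule finsum_closed) (use yc in auto)
      have "A = (\<Oplus>\<^bsub>?Q\<^esub>i\<in>?S. N +>\<^bsub>M\<^esub> y i)" using f y(2) by simp
      also have "\<dots> = N +>\<^bsub>M\<^esub> ?s" by (rule quotient_finsum[OF N]) (use f yc in auto)
      finally have "?s \<ominus> x \<in> N" using x sc coset_eq_iff[OF N, of ?s x] by simp
      have ps: "proj ?s = y" by (rule proj_unique[of _ _ ?S]) (use f y sc in auto)
      have "y i \<ominus> proj x i \<in> N" for i
      proof -
        have "proj (?s \<ominus> x) i \<in> N" using \<open>?s \<ominus> x \<in> N\<close> graded_subD(5)[OF N] by blast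
        thus ?thesis using sc x ps by (simp add: a_minus_def proj_add proj_neg)
      qed
      hence "f i = N +>\<^bsub>M\<^esub> proj x i" for i
        using y(2)[of i] coset_eq_iff[OF N yc[of i] proj_carrier[OF x(1)], of i] by simp
      thus "f = (\<lambda>i. N +>\<^bsub>M\<^esub> proj x i)" by blast
    qed
  qed
qed

text \<open>The elements whose coset lies in the span of the images of the generators form a
  submodule of \<open>M\<close> containing the generators.\<close>

lemma quotient_fg:
  assumes N: "graded_sub N" and fg: "finitely_generated n M"
  shows "finitely_generated n (quotient_module M N)"
proof -
  let ?Q = "quotient_module M N"
  interpret Q: graded_poly_module n ?Q by (rule quotient_graded[OF N])
  obtain S where S: "finite S" "S \<subseteq> carrier M" "span S = carrier M" using fg by (auto simp: finitely_generated_def)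
  let ?S = "(\<lambda>x. N +>\<^bsub>M\<^esub> x) ` S"
  have Sc: "?S \<subseteq> carrier ?Q" using S by auto
  have sub: "submodule (poly_ring n) (Q.span ?S) ?Q" by (rule Q.span_is_submodule[OF Sc])
  interpret s: submodule "poly_ring n" "Q.span ?S" ?Q by (rule sub)
  let ?W = "{x \<in> carrier M. N +>\<^bsub>M\<^esub> x \<in> Q.span ?S}"
  have "submodule (poly_ring n) ?W M"
    unfolding submodule_def
    using module_axioms s.m_closed s.smult_closed s.zero_closed
    by (auto simp: quotient_add[OF N, symmetric] quotient_smult[OF N, symmetric] coset_zero[OF N] quotient_zero)
  moreover have "S \<subseteq> ?W"
  proof
    fix x assume x: "x \<in> S"
    have "Q.lincomb (\<lambda>_. 1) {N +>\<^bsub>M\<^esub> x} = N +>\<^bsub>M\<^esub> x"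
      unfolding Q.lincomb_def using x S by (auto simp: Q.finsum_insert)
    hence "N +>\<^bsub>M\<^esub> x \<in> Q.span ?S"
      unfolding Q.span_def using x by (intro CollectI exI[of _ "\<lambda>_. 1"] exI[of _ "{N +>\<^bsub>M\<^esub> x}"]) auto
    thus "x \<in> ?W" using x S by auto
  qed
  ultimately have "carrier M \<subseteq> ?W" using span_is_subset[of S ?W] S by auto
  hence "carrier ?Q \<subseteq> Q.span ?S" by (auto simp: quotient_carrier)
  moreover have "Q.span ?S \<subseteq> carrier ?Q" by (rule Q.span_is_subset2[OF Sc])
  ultimately have "Q.span ?S = carrier ?Q" by blast
  thus ?thesis unfolding finitely_generated_def using S(1) Sc by (intro exI[of _ ?S]) auto
qed

section \<open>Submodules generated by multiples of homogeneous polynomials\<close>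

lemma proj_smult_mem:
  assumes x: "x \<in> carrier M" and p: "p \<in> Rn n"
    and N: "\<zero> \<in> N" "\<And>y z. y \<in> N \<Longrightarrow> z \<in> N \<Longrightarrow> y \<oplus> z \<in> N" "\<And>p y. p \<in> Rn n \<Longrightarrow> y \<in> N \<Longrightarrow> p \<odot> y \<in> N"
    and px: "\<And>i. proj x i \<in> N" and Nc: "N \<subseteq> carrier M"
  shows "proj (p \<odot> x) i \<in> N"
proof -
  let ?f = "\<lambda>m. Poly_Mapping.single m (Poly_Mapping.lookup p m)"
  have k: "Poly_Mapping.keys m \<subseteq> {1..n}" if "m \<in> Poly_Mapping.keys p" for m
    using p that by (auto simp: mem_Rn)
  have kR: "?f m \<in> Rn n" if "m \<in> Poly_Mapping.keys p" for m by (rule Rn_single[OF k[OF that]])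
  have "p \<odot> x = (\<Sum>m\<in>Poly_Mapping.keys p. ?f m) \<odot> x" by (subst poly_eq_sum_monomials[of p]) simp
  also have "\<dots> = (\<Oplus>m\<in>Poly_Mapping.keys p. ?f m \<odot> x)" by (rule smult_sum) (use kR x in auto)
  also have "proj \<dots> i = (\<Oplus>m\<in>Poly_Mapping.keys p. proj (?f m \<odot> x) i)" by (rule proj_finsum) (use kR x in auto)
  also have "\<dots> \<in> N"
  proof -
    have fN: "proj (?f m \<odot> x) i \<in> N" if "m \<in> Poly_Mapping.keys p" for m
      using proj_smult[OF x Hom_single[OF k[OF that]]] N(3)[OF kR[OF that] px] by simp
    have "finsum M (\<lambda>m. proj (?f m \<odot> x) i) A \<in> N" if "finite A" "A \<subseteq> Poly_Mapping.keys p" for A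
      using that
    proof (induction A)
      case (insert a A)
      have "(\<lambda>m. proj (?f m \<odot> x) i) \<in> A \<rightarrow> carrier M" "proj (?f a \<odot> x) i \<in> carrier M"
        using insert.prems Nc fN by blast+
      thus ?case using insert N fN by (simp add: finsum_insert)
    qed (use N in auto)
    thus ?thesis by simp
  qed
  finally show ?thesis .
qed

text \<open>For minimality: the scalars that map \<open>M\<close> into \<open>W\<close> form an
  ideal containing \<open>S\<close>, hence contain the ideal generated by \<open>S\<close>.
  Homogeneity is minimality applied to the elements all of whose components lie in the
  submodule.\<close>

lemma ideal_times_module_props:
  assumes S: "\<And>s. s \<in> S \<Longrightarrow> \<exists>D. s \<in> Hom n D"
  shows ideal_times_graded: "graded_sub (ideal_times_module n S M)"
    and ideal_times_mem: "s \<in> S \<Longrightarrow> x \<in> carrier M \<Longrightarrow> s \<odot> x \<in> ideal_times_module n S M"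
    and ideal_times_least: "W \<subseteq> carrier M \<Longrightarrow> \<zero> \<in> W \<Longrightarrow> (\<And>x y. x \<in> W \<Longrightarrow> y \<in> W \<Longrightarrow> x \<oplus> y \<in> W) \<Longrightarrow>
      (\<And>p x. p \<in> Rn n \<Longrightarrow> x \<in> W \<Longrightarrow> p \<odot> x \<in> W) \<Longrightarrow> (\<And>s x. s \<in> S \<Longrightarrow> x \<in> carrier M \<Longrightarrow> s \<odot> x \<in> W)
      \<Longrightarrow> ideal_times_module n S M \<subseteq> W"
proof -
  have SR: "S \<subseteq> Rn n" using S Hom_Rn by blast
  let ?G = "{a \<odot> x | a x. a \<in> genideal (poly_ring n) S \<and> x \<in> carrier M}"
  have Id: "ideal (genideal (poly_ring n) S) (poly_ring n)" by (rule genideal_ideal) (use SR in auto)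
  have IdR: "genideal (poly_ring n) S \<subseteq> Rn n"
    using additive_subgroup.a_subset[OF ideal.axioms(1)[OF Id]] .
  have Gc: "?G \<subseteq> carrier M" using IdR by auto
  let ?N = "ideal_times_module n S M"
  have Ndef: "?N = span ?G" by (simp add: ideal_times_module_def)
  interpret N: submodule "poly_ring n" ?N M unfolding Ndef by (rule span_is_submodule[OF Gc])
  have GN: "y \<in> ?N" if y: "y \<in> ?G" for y
  proof -
    have yc: "y \<in> carrier M" using y Gc by blast
    have "lincomb (\<lambda>_. 1) {y} = y" unfolding lincomb_def using yc by simp
    thus ?thesis unfolding Ndef span_def using y by (intro CollectI exI[of _ "\<lambda>_. 1"] exI[of _ "{y}"]) auto
  qed
  show mem: "s \<odot> x \<in> ?N" if "s \<in> S" "x \<in> carrier M" for s x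
    by (rule GN) (use that genideal_self[of S] SR in auto)
  show least: "?N \<subseteq> W" if W: "W \<subseteq> carrier M" "\<zero> \<in> W" "\<And>x y. x \<in> W \<Longrightarrow> y \<in> W \<Longrightarrow> x \<oplus> y \<in> W"
    "\<And>p x. p \<in> Rn n \<Longrightarrow> x \<in> W \<Longrightarrow> p \<odot> x \<in> W" "\<And>s x. s \<in> S \<Longrightarrow> x \<in> carrier M \<Longrightarrow> s \<odot> x \<in> W" for W
  proof -
    have subW: "submodule (poly_ring n) W M"
      unfolding submodule_def using module_axioms W(1-4) by auto
    let ?J = "{a \<in> Rn n. \<forall>x\<in>carrier M. a \<odot> x \<in> W}"
    have "ideal ?J (poly_ring n)"
    proof (rule idealI)
      show "ring (poly_ring n :: 'k mpol ring)" by (rule R.ring_axioms)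
      show "subgroup ?J (add_monoid (poly_ring n))"
      proof (rule subgroup.intro)
        fix a assume a: "a \<in> ?J"
        have "\<ominus>\<^bsub>poly_ring n\<^esub> a \<in> ?J"
        proof -
          have "(- a) \<odot> x = (- 1) \<odot> (a \<odot> x)" if "x \<in> carrier M" for x
            using a that by (simp add: smult_mult[symmetric])
          thus ?thesis using a W(4)[of "- 1"] by auto
        qed
        thus "inv\<^bsub>add_monoid (poly_ring n)\<^esub> a \<in> ?J" by (simp add: a_inv_def)
      qed (use W in \<open>auto simp: smult_add\<close>)
    qed (use W in \<open>auto simp: smult_mult\<close>)
    hence "genideal (poly_ring n) S \<subseteq> ?J" by (rule R.genideal_minimal) (use W SR in auto)
    hence "?G \<subseteq> W" by auto
    thus ?thesis unfolding Ndef by (rule span_is_subset[OF _ subW])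
  qed
  have "?N \<subseteq> {x \<in> ?N. \<forall>i. proj x i \<in> ?N}"
  proof (rule least)
    show "{x \<in> ?N. \<forall>i. proj x i \<in> ?N} \<subseteq> carrier M" using N.subset by auto
    show "x \<oplus> y \<in> {x \<in> ?N. \<forall>i. proj x i \<in> ?N}"
      if "x \<in> {x \<in> ?N. \<forall>i. proj x i \<in> ?N}" "y \<in> {x \<in> ?N. \<forall>i. proj x i \<in> ?N}" for x y
    proof -
      have "x \<in> carrier M" "y \<in> carrier M" using that N.subset by auto
      thus ?thesis using that by (auto simp: proj_add)
    qed
    show "p \<odot> x \<in> {x \<in> ?N. \<forall>i. proj x i \<in> ?N}" if p: "p \<in> Rn n" and x: "x \<in> {x \<in> ?N. \<forall>i. proj x i \<in> ?N}" for p x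
    proof -
      have "x \<in> carrier M" using x N.subset by auto
      hence "proj (p \<odot> x) i \<in> ?N" for i
        by (rule proj_smult_mem) (use p x N.subset N.m_closed N.smult_closed in auto)
      thus ?thesis using p x by auto
    qed
    show "s \<odot> x \<in> {x \<in> ?N. \<forall>i. proj x i \<in> ?N}" if s: "s \<in> S" and x: "x \<in> carrier M" for s x
    proof -
      obtain D where "s \<in> Hom n D" using S[OF s] by blast
      thus ?thesis using proj_smult[OF x] mem[OF s] x by auto
    qed
  qed auto
  thus "graded_sub ?N" unfolding graded_sub_def using N.subset by auto
qed

lemma ideal_times_empty: "ideal_times_module n {} M = {\<zero>}"
proof -
  have "ideal_times_module n {} M \<subseteq> {\<zero>}" by (rule ideal_times_least) auto
  thus ?thesis using graded_subD(2)[OF ideal_times_graded[of "{}"]] by auto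
qed

text \<open>This identifies each quotient along the sequence with the previous one modulo the next
  \<open>l\<close>.\<close>

lemma ideal_times_insert:
  assumes S: "\<And>s. s \<in> S \<Longrightarrow> \<exists>D. s \<in> Hom n D" and p: "p \<in> Hom n D"
  shows "ideal_times_module n (insert p S) M = {u \<oplus> p \<odot> y | u y. u \<in> ideal_times_module n S M \<and> y \<in> carrier M}"
    (is "?N' = ?W")
proof
  have pR: "p \<in> Rn n" using p by (rule Hom_Rn)
  have S': "\<And>s. s \<in> insert p S \<Longrightarrow> \<exists>D. s \<in> Hom n D" using S p by auto
  have gN: "graded_sub (ideal_times_module n S M)" by (rule ideal_times_graded[OF S])
  have gN': "graded_sub ?N'" by (rule ideal_times_graded[OF S'])
  note NC = graded_subD[OF gN]
  show "?N' \<subseteq> ?W"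
  proof (rule ideal_times_least[OF S'])
    show "?W \<subseteq> carrier M" using NC(1) pR by auto
    have "\<zero> = \<zero> \<oplus> p \<odot> \<zero>" using pR by simp
    thus "\<zero> \<in> ?W" using NC(2) by blast
    show "x \<oplus> y \<in> ?W" if "x \<in> ?W" "y \<in> ?W" for x y
    proof -
      obtain u v a b where e: "x = u \<oplus> p \<odot> a" "y = v \<oplus> p \<odot> b" "u \<in> ideal_times_module n S M" "v \<in> ideal_times_module n S M"
        "a \<in> carrier M" "b \<in> carrier M" using \<open>x \<in> ?W\<close> \<open>y \<in> ?W\<close> by auto
      have "u \<in> carrier M" "v \<in> carrier M" using NC(1) e by auto
      hence "x \<oplus> y = (u \<oplus> v) \<oplus> p \<odot> (a \<oplus> b)" using e pR by (simp add: smult_r_distr a_ac)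
      moreover have "u \<oplus> v \<in> ideal_times_module n S M" using NC(3) e by blast
      ultimately show ?thesis using e by blast
    qed
    show "q \<odot> x \<in> ?W" if q: "q \<in> Rn n" and "x \<in> ?W" for q x
    proof -
      obtain u a where e: "x = u \<oplus> p \<odot> a" "u \<in> ideal_times_module n S M" "a \<in> carrier M" using \<open>x \<in> ?W\<close> by auto
      have "u \<in> carrier M" using NC(1) e by auto
      hence "q \<odot> x = q \<odot> u \<oplus> p \<odot> (q \<odot> a)" using e pR q by (simp add: smult_r_distr smult_comm[of q p])
      moreover have "q \<odot> u \<in> ideal_times_module n S M" using NC(4) q e by blast
      ultimately show ?thesis using e q by blast
    qed
    show "s \<odot> x \<in> ?W" if s: "s \<in> insert p S" and x: "x \<in> carrier M" for s x
    proof (cases "s = p")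
      case True
      have "s \<odot> x = \<zero> \<oplus> p \<odot> x" using True x pR by simp
      thus ?thesis using NC(2) x by blast
    next
      case False
      hence sN: "s \<odot> x \<in> ideal_times_module n S M" using ideal_times_mem[OF S] s x by auto
      hence "s \<odot> x = s \<odot> x \<oplus> p \<odot> \<zero>" using pR NC(1)[OF sN] by simp
      thus ?thesis using sN by blast
    qed
  qed
  have mem': "s \<odot> x \<in> ?N'" if "s \<in> insert p S" "x \<in> carrier M" for s x
    by (rule ideal_times_mem[OF S' that])
  have "ideal_times_module n S M \<subseteq> ?N'"
    by (rule ideal_times_least[OF S]) (use graded_subD[OF gN'] mem' in auto)
  thus "?W \<subseteq> ?N'" using graded_subD(3)[OF gN'] mem'[of p] by auto
qed

text \<open>Successive quotients are formed from \<open>M\<close> by growing submodules instead of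
  by iterating the quotient construction. They share one type, as induction along the sequence
  demands; the price is this map, which sends a coset to the union of the larger cosets of its
  elements.\<close>

lemma graded_quotient_map_cosets:
  assumes N: "graded_sub N" and N': "graded_sub N'" and l: "l \<in> Hom n D"
    and NN': "N' = {u \<oplus> l \<odot> y | u y. u \<in> N \<and> y \<in> carrier M}"
  shows "graded_quotient_map n (quotient_module M N) (quotient_module M N') (\<lambda>A. \<Union>x\<in>A. N' +>\<^bsub>M\<^esub> x) l D"
proof -
  interpret Q: graded_poly_module n "quotient_module M N" by (rule quotient_graded[OF N])
  interpret Q': graded_poly_module n "quotient_module M N'" by (rule quotient_graded[OF N'])
  have lR: "l \<in> Rn n" using l by (rule Hom_Rn)
  have sub: "N \<subseteq> N'"
  proof
    fix u assume u: "u \<in> N"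
    hence "u = u \<oplus> l \<odot> \<zero>" using lR graded_subD(1)[OF N] by simp
    thus "u \<in> N'" unfolding NN' using u by blast
  qed
  have pi: "(\<Union>y\<in>N +>\<^bsub>M\<^esub> x. N' +>\<^bsub>M\<^esub> y) = N' +>\<^bsub>M\<^esub> x" if x: "x \<in> carrier M" for x
    by (rule coset_UN[OF N x]) (use x sub in \<open>auto simp: coset_eq_iff[OF N']\<close>)
  show ?thesis
  proof (unfold_locales)
    fix A assume "A \<in> carrier (quotient_module M N)"
    then obtain x where x: "x \<in> carrier M" "A = N +>\<^bsub>M\<^esub> x" by (auto simp: quotient_carrier)
    show "(\<Union>x\<in>A. N' +>\<^bsub>M\<^esub> x) \<in> carrier (quotient_module M N')" using x pi by simp
    have "(\<Union>x\<in>A. N' +>\<^bsub>M\<^esub> x) = \<zero>\<^bsub>quotient_module M N'\<^esub> \<longleftrightarrow> x \<in> N'"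
      using x pi coset_eq_zero_iff[OF N' x(1)] by simp
    also have "\<dots> \<longleftrightarrow> (\<exists>y\<in>carrier M. x \<ominus> l \<odot> y \<in> N)"
    proof
      assume "x \<in> N'"
      then obtain u y where uy: "u \<in> N" "y \<in> carrier M" "x = u \<oplus> l \<odot> y" unfolding NN' by blast
      hence "x \<ominus> l \<odot> y = u" using lR graded_subD(1)[OF N] by (simp add: a_minus_def a_assoc r_neg)
      thus "\<exists>y\<in>carrier M. x \<ominus> l \<odot> y \<in> N" using uy by (intro bexI[of _ y]) auto
    next
      assume "\<exists>y\<in>carrier M. x \<ominus> l \<odot> y \<in> N"
      then obtain y where y: "y \<in> carrier M" "x \<ominus> l \<odot> y \<in> N" by blast
      have "x = (x \<ominus> l \<odot> y) \<oplus> l \<odot> y" using x y lR by (simp add: a_minus_def a_assoc l_neg)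
      thus "x \<in> N'" unfolding NN' using y by blast
    qed
    also have "\<dots> \<longleftrightarrow> (\<exists>y\<in>carrier M. A = l \<odot>\<^bsub>quotient_module M N\<^esub> (N +>\<^bsub>M\<^esub> y))"
      using x lR by (auto simp: quotient_smult[OF N] coset_eq_iff[OF N])
    also have "\<dots> \<longleftrightarrow> (\<exists>B\<in>carrier (quotient_module M N). A = l \<odot>\<^bsub>quotient_module M N\<^esub> B)"
      unfolding Bex_def quotient_carrier by blast
    finally show "(\<Union>x\<in>A. N' +>\<^bsub>M\<^esub> x) = \<zero>\<^bsub>quotient_module M N'\<^esub> \<longleftrightarrow> (\<exists>B\<in>carrier (quotient_module M N). A = l \<odot>\<^bsub>quotient_module M N\<^esub> B)" .
    show "(\<Union>x\<in>p \<odot>\<^bsub>quotient_module M N\<^esub> A. N' +>\<^bsub>M\<^esub> x) = p \<odot>\<^bsub>quotient_module M N'\<^esub> (\<Union>x\<in>A. N' +>\<^bsub>M\<^esub> x)" if "p \<in> Rn n" for p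
      using that x pi by (simp add: quotient_smult[OF N] quotient_smult[OF N'])
    fix B assume "B \<in> carrier (quotient_module M N)"
    then obtain y where y: "y \<in> carrier M" "B = N +>\<^bsub>M\<^esub> y" by (auto simp: quotient_carrier)
    show "(\<Union>x\<in>A \<oplus>\<^bsub>quotient_module M N\<^esub> B. N' +>\<^bsub>M\<^esub> x) = (\<Union>x\<in>A. N' +>\<^bsub>M\<^esub> x) \<oplus>\<^bsub>quotient_module M N'\<^esub> (\<Union>x\<in>B. N' +>\<^bsub>M\<^esub> x)"
      using x y pi by (simp add: quotient_add[OF N] quotient_add[OF N'])
  next
    show "(\<Union>x\<in>A. N' +>\<^bsub>M\<^esub> x) \<in> component (quotient_module M N') j" if "A \<in> component (quotient_module M N) j" for A j
      using that pi by (auto simp: quotient_component)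
    show "\<exists>A\<in>component (quotient_module M N) j. (\<Union>x\<in>A. N' +>\<^bsub>M\<^esub> x) = B" if "B \<in> component (quotient_module M N') j" for B j
      using that pi by (auto simp: quotient_component)
  qed (rule l)
qed

end

section \<open>Hilbert functions\<close>

text \<open>The explicit description of the chosen indices matters more than the existence of a
  basis: it is what later makes the standard monomials closed under divisors.\<close>

lemma (in vectorspace) greedy_basis:
  fixes v :: "'z::linorder \<Rightarrow> 'c"
  assumes "finite A" "v ` A \<subseteq> carrier V"
  defines "S \<equiv> {a \<in> A. v a \<notin> span (v ` {b \<in> A. b < a})}"
  shows "inj_on v S \<and> lin_indpt (v ` S) \<and> span (v ` S) = span (v ` A)"
  using assms(1,2) unfolding S_def
proof (induction A rule: finite_linorder_max_induct)
  case empty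
  show ?case using finite_lin_indpt2[of "{}"] by simp
next
  case (insert b A)
  let ?S = "{a \<in> A. v a \<notin> span (v ` {b \<in> A. b < a})}"
  have vA: "v ` A \<subseteq> carrier V" and vb: "v b \<in> carrier V" using insert.prems by auto
  have IH: "inj_on v ?S" "lin_indpt (v ` ?S)" "span (v ` ?S) = span (v ` A)" using insert.IH[OF vA] by auto
  have vS: "v ` ?S \<subseteq> carrier V" using vA by auto
  have b: "b \<notin> A" using insert.hyps by auto
  have below_b: "{c \<in> insert b A. c < b} = A" using insert.hyps by auto
  have below: "{c \<in> insert b A. c < a} = {c \<in> A. c < a}" if "a \<in> A" for a
    using insert.hyps that by auto
  have S': "{a \<in> insert b A. v a \<notin> span (v ` {c \<in> insert b A. c < a})} =
      (if v b \<in> span (v ` A) then ?S else insert b ?S)"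
  proof -
    have "{a \<in> insert b A. v a \<notin> span (v ` {c \<in> insert b A. c < a})}
      = {a. a = b \<and> v b \<notin> span (v ` {c \<in> insert b A. c < b})} \<union> {a \<in> A. v a \<notin> span (v ` {c \<in> insert b A. c < a})}"
      by auto
    also have "{a \<in> A. v a \<notin> span (v ` {c \<in> insert b A. c < a})} = ?S" using below by auto
    finally show ?thesis unfolding below_b by auto
  qed
  show ?case
  proof (cases "v b \<in> span (v ` A)")
    case True
    have "span (v ` insert b A) = span (v ` A)"
    proof -
      have "v ` insert b A = v ` A \<union> {v b}" by auto
      thus ?thesis using already_in_span[OF vA True] by simp
    qed
    thus ?thesis unfolding S' using IH True by simp
  next
    case False
    hence nb: "v b \<notin> span (v ` ?S)" using IH by simp
    have nbS: "v b \<notin> v ` ?S" using nb span_mem[OF vS] by auto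
    have li: "lin_indpt (v ` ?S \<union> {v b})"
      using lin_dep_iff_in_span[OF vS IH(2) vb nbS] nb by simp
    have "span (v ` ?S \<union> {v b}) = span (v ` A \<union> {v b})"
      by (rule span_Un[OF vS vA IH(3)]) (use vb in auto)
    moreover have "v ` insert b ?S = v ` ?S \<union> {v b}" "v ` insert b A = v ` A \<union> {v b}" by auto
    moreover have "inj_on v (insert b ?S)" using IH(1) nbS b by (auto simp: inj_on_insert)
    ultimately show ?thesis unfolding S' using False li by simp
  qed
qed

section \<open>Graded components as vector spaces over the coefficient field\<close>

context graded_poly_module
begin

lemma coeff_vectorspace: "vectorspace coeff_field M"
proof -
  have "Module.module coeff_field M"
  proof (rule moduleI)
    show "cring (coeff_field :: 'k mpol ring)" using field_coeff_field[where 'k = 'k] by (simp add: field_def domain_def)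
    show "abelian_group M" by (rule M.abelian_group_axioms)
  qed (auto simp: smult_add smult_mult smult_r_distr)
  thus ?thesis using field_coeff_field by (simp add: vectorspace_def)
qed

sublocale K: vectorspace "coeff_field :: 'k mpol ring" M
  by (rule coeff_vectorspace)

definition ksub :: "'m set \<Rightarrow> bool" where
  "ksub W \<longleftrightarrow> W \<subseteq> carrier M \<and> \<zero> \<in> W \<and> (\<forall>x\<in>W. \<forall>y\<in>W. x \<oplus> y \<in> W) \<and>
     (\<forall>c. \<forall>x\<in>W. Poly_Mapping.single 0 c \<odot> x \<in> W)"

lemma ksub_submodule: "ksub W \<Longrightarrow> submodule coeff_field W M"
  unfolding submodule_def using K.module_axioms by (auto simp: ksub_def)

lemma ksub_vectorspace: "ksub W \<Longrightarrow> vectorspace coeff_field (M\<lparr>carrier := W\<rparr>)"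
  using K.subspace_is_vs[of W] ksub_submodule[of W] K.vectorspace_axioms by (simp add: subspace_def)

lemma ksub_component: "ksub (component M j)"
  using smult_comp[OF Hom_const, of _ j j] by (auto simp: ksub_def)

lemma ksub_span: "S \<subseteq> carrier M \<Longrightarrow> ksub (K.span S)"
proof -
  assume "S \<subseteq> carrier M"
  hence s: "submodule coeff_field (K.span S) M" by (rule K.span_is_submodule)
  show ?thesis unfolding ksub_def
    using submodule.subset[OF s] submodule.zero_closed[OF s] submodule.m_closed[OF s] submodule.smult_closed[OF s]
    by auto
qed

lemma span_least: "ksub W \<Longrightarrow> S \<subseteq> W \<Longrightarrow> K.span S \<subseteq> W"
  using K.span_is_subset ksub_submodule by blast

lemma ksub_span_eq: "ksub W \<Longrightarrow> S \<subseteq> W \<Longrightarrow> module.span coeff_field (M\<lparr>carrier := W\<rparr>) S = K.span S"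
  and ksub_lin_dep_eq: "ksub W \<Longrightarrow> S \<subseteq> W \<Longrightarrow> module.lin_dep coeff_field (M\<lparr>carrier := W\<rparr>) S = K.lin_dep S"
  using K.span_li_not_depend[of S W] ksub_submodule by auto

lemma ksub_dim_basis:
  assumes W: "ksub W" and S: "finite S" "S \<subseteq> W" "K.span S = W" "K.lin_indpt S"
  shows "vectorspace.dim coeff_field (M\<lparr>carrier := W\<rparr>) = card S"
proof -
  interpret W: vectorspace coeff_field "M\<lparr>carrier := W\<rparr>" by (rule ksub_vectorspace[OF W])
  have "W.basis S"
    unfolding W.basis_def using S ksub_span_eq[OF W S(2)] ksub_lin_dep_eq[OF W S(2)] by auto
  thus ?thesis using W.dim_basis[OF S(1)] by blast
qed

definition findim :: "'m set \<Rightarrow> bool" where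
  "findim W \<longleftrightarrow> ksub W \<and> (\<exists>S. finite S \<and> S \<subseteq> W \<and> K.span S = W)"

lemma findim_iff: "ksub W \<Longrightarrow> findim W \<longleftrightarrow> vectorspace.fin_dim coeff_field (M\<lparr>carrier := W\<rparr>)"
proof -
  assume W: "ksub W"
  interpret W: vectorspace coeff_field "M\<lparr>carrier := W\<rparr>" by (rule ksub_vectorspace[OF W])
  show ?thesis unfolding findim_def W.fin_dim_def using W ksub_span_eq[OF W] by auto
qed

lemma findim_basis:
  assumes "findim W"
  shows "\<exists>S. finite S \<and> S \<subseteq> W \<and> K.span S = W \<and> K.lin_indpt S \<and> card S = vectorspace.dim coeff_field (M\<lparr>carrier := W\<rparr>)"
proof -
  have W: "ksub W" using assms by (simp add: findim_def)
  interpret W: vectorspace coeff_field "M\<lparr>carrier := W\<rparr>" by (rule ksub_vectorspace[OF W])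
  have "W.fin_dim" using assms findim_iff[OF W] by simp
  then obtain S where S: "finite S" "W.basis S" using W.finite_basis_exists by blast
  hence SW: "S \<subseteq> W" by (simp add: W.basis_def)
  have "K.span S = W" "K.lin_indpt S"
    using S SW ksub_span_eq[OF W SW] ksub_lin_dep_eq[OF W SW] by (auto simp: W.basis_def)
  thus ?thesis using S SW W.dim_basis[OF S] by auto
qed

lemma dim_zero_iff:
  assumes "findim W" shows "vectorspace.dim coeff_field (M\<lparr>carrier := W\<rparr>) = 0 \<longleftrightarrow> W = {\<zero>}"
proof -
  obtain S where S: "finite S" "S \<subseteq> W" "K.span S = W" "K.lin_indpt S" "card S = vectorspace.dim coeff_field (M\<lparr>carrier := W\<rparr>)"
    using findim_basis[OF assms] by blast
  have "(1 :: 'k mpol) \<in> carrier coeff_field" by (auto intro: range_eqI[of _ _ 1])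
  hence "carrier (coeff_field :: 'k mpol ring) \<noteq> {\<zero>\<^bsub>coeff_field\<^esub>}" by (metis coeff_field_simps(3) singletonD zero_neq_one)
  hence "K.lin_dep {\<zero>}" using K.zero_lin_dep[of "{\<zero>}"] by simp
  moreover have "S \<subseteq> {\<zero>}" if "W = {\<zero>}" using S that by auto
  ultimately show ?thesis
    using S K.span_empty by (metis card.empty card_eq_0_iff subset_singletonD)
qed

lemma in_span: "S \<subseteq> carrier M \<Longrightarrow> x \<in> S \<Longrightarrow> x \<in> K.span S"
  by (rule K.span_mem)

text \<open>By induction over terms: a term is a field element times one of the listed products of a
  monomial and a generator.\<close>

lemma component_gens:
  assumes G: "hgens G \<delta>"
  defines "I \<equiv> \<lambda>j. {(g, m). g \<in> G \<and> Poly_Mapping.keys m \<subseteq> {1..n} \<and> \<delta> g + int (monomial_degree m) = j}"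
  shows "finite (I j)" "(\<lambda>(g, m). Poly_Mapping.single m 1 \<odot> g) ` I j \<subseteq> component M j"
    "K.span ((\<lambda>(g, m). Poly_Mapping.single m 1 \<odot> g) ` I j) = component M j"
proof -
  have "I j \<subseteq> (SIGMA g:G. {m. Poly_Mapping.keys m \<subseteq> {1..n} \<and> monomial_degree m = nat (j - \<delta> g)})"
    unfolding I_def by auto
  thus "finite (I j)" using finite_expos_degree[of n] hgens_finite[OF G]
    unfolding expos_def by (simp add: finite_subset)
  let ?v = "\<lambda>(g, m). Poly_Mapping.single m 1 \<odot> g"
  show sub: "?v ` I j \<subseteq> component M j"
    unfolding I_def using smult_comp[OF Hom_single hgens_comp[OF G]] by auto
  have "component M j \<subseteq> K.span (?v ` I j)"
  proof
    fix x assume "x \<in> component M j"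
    have ks: "ksub (K.span (?v ` I j))" by (rule ksub_span) (use sub comp_subset in blast)
    from G \<open>x \<in> component M j\<close> show "x \<in> K.span (?v ` I j)"
    proof (induction rule: comp_induct)
      case (mono m c g)
      have g: "g \<in> carrier M" using hgens_comp[OF G mono(1)] by simp
      have "Poly_Mapping.single m c = Poly_Mapping.single 0 c * Poly_Mapping.single m 1" by (simp add: mult_single)
      hence "Poly_Mapping.single m c \<odot> g = Poly_Mapping.single 0 c \<odot> (Poly_Mapping.single m 1 \<odot> g)"
        using smult_mult[OF Rn_const Rn_single[OF mono(2)] g, of c 1] by simp
      moreover have "?v (g, m) \<in> K.span (?v ` I j)"
        by (rule in_span, use sub comp_subset in blast) (use mono in \<open>auto simp: I_def intro!: image_eqI[of _ _ "(g, m)"]\<close>)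
      ultimately show ?case using ks by (simp add: ksub_def)
    qed (use ks in \<open>auto simp: ksub_def\<close>)
  qed
  moreover have "K.span (?v ` I j) \<subseteq> component M j" by (rule span_least[OF ksub_component sub])
  ultimately show "K.span (?v ` I j) = component M j" by blast
qed

lemma component_findim:
  assumes "finitely_generated n M" shows "findim (component M j)"
proof -
  obtain G \<delta> where G: "hgens G \<delta>" using hgens_exists[OF assms] by blast
  show ?thesis unfolding findim_def using component_gens[OF G, of j] ksub_component finite_imageI by blast
qed

lemma hilbert_zero_iff:
  "finitely_generated n M \<Longrightarrow> hilbert_function M j = 0 \<longleftrightarrow> component M j = {\<zero>}"
  unfolding hilbert_function_def by (rule dim_zero_iff[OF component_findim])

text \<open>Independent subsets of \<open>U\<close> are independent in \<open>W\<close>, so their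
  size is bounded, and a maximal one is a basis.\<close>

lemma findim_subset:
  assumes W: "findim W" and U: "ksub U" "U \<subseteq> W" shows "findim U"
proof -
  have kW: "ksub W" using W by (simp add: findim_def)
  interpret W: vectorspace coeff_field "M\<lparr>carrier := W\<rparr>" by (rule ksub_vectorspace[OF kW])
  interpret U: vectorspace coeff_field "M\<lparr>carrier := U\<rparr>" by (rule ksub_vectorspace[OF U(1)])
  have fd: "W.fin_dim" using W findim_iff[OF kW] by simp
  have b: "finite A \<and> card A \<le> W.dim" if A: "A \<subseteq> carrier (M\<lparr>carrier := U\<rparr>) \<and> U.lin_indpt A" for A
  proof -
    have "W.lin_indpt A" "A \<subseteq> carrier (M\<lparr>carrier := W\<rparr>)"
      using A ksub_lin_dep_eq[OF U(1), of A] ksub_lin_dep_eq[OF kW, of A] U(2) by auto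
    thus ?thesis using W.li_le_dim[OF fd] by blast
  qed
  have "{} \<subseteq> carrier (M\<lparr>carrier := U\<rparr>) \<and> U.lin_indpt {}" using U.finite_lin_indpt2[of "{}"] by simp
  then obtain A where A: "finite A" "maximal A (\<lambda>S. S \<subseteq> carrier (M\<lparr>carrier := U\<rparr>) \<and> U.lin_indpt S)"
    using maximal_exists[of "\<lambda>S. S \<subseteq> carrier (M\<lparr>carrier := U\<rparr>) \<and> U.lin_indpt S" W.dim "{}"] b by blast
  have "U.basis A" by (rule U.max_li_is_basis[OF A(2)])
  hence "U.fin_dim" unfolding U.fin_dim_def U.basis_def using A(1) by auto
  thus ?thesis using findim_iff[OF U(1)] by simp
qed

end

section \<open>Exactness and dimensions\<close>

lemma rank_nullity_graded:
  assumes M: "graded_poly_module n (M :: ('k::field mpol, 'm) graded_module)" and N: "graded_poly_module n (N :: ('k mpol, 'p) graded_module)"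
    and V: "graded_poly_module.findim M V" and W: "graded_poly_module.ksub N W"
    and f: "\<And>x. x \<in> V \<Longrightarrow> f x \<in> W" "\<And>x y. x \<in> V \<Longrightarrow> y \<in> V \<Longrightarrow> f (x \<oplus>\<^bsub>M\<^esub> y) = f x \<oplus>\<^bsub>N\<^esub> f y"
      "\<And>c x. x \<in> V \<Longrightarrow> f (Poly_Mapping.single 0 c \<odot>\<^bsub>M\<^esub> x) = Poly_Mapping.single 0 c \<odot>\<^bsub>N\<^esub> f x"
  shows "vectorspace.dim coeff_field (N\<lparr>carrier := f ` V\<rparr>) + vectorspace.dim coeff_field (M\<lparr>carrier := {x \<in> V. f x = \<zero>\<^bsub>N\<^esub>}\<rparr>)
    = vectorspace.dim coeff_field (M\<lparr>carrier := V\<rparr>)"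
proof -
  interpret M: graded_poly_module n M by (rule M)
  interpret N: graded_poly_module n N by (rule N)
  have kV: "M.ksub V" using V by (simp add: M.findim_def)
  interpret V: vectorspace coeff_field "M\<lparr>carrier := V\<rparr>" by (rule M.ksub_vectorspace[OF kV])
  interpret W: vectorspace coeff_field "N\<lparr>carrier := W\<rparr>" by (rule N.ksub_vectorspace[OF W])
  interpret T: linear_map coeff_field "M\<lparr>carrier := V\<rparr>" "N\<lparr>carrier := W\<rparr>" f
    by (unfold_locales) (use f in \<open>auto simp: module_hom_def\<close>)
  have "V.fin_dim" using V M.findim_iff[OF kV] by simp
  from T.rank_nullity[OF this] show ?thesis by (simp add: T.im_def T.ker_def)
qed

context graded_quotient_map
begin

definition ker_dim :: "int \<Rightarrow> nat" where
  "ker_dim j = vectorspace.dim coeff_field (M\<lparr>carrier := {x \<in> component M j. l \<odot>\<^bsub>M\<^esub> x = \<zero>\<^bsub>M\<^esub>}\<rparr>)"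

lemma ksub_ker: "M.ksub {x \<in> component M j. l \<odot>\<^bsub>M\<^esub> x = \<zero>\<^bsub>M\<^esub>}"
  using M.ksub_component[of j] M.smult_comm[of l "Poly_Mapping.single 0 c" for c]
  by (auto simp: M.ksub_def M.smult_r_distr)

lemma ker_dim_zero_iff:
  assumes "finitely_generated n M"
  shows "ker_dim j = 0 \<longleftrightarrow> (\<forall>x\<in>component M j. l \<odot>\<^bsub>M\<^esub> x = \<zero>\<^bsub>M\<^esub> \<longrightarrow> x = \<zero>\<^bsub>M\<^esub>)"
proof -
  have "M.findim {x \<in> component M j. l \<odot>\<^bsub>M\<^esub> x = \<zero>\<^bsub>M\<^esub>}"
    by (rule M.findim_subset[OF M.component_findim[OF assms, of j] ksub_ker]) auto
  from M.dim_zero_iff[OF this] show ?thesis unfolding ker_dim_def by auto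
qed

text \<open>Rank and nullity for \<open>l\<close> from degree \<open>j - D\<close> to degree
  \<open>j\<close> and for \<open>\<pi>\<close> in degree \<open>j\<close>; the kernel of the second
  map is the image of the first.\<close>

theorem hilbert_function_exact:
  assumes fg: "finitely_generated n M"
  shows "hilbert_function N j + hilbert_function M (j - int D) = hilbert_function M j + ker_dim (j - int D)"
proof -
  note fd = M.component_findim[OF fg]
  have smc: "Poly_Mapping.single 0 c \<odot>\<^bsub>M\<^esub> x \<in> component M i" if "x \<in> component M i" for c x i
    using that M.ksub_component[of i] by (simp add: M.ksub_def)
  have 1: "vectorspace.dim coeff_field (M\<lparr>carrier := (\<lambda>x. l \<odot>\<^bsub>M\<^esub> x) ` component M (j - int D)\<rparr>) + ker_dim (j - int D)
      = hilbert_function M (j - int D)"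
    unfolding ker_dim_def hilbert_function_def
  proof (rule rank_nullity_graded[OF M.graded_poly_module_axioms M.graded_poly_module_axioms fd M.ksub_component])
    show "l \<odot>\<^bsub>M\<^esub> x \<in> component M j" if "x \<in> component M (j - int D)" for x
      by (rule M.smult_comp[OF l_Hom that]) simp
  qed (auto simp: M.smult_r_distr intro: M.smult_comm)
  have 2: "vectorspace.dim coeff_field (N\<lparr>carrier := \<pi> ` component M j\<rparr>) + vectorspace.dim coeff_field (M\<lparr>carrier := {x \<in> component M j. \<pi> x = \<zero>\<^bsub>N\<^esub>}\<rparr>)
      = hilbert_function M j"
    unfolding hilbert_function_def
    by (rule rank_nullity_graded[OF M.graded_poly_module_axioms N.graded_poly_module_axioms fd N.ksub_component])
      (auto simp: pi_add pi_smult intro: pi_comp)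
  have 3: "\<pi> ` component M j = component N j" using pi_comp pi_surj by (auto simp: image_iff) metis
  have 4: "{x \<in> component M j. \<pi> x = \<zero>\<^bsub>N\<^esub>} = (\<lambda>x. l \<odot>\<^bsub>M\<^esub> x) ` component M (j - int D)"
    using pi_ker_comp M.smult_comp[OF l_Hom, of _ "j - int D" j] by force
  show ?thesis using 1 2 unfolding 3 4 hilbert_function_def[of N] by simp
qed

end

section \<open>The Hilbert-Serre theorem\<close>

text \<open>Backward difference: on generating series, multiplication by
  \<open>1 - Z\<close>.\<close>

definition bdiff :: "(int \<Rightarrow> int) \<Rightarrow> int \<Rightarrow> int" where
  "bdiff f j = f j - f (j - 1)"

text \<open>For \<open>f\<close> vanishing in low degrees: the generating series becomes a Laurent
  polynomial when multiplied by \<open>(1 - Z) ^ n\<close>.\<close>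

definition diff_finite :: "nat \<Rightarrow> (int \<Rightarrow> int) \<Rightarrow> bool" where
  "diff_finite n f \<longleftrightarrow> finite {j. (bdiff ^^ n) f j \<noteq> 0}"

lemma bdiff_pow_add: "(bdiff ^^ n) (\<lambda>j. f j + g j) = (\<lambda>j. (bdiff ^^ n) f j + (bdiff ^^ n) g j)"
  by (induction n) (auto simp: bdiff_def)

lemma bdiff_pow_diff: "(bdiff ^^ n) (\<lambda>j. f j - g j) = (\<lambda>j. (bdiff ^^ n) f j - (bdiff ^^ n) g j)"
  by (induction n) (auto simp: bdiff_def)

lemma bdiff_pow_shift: "(bdiff ^^ n) (\<lambda>j. f (j - k)) = (\<lambda>j. (bdiff ^^ n) f (j - k))"
  by (induction n) (auto simp: bdiff_def algebra_simps)

lemma diff_finite_zero: "diff_finite n (\<lambda>j. 0)"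
proof -
  have "(bdiff ^^ n) (\<lambda>j. 0) = (\<lambda>j. 0)" by (induction n) (auto simp: bdiff_def)
  thus ?thesis by (simp add: diff_finite_def)
qed

lemma diff_finite_add: "diff_finite n f \<Longrightarrow> diff_finite n g \<Longrightarrow> diff_finite n (\<lambda>j. f j + g j)"
  unfolding diff_finite_def bdiff_pow_add by (rule finite_subset[rotated], erule finite_UnI, assumption) auto

lemma diff_finite_diff: "diff_finite n f \<Longrightarrow> diff_finite n g \<Longrightarrow> diff_finite n (\<lambda>j. f j - g j)"
  unfolding diff_finite_def bdiff_pow_diff by (rule finite_subset[rotated], erule finite_UnI, assumption) auto

lemma diff_finite_sum: "(\<And>i. i \<in> A \<Longrightarrow> diff_finite n (f i)) \<Longrightarrow> diff_finite n (\<lambda>j. \<Sum>i\<in>A. f i j)"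
  by (induction A rule: infinite_finite_induct) (auto simp: diff_finite_zero diff_finite_add)

lemma diff_finite_shift: "diff_finite n f \<Longrightarrow> diff_finite n (\<lambda>j. f (j - k))"
proof -
  assume "diff_finite n f"
  hence "finite ((\<lambda>j. j + k) ` {j. (bdiff ^^ n) f j \<noteq> 0})" by (simp add: diff_finite_def)
  moreover have "{j. (bdiff ^^ n) f (j - k) \<noteq> 0} \<subseteq> (\<lambda>j. j + k) ` {j. (bdiff ^^ n) f j \<noteq> 0}"
    by (force simp: image_iff)
  ultimately show ?thesis unfolding diff_finite_def bdiff_pow_shift by (rule finite_subset[rotated])
qed

lemma diff_finite_Suc: "diff_finite n (bdiff f) \<Longrightarrow> diff_finite (Suc n) f"
  by (simp add: diff_finite_def funpow_Suc_right del: funpow.simps)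

subsection \<open>Dickson's lemma\<close>

text \<open>A decreasing sequence of natural numbers is constant from the point where it attains its
  minimum.\<close>

lemma mono_subseq_nat: "\<exists>r :: nat \<Rightarrow> nat. strict_mono r \<and> mono (\<lambda>k. f (r k) :: nat)"
proof -
  obtain r where r: "strict_mono r" "monoseq (\<lambda>k. f (r k))" using seq_monosub[of f] by blast
  show ?thesis
  proof (cases "incseq (\<lambda>k. f (r k))")
    case True
    thus ?thesis using r by blast
  next
    case False
    hence dec: "decseq (\<lambda>k. f (r k))" using r(2) by (simp add: monoseq_iff)
    define m where "m = (LEAST v. v \<in> range (\<lambda>k. f (r k)))"
    have "m \<in> range (\<lambda>k. f (r k))" unfolding m_def by (rule LeastI[of _ "f (r 0)"]) auto
    then obtain k where k: "f (r k) = m" by auto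
    have "f (r (k + i)) = m" for i
    proof -
      have "f (r (k + i)) \<le> f (r k)" using decseqD[OF dec, of k "k + i"] by simp
      moreover have "m \<le> f (r (k + i))" unfolding m_def by (rule Least_le) auto
      ultimately show ?thesis using k by simp
    qed
    moreover have "strict_mono (\<lambda>i. r (k + i))" using r(1) by (auto simp: strict_mono_def)
    ultimately show ?thesis by (intro exI[of _ "\<lambda>i. r (k + i)"]) (auto simp: mono_def)
  qed
qed

text \<open>The subsequence is refined one coordinate at a time; passing to a further subsequence
  keeps the coordinates already treated monotone.\<close>

lemma dickson:
  assumes "finite I" shows "\<exists>r :: nat \<Rightarrow> nat. strict_mono r \<and> (\<forall>i\<in>I. mono (\<lambda>k. f (r k) i :: nat))"
  using assms
proof (induction I)
  case empty
  show ?case by (intro exI[of _ id]) (auto simp: strict_mono_def)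
next
  case (insert i I)
  then obtain r :: "nat \<Rightarrow> nat" where r: "strict_mono r" "\<forall>i\<in>I. mono (\<lambda>k. f (r k) i)" by auto
  obtain s :: "nat \<Rightarrow> nat" where s: "strict_mono s" "mono (\<lambda>k. f (r (s k)) i)" using mono_subseq_nat[of "\<lambda>k. f (r k) i"] by auto
  have "mono (\<lambda>k. f (r (s k)) i')" if "i' \<in> I" for i'
    using r(2) that strict_mono_less_eq[OF s(1)] by (auto simp: mono_def)
  moreover have "strict_mono (\<lambda>k. r (s k))" using r(1) s(1) by (auto simp: strict_mono_def)
  ultimately show ?case using s(2) by (intro exI[of _ "\<lambda>k. r (s k)"]) auto
qed

text \<open>The complement of a monomial ideal, in terms of exponents.\<close>

definition down_closed :: "(nat \<Rightarrow>\<^sub>0 nat) set \<Rightarrow> bool" where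
  "down_closed B \<longleftrightarrow> (\<forall>a b. a + b \<in> B \<longrightarrow> a \<in> B)"

text \<open>The ascending chain condition for monomial ideals. Without stabilization, every stage
  has an exponent that is lost later. By Dickson's lemma some such exponent divides a later one,
  which survives at a stage where its divisor is already lost.\<close>

lemma down_closed_chain_stabilizes:
  assumes B: "\<And>k :: nat. B k \<subseteq> expos n" "\<And>k. down_closed (B k)" "\<And>k. B (Suc k) \<subseteq> B k"
  shows "\<exists>k0. \<forall>k\<ge>k0. B k = B k0"
proof (rule ccontr)
  assume "\<not> ?thesis"
  hence "\<forall>k. \<exists>k'>k. B k' \<noteq> B k" using le_eq_less_or_eq by metis
  then obtain h where h: "\<And>k. h k > k \<and> B (h k) \<noteq> B k" by metis
  have anti: "B k' \<subseteq> B k" if "k \<le> k'" for k k' using that B(3) by (rule lift_Suc_antimono_le[rotated])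
  have "\<forall>k. \<exists>a. a \<in> B k \<and> a \<notin> B (h k)" using h anti by (metis less_imp_le psubsetI subset_iff subset_antisym)
  then obtain a where a: "\<And>k. a k \<in> B k \<and> a k \<notin> B (h k)" by metis
  \<comment> \<open>Stages spaced so that the exponent chosen at one of them is missing from the
    next.\<close>
  define s where "s i = (h ^^ i) 0" for i
  have sm: "strict_mono s" unfolding strict_mono_Suc_iff s_def using h by simp
  obtain r :: "nat \<Rightarrow> nat" where r: "strict_mono r" "\<forall>x\<in>{1..n}. mono (\<lambda>k. Poly_Mapping.lookup (a (s (r k))) x)"
    using dickson[of "{1..n}" "\<lambda>k. Poly_Mapping.lookup (a (s k))"] by auto
  let ?u = "a (s (r 0))" and ?v = "a (s (r 1))"
  have le: "Poly_Mapping.lookup ?u x \<le> Poly_Mapping.lookup ?v x" for x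
  proof (cases "x \<in> {1..n}")
    case True
    thus ?thesis using r(2) by (auto simp: mono_def)
  next
    case False
    moreover have "?u \<in> expos n" using a B(1) by blast
    ultimately have "x \<notin> Poly_Mapping.keys ?u" unfolding expos_def by blast
    thus ?thesis by (simp add: in_keys_iff)
  qed
  have "?v = ?u + (?v - ?u)"
    by (rule poly_mapping_eqI) (use le in \<open>simp add: lookup_add lookup_minus\<close>)
  moreover have "?v \<in> B (h (s (r 0)))"
  proof -
    have "r 0 < r 1" using r(1) by (simp add: strict_mono_def)
    hence "s (Suc (r 0)) \<le> s (r 1)" using strict_mono_less_eq[OF sm] by simp
    moreover have "s (Suc (r 0)) = h (s (r 0))" by (simp add: s_def)
    ultimately show ?thesis using anti a by (metis subsetD)
  qed
  ultimately have "?u \<in> B (h (s (r 0)))" using B(2) unfolding down_closed_def by metis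
  thus False using a by blast
qed

definition cnt :: "(nat \<Rightarrow>\<^sub>0 nat) set \<Rightarrow> int \<Rightarrow> int" where
  "cnt B j = int (card {m \<in> B. int (monomial_degree m) = j})"

text \<open>Slices by the exponent of the last variable. An exponent cannot exceed the degree, so
  the slices below \<open>K > j\<close> are all that contribute.\<close>

lemma cnt_slices:
  assumes B: "B \<subseteq> expos (Suc n)" and K: "j < int K"
  shows "cnt B j = (\<Sum>k<K. cnt {m \<in> expos n. m + Poly_Mapping.single (Suc n) k \<in> B} (j - int k))"
proof -
  let ?s = "\<lambda>k. Poly_Mapping.single (Suc n) k :: nat \<Rightarrow>\<^sub>0 nat"
  let ?S = "\<lambda>k. {m \<in> {m \<in> expos n. m + ?s k \<in> B}. int (monomial_degree m) = j - int k}"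
  have dec: "\<exists>k<K. \<exists>a\<in>?S k. m = a + ?s k" if m: "m \<in> B" "int (monomial_degree m) = j" for m
  proof -
    define k where "k = Poly_Mapping.lookup m (Suc n)"
    define a where "a = m - ?s k"
    have ma: "m = a + ?s k"
      unfolding a_def k_def by (rule poly_mapping_eqI) (auto simp: lookup_add lookup_minus lookup_single when_def)
    have az: "Poly_Mapping.lookup a i = 0" if "i \<notin> {1..n}" for i
    proof (cases "i = Suc n")
      case True
      thus ?thesis by (simp add: a_def k_def lookup_minus)
    next
      case False
      hence "i \<notin> Poly_Mapping.keys m" using that B m by (force simp: expos_def)
      thus ?thesis by (simp add: a_def lookup_minus in_keys_iff)
    qed
    have a: "a \<in> expos n"
      unfolding expos_def
    proof (rule CollectI, rule subsetI)
      fix i assume "i \<in> Poly_Mapping.keys a"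
      thus "i \<in> {1..n}" using az[of i] by (auto simp only: in_keys_iff)
    qed
    have "int (monomial_degree a) = j - int k" "k < K" using m(2) K ma by (auto simp: monomial_degree_add)
    thus ?thesis using a ma m by auto
  qed
  have "{m \<in> B. int (monomial_degree m) = j} = (\<Union>k\<in>{..<K}. (\<lambda>a. a + ?s k) ` ?S k)"
  proof (intro equalityI subsetI)
    fix m assume "m \<in> {m \<in> B. int (monomial_degree m) = j}"
    thus "m \<in> (\<Union>k\<in>{..<K}. (\<lambda>a. a + ?s k) ` ?S k)" using dec[of m] by blast
  next
    fix m assume "m \<in> (\<Union>k\<in>{..<K}. (\<lambda>a. a + ?s k) ` ?S k)"
    then obtain k a where "a \<in> ?S k" "m = a + ?s k" by blast
    thus "m \<in> {m \<in> B. int (monomial_degree m) = j}" by (simp add: monomial_degree_add)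
  qed
  moreover have "card (\<Union>k\<in>{..<K}. (\<lambda>a. a + ?s k) ` ?S k) = (\<Sum>k<K. card ((\<lambda>a. a + ?s k) ` ?S k))"
  proof (rule card_UN_disjoint)
    show "\<forall>k\<in>{..<K}. finite ((\<lambda>a. a + ?s k) ` ?S k)"
    proof
      fix k
      have "?S k \<subseteq> {m \<in> expos n. monomial_degree m = nat (j - int k)}" by auto
      thus "finite ((\<lambda>a. a + ?s k) ` ?S k)" using finite_expos_degree by (meson finite_imageI finite_subset)
    qed
    have "k = k'" if "a \<in> expos n" "b \<in> expos n" "a + ?s k = b + ?s k'" for a b k k'
    proof -
      have z: "Poly_Mapping.lookup a (Suc n) = 0" "Poly_Mapping.lookup b (Suc n) = 0"
        using that(1,2) by (auto simp: expos_def in_keys_iff subset_iff)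
      have "Poly_Mapping.lookup (a + ?s k) (Suc n) = Poly_Mapping.lookup (b + ?s k') (Suc n)" using that(3) by simp
      thus ?thesis using z by (simp add: lookup_add)
    qed
    thus "\<forall>k\<in>{..<K}. \<forall>k'\<in>{..<K}. k \<noteq> k' \<longrightarrow> (\<lambda>a. a + ?s k) ` ?S k \<inter> (\<lambda>a. a + ?s k') ` ?S k' = {}" by blast
  qed simp
  moreover have "card ((\<lambda>a. a + ?s k) ` ?S k) = card (?S k)" for k by (rule card_image) (auto simp: inj_on_def)
  ultimately show ?thesis unfolding cnt_def by simp
qed

text \<open>Induction on the number of variables. Lowering the degree by one lowers the slice index,
  so the difference of \<open>cnt B\<close> involves only differences of consecutive slices, and
  these vanish from the point where the decreasing slices stabilize.\<close>

lemma cnt_diff_finite: "B \<subseteq> expos n \<Longrightarrow> down_closed B \<Longrightarrow> diff_finite n (cnt B)"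
proof (induction n arbitrary: B)
  case 0
  have "B \<subseteq> {0}" using 0 by (auto simp: expos_def)
  hence "{j. cnt B j \<noteq> 0} \<subseteq> {0}" by (auto simp: cnt_def card_eq_0_iff)
  thus ?case by (auto simp: diff_finite_def intro: finite_subset)
next
  case (Suc n)
  let ?s = "\<lambda>k. Poly_Mapping.single (Suc n) k :: nat \<Rightarrow>\<^sub>0 nat"
  define S where "S k = {m \<in> expos n. m + ?s k \<in> B}" for k
  have Se: "S k \<subseteq> expos n" for k by (auto simp: S_def)
  have Sd: "down_closed (S k)" for k
    unfolding down_closed_def
  proof (intro allI impI)
    fix a b assume ab: "a + b \<in> S k"
    hence "(a + ?s k) + b \<in> B" by (simp add: S_def add_ac)
    hence "a + ?s k \<in> B" using Suc.prems(2) unfolding down_closed_def by blast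
    thus "a \<in> S k" using ab by (auto simp: S_def expos_def keys_add_nat)
  qed
  have Sdec: "S (Suc k) \<subseteq> S k" for k
  proof
    fix m assume m: "m \<in> S (Suc k)"
    have "?s (Suc k) = ?s k + ?s 1" by (simp add: single_add[symmetric])
    hence "(m + ?s k) + ?s 1 \<in> B" using m by (simp add: S_def add.assoc)
    hence "m + ?s k \<in> B" using Suc.prems(2) unfolding down_closed_def by blast
    thus "m \<in> S k" using m by (simp add: S_def)
  qed
  obtain k0 where k0: "\<And>k. k \<ge> k0 \<Longrightarrow> S k = S k0" using down_closed_chain_stabilizes[of S n] Se Sd Sdec by blast
  have "bdiff (cnt B) = (\<lambda>j. cnt (S 0) j - (\<Sum>k<k0. cnt (S k) (j - int (Suc k)) - cnt (S (Suc k)) (j - int (Suc k))))"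
  proof
    fix j
    \<comment> \<open>\<open>K\<close> is at least \<open>k0\<close> and exceeds \<open>j\<close>,
      so the truncated sums over slices are complete both at \<open>j\<close> and at
      \<open>j - 1\<close>.\<close>
    define K where "K = max k0 (Suc (nat j))"
    have K: "j < int (Suc K)" "j - 1 < int K" "j < int K" unfolding K_def by auto
    have "cnt B j = (\<Sum>k<Suc K. cnt (S k) (j - int k))" using cnt_slices[OF Suc.prems(1) K(1)] by (simp add: S_def)
    also have "\<dots> = cnt (S 0) j + (\<Sum>k<K. cnt (S (Suc k)) (j - int (Suc k)))"
      by (subst sum.lessThan_Suc_shift) simp
    finally have 1: "cnt B j = cnt (S 0) j + (\<Sum>k<K. cnt (S (Suc k)) (j - int (Suc k)))" .
    have 2: "cnt B (j - 1) = (\<Sum>k<K. cnt (S k) (j - int (Suc k)))"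
      using cnt_slices[OF Suc.prems(1) K(2)] by (simp add: S_def algebra_simps)
    have "(\<Sum>k<K. cnt (S k) (j - int (Suc k)) - cnt (S (Suc k)) (j - int (Suc k)))
      = (\<Sum>k<k0. cnt (S k) (j - int (Suc k)) - cnt (S (Suc k)) (j - int (Suc k)))"
    proof (rule sum.mono_neutral_right)
      show "\<forall>k\<in>{..<K} - {..<k0}. cnt (S k) (j - int (Suc k)) - cnt (S (Suc k)) (j - int (Suc k)) = 0"
        using k0 by (metis DiffE diff_self le_SucI lessThan_iff not_le)
    qed (auto simp: K_def)
    thus "bdiff (cnt B) j = cnt (S 0) j - (\<Sum>k<k0. cnt (S k) (j - int (Suc k)) - cnt (S (Suc k)) (j - int (Suc k)))"
      unfolding bdiff_def 1 2 by (simp add: sum_subtractf)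
  qed
  moreover have "diff_finite n (cnt (S k))" for k by (rule Suc.IH[OF Se Sd])
  ultimately have "diff_finite n (bdiff (cnt B))"
    by (simp only:) (intro diff_finite_diff diff_finite_sum diff_finite_shift)
  thus ?case by (rule diff_finite_Suc)
qed

subsection \<open>Standard monomials\<close>

context graded_poly_module
begin

lemma smult_span:
  assumes S: "S \<subseteq> carrier M" and p: "p \<in> Rn n" and y: "y \<in> K.span S"
  shows "p \<odot> y \<in> K.span ((\<lambda>x. p \<odot> x) ` S)"
proof -
  have pS: "(\<lambda>x. p \<odot> x) ` S \<subseteq> carrier M" using S p by auto
  have k: "ksub (K.span ((\<lambda>x. p \<odot> x) ` S))" by (rule ksub_span[OF pS])
  let ?W = "{x \<in> carrier M. p \<odot> x \<in> K.span ((\<lambda>x. p \<odot> x) ` S)}"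
  have "ksub ?W"
    using k p smult_comm[OF p, of "Poly_Mapping.single 0 c" for c]
    by (auto simp: ksub_def smult_r_distr)
  moreover have "S \<subseteq> ?W" using S in_span[OF pS] by auto
  ultimately show ?thesis using span_least[of ?W S] y by blast
qed

text \<open>The pairs of a generator and a monomial that are not spanned by smaller pairs index a basis.
  Since the order is compatible with multiplication by monomials, the monomials occurring with a
  fixed generator are closed under divisors, so that Dickson's lemma applies.\<close>

theorem hilbert_function_diff_finite:
  assumes fg: "finitely_generated n M"
  shows "diff_finite n (\<lambda>j. int (hilbert_function M j))"
proof -
  obtain G \<delta> where G: "hgens G \<delta>" using hgens_exists[OF fg] by blast
  \<comment> \<open>Numbering the generators makes the lexicographic order on pairs of a generator
    and a monomial available.\<close>
  obtain idx :: "'m \<Rightarrow> nat" where idx: "inj_on idx G" using finite_imp_inj_to_nat_seg[OF hgens_finite[OF G]] by blast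
  define gen where "gen = the_inv_into G idx"
  have gen: "gen (idx g) = g" if "g \<in> G" for g using the_inv_into_f_f[OF idx that] by (simp add: gen_def)
  define v where "v = (\<lambda>(i, m). Poly_Mapping.single m (1 :: 'k) \<odot> gen i)"
  define I where "I j = {(i, m). i \<in> idx ` G \<and> m \<in> expos n \<and> \<delta> (gen i) + int (monomial_degree m) = j}" for j
  have ex: "m \<in> expos n \<longleftrightarrow> Poly_Mapping.keys m \<subseteq> {1..n}" for m by (simp add: expos_def)
  let ?I' = "\<lambda>j. {(g, m). g \<in> G \<and> Poly_Mapping.keys m \<subseteq> {1..n} \<and> \<delta> g + int (monomial_degree m) = j}"
  have I_img: "I j = (\<lambda>(g, m). (idx g, m)) ` ?I' j" for j
    unfolding I_def ex using gen by (force simp: image_iff)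
  have vI: "v ` I j = (\<lambda>(g, m). Poly_Mapping.single m 1 \<odot> g) ` ?I' j" for j
    unfolding I_img image_image v_def using gen by (intro image_cong) auto
  have finI: "finite (I j)" for j unfolding I_img using component_gens(1)[OF G] by simp
  have vc: "v ` I j \<subseteq> component M j" for j unfolding vI by (rule component_gens(2)[OF G])
  have vC: "v ` I j \<subseteq> carrier M" for j using vc comp_subset by blast
  have spanI: "K.span (v ` I j) = component M j" for j unfolding vI by (rule component_gens(3)[OF G])
  define St where "St j = {a \<in> I j. v a \<notin> K.span (v ` {b \<in> I j. b < a})}" for j
  have H: "hilbert_function M j = card (St j)" for j
  proof -
    have g: "inj_on v (St j)" "K.lin_indpt (v ` St j)" "K.span (v ` St j) = component M j"
      using K.greedy_basis[OF finI vC, of j] spanI unfolding St_def by auto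
    have sub: "v ` St j \<subseteq> component M j" using vc[of j] unfolding St_def by blast
    have fin: "finite (v ` St j)" using finI[of j] by (auto simp: St_def)
    show ?thesis
      unfolding hilbert_function_def using ksub_dim_basis[OF ksub_component fin sub g(3,2)] card_image[OF g(1)] by simp
  qed
  define B where "B i = {m \<in> expos n. (i, m) \<in> St (\<delta> (gen i) + int (monomial_degree m))}" for i
  have Bd: "down_closed (B i)" for i
    unfolding down_closed_def
  proof (intro allI impI, rule ccontr)
    fix a b assume ab: "a + b \<in> B i" and na: "a \<notin> B i"
    let ?j = "\<delta> (gen i) + int (monomial_degree a)" and ?j' = "\<delta> (gen i) + int (monomial_degree (a + b))"
    have e: "a \<in> expos n" "b \<in> expos n" using ab by (auto simp: B_def expos_def keys_add_nat)
    have i: "i \<in> idx ` G" using ab by (auto simp: B_def St_def I_def)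
    have b: "(Poly_Mapping.single b 1 :: 'k mpol) \<in> Rn n" by (rule Rn_single) (use e ex in auto)
    have mulv: "Poly_Mapping.single b 1 \<odot> v (i', m) = v (i', m + b)" if "i' \<in> idx ` G" "m \<in> expos n" for i' m
    proof -
      have "gen i' \<in> carrier M" using that gen hgens_comp[OF G] by fastforce
      moreover have "(Poly_Mapping.single m 1 :: 'k mpol) \<in> Rn n" by (rule Rn_single) (use that ex in auto)
      ultimately show ?thesis using b by (simp add: v_def smult_mult[symmetric] mult_single add.commute)
    qed
    have "(i, a) \<in> I ?j" using i e by (simp add: I_def)
    hence "v (i, a) \<in> K.span (v ` {c \<in> I ?j. c < (i, a)})" using na e by (auto simp: B_def St_def)
    hence "Poly_Mapping.single b 1 \<odot> v (i, a) \<in> K.span ((\<lambda>x. Poly_Mapping.single b 1 \<odot> x) ` v ` {c \<in> I ?j. c < (i, a)})"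
      by (rule smult_span[rotated 2]) (use vC b in auto)
    moreover have "(\<lambda>x. Poly_Mapping.single b 1 \<odot> x) ` v ` {c \<in> I ?j. c < (i, a)} \<subseteq> v ` {c \<in> I ?j'. c < (i, a + b)}"
    proof
      fix z assume "z \<in> (\<lambda>x. Poly_Mapping.single b 1 \<odot> x) ` v ` {c \<in> I ?j. c < (i, a)}"
      then obtain i' m where c: "(i', m) \<in> I ?j" "(i', m) < (i, a)" "z = Poly_Mapping.single b 1 \<odot> v (i', m)" by auto
      have "(i', m + b) \<in> I ?j'"
        using c e by (auto simp: I_def monomial_degree_add expos_def keys_add_nat)
      moreover have "(i', m + b) < (i, a + b)" using c(2) by (auto simp: less_prod_def)
      moreover have "Poly_Mapping.single b 1 \<odot> v (i', m) = v (i', m + b)" by (rule mulv) (use c in \<open>auto simp: I_def\<close>)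
      ultimately show "z \<in> v ` {c \<in> I ?j'. c < (i, a + b)}" unfolding c(3) by blast
    qed
    ultimately have "v (i, a + b) \<in> K.span (v ` {c \<in> I ?j'. c < (i, a + b)})"
      unfolding mulv[OF i e(1), symmetric] by (rule subsetD[OF K.span_is_monotone, rotated])
    thus False using ab by (auto simp: B_def St_def)
  qed
  have "int (hilbert_function M j) = (\<Sum>i\<in>idx ` G. cnt (B i) (j - \<delta> (gen i)))" for j
  proof -
    have "St j = (SIGMA i:idx ` G. {m \<in> B i. int (monomial_degree m) = j - \<delta> (gen i)})"
      unfolding B_def by (auto simp: St_def I_def)
    moreover have "finite {m \<in> B i. int (monomial_degree m) = j - \<delta> (gen i)}" for i
      by (rule finite_subset[OF _ finite_expos_degree[of n "nat (j - \<delta> (gen i))"]]) (auto simp: B_def)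
    ultimately have "card (St j) = (\<Sum>i\<in>idx ` G. card {m \<in> B i. int (monomial_degree m) = j - \<delta> (gen i)})"
      using hgens_finite[OF G] by (simp add: card_SigmaI)
    thus ?thesis by (simp add: H cnt_def)
  qed
  hence "(\<lambda>j. int (hilbert_function M j)) = (\<lambda>j. \<Sum>i\<in>idx ` G. cnt (B i) (j - \<delta> (gen i)))" by blast
  moreover have "diff_finite n (cnt (B i))" for i by (rule cnt_diff_finite[OF _ Bd]) (auto simp: B_def)
  ultimately show ?thesis by (simp only:) (intro diff_finite_sum diff_finite_shift)
qed

end

section \<open>Prime ideals and Krull dimension\<close>

context cring
begin

text \<open>By Zorn's lemma there is an ideal maximal among those that contain \<open>I\<close> and
  miss \<open>S\<close>. It is prime: enlarging it by \<open>a\<close> or by \<open>b\<close> meets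
  \<open>S\<close>, and the product of the two common elements lies in \<open>S\<close>, but also in
  the ideal if \<open>a \<otimes> b\<close> does.\<close>

lemma prime_avoiding_multiplicative_set:
  assumes I: "ideal I R" and S: "S \<subseteq> carrier R" "\<one> \<in> S" "\<And>a b. a \<in> S \<Longrightarrow> b \<in> S \<Longrightarrow> a \<otimes> b \<in> S"
    and IS: "I \<inter> S = {}"
  shows "\<exists>Q. primeideal Q R \<and> I \<subseteq> Q \<and> Q \<inter> S = {}"
proof -
  define \<A> where "\<A> = {J. ideal J R \<and> I \<subseteq> J \<and> J \<inter> S = {}}"
  have "\<exists>Q\<in>\<A>. \<forall>X\<in>\<A>. Q \<subseteq> X \<longrightarrow> X = Q"
  proof (rule subset_Zorn)
    fix C assume C: "subset.chain \<A> C"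
    show "\<exists>U\<in>\<A>. \<forall>X\<in>C. X \<subseteq> U"
    proof (cases "C = {}")
      case True
      thus ?thesis using I IS by (auto simp: \<A>_def)
    next
      case False
      have CA: "C \<subseteq> \<A>" using C by (auto simp: subset_chain_def)
      have "subset.chain {I. ideal I R} C" using C by (auto simp: subset_chain_def \<A>_def)
      hence "ideal (\<Union>C) R" using chain_Union_is_ideal[of C] False by simp
      hence "\<Union>C \<in> \<A>" using CA False unfolding \<A>_def by blast
      thus ?thesis by blast
    qed
  qed
  then obtain Q where Q: "ideal Q R" "I \<subseteq> Q" "Q \<inter> S = {}"
    and max: "\<And>J. ideal J R \<Longrightarrow> J \<inter> S = {} \<Longrightarrow> Q \<subseteq> J \<Longrightarrow> J = Q"
    unfolding \<A>_def by (auto dest: subset_trans)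
  interpret Q: ideal Q R by (rule Q(1))
  have meets: "\<exists>q\<in>Q. \<exists>r\<in>carrier R. q \<oplus> r \<otimes> a \<in> S" if a: "a \<in> carrier R" "a \<notin> Q" for a
  proof -
    have J: "ideal (Q <+>\<^bsub>R\<^esub> PIdl a) R" by (rule add_ideals[OF Q(1) cgenideal_ideal[OF a(1)]])
    have mem: "x \<in> Q <+>\<^bsub>R\<^esub> PIdl a \<longleftrightarrow> (\<exists>q\<in>Q. \<exists>r\<in>carrier R. x = q \<oplus> r \<otimes> a)" for x
      by (auto simp: set_add_def' cgenideal_def)
    have "Q \<subseteq> Q <+>\<^bsub>R\<^esub> PIdl a"
    proof
      fix q assume q: "q \<in> Q"
      hence "q = q \<oplus> \<zero> \<otimes> a" using a Q.a_subset by auto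
      thus "q \<in> Q <+>\<^bsub>R\<^esub> PIdl a" using q mem by blast
    qed
    moreover have "a \<in> Q <+>\<^bsub>R\<^esub> PIdl a"
    proof -
      have "a = \<zero> \<oplus> \<one> \<otimes> a" using a by simp
      thus ?thesis using mem Q.zero_closed one_closed by blast
    qed
    ultimately have "(Q <+>\<^bsub>R\<^esub> PIdl a) \<inter> S \<noteq> {}" using max[OF J] a(2) by blast
    then obtain x where x: "x \<in> Q <+>\<^bsub>R\<^esub> PIdl a" "x \<in> S" by blast
    thus ?thesis using mem[of x] by blast
  qed
  have "primeideal Q R"
  proof (rule primeidealI[OF Q(1) is_cring])
    show "carrier R \<noteq> Q" using Q(3) S(1,2) by auto
    fix a b assume ab: "a \<in> carrier R" "b \<in> carrier R" "a \<otimes> b \<in> Q"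
    show "a \<in> Q \<or> b \<in> Q"
    proof (rule ccontr)
      assume "\<not> ?thesis"
      then obtain q r q' r' where q: "q \<in> Q" "r \<in> carrier R" "q \<oplus> r \<otimes> a \<in> S" "q' \<in> Q" "r' \<in> carrier R" "q' \<oplus> r' \<otimes> b \<in> S"
        using meets ab by metis
      have c: "q \<in> carrier R" "q' \<in> carrier R" using q Q.a_subset by auto
      have "(q \<oplus> r \<otimes> a) \<otimes> (q' \<oplus> r' \<otimes> b) = q \<otimes> (q' \<oplus> r' \<otimes> b) \<oplus> (r \<otimes> a \<otimes> q' \<oplus> r \<otimes> r' \<otimes> (a \<otimes> b))"
        using c q ab by (simp add: l_distr r_distr a_ac m_ac)
      moreover have "\<dots> \<in> Q"
      proof -
        have "q \<otimes> (q' \<oplus> r' \<otimes> b) \<in> Q" by (rule Q.I_r_closed) (use c q ab in auto)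
        moreover have "r \<otimes> a \<otimes> q' \<in> Q" by (rule Q.I_l_closed) (use c q ab in auto)
        moreover have "r \<otimes> r' \<otimes> (a \<otimes> b) \<in> Q" by (rule Q.I_l_closed) (use c q ab in auto)
        ultimately show ?thesis by (intro Q.a_closed)
      qed
      ultimately show False using S(3)[OF q(3,6)] Q(3) by auto
    qed
  qed
  thus ?thesis using Q by blast
qed

text \<open>The multiplicative set consists of the products of a power of \<open>f\<close> with an
  element outside \<open>P\<close>. A prime missing it lies inside \<open>P\<close> and does not
  contain \<open>f\<close>.\<close>

lemma prime_below:
  assumes I: "ideal I R" and P: "primeideal P R" and f: "f \<in> carrier R"
    and fs: "\<And>k::nat. \<And>s. s \<in> carrier R - P \<Longrightarrow> f [^] k \<otimes> s \<notin> I"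
  shows "\<exists>Q. primeideal Q R \<and> I \<subseteq> Q \<and> Q \<subseteq> P \<and> f \<notin> Q"
proof -
  interpret P: primeideal P R by (rule P)
  define S where "S = {f [^] (k::nat) \<otimes> s | k s. s \<in> carrier R - P}"
  have one: "\<one> \<in> carrier R - P" using P.I_notcarr P.one_imp_carrier by auto
  have mem: "f [^] (k::nat) \<otimes> s \<in> S" if "s \<in> carrier R - P" for k s using that S_def by blast
  have "\<exists>Q. primeideal Q R \<and> I \<subseteq> Q \<and> Q \<inter> S = {}"
  proof (rule prime_avoiding_multiplicative_set[OF I])
    show "S \<subseteq> carrier R" using f by (auto simp: S_def)
    show "\<one> \<in> S" using mem[OF one, of 0] by simp
    show "I \<inter> S = {}" using fs by (auto simp: S_def)
    fix a b assume "a \<in> S" "b \<in> S"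
    then obtain k s l t where st: "a = f [^] (k::nat) \<otimes> s" "b = f [^] (l::nat) \<otimes> t" "s \<in> carrier R - P" "t \<in> carrier R - P"
      by (auto simp: S_def)
    have "a \<otimes> b = f [^] (k + l) \<otimes> (s \<otimes> t)" using st f by (simp add: nat_pow_mult[symmetric] m_ac)
    moreover have "s \<otimes> t \<in> carrier R - P" using st P.I_prime by auto
    ultimately show "a \<otimes> b \<in> S" using mem by simp
  qed
  then obtain Q where Q: "primeideal Q R" "I \<subseteq> Q" "Q \<inter> S = {}" by blast
  interpret Q: primeideal Q R by (rule Q(1))
  have "a \<in> P" if a: "a \<in> Q" for a
  proof (rule ccontr)
    assume n: "a \<notin> P"
    have ac: "a \<in> carrier R" using a Q.a_subset by auto
    hence "a \<in> S" using mem[of a 0] n by simp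
    thus False using a Q(3) by auto
  qed
  moreover have "f \<notin> Q" using mem[OF one, of 1] f Q(3) by auto
  ultimately show ?thesis using Q by blast
qed

lemma quot_carrier: "carrier (R Quot I) = (+>) I ` carrier R"
  unfolding FactRing_def A_RCOSETS_def' by (simp add: UNION_singleton_eq_range)

lemma quot_zero: "\<zero>\<^bsub>R Quot I\<^esub> = I"
  unfolding FactRing_def by simp

lemma quot_prime_image:
  assumes I: "ideal I R" and P: "primeideal P R" "I \<subseteq> P"
  shows "primeideal ((+>) I ` P) (R Quot I)"
    and "\<And>a. a \<in> carrier R \<Longrightarrow> I +> a \<in> (+>) I ` P \<longleftrightarrow> a \<in> P"
proof -
  interpret I: ideal I R by (rule I)
  interpret P: primeideal P R by (rule P(1))
  interpret Q: cring "R Quot I" by (rule I.quotient_is_cring[OF is_cring])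
  interpret h: ring_hom_ring R "R Quot I" "(+>) I" by (rule I.rcos_ring_hom_ring)
  have carr: "carrier (R Quot I) = (+>) I ` carrier R" by (rule quot_carrier)
  have PR: "P \<subseteq> carrier R" by (rule P.a_subset)
  show mem: "I +> a \<in> (+>) I ` P \<longleftrightarrow> a \<in> P" if a: "a \<in> carrier R" for a
  proof
    assume "I +> a \<in> (+>) I ` P"
    then obtain p where p: "p \<in> P" "I +> a = I +> p" by auto
    have "a \<in> I +> p" using p(2) I.a_rcos_self[OF a] by simp
    then obtain i where "i \<in> I" "a = i \<oplus> p" by (auto simp: a_r_coset_def')
    thus "a \<in> P" using p(1) P(2) by auto
  qed simp
  show "primeideal ((+>) I ` P) (R Quot I)"
  proof (rule primeidealI)
    show "cring (R Quot I)" by (rule Q.is_cring)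
    show "ideal ((+>) I ` P) (R Quot I)"
    proof (rule idealI)
      show "ring (R Quot I)" by (rule Q.ring_axioms)
      show "subgroup ((+>) I ` P) (add_monoid (R Quot I))"
      proof (rule Q.add.subgroupI)
        show "(+>) I ` P \<subseteq> carrier (R Quot I)" using PR carr by auto
        show "(+>) I ` P \<noteq> {}" using P.zero_closed by blast
        fix A assume "A \<in> (+>) I ` P"
        then obtain a where a: "a \<in> P" "A = I +> a" by auto
        have "\<ominus>\<^bsub>R Quot I\<^esub> A = I +> (\<ominus> a)" using a PR h.hom_a_inv[of a] by auto
        thus "\<ominus>\<^bsub>R Quot I\<^esub> A \<in> (+>) I ` P" using P.a_inv_closed[OF a(1)] by simp
        fix B assume "B \<in> (+>) I ` P"
        then obtain b where b: "b \<in> P" "B = I +> b" by auto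
        have "A \<oplus>\<^bsub>R Quot I\<^esub> B = I +> (a \<oplus> b)" using a b PR h.hom_add[of a b] by auto
        thus "A \<oplus>\<^bsub>R Quot I\<^esub> B \<in> (+>) I ` P" using P.a_closed[OF a(1) b(1)] by simp
      qed
      fix A B assume "A \<in> (+>) I ` P" "B \<in> carrier (R Quot I)"
      then obtain a b where ab: "a \<in> P" "A = I +> a" "b \<in> carrier R" "B = I +> b" using carr by auto
      show "B \<otimes>\<^bsub>R Quot I\<^esub> A \<in> (+>) I ` P" using ab PR h.hom_mult[of b a] P.I_l_closed[of a b] by (metis imageI subsetD)
      show "A \<otimes>\<^bsub>R Quot I\<^esub> B \<in> (+>) I ` P" using ab PR h.hom_mult[of a b] P.I_r_closed[of a b] by (metis imageI subsetD)
    qed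
    show "carrier (R Quot I) \<noteq> (+>) I ` P"
    proof
      assume "carrier (R Quot I) = (+>) I ` P"
      hence "a \<in> P" if "a \<in> carrier R" for a using mem[OF that] that carr by auto
      thus False using P.I_notcarr PR by blast
    qed
    fix A B assume "A \<in> carrier (R Quot I)" "B \<in> carrier (R Quot I)" "A \<otimes>\<^bsub>R Quot I\<^esub> B \<in> (+>) I ` P"
    then obtain a b where ab: "a \<in> carrier R" "A = I +> a" "b \<in> carrier R" "B = I +> b" using carr by auto
    have "I +> (a \<otimes> b) \<in> (+>) I ` P" using \<open>A \<otimes>\<^bsub>R Quot I\<^esub> B \<in> (+>) I ` P\<close> ab h.hom_mult[of a b] by simp
    thus "A \<in> (+>) I ` P \<or> B \<in> (+>) I ` P" using ab mem P.I_prime by (metis m_closed)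
  qed
qed

definition prime_chain :: "'a set \<Rightarrow> nat \<Rightarrow> (nat \<Rightarrow> 'a set) \<Rightarrow> bool" where
  "prime_chain I r P \<longleftrightarrow> (\<forall>i\<le>r. primeideal (P i) R \<and> I \<subseteq> P i) \<and> (\<forall>i<r. P i \<subset> P (Suc i))"

text \<open>Primes of the quotient correspond to primes containing \<open>I\<close>, with strict
  inclusions preserved both ways; chains can therefore be handled inside the polynomial
  ring.\<close>

lemma krull_dim_quotient:
  assumes I: "ideal I R"
  shows "ring_krull_dim (R Quot I) = Sup {enat r | r. \<exists>P. prime_chain I r P}"
proof -
  interpret I: ideal I R by (rule I)
  interpret h: ring_hom_ring R "R Quot I" "(+>) I" by (rule I.rcos_ring_hom_ring)
  have carr: "carrier (R Quot I) = (+>) I ` carrier R" by (rule quot_carrier)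
  have "(\<exists>P. (\<forall>i\<le>r. primeideal (P i) (R Quot I)) \<and> (\<forall>i<r. P i \<subset> P (Suc i))) \<longleftrightarrow> (\<exists>P. prime_chain I r P)" for r
  proof
    assume "\<exists>P. (\<forall>i\<le>r. primeideal (P i) (R Quot I)) \<and> (\<forall>i<r. P i \<subset> P (Suc i))"
    then obtain P where P: "\<And>i. i \<le> r \<Longrightarrow> primeideal (P i) (R Quot I)" "\<And>i. i < r \<Longrightarrow> P i \<subset> P (Suc i)" by blast
    define Q where "Q i = {a \<in> carrier R. I +> a \<in> P i}" for i
    have Pc: "P i \<subseteq> carrier (R Quot I)" if "i \<le> r" for i
      using additive_subgroup.a_subset[OF ideal.axioms(1)[OF primeideal.axioms(1)[OF P(1)[OF that]]]] .
    have "prime_chain I r Q"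
      unfolding prime_chain_def
    proof (intro conjI allI impI)
      fix i assume i: "i \<le> r"
      show "primeideal (Q i) R" unfolding Q_def by (rule h.primeideal_vimage[OF is_cring P(1)[OF i]])
      show "I \<subseteq> Q i"
      proof
        fix a assume a: "a \<in> I"
        hence "I +> a = \<zero>\<^bsub>R Quot I\<^esub>" using I.a_rcos_const[OF a] by (simp add: quot_zero)
        moreover have "\<zero>\<^bsub>R Quot I\<^esub> \<in> P i"
          using additive_subgroup.zero_closed[OF ideal.axioms(1)[OF primeideal.axioms(1)[OF P(1)[OF i]]]] .
        ultimately show "a \<in> Q i" using a I.a_subset by (auto simp: Q_def)
      qed
    next
      fix i assume i: "i < r"
      have "Q i \<subseteq> Q (Suc i)" using P(2)[OF i] by (auto simp: Q_def)
      moreover have "Q i \<noteq> Q (Suc i)"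
      proof -
        obtain A where A: "A \<in> P (Suc i)" "A \<notin> P i" using P(2)[OF i] by blast
        then obtain a where "a \<in> carrier R" "A = I +> a" using Pc[of "Suc i"] i carr by auto
        thus ?thesis using A by (auto simp: Q_def)
      qed
      ultimately show "Q i \<subset> Q (Suc i)" by blast
    qed
    thus "\<exists>P. prime_chain I r P" by blast
  next
    assume "\<exists>P. prime_chain I r P"
    then obtain P where P: "\<And>i. i \<le> r \<Longrightarrow> primeideal (P i) R" "\<And>i. i \<le> r \<Longrightarrow> I \<subseteq> P i" "\<And>i. i < r \<Longrightarrow> P i \<subset> P (Suc i)"
      by (auto simp: prime_chain_def)
    have "primeideal ((+>) I ` P i) (R Quot I)" if "i \<le> r" for i by (rule quot_prime_image(1)[OF I P(1,2)[OF that]])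
    moreover have "(+>) I ` P i \<subset> (+>) I ` P (Suc i)" if i: "i < r" for i
    proof -
      obtain a where a: "a \<in> P (Suc i)" "a \<notin> P i" using P(3)[OF i] by blast
      have "a \<in> carrier R"
        using a(1) additive_subgroup.a_subset[OF ideal.axioms(1)[OF primeideal.axioms(1)[OF P(1)[of "Suc i"]]]] i by auto
      hence "I +> a \<notin> (+>) I ` P i" using quot_prime_image(2)[OF I P(1,2)[of i]] a(2) i by auto
      moreover have "I +> a \<in> (+>) I ` P (Suc i)" using a by simp
      moreover have "(+>) I ` P i \<subseteq> (+>) I ` P (Suc i)" using P(3)[OF i] by auto
      ultimately show ?thesis by blast
    qed
    ultimately show "\<exists>P. (\<forall>i\<le>r. primeideal (P i) (R Quot I)) \<and> (\<forall>i<r. P i \<subset> P (Suc i))"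
      by (intro exI[of _ "\<lambda>i. (+>) I ` P i"]) auto
  qed
  thus ?thesis unfolding ring_krull_dim_def by simp
qed

end

section \<open>The irrelevant ideal and primes of the polynomial ring\<close>

definition irrelevant :: "nat \<Rightarrow> 'k::field mpol set" where
  "irrelevant n = {p \<in> Rn n. Poly_Mapping.lookup p 0 = 0}"

lemma poly_add_eq_0_iff: "(a :: nat \<Rightarrow>\<^sub>0 nat) + b = 0 \<longleftrightarrow> a = 0 \<and> b = 0"
proof
  assume "a + b = 0"
  hence "Poly_Mapping.lookup (a + b) i = 0" for i by simp
  hence "Poly_Mapping.lookup a i = 0 \<and> Poly_Mapping.lookup b i = 0" for i by (simp add: lookup_add)
  thus "a = 0 \<and> b = 0" by (auto intro!: poly_mapping_eqI)
qed simp

lemma irrelevant_mult: "p \<in> irrelevant n \<Longrightarrow> q \<in> Rn n \<Longrightarrow> p * q \<in> irrelevant n"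
proof -
  assume p: "p \<in> irrelevant n" and q: "q \<in> Rn n"
  have "0 \<notin> Poly_Mapping.keys (p * q)"
  proof
    assume "0 \<in> Poly_Mapping.keys (p * q)"
    then obtain a b where "a \<in> Poly_Mapping.keys p" "(0 :: nat \<Rightarrow>\<^sub>0 nat) = a + b" using keys_mult[of p q] by blast
    hence "0 \<in> Poly_Mapping.keys p" using poly_add_eq_0_iff[of a b] by auto
    thus False using p by (simp add: irrelevant_def in_keys_iff)
  qed
  thus ?thesis using p q by (simp add: irrelevant_def in_keys_iff)
qed

lemma irrelevant_add: "p \<in> irrelevant n \<Longrightarrow> q \<in> irrelevant n \<Longrightarrow> p + q \<in> irrelevant n"
  by (simp add: irrelevant_def lookup_add)

lemma const_decomp: "p \<in> Rn n \<Longrightarrow> \<exists>p'\<in>irrelevant n. p = Poly_Mapping.single 0 (Poly_Mapping.lookup p 0) + p'"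
  by (intro bexI[of _ "p - Poly_Mapping.single 0 (Poly_Mapping.lookup p 0)"]) (auto simp: irrelevant_def lookup_minus)

lemma lookup_mult_0: "p \<in> Rn n \<Longrightarrow> q \<in> Rn n \<Longrightarrow>
  Poly_Mapping.lookup (p * q) 0 = Poly_Mapping.lookup p 0 * Poly_Mapping.lookup (q :: 'k::field mpol) 0"
proof -
  assume p: "p \<in> Rn n" and q: "q \<in> Rn n"
  obtain p' where p': "p' \<in> irrelevant n" "p = Poly_Mapping.single 0 (Poly_Mapping.lookup p 0) + p'" using const_decomp[OF p] by blast
  obtain q' where q': "q' \<in> irrelevant n" "q = Poly_Mapping.single 0 (Poly_Mapping.lookup q 0) + q'" using const_decomp[OF q] by blast
  let ?c = "Poly_Mapping.single 0 (Poly_Mapping.lookup p 0) :: 'k mpol" and ?d = "Poly_Mapping.single 0 (Poly_Mapping.lookup q 0) :: 'k mpol"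
  have "p * q = ?c * ?d + (q' * ?c + p' * q)"
    by (subst p'(2), subst (1 2) q'(2)) (simp add: algebra_simps)
  moreover have "q' * ?c + p' * q \<in> irrelevant n" by (intro irrelevant_add irrelevant_mult p' q' q) simp
  ultimately show ?thesis by (simp add: lookup_add mult_single irrelevant_def)
qed

text \<open>It is the kernel of the constant coefficient, which is multiplicative with values in a
  field.\<close>

lemma irrelevant_prime: "primeideal (irrelevant n :: 'k::field mpol set) (poly_ring n)"
proof (rule primeidealI)
  interpret R: cring "poly_ring n :: 'k mpol ring" by (rule cring_poly_ring)
  show "cring (poly_ring n :: 'k mpol ring)" by (rule R.is_cring)
  show "ideal (irrelevant n) (poly_ring n :: 'k mpol ring)"
  proof (rule idealI)
    show "ring (poly_ring n :: 'k mpol ring)" by (rule R.ring_axioms)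
    show "subgroup (irrelevant n) (add_monoid (poly_ring n :: 'k mpol ring))"
      by (rule R.add.subgroupI) (auto simp: irrelevant_def lookup_add intro: exI[of _ 0])
    fix a x :: "'k mpol" assume "a \<in> irrelevant n" "x \<in> Rn n"
    thus "x \<otimes>\<^bsub>poly_ring n\<^esub> a \<in> irrelevant n" "a \<otimes>\<^bsub>poly_ring n\<^esub> x \<in> irrelevant n"
      using irrelevant_mult[of a n x] by (simp_all add: mult.commute)
  qed
  have "1 \<notin> (irrelevant n :: 'k mpol set)" by (simp add: irrelevant_def lookup_one)
  thus "Rn n \<noteq> (irrelevant n :: 'k mpol set)" using Rn_one by blast
  fix a b :: "'k mpol" assume "a \<in> Rn n" "b \<in> Rn n" "a \<otimes>\<^bsub>poly_ring n\<^esub> b \<in> irrelevant n"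
  thus "a \<in> irrelevant n \<or> b \<in> irrelevant n" by (auto simp: irrelevant_def lookup_mult_0)
qed

lemma prime_Rn: "primeideal P (poly_ring n) \<Longrightarrow> P \<subseteq> Rn n"
  using additive_subgroup.a_subset[OF ideal.axioms(1)[OF primeideal.axioms(1)]] by blast

lemma primeD:
  assumes "primeideal P (poly_ring n :: 'k::field mpol ring)"
  shows "0 \<in> P" "a \<in> P \<Longrightarrow> b \<in> P \<Longrightarrow> a + b \<in> P" "a \<in> P \<Longrightarrow> b \<in> P \<Longrightarrow> a - b \<in> P"
    "a \<in> P \<Longrightarrow> r \<in> Rn n \<Longrightarrow> r * a \<in> P"
    "a \<in> Rn n \<Longrightarrow> b \<in> Rn n \<Longrightarrow> a * b \<in> P \<Longrightarrow> a \<in> P \<or> b \<in> P"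
    "c \<noteq> 0 \<Longrightarrow> Poly_Mapping.single 0 c \<notin> P"
proof -
  interpret P: primeideal P "poly_ring n" by (rule assms)
  have PR: "P \<subseteq> Rn n" by (rule prime_Rn[OF assms])
  have sub: "additive_subgroup P (poly_ring n)" by (rule P.additive_subgroup_axioms)
  show "0 \<in> P" using additive_subgroup.zero_closed[OF sub] by simp
  show add: "a \<in> P \<Longrightarrow> b \<in> P \<Longrightarrow> a + b \<in> P" for a b using additive_subgroup.a_closed[OF sub, of a b] by simp
  show mult: "a \<in> P \<Longrightarrow> r \<in> Rn n \<Longrightarrow> r * a \<in> P" for a r using P.I_l_closed[of a r] by simp
  show "a \<in> P \<Longrightarrow> b \<in> P \<Longrightarrow> a - b \<in> P"
    using add[of a "(- 1) * b"] mult[of b "- 1"] by simp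
  show "a \<in> Rn n \<Longrightarrow> b \<in> Rn n \<Longrightarrow> a * b \<in> P \<Longrightarrow> a \<in> P \<or> b \<in> P" using P.I_prime[of a b] by simp
  show "Poly_Mapping.single 0 c \<notin> P" if "c \<noteq> 0"
  proof
    assume "Poly_Mapping.single 0 c \<in> P"
    hence "Poly_Mapping.single 0 (inverse c) * Poly_Mapping.single 0 c \<in> P" by (rule mult) simp
    hence "1 \<in> P" using that by (simp add: mult_single)
    hence "r \<in> P" if "r \<in> Rn n" for r using mult[of 1 r] that by simp
    thus False using P.I_notcarr PR by blast
  qed
qed

text \<open>An element of \<open>P\<close> differs from its constant term by an irrelevant element,
  so this constant lies in \<open>P\<close> and must be zero.\<close>

lemma irrelevant_maximal:
  assumes P: "primeideal P (poly_ring n)" and sub: "irrelevant n \<subseteq> P" shows "P = irrelevant n"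
proof
  show "P \<subseteq> irrelevant n"
  proof
    fix p assume p: "p \<in> P"
    hence pR: "p \<in> Rn n" using prime_Rn[OF P] by blast
    obtain p' where p': "p' \<in> irrelevant n" "p = Poly_Mapping.single 0 (Poly_Mapping.lookup p 0) + p'" using const_decomp[OF pR] by blast
    have "p - p' \<in> P" using primeD(3)[OF P p] p'(1) sub by blast
    hence "Poly_Mapping.single 0 (Poly_Mapping.lookup p 0) \<in> P" using p'(2) by (metis add_diff_cancel_right')
    hence "Poly_Mapping.lookup p 0 = 0" using primeD(6)[OF P] by blast
    thus "p \<in> irrelevant n" using pR by (simp add: irrelevant_def)
  qed
qed (rule sub)

lemma prime_power_mem:
  assumes P: "primeideal P (poly_ring n)" and a: "a \<in> Rn n" "a ^ k \<in> P" shows "a \<in> P"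
  using a(2)
proof (induction k)
  case 0
  have "(1 :: 'a mpol) = Poly_Mapping.single 0 1" by simp
  thus ?case using 0 primeD(6)[OF P, of 1] by simp
next
  case (Suc k)
  thus ?case using primeD(5)[OF P a(1), of "a ^ k"] a(1) by auto
qed

text \<open>The monomials of large degree include \<open>X_var t ^ p\<close>, and a prime that
  contains a power of a variable contains the variable.\<close>

lemma prime_contains_irrelevant:
  assumes P: "primeideal P (poly_ring n :: 'k::field mpol ring)"
    and m: "\<And>m. Poly_Mapping.keys m \<subseteq> {1..n} \<Longrightarrow> p \<le> monomial_degree m \<Longrightarrow> Poly_Mapping.single m 1 \<in> P"
  shows "irrelevant n \<subseteq> P"
proof
  have X: "X_var t \<in> P" if t: "t \<in> {1..n}" for t
  proof (rule prime_power_mem[OF P, of _ p])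
    have "X_var t ^ p = (Poly_Mapping.single (Poly_Mapping.single t p) 1 :: 'k mpol)"
      using single_X_var_factor[of p "Poly_Mapping.single t p" t "1 :: 'k"] by simp
    thus "X_var t ^ p \<in> P" using m[of "Poly_Mapping.single t p"] t by (cases "p = 0") auto
  qed (use t in auto)
  fix q :: "'k mpol" assume q: "q \<in> irrelevant n"
  have mem: "Poly_Mapping.single m c \<in> P" if m: "Poly_Mapping.keys m \<subseteq> {1..n}" "m \<noteq> 0" for m c
  proof -
    obtain t where t: "t \<in> Poly_Mapping.keys m" using m(2) by fastforce
    hence "1 \<le> Poly_Mapping.lookup m t" by (simp add: in_keys_iff)
    from single_X_var_factor[OF this, of c]
    have "Poly_Mapping.single m c = Poly_Mapping.single (m - Poly_Mapping.single t 1) c * X_var t" by (simp add: mult.commute)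
    moreover have "Poly_Mapping.single (m - Poly_Mapping.single t 1) c \<in> Rn n"
    proof (rule Rn_single, rule subset_trans[OF _ m(1)], rule subsetI)
      fix x assume "x \<in> Poly_Mapping.keys (m - Poly_Mapping.single t 1)"
      thus "x \<in> Poly_Mapping.keys m" by (auto simp: in_keys_iff lookup_minus)
    qed
    moreover have "X_var t \<in> P" using X t m(1) by blast
    ultimately show ?thesis using primeD(4)[OF P] by simp
  qed
  have "(\<Sum>m\<in>A. Poly_Mapping.single m (Poly_Mapping.lookup q m)) \<in> P" if "finite A" "A \<subseteq> Poly_Mapping.keys q" for A
    using that
  proof (induction A)
    case (insert m A)
    have "Poly_Mapping.keys m \<subseteq> {1..n}" "m \<noteq> 0" using insert.prems q by (auto simp: irrelevant_def mem_Rn in_keys_iff)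
    thus ?case using insert mem primeD(2)[OF P] by simp
  qed (simp add: primeD(1)[OF P])
  from this[of "Poly_Mapping.keys q"] show "q \<in> P" by (simp flip: poly_eq_sum_monomials)
qed

section \<open>Annihilators, and modules of dimension zero\<close>

context graded_poly_module
begin

lemma annihilator_iff: "a \<in> annihilator n M \<longleftrightarrow> a \<in> Rn n \<and> (\<forall>x\<in>carrier M. a \<odot> x = \<zero>)"
  by (simp add: annihilator_def)

lemma annihilator_ideal: "ideal (annihilator n M) (poly_ring n)"
proof (rule idealI)
  show "ring (poly_ring n :: 'k mpol ring)" by (rule R.ring_axioms)
  have z: "(0 :: 'k mpol) \<in> annihilator n M" by (simp add: annihilator_iff)
  show "subgroup (annihilator n M) (add_monoid (poly_ring n))"
  proof (rule R.add.subgroupI)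
    show "annihilator n M \<noteq> {}" using z by blast
  qed (auto simp: annihilator_iff smult_add smult_uminus)
qed (auto simp: annihilator_iff smult_mult)

lemma krull_dim_alt: "krull_dim n M = Sup {enat r | r. \<exists>P. R.prime_chain (annihilator n M) r P}"
  unfolding krull_dim_def by (rule R.krull_dim_quotient[OF annihilator_ideal])

lemma krull_dim_ge: "R.prime_chain (annihilator n M) r P \<Longrightarrow> enat r \<le> krull_dim n M"
  unfolding krull_dim_alt by (rule Sup_upper) auto

lemma krull_dim_le: "(\<And>r P. R.prime_chain (annihilator n M) r P \<Longrightarrow> enat r \<le> e) \<Longrightarrow> krull_dim n M \<le> e"
  unfolding krull_dim_alt by (rule Sup_least) auto

lemma proj_smult_sum:
  assumes x: "x \<in> carrier M" and p: "p \<in> Rn n"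
  shows "proj (p \<odot> x) i = (\<Oplus>m\<in>Poly_Mapping.keys p. Poly_Mapping.single m (Poly_Mapping.lookup p m) \<odot> proj x (i - int (monomial_degree m)))"
proof -
  let ?f = "\<lambda>m. Poly_Mapping.single m (Poly_Mapping.lookup p m)"
  have k: "Poly_Mapping.keys m \<subseteq> {1..n}" if "m \<in> Poly_Mapping.keys p" for m
    using p that by (auto simp: mem_Rn)
  have kR: "?f m \<in> Rn n" if "m \<in> Poly_Mapping.keys p" for m by (rule Rn_single[OF k[OF that]])
  have "p \<odot> x = (\<Sum>m\<in>Poly_Mapping.keys p. ?f m) \<odot> x" by (subst poly_eq_sum_monomials[of p]) simp
  also have "\<dots> = (\<Oplus>m\<in>Poly_Mapping.keys p. ?f m \<odot> x)" by (rule smult_sum) (use kR x in auto)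
  also have "proj \<dots> i = (\<Oplus>m\<in>Poly_Mapping.keys p. proj (?f m \<odot> x) i)" by (rule proj_finsum) (use kR x in auto)
  also have "\<dots> = (\<Oplus>m\<in>Poly_Mapping.keys p. ?f m \<odot> proj x (i - int (monomial_degree m)))"
    by (rule finsum_cong') (use kR x in \<open>auto intro!: proj_smult[OF x Hom_single[OF k]]\<close>)
  finally show ?thesis .
qed

lemma proj_smult_below:
  assumes x: "x \<in> carrier M" "\<And>i. i < a \<Longrightarrow> proj x i = \<zero>" and p: "p \<in> Rn n" and i: "i < a"
  shows "proj (p \<odot> x) i = \<zero>"
proof -
  have "Poly_Mapping.single m (Poly_Mapping.lookup p m) \<odot> proj x (i - int (monomial_degree m)) = \<zero>" if "m \<in> Poly_Mapping.keys p" for m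
  proof -
    have "(Poly_Mapping.single m (Poly_Mapping.lookup p m) :: 'k mpol) \<in> Rn n" by (rule Rn_single) (use p that in \<open>auto simp: mem_Rn\<close>)
    moreover have "proj x (i - int (monomial_degree m)) = \<zero>" using x(2) i by simp
    ultimately show ?thesis by simp
  qed
  thus ?thesis unfolding proj_smult_sum[OF x(1) p] by (intro add.finprod_one_eqI) auto
qed

text \<open>Among the terms of \<open>s\<close>, the constant one alone preserves degrees.\<close>

lemma proj_smult_const:
  assumes x: "x \<in> component M j" and s: "s \<in> Rn n"
  shows "proj (s \<odot> x) j = Poly_Mapping.single 0 (Poly_Mapping.lookup s 0) \<odot> x"
proof -
  have xc: "x \<in> carrier M" using x by simp
  obtain s' where s': "s' \<in> irrelevant n" "s = Poly_Mapping.single 0 (Poly_Mapping.lookup s 0) + s'" using const_decomp[OF s] by blast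
  have s'R: "s' \<in> Rn n" using s'(1) by (simp add: irrelevant_def)
  have "proj (s' \<odot> x) j = \<zero>"
  proof -
    have "Poly_Mapping.single m (Poly_Mapping.lookup s' m) \<odot> proj x (j - int (monomial_degree m)) = \<zero>" if m: "m \<in> Poly_Mapping.keys s'" for m
    proof -
      have mR: "(Poly_Mapping.single m (Poly_Mapping.lookup s' m) :: 'k mpol) \<in> Rn n" by (rule Rn_single) (use s'R m in \<open>auto simp: mem_Rn\<close>)
      have "m \<noteq> 0" using m s'(1) by (auto simp: irrelevant_def in_keys_iff)
      then obtain t where "Poly_Mapping.lookup m t \<noteq> 0" by (metis lookup_zero poly_mapping_eqI)
      hence "monomial_degree m \<noteq> 0" unfolding monomial_degree_def by (auto simp: in_keys_iff)
      thus ?thesis using proj_of_comp[OF x] mR by simp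
    qed
    thus ?thesis unfolding proj_smult_sum[OF xc s'R] by (intro add.finprod_one_eqI) auto
  qed
  moreover have "Poly_Mapping.single 0 (Poly_Mapping.lookup s 0) \<odot> x \<in> component M j" by (rule smult_comp[OF Hom_const x]) simp
  ultimately show ?thesis
    using xc s'R by (subst s'(2)) (simp add: smult_add proj_add proj_of_comp)
qed

definition bounded_above :: bool where
  "bounded_above \<longleftrightarrow> (\<exists>j0. \<forall>j\<ge>j0. component M j = {\<zero>})"

text \<open>If every variable had a power annihilating \<open>M\<close>, all monomials of large
  degree would kill the generators and \<open>M\<close> would be bounded. Otherwise some
  \<open>X_var t\<close> has no such power, and a prime inside the irrelevant ideal that avoids it
  gives a chain of length one.\<close>

lemma krull_dim_zero_bounded:
  assumes fg: "finitely_generated n M" and d: "krull_dim n M = 0"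
  shows "bounded_above"
proof (rule ccontr)
  assume unb: "\<not> bounded_above"
  obtain G \<delta> where G: "hgens G \<delta>" using hgens_exists[OF fg] by blast
  have "\<exists>t\<in>{1..n}. \<forall>k. X_var t ^ k \<notin> annihilator n M"
  proof (rule ccontr)
    assume "\<not> ?thesis"
    then obtain k where k: "\<And>t. t \<in> {1..n} \<Longrightarrow> X_var t ^ k t \<in> annihilator n M" by metis
    \<comment> \<open>\<open>\<kappa>\<close> dominates every \<open>k t\<close>. From degree
      \<open>b\<close> on, the monomial of a term has degree above \<open>n * \<kappa>\<close>,
      hence some variable occurs with exponent at least its \<open>k t\<close>.\<close>
    define \<kappa> where "\<kappa> = (\<Sum>t\<in>{1..n}. k t)"
    define b where "b = Max (insert 0 (\<delta> ` G)) + int (n * \<kappa>) + 1"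
    have "component M j = {\<zero>}" if j: "j \<ge> b" for j
    proof -
      have "x = \<zero>" if "x \<in> component M j" for x
        using G that
      proof (induction rule: comp_induct)
        case (mono m c g)
        have gc: "g \<in> carrier M" using hgens_comp[OF G mono(1)] by simp
        have "\<delta> g \<le> Max (insert 0 (\<delta> ` G))" using mono(1) hgens_finite[OF G] by simp
        hence "n * \<kappa> < monomial_degree m" using mono(3) j unfolding b_def by linarith
        then obtain t where t: "t \<in> {1..n}" "\<kappa> \<le> Poly_Mapping.lookup m t"
          using monomial_degree_ge_imp_large_exponent[OF mono(2)] by blast
        have kt: "k t \<le> \<kappa>" unfolding \<kappa>_def by (rule member_le_sum) (use t in auto)
        hence "Poly_Mapping.single m c = X_var t ^ k t * Poly_Mapping.single (m - Poly_Mapping.single t (k t)) c"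
          using t(2) by (intro single_X_var_factor) simp
        moreover have "Poly_Mapping.single (m - Poly_Mapping.single t (k t)) c \<in> Rn n"
        proof (rule Rn_single, rule subset_trans[OF _ mono(2)], rule subsetI)
          fix x assume "x \<in> Poly_Mapping.keys (m - Poly_Mapping.single t (k t))"
          thus "x \<in> Poly_Mapping.keys m" by (auto simp: in_keys_iff lookup_minus)
        qed
        ultimately show ?case using k[OF t(1)] gc by (simp add: annihilator_iff smult_mult)
      qed auto
      thus ?thesis by auto
    qed
    thus False using unb unfolding bounded_above_def by blast
  qed
  then obtain t where t: "t \<in> {1..n}" "\<And>k. X_var t ^ k \<notin> annihilator n M" by blast
  have XR: "(X_var t :: 'k mpol) \<in> Rn n" using t by simp
  have "\<exists>Q. primeideal Q (poly_ring n) \<and> annihilator n M \<subseteq> Q \<and> Q \<subseteq> irrelevant n \<and> X_var t \<notin> Q"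
  proof (rule R.prime_below[OF annihilator_ideal irrelevant_prime XR])
    fix k :: nat and s :: "'k mpol" assume s: "s \<in> Rn n - irrelevant n"
    show "X_var t [^]\<^bsub>poly_ring n\<^esub> k \<otimes>\<^bsub>poly_ring n\<^esub> s \<notin> annihilator n M"
    proof
      assume "X_var t [^]\<^bsub>poly_ring n\<^esub> k \<otimes>\<^bsub>poly_ring n\<^esub> s \<in> annihilator n M"
      hence a: "X_var t ^ k * s \<in> annihilator n M" by simp
      define c where "c = Poly_Mapping.lookup s 0"
      have c: "c \<noteq> 0" using s by (simp add: irrelevant_def c_def)
      have XH: "(X_var t ^ k :: 'k mpol) \<in> Hom n k" using Hom_power[OF X_var_Hom[OF t(1)]] by simp
      have XkR: "(X_var t ^ k :: 'k mpol) \<in> Rn n" using XR by simp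
      \<comment> \<open>For homogeneous \<open>x\<close> the component of \<open>s \<odot> x\<close>
        in the degree of \<open>x\<close> is \<open>c\<close> times \<open>x\<close>; since
        \<open>c\<close> is invertible, \<open>X_var t ^ k\<close> annihilates \<open>x\<close> by
        itself.\<close>
      have comp: "X_var t ^ k \<odot> x = \<zero>" if x: "x \<in> component M j" for x j
      proof -
        have xc: "x \<in> carrier M" using x by simp
        have "\<zero> = proj ((X_var t ^ k * s) \<odot> x) (j + int k)" using a xc by (simp add: annihilator_iff)
        also have "\<dots> = X_var t ^ k \<odot> proj (s \<odot> x) j"
          using s xc XkR proj_smult[OF _ XH, of "s \<odot> x" "j + int k"] by (simp add: smult_mult)
        also have "\<dots> = X_var t ^ k \<odot> (Poly_Mapping.single 0 c \<odot> x)"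
          using proj_smult_const[OF x, of s] s by (simp add: c_def)
        finally have "Poly_Mapping.single 0 c \<odot> (X_var t ^ k \<odot> x) = \<zero>"
          using smult_comm[OF XkR Rn_const xc, of c] by simp
        hence "Poly_Mapping.single 0 (inverse c) \<odot> (Poly_Mapping.single 0 c \<odot> (X_var t ^ k \<odot> x)) = \<zero>"
          using smult_r_null[of "Poly_Mapping.single 0 (inverse c)"] by simp
        thus ?thesis using c xc XkR smult_mult[of "Poly_Mapping.single 0 (inverse c)" "Poly_Mapping.single 0 c" "X_var t ^ k \<odot> x"]
          by (simp add: mult_single)
      qed
      have "X_var t ^ k \<odot> x = \<zero>" if x: "x \<in> carrier M" for x
      proof (rule proj_all_zero)
        fix i
        show "proj (X_var t ^ k \<odot> x) i = \<zero>" using proj_smult[OF x XH] comp[OF proj_comp[OF x]] by simp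
      qed (use x XkR in simp)
      hence "X_var t ^ k \<in> annihilator n M" using XkR by (simp add: annihilator_iff)
      thus False using t(2) by blast
    qed
  qed
  then obtain Q where Q: "primeideal Q (poly_ring n)" "annihilator n M \<subseteq> Q" "Q \<subseteq> irrelevant n" "X_var t \<notin> Q" by blast
  have "Poly_Mapping.single t 1 \<noteq> (0 :: nat \<Rightarrow>\<^sub>0 nat)" using lookup_single_eq[of t "1 :: nat"] by (metis lookup_zero one_neq_zero)
  hence "X_var t \<in> (irrelevant n :: 'k mpol set)"
    using XR by (simp add: irrelevant_def X_var_def lookup_single when_def)
  hence "Q \<subset> irrelevant n" using Q by blast
  hence "R.prime_chain (annihilator n M) 1 (\<lambda>i. if i = 0 then Q else irrelevant n)"
    unfolding R.prime_chain_def using Q irrelevant_prime by auto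
  from krull_dim_ge[OF this] d show False by (simp add: zero_enat_def one_enat_def)
qed

end

section \<open>Prolonging chains of primes downwards\<close>

context graded_quotient_map
begin

lemma pi_surj_carrier:
  assumes "y \<in> carrier N" shows "\<exists>x\<in>carrier M. \<pi> x = y"
proof -
  have "\<forall>i. \<exists>x. x \<in> component M i \<and> \<pi> x = N.proj y i" using pi_surj N.proj_comp[OF assms] by blast
  then obtain f where f: "\<And>i. f i \<in> component M i" "\<And>i. \<pi> (f i) = N.proj y i" by metis
  have fc: "f i \<in> carrier M" for i using M.comp_carrier[OF f(1)] .
  let ?A = "{i. N.proj y i \<noteq> \<zero>\<^bsub>N\<^esub>}"
  have "\<pi> (finsum M f ?A) = y" using pi_finsum[of ?A f] fc f(2) N.proj_sum[OF assms] by simp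
  thus ?thesis using fc by (intro bexI[of _ "finsum M f ?A"]) (auto intro: M.finsum_closed)
qed

lemma annihilator_mono: "annihilator n M \<subseteq> annihilator n N" and l_annihilates: "l \<in> annihilator n N"
proof -
  show "annihilator n M \<subseteq> annihilator n N"
  proof
    fix a assume a: "a \<in> annihilator n M"
    have "a \<odot>\<^bsub>N\<^esub> y = \<zero>\<^bsub>N\<^esub>" if y: "y \<in> carrier N" for y
    proof -
      obtain x where "x \<in> carrier M" "\<pi> x = y" using pi_surj_carrier[OF y] by blast
      thus ?thesis using a pi_smult[of a x] by (simp add: M.annihilator_iff)
    qed
    thus "a \<in> annihilator n N" using a by (simp add: M.annihilator_iff N.annihilator_iff)
  qed
  have "l \<odot>\<^bsub>N\<^esub> y = \<zero>\<^bsub>N\<^esub>" if y: "y \<in> carrier N" for y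
  proof -
    obtain x where "x \<in> carrier M" "\<pi> x = y" using pi_surj_carrier[OF y] by blast
    thus ?thesis using pi_smult[of l x] pi_l[of x] by simp
  qed
  thus "l \<in> annihilator n N" by (simp add: N.annihilator_iff)
qed

end

context filter_regular_quotient
begin

text \<open>If \<open>P 0\<close> is the irrelevant ideal, it is maximal, so \<open>r = 0\<close>
  and the assumption on the dimension suffices. Otherwise there is a prime below \<open>P 0\<close>
  avoiding \<open>l\<close>: if \<open>l ^ k * s\<close> annihilated \<open>M\<close> with
  \<open>s\<close> outside \<open>P 0\<close>, then \<open>s\<close> would kill everything in large
  degrees, so \<open>s\<close> times any monomial of large degree would annihilate \<open>M\<close>;
  all these monomials would lie in \<open>P 0\<close>, making it irrelevant.\<close>

lemma krull_dim_step:
  assumes fg: "finitely_generated n M" and d: "krull_dim n M \<ge> 1"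
    and P: "M.R.prime_chain (annihilator n N) r P"
  shows "enat (Suc r) \<le> krull_dim n M"
proof (cases "P 0 = irrelevant n")
  case True
  have "r = 0"
  proof (rule ccontr)
    assume "r \<noteq> 0"
    hence "primeideal (P 1) (poly_ring n)" "P 0 \<subset> P (Suc 0)" using P unfolding M.R.prime_chain_def by (auto simp del: One_nat_def)
    hence "primeideal (P 1) (poly_ring n)" "irrelevant n \<subset> P 1" using True by simp_all
    thus False using irrelevant_maximal by blast
  qed
  thus ?thesis using d by (simp add: one_enat_def)
next
  case False
  have P0: "primeideal (P 0) (poly_ring n)" "annihilator n N \<subseteq> P 0" using P unfolding M.R.prime_chain_def by auto
  obtain a where a: "\<And>j. j < a \<Longrightarrow> component M j = {\<zero>\<^bsub>M\<^esub>}" using M.comp_bounded_below[OF fg] by blast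
  have linj: "z = \<zero>\<^bsub>M\<^esub>" if z: "z \<in> carrier M" "\<And>i. i < j0 \<Longrightarrow> M.proj z i = \<zero>\<^bsub>M\<^esub>" "l \<odot>\<^bsub>M\<^esub> z = \<zero>\<^bsub>M\<^esub>" for z
  proof (rule M.proj_all_zero[OF z(1)])
    fix i
    show "M.proj z i = \<zero>\<^bsub>M\<^esub>"
    proof (cases "i < j0")
      case False
      have "l \<odot>\<^bsub>M\<^esub> M.proj z i = M.proj (l \<odot>\<^bsub>M\<^esub> z) (i + int D)" using M.proj_smult[OF z(1) l_Hom, of "i + int D"] by simp
      thus ?thesis using l_regular[of i "M.proj z i"] False z by simp
    qed (use z in auto)
  qed
  have "\<exists>Q. primeideal Q (poly_ring n) \<and> annihilator n M \<subseteq> Q \<and> Q \<subseteq> P 0 \<and> l \<notin> Q"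
  proof (rule M.R.prime_below[OF M.annihilator_ideal P0(1) l_Rn])
    fix k :: nat and s :: "'k mpol" assume s: "s \<in> Rn n - P 0"
    show "l [^]\<^bsub>poly_ring n\<^esub> k \<otimes>\<^bsub>poly_ring n\<^esub> s \<notin> annihilator n M"
    proof
      assume "l [^]\<^bsub>poly_ring n\<^esub> k \<otimes>\<^bsub>poly_ring n\<^esub> s \<in> annihilator n M"
      hence ann: "l ^ k * s \<in> annihilator n M" by simp
      \<comment> \<open>The components of \<open>x\<close> start in degree \<open>a\<close>; a
        monomial of degree at least \<open>nat (j0 - a)\<close> moves them to degrees where
        \<open>l\<close> is injective.\<close>
      have "Poly_Mapping.single m 1 \<in> P 0" if m: "Poly_Mapping.keys m \<subseteq> {1..n}" "nat (j0 - a) \<le> monomial_degree m" for m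
      proof -
        have mH: "(Poly_Mapping.single m 1 :: 'k mpol) \<in> Hom n (monomial_degree m)" by (rule Hom_single[OF m(1)])
        have mR: "(Poly_Mapping.single m 1 :: 'k mpol) \<in> Rn n" by (rule Hom_Rn[OF mH])
        have "(s * Poly_Mapping.single m 1) \<odot>\<^bsub>M\<^esub> x = \<zero>\<^bsub>M\<^esub>" if x: "x \<in> carrier M" for x
        proof -
          define y where "y = Poly_Mapping.single m 1 \<odot>\<^bsub>M\<^esub> x"
          have yc: "y \<in> carrier M" using x mR by (simp add: y_def)
          have y0: "M.proj y i = \<zero>\<^bsub>M\<^esub>" if "i < j0" for i
          proof -
            have "i - int (monomial_degree m) < a" using that m(2) by linarith
            hence "M.proj x (i - int (monomial_degree m)) = \<zero>\<^bsub>M\<^esub>" using a M.proj_comp[OF x] by blast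
            thus ?thesis using M.proj_smult[OF x mH, of i] mR by (simp add: y_def)
          qed
          define z where "z = s \<odot>\<^bsub>M\<^esub> y"
          have zc: "z \<in> carrier M" using yc s by (simp add: z_def)
          have z0: "M.proj z i = \<zero>\<^bsub>M\<^esub>" if "i < j0" for i
            unfolding z_def by (rule M.proj_smult_below[OF yc y0 _ that]) (use s in auto)
          have lk0: "M.proj (l ^ q \<odot>\<^bsub>M\<^esub> z) i = \<zero>\<^bsub>M\<^esub>" if "i < j0" for i q
            by (rule M.proj_smult_below[OF zc z0 _ that]) auto
          have "l ^ k \<odot>\<^bsub>M\<^esub> z = \<zero>\<^bsub>M\<^esub>"
            using ann yc s by (simp add: M.annihilator_iff z_def M.smult_mult)
          hence "z = \<zero>\<^bsub>M\<^esub>"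
          proof (induction k)
            case 0
            thus ?case using zc by simp
          next
            case (Suc k)
            have "l \<odot>\<^bsub>M\<^esub> (l ^ k \<odot>\<^bsub>M\<^esub> z) = \<zero>\<^bsub>M\<^esub>" using Suc.prems zc by (simp add: M.smult_mult)
            hence "l ^ k \<odot>\<^bsub>M\<^esub> z = \<zero>\<^bsub>M\<^esub>" by (rule linj[rotated 2]) (use zc lk0 in auto)
            thus ?case by (rule Suc.IH)
          qed
          thus ?thesis using x s mR by (simp add: z_def y_def M.smult_mult)
        qed
        hence "s * Poly_Mapping.single m 1 \<in> annihilator n M" using s mR by (simp add: M.annihilator_iff)
        hence "s * Poly_Mapping.single m 1 \<in> P 0" using annihilator_mono P0(2) by blast
        thus ?thesis using primeD(5)[OF P0(1), of s "Poly_Mapping.single m 1"] s mR by auto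
      qed
      hence "irrelevant n \<subseteq> P 0" by (rule prime_contains_irrelevant[OF P0(1)])
      thus False using irrelevant_maximal[OF P0(1)] False by blast
    qed
  qed
  then obtain Q where Q: "primeideal Q (poly_ring n)" "annihilator n M \<subseteq> Q" "Q \<subseteq> P 0" "l \<notin> Q" by blast
  have "l \<in> P 0" using l_annihilates P0(2) by blast
  hence QP: "Q \<subset> P 0" using Q by blast
  have "M.R.prime_chain (annihilator n M) (Suc r) (\<lambda>i. case i of 0 \<Rightarrow> Q | Suc i \<Rightarrow> P i)"
    unfolding M.R.prime_chain_def
  proof (intro conjI allI impI)
    fix i assume i: "i \<le> Suc r"
    show "primeideal (case i of 0 \<Rightarrow> Q | Suc i \<Rightarrow> P i) (poly_ring n)"
      using P Q i unfolding M.R.prime_chain_def by (cases i) auto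
    show "annihilator n M \<subseteq> (case i of 0 \<Rightarrow> Q | Suc i \<Rightarrow> P i)"
    proof (cases i)
      case (Suc i')
      hence "annihilator n N \<subseteq> P i'" using P i unfolding M.R.prime_chain_def by simp
      thus ?thesis using annihilator_mono Suc by simp
    qed (simp add: Q(2))
  next
    fix i assume i: "i < Suc r"
    show "(case i of 0 \<Rightarrow> Q | Suc i \<Rightarrow> P i) \<subset> (case Suc i of 0 \<Rightarrow> Q | Suc i \<Rightarrow> P i)"
      using P QP i unfolding M.R.prime_chain_def by (cases i) auto
  qed
  thus ?thesis by (rule M.krull_dim_ge)
qed

end

section \<open>Growth of the Hilbert function bounds the dimension\<close>

text \<open>Exponents are kept in a list so that removing the head goes along with shifting both
  \<open>f\<close> and the chain of primes.\<close>

fun mon :: "(nat \<Rightarrow> 'k::field mpol) \<Rightarrow> nat list \<Rightarrow> 'k mpol" where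
  "mon f [] = 1"
| "mon f (k # \<alpha>) = f 0 ^ k * mon (\<lambda>i. f (Suc i)) \<alpha>"

lemma mon_Rn: "(\<And>i. i < length \<alpha> \<Longrightarrow> f i \<in> Rn n) \<Longrightarrow> mon f \<alpha> \<in> Rn n"
proof (induction \<alpha> arbitrary: f)
  case (Cons k \<alpha>)
  have "mon (\<lambda>i. f (Suc i)) \<alpha> \<in> Rn n" by (rule Cons.IH) (use Cons.prems in auto)
  thus ?case using Cons.prems[of 0] by simp
qed simp

definition deg_le :: "'k::field mpol \<Rightarrow> nat \<Rightarrow> bool" where
  "deg_le p d \<longleftrightarrow> (\<forall>m\<in>Poly_Mapping.keys p. monomial_degree m \<le> d)"

lemma deg_le_mult: "deg_le p a \<Longrightarrow> deg_le q b \<Longrightarrow> deg_le (p * q) (a + b)"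
  unfolding deg_le_def using keys_mult[of p q] by (fastforce simp: monomial_degree_add intro: add_mono)

lemma deg_le_power: "deg_le p a \<Longrightarrow> deg_le (p ^ k) (a * k)"
  by (induction k) (auto simp: deg_le_def[of 1] dest: deg_le_mult)

lemma deg_le_mono: "deg_le p a \<Longrightarrow> a \<le> b \<Longrightarrow> deg_le p b"
  unfolding deg_le_def by (meson le_trans)

lemma deg_le_mon: "(\<And>i. i < length \<alpha> \<Longrightarrow> deg_le (f i) c) \<Longrightarrow> deg_le (mon f \<alpha>) (c * sum_list \<alpha>)"
proof (induction \<alpha> arbitrary: f)
  case (Cons k \<alpha>)
  have "deg_le (mon (\<lambda>i. f (Suc i)) \<alpha>) (c * sum_list \<alpha>)" by (rule Cons.IH) (use Cons.prems in auto)
  hence "deg_le (f 0 ^ k * mon (\<lambda>i. f (Suc i)) \<alpha>) (c * k + c * sum_list \<alpha>)"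
    using Cons.prems[of 0] by (intro deg_le_mult deg_le_power) auto
  thus ?case by (simp add: algebra_simps)
qed (simp add: deg_le_def)

lemma deg_le_exists: "\<exists>d. deg_le p d"
  unfolding deg_le_def by (intro exI[of _ "\<Sum>m\<in>Poly_Mapping.keys p. monomial_degree m"]) (auto intro: member_le_sum)

definition exp_lists :: "nat \<Rightarrow> nat \<Rightarrow> nat list set" where
  "exp_lists r t = {\<alpha>. set \<alpha> \<subseteq> {..t} \<and> length \<alpha> = r}"

lemma finite_exp_lists: "finite (exp_lists r t)" and card_exp_lists: "card (exp_lists r t) = Suc t ^ r"
  unfolding exp_lists_def using finite_lists_length_eq[of "{..t}" r] card_lists_length_eq[of "{..t}" r] by auto

lemma exp_lists_0: "exp_lists 0 t = {[]}"
  by (auto simp: exp_lists_def)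

lemma sum_exp_lists_Suc: "(\<Sum>\<alpha>\<in>exp_lists (Suc r) t. h \<alpha>) = (\<Sum>k\<le>t. \<Sum>\<beta>\<in>exp_lists r t. h (k # \<beta>))"
proof -
  have "exp_lists (Suc r) t = (\<lambda>(k, \<beta>). k # \<beta>) ` ({..t} \<times> exp_lists r t)"
    by (force simp: exp_lists_def length_Suc_conv image_iff)
  moreover have "inj_on (\<lambda>(k, \<beta>). k # \<beta>) ({..t} \<times> exp_lists r t)" by (auto simp: inj_on_def)
  ultimately show ?thesis by (simp add: sum.reindex sum.cartesian_product case_prod_unfold)
qed

text \<open>Elements chosen from the successive differences of a chain of primes are algebraically
  independent modulo the smallest one: reducing modulo the next prime kills the first element.\<close>

lemma mon_independent:
  fixes f :: "nat \<Rightarrow> 'k::field mpol"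
  assumes "\<And>i. i \<le> r \<Longrightarrow> primeideal (P i) (poly_ring n)"
    and "\<And>i. i < r \<Longrightarrow> P i \<subseteq> P (Suc i) \<and> f i \<in> P (Suc i) \<and> f i \<notin> P i"
    and "(\<Sum>\<alpha>\<in>exp_lists r t. Poly_Mapping.single 0 (c \<alpha>) * mon f \<alpha>) \<in> P 0" and "\<alpha> \<in> exp_lists r t"
  shows "c \<alpha> = 0"
  using assms
proof (induction r arbitrary: P f c \<alpha>)
  case 0
  thus ?case using primeD(6)[OF 0(1)[of 0], of "c []"] by (auto simp: exp_lists_0)
next
  case (Suc r)
  let ?f = "\<lambda>i. f (Suc i)" and ?P = "\<lambda>i. P (Suc i)"
  have P0: "primeideal (P 0) (poly_ring n)" and P1: "primeideal (P 1) (poly_ring n)" using Suc.prems(1) by auto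
  have f: "f 0 \<in> P 1" "f 0 \<notin> P 0" "P 0 \<subseteq> P 1" using Suc.prems(2)[of 0] by auto
  have fR: "f i \<in> Rn n" if "i < Suc r" for i
    using Suc.prems(2)[OF that] prime_Rn[OF Suc.prems(1)[of "Suc i"]] that by auto
  have IH: "d \<beta> = 0" if "(\<Sum>\<beta>\<in>exp_lists r t. Poly_Mapping.single 0 (d \<beta>) * mon ?f \<beta>) \<in> P 1" "\<beta> \<in> exp_lists r t" for d \<beta>
    by (rule Suc.IH[of ?P ?f d]) (use Suc.prems(1,2) that in auto)
  define Q where "Q d = (\<Sum>\<beta>\<in>exp_lists r t. Poly_Mapping.single 0 (d \<beta>) * mon ?f \<beta>)" for d :: "nat list \<Rightarrow> 'k"
  have QR: "Q d \<in> Rn n" for d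
    unfolding Q_def using fR by (intro Rn_sum Rn_mult mon_Rn) (auto simp: exp_lists_def)
  \<comment> \<open>In the manner of Horner's scheme: the part without \<open>f 0\<close> lies in
    \<open>P 1\<close>, so its coefficients vanish by the outer induction; then a factor
    \<open>f 0\<close>, which is outside the prime \<open>P 0\<close>, is cancelled from the
    rest.\<close>
  have inner: "\<forall>k<T. \<forall>\<beta>\<in>exp_lists r t. d k \<beta> = 0" if "(\<Sum>k<T. f 0 ^ k * Q (d k)) \<in> P 0" for T and d :: "nat \<Rightarrow> nat list \<Rightarrow> 'k"
    using that
  proof (induction T arbitrary: d)
    case (Suc T)
    define S where "S = (\<Sum>k<T. f 0 ^ k * Q (d (Suc k)))"
    have SR: "S \<in> Rn n" unfolding S_def using fR[of 0] QR by (intro Rn_sum) auto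
    have e: "(\<Sum>k<Suc T. f 0 ^ k * Q (d k)) = Q (d 0) + f 0 * S"
      unfolding S_def sum_distrib_left by (subst sum.lessThan_Suc_shift) (simp add: mult.assoc)
    have "S * f 0 \<in> P 1" by (rule primeD(4)[OF P1 f(1) SR])
    moreover have "Q (d 0) + f 0 * S \<in> P 1" using Suc.prems f(3) unfolding e by blast
    ultimately have "Q (d 0) + f 0 * S - S * f 0 \<in> P 1" using primeD(3)[OF P1] by blast
    hence "Q (d 0) \<in> P 1" by (simp add: mult.commute)
    hence d0: "d 0 \<beta> = 0" if "\<beta> \<in> exp_lists r t" for \<beta> using IH that unfolding Q_def by blast
    hence "Q (d 0) = 0" unfolding Q_def by simp
    hence "f 0 * S \<in> P 0" using Suc.prems unfolding e by simp
    hence "S \<in> P 0" using primeD(5)[OF P0 fR[of 0] SR] f(2) by auto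
    hence "\<forall>k<T. \<forall>\<beta>\<in>exp_lists r t. d (Suc k) \<beta> = 0" using Suc.IH[of "\<lambda>k. d (Suc k)"] unfolding S_def by blast
    thus ?case using d0 by (auto simp: less_Suc_eq_0_disj)
  qed simp
  have "(\<Sum>\<alpha>\<in>exp_lists (Suc r) t. Poly_Mapping.single 0 (c \<alpha>) * mon f \<alpha>) = (\<Sum>k<Suc t. f 0 ^ k * Q (\<lambda>\<beta>. c (k # \<beta>)))"
    unfolding sum_exp_lists_Suc Q_def lessThan_Suc_atMost by (simp add: sum_distrib_left mult_ac)
  hence "(\<Sum>k<Suc t. f 0 ^ k * Q (\<lambda>\<beta>. c (k # \<beta>))) \<in> P 0" using Suc.prems(3) by simp
  from inner[OF this] have all: "\<forall>k<Suc t. \<forall>\<beta>\<in>exp_lists r t. c (k # \<beta>) = 0" .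
  obtain k \<beta> where "\<alpha> = k # \<beta>" "k \<le> t" "\<beta> \<in> exp_lists r t"
    using Suc.prems(4) by (auto simp: exp_lists_def length_Suc_conv)
  thus ?case using all by auto
qed

context graded_poly_module
begin

text \<open>All \<open>v \<alpha>\<close> lie in the sum of the components of the \<open>T\<close>
  degrees starting with \<open>a\<close>, whose dimension is at most the right-hand side.\<close>

lemma indep_card_le:
  assumes fg: "finitely_generated n M" and I: "finite I" and v: "\<And>\<alpha>. \<alpha> \<in> I \<Longrightarrow> v \<alpha> \<in> carrier M"
    and ind: "\<And>c \<alpha>. (\<Oplus>\<alpha>\<in>I. Poly_Mapping.single 0 (c \<alpha>) \<odot> v \<alpha>) = \<zero> \<Longrightarrow> \<alpha> \<in> I \<Longrightarrow> c \<alpha> = 0"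
    and pr: "\<And>\<alpha> i. \<alpha> \<in> I \<Longrightarrow> i < a \<or> i \<ge> a + int T \<Longrightarrow> proj (v \<alpha>) i = \<zero>"
  shows "card I \<le> (\<Sum>i<T. hilbert_function M (a + int i))"
proof -
  have "\<forall>i. \<exists>S. finite S \<and> S \<subseteq> component M (a + int i) \<and> K.span S = component M (a + int i) \<and> card S = hilbert_function M (a + int i)"
    using findim_basis[OF component_findim[OF fg]] unfolding hilbert_function_def by blast
  then obtain S where S: "\<And>i. finite (S i)" "\<And>i. S i \<subseteq> component M (a + int i)" "\<And>i. K.span (S i) = component M (a + int i)"
    "\<And>i. card (S i) = hilbert_function M (a + int i)" by metis
  define B where "B = (\<Union>i<T. S i)"
  have Bc: "B \<subseteq> carrier M" unfolding B_def using S(2) comp_subset by blast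
  have finB: "finite B" unfolding B_def using S(1) by simp
  define W where "W = K.span B"
  have kW: "ksub W" unfolding W_def by (rule ksub_span[OF Bc])
  have BW: "B \<subseteq> W" unfolding W_def using in_span[OF Bc] by blast
  have compW: "component M (a + int i) \<subseteq> W" if "i < T" for i
  proof -
    have "S i \<subseteq> W" using BW that unfolding B_def by blast
    thus ?thesis using span_least[OF kW] S(3) by blast
  qed
  have vW: "v \<alpha> \<in> W" if \<alpha>: "\<alpha> \<in> I" for \<alpha>
  proof -
    have p: "proj (v \<alpha>) i \<in> W" for i
    proof (cases "i < a \<or> i \<ge> a + int T")
      case True
      thus ?thesis using pr[OF \<alpha>] kW by (simp add: ksub_def)
    next
      case False
      hence "nat (i - a) < T" "a + int (nat (i - a)) = i" by auto
      thus ?thesis using compW[of "nat (i - a)"] proj_comp[OF v[OF \<alpha>], of i] by auto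
    qed
    have "finsum M (proj (v \<alpha>)) A \<in> W" if "finite A" for A
      using that
    proof (induction A)
      case (insert i A)
      have "proj (v \<alpha>) \<in> A \<rightarrow> carrier M" "proj (v \<alpha>) i \<in> carrier M" using v[OF \<alpha>] by auto
      thus ?case using insert p kW by (simp add: finsum_insert ksub_def)
    qed (use kW in \<open>simp add: ksub_def\<close>)
    from this[OF proj_finite[OF v[OF \<alpha>]]] show ?thesis using proj_sum[OF v[OF \<alpha>]] by simp
  qed
  have ce: "(\<Oplus>\<alpha>\<in>I. Poly_Mapping.single 0 (c \<alpha>) \<odot> v \<alpha>) = Poly_Mapping.single 0 (c \<alpha>) \<odot> v \<alpha> \<oplus> Poly_Mapping.single 0 (c \<beta>) \<odot> v \<beta>"
    if ab: "\<alpha> \<in> I" "\<beta> \<in> I" "\<alpha> \<noteq> \<beta>" "\<And>\<gamma>. \<gamma> \<in> I \<Longrightarrow> \<gamma> \<noteq> \<alpha> \<Longrightarrow> \<gamma> \<noteq> \<beta> \<Longrightarrow> c \<gamma> = 0" for c \<alpha> \<beta>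
  proof -
    have "(\<Oplus>\<gamma>\<in>I. Poly_Mapping.single 0 (c \<gamma>) \<odot> v \<gamma>) = (\<Oplus>\<gamma>\<in>{\<alpha>, \<beta>}. Poly_Mapping.single 0 (c \<gamma>) \<odot> v \<gamma>)"
      by (rule finsum_mono_neutral[symmetric]) (use I ab v in auto)
    thus ?thesis using ab v by simp
  qed
  have inj: "inj_on v I"
  proof (rule inj_onI, rule ccontr)
    fix \<alpha> \<beta> assume ab: "\<alpha> \<in> I" "\<beta> \<in> I" "v \<alpha> = v \<beta>" "\<alpha> \<noteq> \<beta>"
    \<comment> \<open>Equal vectors at two indices satisfy the relation with coefficients
      \<open>1\<close> and \<open>-1\<close>.\<close>
    define c where "c \<gamma> = (if \<gamma> = \<alpha> then 1 else if \<gamma> = \<beta> then -1 else 0 :: 'k)" for \<gamma>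
    have cv: "c \<alpha> = 1" "c \<beta> = - 1" using ab(4) by (auto simp: c_def)
    have m1: "(Poly_Mapping.single 0 (- 1) :: 'k mpol) = - 1" by (simp add: single_uminus)
    have "(\<Oplus>\<gamma>\<in>I. Poly_Mapping.single 0 (c \<gamma>) \<odot> v \<gamma>) = Poly_Mapping.single 0 (c \<alpha>) \<odot> v \<alpha> \<oplus> Poly_Mapping.single 0 (c \<beta>) \<odot> v \<beta>"
      by (rule ce[OF ab(1,2,4)]) (simp add: c_def)
    also have "\<dots> = v \<beta> \<oplus> (- 1) \<odot> v \<beta>" unfolding cv m1 ab(3) using v[OF ab(2)] by simp
    also have "\<dots> = \<zero>" using smult_uminus[of 1 "v \<beta>"] v[OF ab(2)] by (simp add: r_neg)
    finally have "c \<alpha> = 0" by (rule ind) (use ab in auto)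
    thus False by (simp add: c_def)
  qed
  have vI: "v ` I \<subseteq> carrier M" using v by auto
  have li: "K.lin_indpt (v ` I)"
  proof (rule K.finite_lin_indpt2)
    fix b assume b: "b \<in> v ` I \<rightarrow> carrier coeff_field" and l0: "K.lincomb b (v ` I) = \<zero>"
    define c where "c \<alpha> = Poly_Mapping.lookup (b (v \<alpha>)) 0" for \<alpha>
    have bc: "b (v \<alpha>) = Poly_Mapping.single 0 (c \<alpha>)" if "\<alpha> \<in> I" for \<alpha>
    proof -
      have "b (v \<alpha>) \<in> carrier coeff_field" using b that by blast
      then obtain x where "b (v \<alpha>) = Poly_Mapping.single 0 x" unfolding coeff_field_simps by blast
      thus ?thesis by (simp add: c_def)
    qed
    have "K.lincomb b (v ` I) = (\<Oplus>\<alpha>\<in>I. b (v \<alpha>) \<odot> v \<alpha>)"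
      unfolding K.lincomb_def by (rule finsum_reindex[OF _ inj]) (use bc v in auto)
    also have "\<dots> = (\<Oplus>\<alpha>\<in>I. Poly_Mapping.single 0 (c \<alpha>) \<odot> v \<alpha>)"
      by (rule finsum_cong') (use bc v in auto)
    finally have "(\<Oplus>\<alpha>\<in>I. Poly_Mapping.single 0 (c \<alpha>) \<odot> v \<alpha>) = \<zero>" using l0 by simp
    hence "c \<alpha> = 0" if "\<alpha> \<in> I" for \<alpha> using ind that by blast
    thus "\<forall>w\<in>v ` I. b w = \<zero>\<^bsub>coeff_field\<^esub>" using bc by auto
  qed (use I vI in auto)
  interpret W: vectorspace coeff_field "M\<lparr>carrier := W\<rparr>" by (rule ksub_vectorspace[OF kW])
  have vIW: "v ` I \<subseteq> W" using vW by auto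
  have "card (v ` I) \<le> card B"
    by (rule W.li_smaller_than_gen) (use I finB vIW BW li ksub_lin_dep_eq[OF kW vIW] ksub_span_eq[OF kW BW] in \<open>auto simp: W_def\<close>)
  also have "\<dots> \<le> (\<Sum>i<T. card (S i))" unfolding B_def by (rule card_UN_le) simp
  finally show ?thesis using S(4) card_image[OF inj] by simp
qed

text \<open>A bound of order \<open>T ^ e\<close> for the sum of the first \<open>T\<close> values.
  It is required for every \<open>a\<close> below which \<open>M\<close> vanishes, so that one
  starting degree can serve a module and its quotient.\<close>

definition growth_le :: "nat \<Rightarrow> bool" where
  "growth_le e \<longleftrightarrow> (\<forall>a. (\<forall>j<a. component M j = {\<zero>}) \<longrightarrow> (\<exists>C. \<forall>T. (\<Sum>i<T. hilbert_function M (a + int i)) \<le> C * T ^ e))"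

lemma growth_le_bounded:
  assumes fg: "finitely_generated n M" and b: "bounded_above" shows "growth_le 0"
  unfolding growth_le_def
proof (intro allI impI)
  fix a assume "\<forall>j<a. component M j = {\<zero>}"
  obtain j0 where j0: "\<And>j. j \<ge> j0 \<Longrightarrow> component M j = {\<zero>}" using b unfolding bounded_above_def by blast
  let ?U = "nat (j0 - a)"
  have "(\<Sum>i<T. hilbert_function M (a + int i)) \<le> (\<Sum>i<?U. hilbert_function M (a + int i))" for T
  proof -
    have "(\<Sum>i<T. hilbert_function M (a + int i)) = (\<Sum>i\<in>{..<T} \<inter> {..<?U}. hilbert_function M (a + int i))"
    proof (rule sum.mono_neutral_right)
      show "\<forall>i\<in>{..<T} - {..<T} \<inter> {..<?U}. hilbert_function M (a + int i) = 0"
        using j0 by (auto simp: hilbert_zero_iff[OF fg])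
    qed auto
    also have "\<dots> \<le> (\<Sum>i<?U. hilbert_function M (a + int i))" by (rule sum_mono2) auto
    finally show ?thesis .
  qed
  thus "\<exists>C. \<forall>T. (\<Sum>i<T. hilbert_function M (a + int i)) \<le> C * T ^ 0" by auto
qed

text \<open>Some generator \<open>g\<close> is annihilated only by elements of the smallest prime of the chain. The
  multiples of \<open>g\<close> by the independent monomials of \<open>mon_independent\<close> with exponents at most \<open>t\<close>
  are then linearly independent, and their degrees are linear in \<open>t\<close>.\<close>

theorem krull_dim_le_growth:
  assumes fg: "finitely_generated n M" and gr: "growth_le e"
  shows "krull_dim n M \<le> enat e"
proof (rule krull_dim_le)
  fix r P assume ch: "R.prime_chain (annihilator n M) r P"
  have P: "primeideal (P i) (poly_ring n)" "annihilator n M \<subseteq> P i" if "i \<le> r" for i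
    using ch that unfolding R.prime_chain_def by auto
  have inc: "P i \<subset> P (Suc i)" if "i < r" for i using ch that unfolding R.prime_chain_def by auto
  have P0: "primeideal (P 0) (poly_ring n)" using P by simp
  have "\<forall>i. \<exists>f. i < r \<longrightarrow> f \<in> P (Suc i) \<and> f \<notin> P i" using inc by blast
  then obtain f where f: "\<And>i. i < r \<Longrightarrow> f i \<in> P (Suc i) \<and> f i \<notin> P i" by metis
  have fR: "f i \<in> Rn n" if "i < r" for i using f[OF that] prime_Rn[OF P(1)[of "Suc i"]] that by auto
  have "\<forall>i. \<exists>d. deg_le (f i) d" using deg_le_exists by blast
  then obtain d where d: "\<And>i. deg_le (f i) (d i)" by metis
  define c where "c = (\<Sum>i<r. d i)"
  have dc: "deg_le (f i) c" if "i < r" for i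
    by (rule deg_le_mono[OF d]) (use that in \<open>auto simp: c_def intro: member_le_sum\<close>)
  obtain G \<delta> where G: "hgens G \<delta>" using hgens_exists[OF fg] by blast
  note finG = hgens_finite[OF G]
  have gc: "g \<in> carrier M" if "g \<in> G" for g using hgens_comp[OF G that] by simp
  \<comment> \<open>Otherwise each generator is killed by some scalar outside \<open>P 0\<close>.
    The product of these scalars annihilates \<open>M\<close> and so lies in \<open>P 0\<close>,
    against primality.\<close>
  have "\<exists>g\<in>G. \<forall>a\<in>Rn n. a \<odot> g = \<zero> \<longrightarrow> a \<in> P 0"
  proof (rule ccontr)
    assume "\<not> ?thesis"
    then obtain b where b: "\<And>g. g \<in> G \<Longrightarrow> b g \<in> Rn n \<and> b g \<odot> g = \<zero> \<and> b g \<notin> P 0" by metis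
    have np: "(\<Prod>g\<in>A. b g) \<in> Rn n - P 0" if "finite A" "A \<subseteq> G" for A
      using that
    proof (induction A)
      case empty
      thus ?case using primeD(6)[OF P0, of 1] by simp
    next
      case (insert g A)
      thus ?case using b[of g] primeD(5)[OF P0, of "b g" "\<Prod>g\<in>A. b g"] by auto
    qed
    have ann: "(\<Prod>g\<in>G. b g) \<odot> x = \<zero>" if "x \<in> carrier M" for x
    proof -
      have "carrier M \<subseteq> {x \<in> carrier M. (\<Prod>g\<in>G. b g) \<odot> x = \<zero>}"
      proof (rule hgens_submodule[OF G])
        have pR: "(\<Prod>g\<in>G. b g) \<in> Rn n" using np[OF finG] by auto
        show "G \<subseteq> {x \<in> carrier M. (\<Prod>g\<in>G. b g) \<odot> x = \<zero>}"
        proof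
          fix g assume g: "g \<in> G"
          have "(\<Prod>g\<in>G. b g) = (\<Prod>g\<in>G - {g}. b g) * b g" using prod.remove[OF finG g, of b] by (simp add: mult.commute)
          moreover have "(\<Prod>g\<in>G - {g}. b g) \<in> Rn n" using np[of "G - {g}"] finG by auto
          ultimately show "g \<in> {x \<in> carrier M. (\<Prod>g\<in>G. b g) \<odot> x = \<zero>}" using b[OF g] gc[OF g] by (simp add: smult_mult)
        qed
        show "\<zero> \<in> {x \<in> carrier M. (\<Prod>g\<in>G. b g) \<odot> x = \<zero>}" using pR by simp
        show "x \<oplus> y \<in> {x \<in> carrier M. (\<Prod>g\<in>G. b g) \<odot> x = \<zero>}"
          if "x \<in> {x \<in> carrier M. (\<Prod>g\<in>G. b g) \<odot> x = \<zero>}" "y \<in> {x \<in> carrier M. (\<Prod>g\<in>G. b g) \<odot> x = \<zero>}" for x y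
          using that pR by (simp add: smult_r_distr)
        show "p \<odot> x \<in> {x \<in> carrier M. (\<Prod>g\<in>G. b g) \<odot> x = \<zero>}"
          if "p \<in> Rn n" "x \<in> {x \<in> carrier M. (\<Prod>g\<in>G. b g) \<odot> x = \<zero>}" for p x
          using that pR smult_comm[OF pR that(1), of x] by simp
      qed
      thus ?thesis using that by blast
    qed
    hence "(\<Prod>g\<in>G. b g) \<in> annihilator n M" using np[OF finG] by (simp add: annihilator_iff)
    thus False using np[OF finG] P(2)[of 0] by blast
  qed
  then obtain g where g: "g \<in> G" "\<And>a. a \<in> Rn n \<Longrightarrow> a \<odot> g = \<zero> \<Longrightarrow> a \<in> P 0" by blast
  have gcomp: "g \<in> component M (\<delta> g)" by (rule hgens_comp[OF G g(1)])
  obtain a where a: "\<And>j. j < a \<Longrightarrow> component M j = {\<zero>}" using comp_bounded_below[OF fg] by blast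
  have "g \<noteq> \<zero>"
  proof
    assume "g = \<zero>"
    hence "1 \<in> P 0" using g(2)[of 1] by simp
    thus False using primeD(6)[OF P0, of 1] by simp
  qed
  hence ag: "a \<le> \<delta> g" using a[of "\<delta> g"] gcomp by fastforce
  obtain C where C: "\<And>T. (\<Sum>i<T. hilbert_function M (a + int i)) \<le> C * T ^ e"
    using gr a unfolding growth_le_def by blast
  \<comment> \<open>Exponents up to \<open>t\<close> reach degrees in a range of length
    \<open>T\<close> linear in \<open>t\<close>; \<open>w\<close> is chosen to have
    \<open>T \<le> w * Suc t\<close>.\<close>
  define w where "w = nat (\<delta> g - a) + c * r + 1"
  have bound: "Suc t ^ r \<le> C * (w * Suc t) ^ e" for t
  proof -
    define T where "T = nat (\<delta> g - a) + c * (r * t) + 1"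
    let ?v = "\<lambda>\<alpha>. mon f \<alpha> \<odot> g"
    have mR: "mon f \<alpha> \<in> Rn n" if "\<alpha> \<in> exp_lists r t" for \<alpha>
      by (rule mon_Rn) (use that fR in \<open>auto simp: exp_lists_def\<close>)
    have "card (exp_lists r t) \<le> (\<Sum>i<T. hilbert_function M (a + int i))"
    proof (rule indep_card_le[OF fg finite_exp_lists, where v = ?v])
      show "?v \<alpha> \<in> carrier M" if "\<alpha> \<in> exp_lists r t" for \<alpha> using mR[OF that] gc[OF g(1)] by simp
      show "b \<alpha> = 0" if b: "(\<Oplus>\<alpha>\<in>exp_lists r t. Poly_Mapping.single 0 (b \<alpha>) \<odot> ?v \<alpha>) = \<zero>" and \<alpha>: "\<alpha> \<in> exp_lists r t" for b \<alpha>
      proof -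
        have "(\<Sum>\<alpha>\<in>exp_lists r t. Poly_Mapping.single 0 (b \<alpha>) * mon f \<alpha>) \<odot> g = (\<Oplus>\<alpha>\<in>exp_lists r t. (Poly_Mapping.single 0 (b \<alpha>) * mon f \<alpha>) \<odot> g)"
          by (rule smult_sum) (use mR gc g finite_exp_lists in auto)
        also have "\<dots> = (\<Oplus>\<alpha>\<in>exp_lists r t. Poly_Mapping.single 0 (b \<alpha>) \<odot> ?v \<alpha>)"
          by (rule finsum_cong') (use mR gc g in \<open>auto simp: smult_mult\<close>)
        finally have "(\<Sum>\<alpha>\<in>exp_lists r t. Poly_Mapping.single 0 (b \<alpha>) * mon f \<alpha>) \<in> P 0"
          using b mR by (intro g(2) Rn_sum) auto
        thus ?thesis by (rule mon_independent[rotated 2]) (use P psubset_imp_subset[OF inc] f \<alpha> in auto)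
      qed
      show "proj (?v \<alpha>) i = \<zero>" if \<alpha>: "\<alpha> \<in> exp_lists r t" and i: "i < a \<or> i \<ge> a + int T" for \<alpha> i
      proof -
        have "sum_list \<alpha> \<le> r * t"
          using sum_list_mono[of \<alpha> "\<lambda>x. x" "\<lambda>_. t"] \<alpha> by (auto simp: exp_lists_def sum_list_triv subset_iff)
        hence "deg_le (mon f \<alpha>) (c * (r * t))"
          using \<alpha> dc by (intro deg_le_mono[OF deg_le_mon[of \<alpha> f c]]) (auto simp: exp_lists_def)
        hence "Poly_Mapping.single m (Poly_Mapping.lookup (mon f \<alpha>) m) \<odot> proj g (i - int (monomial_degree m)) = \<zero>"
          if m: "m \<in> Poly_Mapping.keys (mon f \<alpha>)" for m
        proof -
          have mRn: "(Poly_Mapping.single m (Poly_Mapping.lookup (mon f \<alpha>) m) :: 'k mpol) \<in> Rn n"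
            by (rule Rn_single) (use mR[OF \<alpha>] m in \<open>auto simp: mem_Rn\<close>)
          have "monomial_degree m \<le> c * (r * t)" using \<open>deg_le (mon f \<alpha>) (c * (r * t))\<close> m by (auto simp: deg_le_def)
          hence "int (monomial_degree m) \<le> int (c * (r * t))" by (rule of_nat_mono)
          moreover have "a + int T = \<delta> g + int (c * (r * t)) + 1" using ag by (simp add: T_def)
          ultimately have "i - int (monomial_degree m) \<noteq> \<delta> g" using i ag by linarith
          thus ?thesis using proj_of_comp[OF gcomp] mRn by simp
        qed
        thus ?thesis unfolding proj_smult_sum[OF gc[OF g(1)] mR[OF \<alpha>]] by (intro add.finprod_one_eqI) auto
      qed
    qed
    also have "\<dots> \<le> C * T ^ e" by (rule C)
    also have "\<dots> \<le> C * (w * Suc t) ^ e"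
      by (intro mult_le_mono2 power_mono) (auto simp: T_def w_def algebra_simps)
    finally show ?thesis by (simp add: card_exp_lists)
  qed
  have "r \<le> e"
  proof (rule ccontr)
    assume "\<not> r \<le> e"
    \<comment> \<open>For this \<open>t\<close> the bound reads
      \<open>Suc t ^ r \<le> t * Suc t ^ e\<close>, which fails for \<open>r > e\<close>.\<close>
    define t where "t = C * w ^ e"
    have "Suc t ^ Suc e \<le> Suc t ^ r" using \<open>\<not> r \<le> e\<close> by (intro power_increasing) auto
    also have "\<dots> \<le> C * (w * Suc t) ^ e" by (rule bound)
    also have "\<dots> = t * Suc t ^ e" by (simp only: t_def power_mult_distrib mult.assoc)
    finally have "Suc t \<le> t" by simp
    thus False by simp
  qed
  thus "enat r \<le> enat e" by simp
qed

end

context graded_quotient_map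
begin

text \<open>By exactness a value for \<open>M\<close> is at most the value for \<open>N\<close> plus
  the value for \<open>M\<close> in a degree lower by \<open>D\<close>. Iteration bounds it by a sum
  of values of \<open>N\<close>, and summing once more costs one power of \<open>T\<close>.\<close>

lemma growth_le_step:
  assumes fg: "finitely_generated n M" and D: "D > 0" and gr: "N.growth_le e"
  shows "M.growth_le (Suc e)"
  unfolding M.growth_le_def
proof (intro allI impI)
  fix a assume a: "\<forall>j<a. component M j = {\<zero>\<^bsub>M\<^esub>}"
  have "component N j = {\<zero>\<^bsub>N\<^esub>}" if "j < a" for j
    using pi_surj[of _ j] a that N.comp_zero by force
  then obtain C where C: "\<And>T. (\<Sum>i<T. hilbert_function N (a + int i)) \<le> C * T ^ e"
    using gr unfolding N.growth_le_def by blast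
  have H: "hilbert_function M (a + int i) \<le> (\<Sum>k<Suc i. hilbert_function N (a + int k))" for i
  proof (induction i rule: less_induct)
    case (less i)
    have ex: "hilbert_function M (a + int i) \<le> hilbert_function N (a + int i) + hilbert_function M (a + int i - int D)"
      using hilbert_function_exact[OF fg, of "a + int i"] by simp
    show ?case
    proof (cases "i < D")
      case True
      hence "hilbert_function M (a + int i - int D) = 0" using a M.hilbert_zero_iff[OF fg] by simp
      thus ?thesis using ex by simp
    next
      case False
      have "hilbert_function M (a + int (i - D)) \<le> (\<Sum>k<Suc (i - D). hilbert_function N (a + int k))"
        by (rule less.IH) (use False D in auto)
      also have "\<dots> \<le> (\<Sum>k<i. hilbert_function N (a + int k))" by (rule sum_mono2) (use False D in auto)
      finally show ?thesis using ex False by (simp add: of_nat_diff add_diff_eq)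
    qed
  qed
  have "(\<Sum>i<T. hilbert_function M (a + int i)) \<le> C * T ^ Suc e" for T
  proof -
    have "(\<Sum>i<T. hilbert_function M (a + int i)) \<le> (\<Sum>i<T. C * T ^ e)"
    proof (rule sum_mono)
      fix i assume "i \<in> {..<T}"
      hence "Suc i ^ e \<le> T ^ e" by (intro power_mono) auto
      thus "hilbert_function M (a + int i) \<le> C * T ^ e" using H[of i] C[of "Suc i"] by (meson le_trans mult_le_mono2)
    qed
    thus ?thesis by (simp add: mult.left_commute)
  qed
  thus "\<exists>C. \<forall>T. (\<Sum>i<T. hilbert_function M (a + int i)) \<le> C * T ^ Suc e" by blast
qed

end

section \<open>Hilbert functions along a filter regular sequence\<close>

lemma bdiff_pow_zero_below: "\<forall>j<a. f j = 0 \<Longrightarrow> \<forall>j<a. (bdiff ^^ m) f j = 0"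
  by (induction m) (auto simp: bdiff_def)

lemma bdiff_pow_zero_above: "\<forall>j>m. f j = 0 \<Longrightarrow> j > m + int e \<Longrightarrow> (bdiff ^^ e) f j = 0"
  by (induction e arbitrary: j) (auto simp: bdiff_def)

text \<open>Each difference moves the top degree up by one and changes the sign there, as
  \<open>(1 - Z) ^ e\<close> has leading coefficient \<open>(- 1) ^ e\<close>.\<close>

lemma bdiff_pow_top: "\<forall>j>U. f j = 0 \<Longrightarrow> (bdiff ^^ e) f (U + int e) = (- 1) ^ e * f U"
proof (induction e)
  case (Suc e)
  have "(bdiff ^^ e) f (U + int (Suc e)) = 0" by (rule bdiff_pow_zero_above[OF Suc.prems]) simp
  moreover have "(bdiff ^^ Suc e) f (U + int (Suc e)) = (bdiff ^^ e) f (U + int (Suc e)) - (bdiff ^^ e) f (U + int e)"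
    by (simp add: bdiff_def)
  ultimately show ?case using Suc by simp
qed simp

lemma bdiff_pow_sum: "(bdiff ^^ e) (\<lambda>j. \<Sum>t\<in>A. f t j) = (\<lambda>j. \<Sum>t\<in>A. (bdiff ^^ e) (f t) j)"
  by (induction e) (auto simp: bdiff_def sum_subtractf)

text \<open>Telescoping; for series, the factorization of \<open>1 - Z ^ D\<close> into
  \<open>1 - Z\<close> and \<open>1 + Z + ... + Z ^ (D - 1)\<close>.\<close>

lemma sum_bdiff: "(\<Sum>t<D. bdiff f (j - int t)) = f j - f (j - int D)"
  by (induction D) (auto simp: bdiff_def algebra_simps)

lemma constant_above:
  fixes f :: "int \<Rightarrow> int"
  assumes "\<forall>j\<ge>J. bdiff f j = 0" "j \<ge> J" shows "f j = f J"
  using assms(2)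
proof (induction j rule: int_ge_induct)
  case (step i)
  thus ?case using assms(1)[rule_format, of "i + 1"] by (simp add: bdiff_def)
qed simp

text \<open>By the last assumption \<open>f\<close> is eventually a polynomial, and summing over \<open>D\<close> consecutive
  arguments multiplies its leading coefficient by \<open>D\<close>.\<close>

lemma window_sum_zero:
  fixes f :: "int \<Rightarrow> int"
  assumes D: "D > 0" and "\<forall>j\<ge>J. (\<Sum>t<D. f (j - int t)) = 0" and "\<forall>j\<ge>J. (bdiff ^^ m) f j = 0"
  shows "\<exists>J'. \<forall>j\<ge>J'. f j = 0"
  using assms(2,3)
proof (induction m arbitrary: f J)
  case (Suc m)
  have w: "(\<Sum>t<D. bdiff f (j - int t)) = 0" if "j \<ge> J + 1" for j
    using Suc.prems(1)[rule_format, of j] Suc.prems(1)[rule_format, of "j - 1"] that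
    by (simp add: bdiff_def sum_subtractf algebra_simps)
  have p: "\<forall>j\<ge>J + 1. (bdiff ^^ m) (bdiff f) j = 0" using Suc.prems(2) by (simp add: funpow_Suc_right del: funpow.simps)
  obtain J' where J': "\<forall>j\<ge>J'. bdiff f j = 0" using Suc.IH[of "J + 1" "bdiff f"] w p by blast
  \<comment> \<open>The window of \<open>D\<close> arguments ending in \<open>K\<close> lies where
    \<open>f\<close> is constant.\<close>
  define K where "K = max J J' + int D"
  have "f (K - int t) = f J'" if "t < D" for t
    by (rule constant_above[OF J']) (use that in \<open>auto simp: K_def\<close>)
  hence "(\<Sum>t<D. f (K - int t)) = int D * f J'" by simp
  moreover have "K \<ge> J" by (simp add: K_def)
  hence "(\<Sum>t<D. f (K - int t)) = 0" using Suc.prems(1) by blast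
  ultimately have "f J' = 0" using D by simp
  hence "\<forall>j\<ge>J'. f j = 0" using constant_above[OF J'] by metis
  thus ?case by blast
qed auto

section \<open>The exact sequence in terms of Hilbert functions\<close>

locale hilbert_step =
  fixes H H' u :: "int \<Rightarrow> int" and D e :: nat and a :: int
  assumes exact: "H' j + H (j - int D) = H j + u (j - int D)" and D: "D > 0"
    and below: "j < a \<Longrightarrow> H j = 0"
begin

text \<open>The comparison of numerators, coefficient by coefficient: \<open>H\<close>,
  \<open>H'\<close> and \<open>u\<close> play the roles of the Hilbert functions of a module, its
  quotient by \<open>l\<close> and the kernel of \<open>l\<close>, and \<open>e\<close> that of the
  dimension of the quotient. One difference of \<open>H\<close> is split off by
  \<open>sum_bdiff\<close>, the others act on the exactness relation.\<close>

lemma window: "(\<Sum>t<D. (bdiff ^^ Suc e) H (j - int t)) = (bdiff ^^ e) H' j - (bdiff ^^ e) u (j - int D)"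
proof -
  have "(\<lambda>j. \<Sum>t<D. bdiff H (j - int t)) = (\<lambda>j. H' j - u (j - int D))"
  proof
    fix j show "(\<Sum>t<D. bdiff H (j - int t)) = H' j - u (j - int D)" using exact[of j] by (simp add: sum_bdiff)
  qed
  hence "(bdiff ^^ e) (\<lambda>j. \<Sum>t<D. bdiff H (j - int t)) = (\<lambda>j. (bdiff ^^ e) H' j - (bdiff ^^ e) u (j - int D))"
    by (simp add: bdiff_pow_diff bdiff_pow_shift)
  moreover have "(bdiff ^^ e) (\<lambda>j. \<Sum>t<D. bdiff H (j - int t)) = (\<lambda>j. \<Sum>t<D. (bdiff ^^ Suc e) H (j - int t))"
    unfolding bdiff_pow_sum bdiff_pow_shift by (simp only: funpow_Suc_right comp_apply)
  ultimately have "(\<lambda>j. \<Sum>t<D. (bdiff ^^ Suc e) H (j - int t)) = (\<lambda>j. (bdiff ^^ e) H' j - (bdiff ^^ e) u (j - int D))"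
    by (simp only:)
  thus ?thesis by (rule fun_cong)
qed

text \<open>The known finiteness concerns the \<open>m\<close>-th differences of \<open>H\<close>;
  it makes the \<open>Suc e\<close>-th differences polynomial in large degrees. By
  \<open>window\<close> their sums over \<open>D\<close> consecutive degrees vanish eventually,
  hence so do they.\<close>

lemma finite_support:
  assumes "diff_finite m H" "diff_finite e H'" "\<forall>j\<ge>j0. u j = 0"
  shows "diff_finite (Suc e) H"
proof -
  have above: "\<exists>J. \<forall>j\<ge>J. f j = 0" if "finite {j. f j \<noteq> 0}" for f :: "int \<Rightarrow> int"
  proof -
    have "f j = 0" if "j \<ge> Max {j. f j \<noteq> 0} + 1" for j
      using Max_ge[OF \<open>finite {j. f j \<noteq> 0}\<close>, of j] that by (cases "f j = 0") simp_all
    thus ?thesis by blast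
  qed
  obtain J1 where J1: "\<forall>j\<ge>J1. (bdiff ^^ m) H j = 0" using above assms(1) unfolding diff_finite_def by blast
  obtain J2 where J2: "\<forall>j\<ge>J2. (bdiff ^^ e) H' j = 0" using above assms(2) unfolding diff_finite_def by blast
  have u: "(bdiff ^^ e) u j = 0" if "j > j0 + int e" for j
    by (rule bdiff_pow_zero_above[of j0]) (use assms(3) that in auto)
  have m: "\<forall>j>J1. (bdiff ^^ m) H j = 0" using J1 by auto
  have "(bdiff ^^ m) ((bdiff ^^ Suc e) H) = (bdiff ^^ Suc e) ((bdiff ^^ m) H)" by (metis funpow_add comp_apply add.commute)
  hence pf: "(bdiff ^^ m) ((bdiff ^^ Suc e) H) j = 0" if "j > J1 + int (Suc e)" for j
    using bdiff_pow_zero_above[OF m that] by simp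
  define J where "J = max (J1 + int (Suc e) + 1) (max J2 (j0 + int e + 1 + int D))"
  have "\<exists>J'. \<forall>j\<ge>J'. (bdiff ^^ Suc e) H j = 0"
  proof (rule window_sum_zero[OF D, of J _ m])
    show "\<forall>j\<ge>J. (\<Sum>t<D. (bdiff ^^ Suc e) H (j - int t)) = 0"
    proof (intro allI impI)
      fix j assume "j \<ge> J"
      hence "(bdiff ^^ e) H' j = 0" "(bdiff ^^ e) u (j - int D) = 0" using J2 u unfolding J_def by auto
      thus "(\<Sum>t<D. (bdiff ^^ Suc e) H (j - int t)) = 0" by (simp only: window)
    qed
    show "\<forall>j\<ge>J. (bdiff ^^ m) ((bdiff ^^ Suc e) H) j = 0" using pf by (auto simp: J_def simp del: funpow.simps)
  qed
  then obtain J' where J': "\<forall>j\<ge>J'. (bdiff ^^ Suc e) H j = 0" by blast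
  have "\<forall>j<a. (bdiff ^^ Suc e) H j = 0" by (rule bdiff_pow_zero_below) (use below in blast)
  hence "{j. (bdiff ^^ Suc e) H j \<noteq> 0} \<subseteq> {a..J'}" using J' by (auto simp del: funpow.simps) (meson linorder_le_less_linear, meson linorder_le_less_linear less_imp_le)
  thus ?thesis unfolding diff_finite_def by (rule finite_subset) simp
qed

text \<open>\<open>window\<close> is evaluated at two places. The window from \<open>A\<close> to
  \<open>A + D - 1\<close> has \<open>A\<close> as its only nonzero entry; and at
  \<open>U + e + D\<close>, with \<open>U\<close> the top degree of \<open>u\<close>, the kernel
  term is nonzero while the window lies above \<open>A\<close>. If the claim failed, one of these
  terms would be left unbalanced and make the differences of \<open>H'\<close> nonzero above
  \<open>B\<close>.\<close>

lemma kernel_bound_iff: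
  assumes B: "\<forall>j>B. (bdiff ^^ e) H' j = 0" and m: "B - int e \<le> m + int D - 1"
    and A: "(bdiff ^^ Suc e) H A \<noteq> 0" "\<forall>j>A. (bdiff ^^ Suc e) H j = 0"
    and u: "\<forall>j\<ge>j0. u j = 0"
  shows "(\<forall>j>m. u j = 0) \<longleftrightarrow> A - int (Suc e) \<le> m"
proof
  assume um: "\<forall>j>m. u j = 0"
  show "A - int (Suc e) \<le> m"
  proof (rule ccontr)
    assume n: "\<not> A - int (Suc e) \<le> m"
    have "(bdiff ^^ Suc e) H (A + int D - 1 - int t) = 0" if "t \<in> {..<D} - {D - 1}" for t
      by (rule A(2)[rule_format]) (use that in auto)
    hence "(\<Sum>t<D. (bdiff ^^ Suc e) H (A + int D - 1 - int t)) = (\<Sum>t\<in>{D - 1}. (bdiff ^^ Suc e) H (A + int D - 1 - int t))"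
      using D by (intro sum.mono_neutral_right) auto
    hence "(\<Sum>t<D. (bdiff ^^ Suc e) H (A + int D - 1 - int t)) = (bdiff ^^ Suc e) H A"
      using D by (simp add: of_nat_diff)
    moreover have "(bdiff ^^ e) u (A + int D - 1 - int D) = 0" by (rule bdiff_pow_zero_above[OF um]) (use n in simp)
    ultimately have "(bdiff ^^ e) H' (A + int D - 1) \<noteq> 0" using window[of "A + int D - 1"] A(1) by simp
    hence "A + int D - 1 \<le> B" using B by force
    thus False using n m by simp
  qed
next
  assume Am: "A - int (Suc e) \<le> m"
  show "\<forall>j>m. u j = 0"
  proof (rule ccontr)
    assume "\<not> (\<forall>j>m. u j = 0)"
    then obtain j where j: "j > m" "u j \<noteq> 0" by blast
    have "{j. j > m \<and> u j \<noteq> 0} \<subseteq> {m..j0}"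
    proof
      fix j assume "j \<in> {j. j > m \<and> u j \<noteq> 0}"
      thus "j \<in> {m..j0}" using u[rule_format, of j] by (cases "j \<ge> j0") simp_all
    qed
    hence fin: "finite {j. j > m \<and> u j \<noteq> 0}" by (rule finite_subset) simp
    define U where "U = Max {j. j > m \<and> u j \<noteq> 0}"
    have "U \<in> {j. j > m \<and> u j \<noteq> 0}" unfolding U_def by (rule Max_in[OF fin]) (use j in blast)
    hence U: "U > m" "u U \<noteq> 0" by auto
    have "u j = 0" if "j > U" for j
      using Max_ge[OF fin, of j] that U(1) unfolding U_def[symmetric] by force
    hence "(bdiff ^^ e) u (U + int e) \<noteq> 0" using bdiff_pow_top[of U u e] U(2) by simp
    moreover have "(\<Sum>t<D. (bdiff ^^ Suc e) H (U + int e + int D - int t)) = 0"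
      by (rule sum.neutral) (use U(1) Am A(2) in \<open>auto simp del: funpow.simps\<close>)
    ultimately have "(bdiff ^^ e) H' (U + int e + int D) \<noteq> 0" using window[of "U + int e + int D"] by simp
    hence "U + int e + int D \<le> B" using B by force
    thus False using U(1) m by simp
  qed
qed

end

section \<open>Hilbert numerators and postulation numbers\<close>

lemma fls_nth_mult_power_one_minus_X:
  fixes F :: "int fls"
  shows "fls_nth (F * (1 - fls_X) ^ e) = (bdiff ^^ e) (fls_nth F)"
proof (induction e)
  case (Suc e)
  have "F * (1 - fls_X) ^ Suc e = F * (1 - fls_X) ^ e - fls_X * (F * (1 - fls_X) ^ e)" by (simp add: algebra_simps)
  thus ?case using Suc by (auto simp: bdiff_def fls_X_times_conv_shift)
qed simp

text \<open>A function with zero difference is constant, and the constant is zero because of the low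
  degrees.\<close>

lemma bdiff_pow_eq_zeroD:
  assumes "\<forall>j<a. f j = 0" "\<forall>j. (bdiff ^^ e) f j = 0" shows "f j = 0"
  using assms(2)
proof (induction e arbitrary: j)
  case (Suc e)
  have c: "(bdiff ^^ e) f j = (bdiff ^^ e) f (min a j - 1)" for j
    by (rule constant_above[of "min a j - 1"]) (use Suc.prems in auto)
  have "\<forall>j. (bdiff ^^ e) f j = 0" using bdiff_pow_zero_below[OF assms(1), of e] c by auto
  thus ?case by (rule Suc.IH)
qed simp

context graded_poly_module
begin

text \<open>Vanishing in low degrees makes \<open>Abs_fls\<close> return the intended series; each
  factor \<open>1 - fls_X\<close> is then a difference.\<close>

lemma hilbert_numerator_nth:
  assumes fg: "finitely_generated n M" and e: "krull_dim n M = enat e"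
  shows "fls_nth (hilbert_numerator n M) = (bdiff ^^ e) (\<lambda>j. int (hilbert_function M j))"
proof -
  obtain a where "\<forall>j<a. component M j = {\<zero>}" using comp_bounded_below[OF fg] by blast
  hence "\<forall>j<a. int (hilbert_function M j) = 0" using hilbert_zero_iff[OF fg] by simp
  hence "fls_nth (hilbert_series M) = (\<lambda>j. int (hilbert_function M j))"
    unfolding hilbert_series_def using nth_Abs_fls_lower_bound[of a "\<lambda>j. int (hilbert_function M j)"] by blast
  thus ?thesis by (simp add: hilbert_numerator_def e fls_nth_mult_power_one_minus_X)
qed

text \<open>The set under \<open>Max\<close> is finite by \<open>diff_finite\<close>, and nonempty
  since otherwise the Hilbert function would vanish identically and the module with it.\<close>

lemma postulation_number_props:
  assumes fg: "finitely_generated n M" and e: "krull_dim n M = enat e" and nz: "carrier M \<noteq> {\<zero>}"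
    and df: "diff_finite e (\<lambda>j. int (hilbert_function M j))"
  shows postulation_number_nonzero: "(bdiff ^^ e) (\<lambda>j. int (hilbert_function M j)) (postulation_number n M + int e) \<noteq> 0"
    and postulation_number_above: "\<forall>j>postulation_number n M + int e. (bdiff ^^ e) (\<lambda>j. int (hilbert_function M j)) j = 0"
proof -
  let ?h = "(bdiff ^^ e) (\<lambda>j. int (hilbert_function M j))"
  have fin: "finite {j. ?h j \<noteq> 0}" using df by (simp add: diff_finite_def)
  obtain a where "\<forall>j<a. component M j = {\<zero>}" using comp_bounded_below[OF fg] by blast
  hence a: "\<forall>j<a. int (hilbert_function M j) = 0" using hilbert_zero_iff[OF fg] by simp
  have ne: "{j. ?h j \<noteq> 0} \<noteq> {}"
  proof
    assume "{j. ?h j \<noteq> 0} = {}"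
    hence "\<forall>j. ?h j = 0" by blast
    hence "component M j = {\<zero>}" for j using bdiff_pow_eq_zeroD[OF a, of e j] hilbert_zero_iff[OF fg, of j] by simp
    thus False using zero_of_comps nz by blast
  qed
  have p: "postulation_number n M + int e = Max {j. ?h j \<noteq> 0}"
    by (simp add: postulation_number_def hilbert_numerator_nth[OF fg e] e)
  show "?h (postulation_number n M + int e) \<noteq> 0" unfolding p using Max_in[OF fin ne] by simp
  show "\<forall>j>postulation_number n M + int e. ?h j = 0"
  proof (intro allI impI)
    fix j assume "j > postulation_number n M + int e"
    thus "?h j = 0" using Max_ge[OF fin, of j] unfolding p by (cases "?h j = 0") simp_all
  qed
qed

text \<open>On a bounded module the zero polynomial, regarded as homogeneous of degree
  \<open>1\<close>, is filter regular with \<open>M\<close> as its own quotient. The kernel is then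
  all of \<open>M\<close> and the shift \<open>D - 1\<close> is zero, so
  \<open>reg_bound_step\<close> shows that the condition is necessary.\<close>

lemma reg_bound_bounded_iff:
  assumes b: "bounded_above"
  shows "reg_bound n M m \<longleftrightarrow> (\<forall>j>m. component M j = {\<zero>})"
proof -
  obtain j0 where j0: "\<And>j. j \<ge> j0 \<Longrightarrow> component M j = {\<zero>}" using b unfolding bounded_above_def by blast
  interpret Z: filter_regular_quotient n M M "\<lambda>x. x" 0 1 j0
  proof unfold_locales
    show "(0 :: 'k mpol) \<in> Hom n 1" by (simp add: homogeneous_polys_def)
    show "(x = \<zero>) = (\<exists>y\<in>carrier M. x = 0 \<odot> y)" if "x \<in> carrier M" for x using that by auto
    show "x = \<zero>" if "j \<ge> j0" "x \<in> component M j" for j x using that j0 by blast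
  qed auto
  have "reg_bound n M m \<Longrightarrow> j > m \<Longrightarrow> component M j = {\<zero>}" for j
    using Z.reg_bound_step[of m] comp_zero[of j] smult_0 comp_carrier by blast
  thus ?thesis using reg_bound_bounded[of j0 m] j0 by blast
qed

end

section \<open>Transport from a module to its quotient by zero\<close>

context graded_quotient_map
begin

lemma pi_inj:
  assumes "l = 0" "x \<in> carrier M" "y \<in> carrier M" "\<pi> x = \<pi> y" shows "x = y"
proof -
  have "\<pi> (x \<ominus>\<^bsub>M\<^esub> y) = \<pi> y \<ominus>\<^bsub>N\<^esub> \<pi> y" using assms by (simp only: pi_minus)
  hence "\<pi> (x \<ominus>\<^bsub>M\<^esub> y) = \<zero>\<^bsub>N\<^esub>" using assms(3) by (simp only: a_minus_def N.r_neg pi_closed)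
  hence "x \<ominus>\<^bsub>M\<^esub> y = \<zero>\<^bsub>M\<^esub>" using pi_ker[of "x \<ominus>\<^bsub>M\<^esub> y"] assms(1-3) by auto
  thus ?thesis using assms by simp
qed

lemma krull_dim_iso: "l = 0 \<Longrightarrow> krull_dim n N = krull_dim n M"
proof -
  assume l: "l = 0"
  have "a \<odot>\<^bsub>M\<^esub> x = \<zero>\<^bsub>M\<^esub>" if a: "a \<in> annihilator n N" and x: "x \<in> carrier M" for a x
  proof (rule pi_inj[OF l])
    have "a \<in> Rn n" using a by (simp add: N.annihilator_iff)
    thus "a \<odot>\<^bsub>M\<^esub> x \<in> carrier M" "\<pi> (a \<odot>\<^bsub>M\<^esub> x) = \<pi> \<zero>\<^bsub>M\<^esub>"
      using a x by (auto simp: pi_smult N.annihilator_iff)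
  qed simp
  hence "annihilator n N = annihilator n M"
    using annihilator_mono by (auto simp: M.annihilator_iff N.annihilator_iff)
  thus ?thesis by (simp add: krull_dim_def)
qed

text \<open>For \<open>l = 0\<close> the map is bijective in each degree, so cocycles and their
  preimages are carried over in both directions. This links \<open>M\<close> with the first module
  of the tower, its quotient by the zero submodule.\<close>

lemma vanishing_iso: "l = 0 \<Longrightarrow> vanishing n N i j \<longleftrightarrow> vanishing n M i j"
proof
  assume l: "l = 0" and v: "vanishing n N i j"
  show "vanishing n M i j"
    unfolding vanishing_def
  proof (intro allI impI)
    fix k x assume x: "coch n M (Suc i) j k x" "cocycle n M (Suc i) k x"
    have xc: "x S \<in> carrier M" if "S \<subseteq> {1..n}" "card S = i" for S
      using M.coch_comp[OF x(1), of S] that M.comp_carrier by blast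
    have "cocycle n N (Suc i) k (\<lambda>S. \<pi> (x S))"
      unfolding cocycle_def
    proof (intro allI impI)
      fix T assume T: "T \<subseteq> {1..n}" "card T = Suc i"
      have "finite T" using T by (simp add: card_ge_0_finite)
      hence "x (T - {s}) \<in> carrier M" if "s \<in> T" for s using that T by (intro xc) auto
      hence "kd N k (\<lambda>S. \<pi> (x S)) T = \<pi> (kd M k x T)" using pi_kd[OF T(1)] by simp
      thus "kd N k (\<lambda>S. \<pi> (x S)) T = \<zero>\<^bsub>N\<^esub>" using x(2) T unfolding cocycle_def by simp
    qed
    then obtain t z where z: "coch n N i j (k + t) z"
      "\<And>T. T \<subseteq> {1..n} \<Longrightarrow> card T = i \<Longrightarrow> kd N (k + t) z T = level_up N t (\<lambda>S. \<pi> (x S)) T"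
      using v coch_pi[OF x(1)] unfolding vanishing_def coboundary_def by blast
    obtain w where w: "coch n M i j (k + t) w" "\<And>S. S \<subseteq> {1..n} \<Longrightarrow> Suc (card S) = i \<Longrightarrow> \<pi> (w S) = z S"
      using coch_lift[OF z(1)] by blast
    have "kd M (k + t) w T = level_up M t x T" if T: "T \<subseteq> {1..n}" "card T = i" for T
    proof (rule pi_inj[OF l])
      have fT: "finite T" using T(1) by (rule finite_subset) simp
      have r: "T - {s} \<subseteq> {1..n}" "Suc (card (T - {s})) = i" if "s \<in> T" for s
        using T fT that card_Suc_Diff1[OF fT that] by auto
      have wc: "w (T - {s}) \<in> carrier M" if "s \<in> T" for s
        using M.coch_comp[OF w(1) r[OF that]] M.comp_carrier by blast
      show "kd M (k + t) w T \<in> carrier M" by (rule M.kd_closed) (use T(1) wc in auto)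
      show "level_up M t x T \<in> carrier M" unfolding level_up_def using xc[OF T] T(1) by auto
      have "\<pi> (kd M (k + t) w T) = kd N (k + t) (\<lambda>S. \<pi> (w S)) T" by (rule pi_kd) (use T(1) wc in auto)
      also have "\<dots> = kd N (k + t) z T" by (rule N.kd_cong[OF T(1)]) (use wc w(2)[OF r] in \<open>blast intro: pi_closed\<close>)+
      also have "\<dots> = \<pi> (level_up M t x T)" using z(2)[OF T] pi_level_up[OF T(1), of x] xc[OF T] by simp
      finally show "\<pi> (kd M (k + t) w T) = \<pi> (level_up M t x T)" .
    qed
    thus "\<exists>t. coboundary n M i j (k + t) (level_up M t x)" using w(1) unfolding coboundary_def by blast
  qed
next
  assume l: "l = 0" and v: "vanishing n M i j"
  show "vanishing n N i j"
    unfolding vanishing_def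
  proof (intro allI impI)
    fix k z assume z: "coch n N (Suc i) j k z" "cocycle n N (Suc i) k z"
    obtain x where x: "coch n M (Suc i) j k x" "\<And>S. S \<subseteq> {1..n} \<Longrightarrow> Suc (card S) = Suc i \<Longrightarrow> \<pi> (x S) = z S"
      using coch_lift[OF z(1)] by blast
    have xc: "x S \<in> carrier M" if "S \<subseteq> {1..n}" "card S = i" for S
      using M.coch_comp[OF x(1), of S] that M.comp_carrier by blast
    have "cocycle n M (Suc i) k x"
      unfolding cocycle_def
    proof (intro allI impI)
      fix T assume T: "T \<subseteq> {1..n}" "card T = Suc i"
      have fT: "finite T" using T by (simp add: card_ge_0_finite)
      have r: "T - {s} \<subseteq> {1..n}" "Suc (card (T - {s})) = Suc i" if "s \<in> T" for s
        using T fT that card_Suc_Diff1[OF fT that] by auto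
      have wc: "x (T - {s}) \<in> carrier M" if "s \<in> T" for s using xc r[OF that] by simp
      show "kd M k x T = \<zero>\<^bsub>M\<^esub>"
      proof (rule pi_inj[OF l])
        show "kd M k x T \<in> carrier M" by (rule M.kd_closed) (use T(1) wc in auto)
        have "\<pi> (kd M k x T) = kd N k (\<lambda>S. \<pi> (x S)) T" by (rule pi_kd) (use T(1) wc in auto)
        also have "\<dots> = kd N k z T" by (rule N.kd_cong[OF T(1)]) (use wc x(2)[OF r] in \<open>blast intro: pi_closed\<close>)+
        finally show "\<pi> (kd M k x T) = \<pi> \<zero>\<^bsub>M\<^esub>" using z(2) T unfolding cocycle_def by simp
      qed auto
    qed
    then obtain t y where y: "coch n M i j (k + t) y"
      "\<And>T. T \<subseteq> {1..n} \<Longrightarrow> card T = i \<Longrightarrow> kd M (k + t) y T = level_up M t x T"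
      using v x(1) unfolding vanishing_def coboundary_def by blast
    have "kd N (k + t) (\<lambda>S. \<pi> (y S)) T = level_up N t z T" if T: "T \<subseteq> {1..n}" "card T = i" for T
    proof -
      have fT: "finite T" using T(1) by (rule finite_subset) simp
      have yc: "y (T - {s}) \<in> carrier M" if "s \<in> T" for s
      proof -
        have "T - {s} \<subseteq> {1..n}" "Suc (card (T - {s})) = i" using T fT that card_Suc_Diff1[OF fT that] by auto
        thus ?thesis using M.coch_comp[OF y(1)] M.comp_carrier by blast
      qed
      have "kd N (k + t) (\<lambda>S. \<pi> (y S)) T = \<pi> (level_up M t x T)" using pi_kd[OF T(1), of y "k + t"] yc y(2)[OF T] by simp
      also have "\<dots> = level_up N t z T" using pi_level_up[OF T(1), of x] xc[OF T] x(2)[OF T(1)] T(2) by (simp add: level_up_def)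
      finally show ?thesis .
    qed
    thus "\<exists>t. coboundary n N i j (k + t) (level_up N t z)" using coch_pi[OF y(1)] unfolding coboundary_def by blast
  qed
qed

end

section \<open>The tower of successive quotients\<close>

locale filter_regular_tower =
  fixes n d :: nat and Q :: "nat \<Rightarrow> ('k::field mpol, 'p) graded_module"
    and \<pi> :: "nat \<Rightarrow> 'p \<Rightarrow> 'p" and l :: "nat \<Rightarrow> 'k mpol" and D :: "nat \<Rightarrow> nat" and j0 :: "nat \<Rightarrow> int"
  assumes step: "i < d \<Longrightarrow> filter_regular_quotient n (Q i) (Q (Suc i)) (\<pi> i) (l (Suc i)) (D (Suc i)) (j0 i)"
    and graded: "i \<le> d \<Longrightarrow> graded_poly_module n (Q i)"
    and fg: "i \<le> d \<Longrightarrow> finitely_generated n (Q i)"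
    and nonzero_0: "carrier (Q 0) \<noteq> {\<zero>\<^bsub>Q 0\<^esub>}"
    and dim_0: "krull_dim n (Q 0) = enat d"
begin

text \<open>Every step back from a quotient to the module raises the exponent of the growth bound by
  one.\<close>

lemma growth_descends:
  assumes "t \<le> i" "i \<le> d" "graded_poly_module.growth_le (Q i) 0"
  shows "graded_poly_module.growth_le (Q (i - t)) t"
  using assms(1)
proof (induction t)
  case (Suc t)
  then obtain k where k: "i = Suc (k + t)" by (metis add_Suc le_Suc_ex add.commute)
  interpret S: filter_regular_quotient n "Q k" "Q (Suc k)" "\<pi> k" "l (Suc k)" "D (Suc k)" "j0 k"
    by (rule step) (use assms k in simp)
  have "S.N.growth_le t" using Suc k by simp
  thus ?case using S.growth_le_step[OF fg[of k] S.D_pos] assms k by simp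
qed (use assms in simp)

text \<open>If the dimension were zero too early, \<open>Q i\<close> would be bounded, so
  \<open>Q 0\<close> would have growth of order \<open>i\<close> and dimension at most
  \<open>i < d\<close>. This secures the assumption of \<open>krull_dim_step\<close> along the
  tower.\<close>

lemma dim_pos: "i < d \<Longrightarrow> krull_dim n (Q i) \<ge> 1"
proof (rule ccontr)
  assume i: "i < d" and "\<not> krull_dim n (Q i) \<ge> 1"
  hence 0: "krull_dim n (Q i) = 0" by (simp add: ileI1 not_le one_eSuc)
  interpret Qi: graded_poly_module n "Q i" by (rule graded) (use i in simp)
  interpret Q0: graded_poly_module n "Q 0" by (rule graded) simp
  have fgi: "finitely_generated n (Q i)" by (rule fg) (use i in simp)
  have "Qi.growth_le 0" by (rule Qi.growth_le_bounded[OF fgi Qi.krull_dim_zero_bounded[OF fgi 0]])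
  hence "Q0.growth_le i" using growth_descends[of i i] i by simp
  hence "krull_dim n (Q 0) \<le> enat i" using Q0.krull_dim_le_growth[OF fg] by simp
  thus False using dim_0 i by simp
qed

text \<open>Every chain for \<open>Q (Suc i)\<close> prolongs to a longer one for
  \<open>Q i\<close>.\<close>

lemma dim_le: "i \<le> d \<Longrightarrow> krull_dim n (Q i) \<le> enat (d - i)"
proof (induction i)
  case (Suc i)
  interpret S: filter_regular_quotient n "Q i" "Q (Suc i)" "\<pi> i" "l (Suc i)" "D (Suc i)" "j0 i"
    by (rule step) (use Suc in simp)
  show ?case
  proof (rule S.N.krull_dim_le)
    fix r P assume "S.M.prime_chain (annihilator n (Q (Suc i))) r P"
    hence "enat (Suc r) \<le> krull_dim n (Q i)" using S.krull_dim_step[OF fg dim_pos] Suc.prems by simp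
    also have "\<dots> \<le> enat (d - i)" using Suc by simp
    finally show "enat r \<le> enat (d - Suc i)" by simp
  qed
qed (simp add: dim_0)

text \<open>The same prolongation, read from the far end of the tower. A lower bound
  \<open>k > 0\<close> on the supremum yields an actual chain of length at least \<open>k\<close> to
  be prolonged; the first step, \<open>k = 0\<close>, rests on \<open>dim_pos\<close> instead, which
  requires no chain for the quotient.\<close>

lemma dim_ge: "k \<le> d \<Longrightarrow> enat k \<le> krull_dim n (Q (d - k))"
proof (induction k)
  case (Suc k)
  then obtain i where i: "d = Suc (i + k)" by (metis add_Suc le_Suc_ex add.commute)
  interpret S: filter_regular_quotient n "Q i" "Q (Suc i)" "\<pi> i" "l (Suc i)" "D (Suc i)" "j0 i"
    by (rule step) (use i in simp)
  have 1: "krull_dim n (Q i) \<ge> 1" by (rule dim_pos) (use i in simp)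
  show ?case
  proof (cases k)
    case 0
    thus ?thesis using 1 i by (simp add: one_enat_def)
  next
    case (Suc k')
    have "\<exists>r P. S.M.prime_chain (annihilator n (Q (Suc i))) r P \<and> r \<ge> k"
    proof (rule ccontr)
      assume "\<not> ?thesis"
      hence "krull_dim n (Q (Suc i)) \<le> enat k'" by (intro S.N.krull_dim_le) (use Suc in force)
      moreover have "enat k \<le> krull_dim n (Q (Suc i))" using Suc.IH i by simp
      ultimately have "enat k \<le> enat k'" by (rule order_trans[rotated])
      thus False using Suc by simp
    qed
    then obtain r P where rP: "S.M.prime_chain (annihilator n (Q (Suc i))) r P" "r \<ge> k" by blast
    have "enat (Suc r) \<le> krull_dim n (Q i)" by (rule S.krull_dim_step[OF fg 1 rP(1)]) (use i in simp)
    moreover have "enat (Suc k) \<le> enat (Suc r)" using rP(2) by simp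
    ultimately show ?thesis using i by (metis add_diff_cancel_right' add_Suc_right order_trans)
  qed
qed (simp add: zero_enat_def[symmetric])

lemma dim: "i \<le> d \<Longrightarrow> krull_dim n (Q i) = enat (d - i)"
  using dim_le[of i] dim_ge[of "d - i"] by simp

text \<open>Graded Nakayama: if the quotient is zero, every homogeneous element is \<open>l\<close>
  times an element of smaller degree, and in a module bounded below this ends in zero.\<close>

lemma nonzero: "i \<le> d \<Longrightarrow> carrier (Q i) \<noteq> {\<zero>\<^bsub>Q i\<^esub>}"
proof (induction i)
  case (Suc i)
  interpret S: filter_regular_quotient n "Q i" "Q (Suc i)" "\<pi> i" "l (Suc i)" "D (Suc i)" "j0 i"
    by (rule step) (use Suc in simp)
  show ?case
  proof
    assume z: "carrier (Q (Suc i)) = {\<zero>\<^bsub>Q (Suc i)\<^esub>}"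
    obtain a where a: "\<forall>j<a. component (Q i) j = {\<zero>\<^bsub>Q i\<^esub>}"
      using S.M.comp_bounded_below[OF fg[of i]] Suc.prems by auto
    have "component (Q i) (a + int k) = {\<zero>\<^bsub>Q i\<^esub>}" for k
    proof (induction k rule: less_induct)
      case (less k)
      have low: "component (Q i) j = {\<zero>\<^bsub>Q i\<^esub>}" if "j < a + int k" for j
      proof (cases "j < a")
        case False
        thus ?thesis using less.IH[of "nat (j - a)"] that by simp
      qed (use a in blast)
      have "x = \<zero>\<^bsub>Q i\<^esub>" if x: "x \<in> component (Q i) (a + int k)" for x
      proof -
        have "\<pi> i x = \<zero>\<^bsub>Q (Suc i)\<^esub>" using S.pi_closed[OF S.M.comp_carrier[OF x]] z by blast
        then obtain y where "y \<in> component (Q i) (a + int k - int (D (Suc i)))" "x = l (Suc i) \<odot>\<^bsub>Q i\<^esub> y"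
          using S.pi_ker_comp[OF x] by blast
        thus ?thesis using low[of "a + int k - int (D (Suc i))"] S.D_pos by simp
      qed
      thus ?case using S.M.comp_zero by blast
    qed
    hence "component (Q i) j = {\<zero>\<^bsub>Q i\<^esub>}" for j
      using a by (cases "j < a") (blast, metis add.commute diff_add_cancel not_less zle_iff_zadd)
    thus False using S.M.zero_of_comps Suc by simp
  qed
qed (rule nonzero_0)

abbreviation H :: "nat \<Rightarrow> int \<Rightarrow> int" where
  "H i j \<equiv> int (hilbert_function (Q i) j)"

lemma bounded_d: "graded_poly_module.bounded_above (Q d)"
proof -
  interpret Qd: graded_poly_module n "Q d" by (rule graded) simp
  show ?thesis by (rule Qd.krull_dim_zero_bounded[OF fg]) (use dim[of d] in \<open>simp_all add: zero_enat_def\<close>)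
qed

lemma hilbert_step_tower:
  assumes i: "i < d"
  shows "\<exists>a. hilbert_step (H i) (H (Suc i)) (\<lambda>j. int (graded_quotient_map.ker_dim (Q i) (l (Suc i)) j)) (D (Suc i)) a"
proof -
  interpret S: filter_regular_quotient n "Q i" "Q (Suc i)" "\<pi> i" "l (Suc i)" "D (Suc i)" "j0 i" by (rule step[OF i])
  have fgi: "finitely_generated n (Q i)" by (rule fg) (use i in simp)
  obtain a where a: "\<forall>j<a. component (Q i) j = {\<zero>\<^bsub>Q i\<^esub>}" using S.M.comp_bounded_below[OF fgi] by blast
  have "hilbert_step (H i) (H (Suc i)) (\<lambda>j. int (S.ker_dim j)) (D (Suc i)) a"
  proof
    show "H (Suc i) j + H i (j - int (D (Suc i))) = H i j + int (S.ker_dim (j - int (D (Suc i))))" for j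
      using S.hilbert_function_exact[OF fgi, of j] by (metis of_nat_add)
    show "H i j = 0" if "j < a" for j using a that S.M.hilbert_zero_iff[OF fgi] by simp
  qed (rule S.D_pos)
  thus ?thesis by blast
qed

lemma ker_dim_above:
  assumes i: "i < d" shows "\<forall>j\<ge>j0 i. int (graded_quotient_map.ker_dim (Q i) (l (Suc i)) j) = 0"
proof -
  interpret S: filter_regular_quotient n "Q i" "Q (Suc i)" "\<pi> i" "l (Suc i)" "D (Suc i)" "j0 i" by (rule step[OF i])
  show ?thesis using S.ker_dim_zero_iff[OF fg] S.l_regular i by simp
qed

text \<open>Backwards from \<open>Q d\<close>, whose Hilbert function has finite support; each step
  back costs one more difference.\<close>

lemma hilbert_diff_finite: "k \<le> d \<Longrightarrow> diff_finite k (H (d - k))"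
proof (induction k)
  case 0
  interpret Qd: graded_poly_module n "Q d" by (rule graded) simp
  have fgd: "finitely_generated n (Q d)" by (rule fg) simp
  obtain a where a: "\<forall>j<a. component (Q d) j = {\<zero>\<^bsub>Q d\<^esub>}" using Qd.comp_bounded_below[OF fgd] by blast
  obtain b where b: "\<forall>j\<ge>b. component (Q d) j = {\<zero>\<^bsub>Q d\<^esub>}" using bounded_d unfolding Qd.bounded_above_def by blast
  have "{j. H d j \<noteq> 0} \<subseteq> {a..b}"
  proof
    fix j assume "j \<in> {j. H d j \<noteq> 0}"
    hence "component (Q d) j \<noteq> {\<zero>\<^bsub>Q d\<^esub>}" by (simp add: Qd.hilbert_zero_iff[OF fgd])
    hence "\<not> j < a" "\<not> j \<ge> b" using a b by blast+
    thus "j \<in> {a..b}" by simp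
  qed
  thus ?case by (simp add: diff_finite_def finite_subset)
next
  case (Suc k)
  then obtain i where i: "d = Suc (i + k)" by (metis add_Suc le_Suc_ex add.commute)
  interpret Qi: graded_poly_module n "Q i" by (rule graded) (use i in simp)
  obtain a where "hilbert_step (H i) (H (Suc i)) (\<lambda>j. int (graded_quotient_map.ker_dim (Q i) (l (Suc i)) j)) (D (Suc i)) a"
    using hilbert_step_tower[of i] i by auto
  then interpret hilbert_step "H i" "H (Suc i)" "\<lambda>j. int (graded_quotient_map.ker_dim (Q i) (l (Suc i)) j)" "D (Suc i)" k a .
  have "diff_finite (Suc k) (H i)"
  proof (rule finite_support)
    show "diff_finite n (H i)" by (rule Qi.hilbert_function_diff_finite[OF fg]) (use i in simp)
    show "diff_finite k (H (Suc i))" using Suc i by simp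
    show "\<forall>j\<ge>j0 i. int (graded_quotient_map.ker_dim (Q i) (l (Suc i)) j) = 0" by (rule ker_dim_above) (use i in simp)
  qed
  thus ?case using i by simp
qed

abbreviation \<alpha> :: "nat \<Rightarrow> int" where
  "\<alpha> i \<equiv> postulation_number n (Q i)"

text \<open>The induction generalizes \<open>m\<close>, since a step replaces it by
  \<open>m + int (D (Suc i)) - 1\<close>; the partial sums of \<open>D j - 1\<close> record these
  shifts.\<close>

lemma reg_bound_tower:
  "k \<le> d \<Longrightarrow> reg_bound n (Q (d - k)) m \<longleftrightarrow>
     (\<forall>i\<in>{d - k..d}. \<alpha> i - (\<Sum>j\<in>{Suc (d - k)..i}. int (D j) - 1) \<le> m)"
proof (induction k arbitrary: m)
  case 0
  interpret Qd: graded_poly_module n "Q d" by (rule graded) simp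
  have fgd: "finitely_generated n (Q d)" by (rule fg) simp
  have df: "diff_finite 0 (H d)" using hilbert_diff_finite[of 0] by simp
  have d0: "krull_dim n (Q d) = enat 0" using dim[of d] by simp
  have "(\<forall>j>m. component (Q d) j = {\<zero>\<^bsub>Q d\<^esub>}) \<longleftrightarrow> \<alpha> d \<le> m"
    using Qd.postulation_number_nonzero[OF fgd d0 nonzero df] Qd.postulation_number_above[OF fgd d0 nonzero df]
    by (auto simp: Qd.hilbert_zero_iff[OF fgd, symmetric] not_less[symmetric])
  thus ?case using Qd.reg_bound_bounded_iff[OF bounded_d, of m] by simp
next
  case (Suc k)
  then obtain i where i: "d = Suc (i + k)" by (metis add_Suc le_Suc_ex add.commute)
  interpret S: filter_regular_quotient n "Q i" "Q (Suc i)" "\<pi> i" "l (Suc i)" "D (Suc i)" "j0 i"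
    by (rule step) (use i in simp)
  have fgi: "finitely_generated n (Q i)" "finitely_generated n (Q (Suc i))" by (rule fg, use i in simp)+
  have dimi: "krull_dim n (Q i) = enat (Suc k)" "krull_dim n (Q (Suc i)) = enat k" using dim[of i] dim[of "Suc i"] i by simp_all
  have nzi: "carrier (Q i) \<noteq> {\<zero>\<^bsub>Q i\<^esub>}" "carrier (Q (Suc i)) \<noteq> {\<zero>\<^bsub>Q (Suc i)\<^esub>}" by (rule nonzero, use i in simp)+
  have dfi: "diff_finite (Suc k) (H i)" "diff_finite k (H (Suc i))" using hilbert_diff_finite[of "Suc k"] hilbert_diff_finite[of k] i by simp_all
  obtain a where "hilbert_step (H i) (H (Suc i)) (\<lambda>j. int (S.ker_dim j)) (D (Suc i)) a"
    using hilbert_step_tower[of i] i by auto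
  then interpret hilbert_step "H i" "H (Suc i)" "\<lambda>j. int (S.ker_dim j)" "D (Suc i)" k a .
  define B where "B m \<longleftrightarrow> (\<forall>i'\<in>{Suc i..d}. \<alpha> i' - (\<Sum>j\<in>{Suc i..i'}. int (D j) - 1) \<le> m)" for m
  have "reg_bound n (Q (Suc i)) (m + int (D (Suc i)) - 1) \<longleftrightarrow>
      (\<forall>i'\<in>{Suc i..d}. \<alpha> i' - (\<Sum>j\<in>{Suc (Suc i)..i'}. int (D j) - 1) \<le> m + int (D (Suc i)) - 1)"
    using Suc.IH[of "m + int (D (Suc i)) - 1"] i by simp
  also have "\<dots> \<longleftrightarrow> B m"
    unfolding B_def by (rule ball_cong) (auto simp: sum.atLeast_Suc_atMost[of "Suc i"])
  finally have N: "reg_bound n (Q (Suc i)) (m + int (D (Suc i)) - 1) \<longleftrightarrow> B m" .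
  \<comment> \<open>\<open>B m\<close> contains the bound on \<open>\<alpha> (Suc i)\<close> that
    \<open>kernel_bound_iff\<close> requires. The equivalence is thus conditional, which is enough
    inside the conjunction with \<open>B m\<close>.\<close>
  have u: "(\<forall>j>m. \<forall>x\<in>component (Q i) j. l (Suc i) \<odot>\<^bsub>Q i\<^esub> x = \<zero>\<^bsub>Q i\<^esub> \<longrightarrow> x = \<zero>\<^bsub>Q i\<^esub>) \<longleftrightarrow> \<alpha> i \<le> m" if "B m"
  proof -
    have "\<alpha> (Suc i) \<le> m + int (D (Suc i)) - 1" using that i unfolding B_def by (auto dest: bspec[of _ _ "Suc i"])
    hence "\<alpha> (Suc i) + int k - int k \<le> m + int (D (Suc i)) - 1" by simp
    from kernel_bound_iff[OF S.N.postulation_number_above[OF fgi(2) dimi(2) nzi(2) dfi(2)] this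
        S.M.postulation_number_nonzero[OF fgi(1) dimi(1) nzi(1) dfi(1)]
        S.M.postulation_number_above[OF fgi(1) dimi(1) nzi(1) dfi(1)] ker_dim_above]
    show ?thesis using i by (simp add: S.ker_dim_zero_iff[OF fgi(1)])
  qed
  have "reg_bound n (Q i) m \<longleftrightarrow> \<alpha> i \<le> m \<and> B m" using S.reg_bound_step[of m] N u by blast
  also have "\<dots> \<longleftrightarrow> (\<forall>i'\<in>{i..d}. \<alpha> i' - (\<Sum>j\<in>{Suc i..i'}. int (D j) - 1) \<le> m)"
  proof -
    have "{i..d} = insert i {Suc i..d}" using i by auto
    thus ?thesis by (simp add: B_def)
  qed
  finally show ?case using i by simp
qed

end

theorem theorem4p8:
  fixes n d :: nat
    and M :: "('k::field mpol, 'm) graded_module"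
    and l :: "nat \<Rightarrow> 'k mpol"
    and D :: "nat \<Rightarrow> nat"
  assumes "graded_poly_module n M"
    and "carrier M \<noteq> {\<zero>\<^bsub>M\<^esub>}"
    and "finitely_generated n M"
    and "krull_dim n M = enat d"
    and "filter_regular_sequence n M d D l"
    and "\<forall>i\<in>{1..d}. D i > 0"
  shows "regularity n M =
    Max ((\<lambda>i. postulation_number n (quotient_by_ideal n M (l ` {1..i}))
                - (\<Sum>j\<in>{1..i}. (int (D j) - 1))) ` {0..d})"
proof -
  interpret M: graded_poly_module n M by (rule assms(1))
  define N where "N i = ideal_times_module n (l ` {1..i}) M" for i
  define Q where "Q i = quotient_module M (N i)" for i
  have Q_alt: "quotient_by_ideal n M (l ` {1..i}) = Q i" for i
    by (simp add: Q_def N_def quotient_by_ideal_def)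
  have fr: "filter_regular n (Q i) (D (Suc i)) (l (Suc i))" if "i < d" for i
  proof -
    have "{1..<Suc i} = {1..i}" by auto
    moreover have "Suc i \<in> {1..d}" using that by simp
    ultimately show ?thesis using assms(5) unfolding filter_regular_sequence_def Q_alt[symmetric] by metis
  qed
  have lH: "l (Suc i) \<in> Hom n (D (Suc i))" if "i < d" for i using fr[OF that] by (simp add: filter_regular_def)
  have SH: "\<exists>e. s \<in> Hom n e" if s: "s \<in> l ` {1..i}" and i: "i \<le> d" for s i
  proof -
    obtain j where j: "s = l j" "1 \<le> j" "j \<le> i" using s by auto
    then obtain j' where "j = Suc j'" by (cases j) auto
    thus ?thesis using lH[of j'] j i by auto
  qed
  have gN: "M.graded_sub (N i)" if "i \<le> d" for i
    unfolding N_def by (rule M.ideal_times_graded) (rule SH[OF _ that])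
  have NS: "N (Suc i) = {u \<oplus>\<^bsub>M\<^esub> l (Suc i) \<odot>\<^bsub>M\<^esub> y | u y. u \<in> N i \<and> y \<in> carrier M}" if i: "i < d" for i
  proof -
    have "l ` {1..Suc i} = insert (l (Suc i)) (l ` {1..i})" by (simp add: atLeastAtMostSuc_conv)
    moreover have "\<exists>e. s \<in> Hom n e" if "s \<in> l ` {1..i}" for s using SH[OF that] i by simp
    ultimately show ?thesis unfolding N_def using M.ideal_times_insert[OF _ lH[OF i], of "l ` {1..i}"] by metis
  qed
  define \<pi> where "\<pi> i A = (\<Union>x\<in>A. N (Suc i) +>\<^bsub>M\<^esub> x)" for i A
  have gqm: "graded_quotient_map n (Q i) (Q (Suc i)) (\<pi> i) (l (Suc i)) (D (Suc i))" if i: "i < d" for i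
    unfolding Q_def \<pi>_def by (rule M.graded_quotient_map_cosets[OF _ _ lH[OF i] NS[OF i]]) (use i in \<open>auto intro: gN\<close>)
  have "\<exists>j0. filter_regular_quotient n (Q i) (Q (Suc i)) (\<pi> i) (l (Suc i)) (D (Suc i)) j0" if i: "i < d" for i
  proof -
    interpret S: graded_quotient_map n "Q i" "Q (Suc i)" "\<pi> i" "l (Suc i)" "D (Suc i)" by (rule gqm[OF i])
    obtain i0 where i0: "\<And>j. j \<ge> i0 \<Longrightarrow> inj_on (\<lambda>x. l (Suc i) \<odot>\<^bsub>Q i\<^esub> x) (component (Q i) (j - int (D (Suc i))))"
      using fr[OF i] unfolding filter_regular_def by blast
    \<comment> \<open>Filter regularity is stated for the source degree \<open>j - D\<close>, so
      injectivity starts in degree \<open>i0 - D\<close>.\<close>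
    have "filter_regular_quotient n (Q i) (Q (Suc i)) (\<pi> i) (l (Suc i)) (D (Suc i)) (i0 - int (D (Suc i)))"
    proof
      show "D (Suc i) > 0" using assms(6) i by simp
      fix j x assume j: "i0 - int (D (Suc i)) \<le> j" and x: "x \<in> component (Q i) j" "l (Suc i) \<odot>\<^bsub>Q i\<^esub> x = \<zero>\<^bsub>Q i\<^esub>"
      have "inj_on (\<lambda>x. l (Suc i) \<odot>\<^bsub>Q i\<^esub> x) (component (Q i) j)" using i0[of "j + int (D (Suc i))"] j by simp
      moreover have "l (Suc i) \<odot>\<^bsub>Q i\<^esub> x = l (Suc i) \<odot>\<^bsub>Q i\<^esub> \<zero>\<^bsub>Q i\<^esub>" using x(2) by simp
      ultimately show "x = \<zero>\<^bsub>Q i\<^esub>" using x(1) S.M.comp_zero by (rule inj_onD)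
    qed
    thus ?thesis by blast
  qed
  then obtain j0 where j0: "\<And>i. i < d \<Longrightarrow>
      filter_regular_quotient n (Q i) (Q (Suc i)) (\<pi> i) (l (Suc i)) (D (Suc i)) (j0 i)" by metis
  have N0: "N 0 = {\<zero>\<^bsub>M\<^esub>}" by (simp add: N_def M.ideal_times_empty)
  \<comment> \<open>\<open>Q 0\<close> is \<open>M\<close> modulo the zero submodule, of another
    type than \<open>M\<close>. With the zero polynomial in the role of \<open>l\<close>, regarded
    as homogeneous of degree \<open>1\<close>, the projection is an instance of the quotient map
    with kernel zero.\<close>
  interpret I: graded_quotient_map n M "Q 0" "\<lambda>x. N 0 +>\<^bsub>M\<^esub> x" 0 1
  proof -
    have gN0: "M.graded_sub (N 0)" by (rule gN) simp
    interpret Q0: graded_poly_module n "Q 0" unfolding Q_def by (rule M.quotient_graded[OF gN0])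
    show "graded_quotient_map n M (Q 0) (\<lambda>x. N 0 +>\<^bsub>M\<^esub> x) 0 1"
    proof
      show "(0 :: 'k mpol) \<in> Hom n 1" by (simp add: homogeneous_polys_def)
      show "(N 0 +>\<^bsub>M\<^esub> x = \<zero>\<^bsub>Q 0\<^esub>) = (\<exists>y\<in>carrier M. x = 0 \<odot>\<^bsub>M\<^esub> y)" if "x \<in> carrier M" for x
        using that M.coset_eq_zero_iff[OF gN0 that] N0 by (auto simp: Q_def)
    qed (auto simp: Q_def M.quotient_add[OF gN0] M.quotient_smult[OF gN0] M.quotient_component)
  qed
  interpret T: filter_regular_tower n d Q \<pi> l D j0
  proof (rule filter_regular_tower.intro)
    show "graded_poly_module n (Q i)" if "i \<le> d" for i unfolding Q_def by (rule M.quotient_graded[OF gN[OF that]])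
    show "finitely_generated n (Q i)" if "i \<le> d" for i unfolding Q_def by (rule M.quotient_fg[OF gN[OF that] assms(3)])
    show "krull_dim n (Q 0) = enat d" using I.krull_dim_iso assms(4) by simp
    show "carrier (Q 0) \<noteq> {\<zero>\<^bsub>Q 0\<^esub>}"
    proof
      assume z: "carrier (Q 0) = {\<zero>\<^bsub>Q 0\<^esub>}"
      have "x = \<zero>\<^bsub>M\<^esub>" if x: "x \<in> carrier M" for x
        using I.pi_inj[OF refl x M.zero_closed] I.pi_closed[OF x] I.pi_zero z by simp
      thus False using assms(2) M.zero_closed by blast
    qed
  qed (rule j0)
  let ?r = "\<lambda>i. postulation_number n (Q i) - (\<Sum>j\<in>{1..i}. int (D j) - 1)"
  \<comment> \<open>The bounds are exactly the integers from the maximum on, so the least of them is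
    the maximum.\<close>
  have "reg_bound n M m \<longleftrightarrow> Max (?r ` {0..d}) \<le> m" for m
  proof -
    have "reg_bound n M m \<longleftrightarrow> reg_bound n (Q 0) m" by (simp add: reg_bound_def I.vanishing_iso)
    also have "\<dots> \<longleftrightarrow> (\<forall>i\<in>{0..d}. ?r i \<le> m)" using T.reg_bound_tower[of d m] by simp
    also have "\<dots> \<longleftrightarrow> Max (?r ` {0..d}) \<le> m" by (subst Max_le_iff) auto
    finally show ?thesis .
  qed
  hence "regularity n M = (LEAST m. Max (?r ` {0..d}) \<le> m)" by (simp add: M.regularity_reg_bound)
  also have "\<dots> = Max (?r ` {0..d})" by (rule Least_equality) auto
  finally show ?thesis by (simp only: Q_alt)
qed

end
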